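(* There exists a one-dimensional family $\mathcal M_{\mathrm{rot}}^0\subset\mathcal M_+^0$ of spectral data of mean-convex Alexandrov embedded constant mean curvature cylinders, parameterised by the mean curvature $H\in[0,\infty)$. For all elements of $\mathcal M_{\mathrm{rot}}^0$ the function $\mu^2-1$ vanishes at the two Sym points $\lambda_1$ and $\lambda_2$ and at $\lambda=-1$, and has no other root on $\mathbb S^1$. This family contains all spectral data (in $\mathcal M^0_+$) of mean-convex Alexandrov embedded constant mean curvature cylinders of spectral genus zero. Moreover, the one-dimensional family $\{((\lambda+1)^2a,(\lambda+1)b,\lambda_1,\lambda_2)\mid (a,b,\lambda_1,\lambda_2)\in\mathcal M_{\mathrm{rot}}^0\}$ extends to a two-dimensional family $\mathcal M_{\mathrm{rot}}^1\subset\mathcal M_+^1$ parameterised by $(H,\alpha)\in[0,\infty)\times[2,\infty)$. The one-dimensional subfamily of $\mathcal M_{\mathrm{rot}}^1$ which is isomorphic to $\mathcal M_{\mathrm{rot}}^0$ corresponds to $\alpha=2$. For $\alpha>2$ the function $\mu^2-1$ vanishes on $\mathbb S^1$ only at $\lambda_1$ and $\lambda_2$.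
   Context: Notation: $\mathbb S^1=\{|\lambda|=1\}$, $\mathbb C^*=\mathbb C\setminus\{0\}$; for a polynomial $q$, $\bar q(\bar\lambda^{-1})$ is the complex conjugate of $q(\bar\lambda^{-1})$. Spectral data. For $g\in\mathbb N\cup\{0\}$, $\mathcal M^g$ is the set of quadruples $(a,b,\lambda_1,\lambda_2)$ of complex polynomials $a,b$ of degree $2g$ and $g+1$ and Sym points $\lambda_1\ne\lambda_2\in\mathbb S^1$ satisfying the following, where $\Sigma^*=\{(\lambda,\nu)\in\mathbb C^*\times\mathbb C\mid\nu^2=\lambda^{-1}a(\lambda)\}$, $\Sigma$ is its compactification by one point over each of $\lambda=0,\infty$, and $\sigma(\lambda,\nu)=(\lambda,-\nu)$: (i) $\lambda^{2g}\bar a(\bar\lambda^{-1})=a(\lambda)$, $\lambda^{-g}a(\lambda)\le0$ for $\lambda\in\mathbb S^1$, and $\lambda^{g+1}\bar b(\bar\lambda^{-1})=-b(\lambda)$. (ii) $\mathrm{Re}\int_{\alpha_i}^{1/\bar\alpha_i}\frac{b\,d\lambda}{\nu\lambda^2}=0$ for all roots $\alpha_i$ of $a$, integrated along the straight segment $[\alpha_i,1/\bar\alpha_i]$. (iii) Let $\gamma_i\subset\Sigma$ be the closed cycles over these segments and $\tilde\Sigma=\Sigma\setminus\bigcup\gamma_i$. There is a unique meromorphic function $h$ on $\tilde\Sigma$ with $dh=\frac{b\,d\lambda}{\nu\lambda^2}$ and $\sigma^*h=-h$; it extends continuously to the boundary cycles and takes at all roots of $a$ values in $\pi i\mathbb Z$.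 (iv) There are holomorphic functions $f,g$ of $\lambda\in\mathbb C^*$ with $\mu=e^h=f\nu+g$ on $\tilde\Sigma\setminus\{0,\infty\}$, $f(\lambda_1)=f(\lambda_2)=0$, $g(\lambda_1)=g(\lambda_2)=\pm1$, and $g(\alpha_i)=\pm1$ at all roots $\alpha_i$ of $a$. (v) $|a(0)|=\frac1{16}$, $\lambda_2=\lambda_1^{-1}$ and $\mathrm{Im}(\lambda_1)<0$. The number $g$ is the spectral genus; $\mu$ is regarded as a two-valued function of $\lambda$ with branches $\mu^{\pm1}$. The mean curvature is $H=i\frac{\lambda_1+\lambda_2}{\lambda_2-\lambda_1}$, and $\mathcal M^g_+\subset\mathcal M^g$ is the subset with $H\ge0$. Cylinders. Identify $\mathbb S^3\cong\mathrm{SU}_2$. Let $\bar{\mathcal P}_g$ be the space of $\xi=\sum_{d=-1}^g\xi_d\lambda^d$ with $\xi_{-1}\in\mathbb C\begin{pmatrix}0&1\\0&0\end{pmatrix}$ and $\xi_d=-\bar\xi^T_{g-1-d}\in\mathfrak{sl}_2(\mathbb C)$ for $d=-1,\dots,g$, and $\mathcal P_g\subset\bar{\mathcal P}_g$ the subset with $\xi_{-1}\in\mathbb R^+\begin{pmatrix}0&i\\0&0\end{pmatrix}$ and $\mathrm{tr}(\xi_{-1}\xi_0)\ne0$. For $\xi\in\mathcal P_g$ let $\zeta:\mathbb C\to\bar{\mathcal P}_g$ solve $d\zeta=[\zeta,\alpha(\zeta)]$, $\zeta(0)=\xi$, where with $\zeta_{-1}=\begin{pmatrix}0&\beta_{-1}\\0&0\end{pmatrix}$,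 $\zeta_0=\begin{pmatrix}\alpha_0&\beta_0\\\gamma_0&-\alpha_0\end{pmatrix}$, $$\alpha(\zeta)=\begin{pmatrix}\alpha_0&\beta_{-1}\lambda^{-1}\\\gamma_0&-\alpha_0\end{pmatrix}dz-\begin{pmatrix}\bar\alpha_0&\bar\gamma_0\\\bar\beta_{-1}\lambda&-\bar\alpha_0\end{pmatrix}d\bar z .$$ Let $dF_\lambda=F_\lambda\alpha(\zeta)$, $F_\lambda(0)=\mathbf 1$. The triple $(\xi,\lambda_1,\lambda_2)$ corresponds to the CMC immersion $\mathrm f=F_{\lambda_1}F_{\lambda_2}^{-1}:\mathbb C\to\mathbb S^3$. For $(a,b,\lambda_1,\lambda_2)\in\mathcal M^g$ there is $\tau\in\mathbb C^*$ determined by $(a,b)$ ($h-\tau\nu$ is bounded near $\lambda=0$, and $F_\lambda(\tau)$ has eigenvalues $e^{\pm h}$) such that for every $\xi\in\mathcal P_g$ with $\det\xi=-\lambda^{-1}a$ the immersion $\mathrm f$ descends to a cylinder $\mathbb C/\tau\mathbb Z\to\mathbb S^3$; $(a,b,\lambda_1,\lambda_2)$ are spectral data of these cylinders. Since $(a,b,\lambda_1,\lambda_2)$ and $(a,-b,\lambda_1,\lambda_2)$ (periods $\tau$ and $-\tau$) describe the same cylinders, $b$ is understood up to sign in the parameterisations. Mean-convex Alexandrov embedding: a smooth immersion $\mathrm f:M\to\mathbb S^3$ of a connected surface which extends as an immersion to a connected 3-manifold $N$ with $\partial N=M$, such that the mean curvature with respect to the inward normal is non-negative everywhere and $N$ is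 complete with respect to the induced metric.
   Formalization: The inward normal is required to be the one for which H is the mean curvature; this matters only at H=0, where otherwise the Clifford torus filled on its other side is spectral data with μ²≠1 at λ=−1 and the claim that the family contains all such data fails. *)

theory Defs
  imports "HOL-Complex_Analysis.Complex_Analysis"
begin

section \<open>Spectral data\<close>

type_synonym spectral_quadruple = "complex poly \<times> complex poly \<times> complex \<times> complex"

definition spectral_curve :: "complex poly \<Rightarrow> (complex \<times> complex) set" where
  "spectral_curve a = {(l, \<nu>). l \<noteq> 0 \<and> \<nu>\<^sup>2 = poly a l / l}"

definition segments :: "complex poly \<Rightarrow> complex set" where
  "segments a = (\<Union>\<alpha>\<in>{\<alpha>. poly a \<alpha> = 0}. closed_segment \<alpha> (1 / cnj \<alpha>))"

text \<open>The part of the cut curve lying over \<^term>\<open>-{0::complex}\<close>. The two remaining points, over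
  $0$ and $\infty$, only enter in the notion of a meromorphic function below.\<close>

definition cut_curve :: "complex poly \<Rightarrow> (complex \<times> complex) set" where
  "cut_curve a = {(l, \<nu>) \<in> spectral_curve a. l \<notin> segments a}"

text \<open>On the cut curve $\nu \neq 0$, so $\lambda$ is a local coordinate there and the equation for
  $dh$ is expressed along local holomorphic branches of $\nu$. Local coordinates at the points over
  $0$ and $\infty$ are $s$ with $\lambda = s^2$, $\nu = w(s)/s$ and $\lambda = s^{-2}$,
  $\nu = s\,w(s)/s^{\deg a}$ respectively, where $w$ is a root of the nonvanishing function under
  the square.\<close>

definition is_h :: "complex poly \<Rightarrow> complex poly \<Rightarrow> (complex \<times> complex \<Rightarrow> complex) \<Rightarrow> bool" where
  "is_h a b h \<longleftrightarrow>
     (\<forall>U \<nu>. open U \<and> U \<inter> ({0} \<union> segments a) = {} \<and> \<nu> holomorphic_on U \<and>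
             (\<forall>l\<in>U. (\<nu> l)\<^sup>2 = poly a l / l) \<longrightarrow>
        (\<forall>l\<in>U. ((\<lambda>x. h (x, \<nu> x)) has_field_derivative poly b l / (\<nu> l * l\<^sup>2)) (at l))) \<and>
     (\<forall>r w. 0 < r \<and> w holomorphic_on ball 0 r \<and> (\<forall>s\<in>ball 0 r. (w s)\<^sup>2 = poly a (s\<^sup>2)) \<longrightarrow>
        (\<lambda>s. h (s\<^sup>2, w s / s)) meromorphic_on {0}) \<and>
     (\<forall>r w. 0 < r \<and> w holomorphic_on ball 0 r \<and>
             (\<forall>s\<in>ball 0 r. (w s)\<^sup>2 = poly (reflect_poly a) (s\<^sup>2)) \<longrightarrow>
        (\<lambda>s. h (1 / s\<^sup>2, s * w s / s ^ degree a)) meromorphic_on {0}) \<and>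
     (\<forall>(l, \<nu>) \<in> cut_curve a. h (l, - \<nu>) = - h (l, \<nu>))"

text \<open>Near a point of a boundary cycle the cut curve has several sides (for a zero of $a$ on the
  unit circle: the branches of the curve), and $h$ has one boundary value for each of them.
  These sides are the connected components of the cut curve in a small ball; for a component not
  adherent to the point the limit below is vacuous.\<close>

definition extends_to_boundary :: "complex poly \<Rightarrow> (complex \<times> complex \<Rightarrow> complex) \<Rightarrow> bool" where
  "extends_to_boundary a h \<longleftrightarrow>
     (\<forall>P \<in> spectral_curve a. fst P \<in> segments a \<longrightarrow>
        (\<exists>\<epsilon>>0. \<forall>C \<in> components (cut_curve a \<inter> ball P \<epsilon>).
           \<exists>c. (h \<longlongrightarrow> c) (at P within C) \<and>
               (poly a (fst P) = 0 \<longrightarrow> (\<exists>k::int. c = of_real pi * \<i> * of_int k))))"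

text \<open>The pair $(f,g)$ with $\mu = e^h = f\nu + g$.\<close>

definition is_mu :: "complex poly \<Rightarrow> complex poly \<Rightarrow> (complex \<Rightarrow> complex) \<Rightarrow> (complex \<Rightarrow> complex) \<Rightarrow> bool" where
  "is_mu a b f g \<longleftrightarrow> f holomorphic_on -{0} \<and> g holomorphic_on -{0} \<and>
     (\<exists>h. is_h a b h \<and> (\<forall>(l, \<nu>) \<in> cut_curve a. exp (h (l, \<nu>)) = f l * \<nu> + g l))"

definition reality_condition :: "nat \<Rightarrow> complex poly \<Rightarrow> complex poly \<Rightarrow> bool" where
  "reality_condition n a b \<longleftrightarrow>
     (\<forall>l. l \<noteq> 0 \<longrightarrow> l ^ (2 * n) * cnj (poly a (1 / cnj l)) = poly a l) \<and>
     (\<forall>l\<in>sphere 0 1. poly a l / l ^ n \<in> \<real>\<^sub>\<le>\<^sub>0) \<and>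
     (\<forall>l. l \<noteq> 0 \<longrightarrow> l ^ (n + 1) * cnj (poly b (1 / cnj l)) = - poly b l)"

text \<open>If a segment contains further zeros of $a$, then $\nu$ has several continuous branches along
  it, and the condition is imposed for all of them. The integrals are improper at the zeros of
  $a$.\<close>

definition period_condition :: "complex poly \<Rightarrow> complex poly \<Rightarrow> bool" where
  "period_condition a b \<longleftrightarrow>
     (\<forall>\<alpha> \<nu>. poly a \<alpha> = 0 \<and> continuous_on (closed_segment \<alpha> (1 / cnj \<alpha>)) \<nu> \<and>
            (\<forall>l\<in>closed_segment \<alpha> (1 / cnj \<alpha>). (\<nu> l)\<^sup>2 = poly a l / l) \<longrightarrow>
        (\<exists>I. ((\<lambda>l. poly b l / (\<nu> l * l\<^sup>2)) has_contour_integral I) (linepath \<alpha> (1 / cnj \<alpha>)) \<and>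
             Re I = 0))"

definition h_condition :: "complex poly \<Rightarrow> complex poly \<Rightarrow> bool" where
  "h_condition a b \<longleftrightarrow>
     (\<exists>h. is_h a b h \<and> (\<forall>h'. is_h a b h' \<longrightarrow> (\<forall>P \<in> cut_curve a. h' P = h P)) \<and>
          extends_to_boundary a h)"

definition mu_condition :: "complex poly \<Rightarrow> complex poly \<Rightarrow> complex \<Rightarrow> complex \<Rightarrow> bool" where
  "mu_condition a b l1 l2 \<longleftrightarrow>
     (\<exists>f g. is_mu a b f g \<and> f l1 = 0 \<and> f l2 = 0 \<and>
            g l1 = g l2 \<and> g l1 \<in> {1, -1} \<and> (\<forall>\<alpha>. poly a \<alpha> = 0 \<longrightarrow> g \<alpha> \<in> {1, -1}))"

definition spectral_data :: "nat \<Rightarrow> spectral_quadruple set" where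
  "spectral_data n = {(a, b, l1, l2).
     degree a = 2 * n \<and> degree b = n + 1 \<and> l1 \<in> sphere 0 1 \<and> l2 \<in> sphere 0 1 \<and> l1 \<noteq> l2 \<and>
     reality_condition n a b \<and> period_condition a b \<and> h_condition a b \<and> mu_condition a b l1 l2 \<and>
     norm (poly a 0) = 1 / 16 \<and> l2 = 1 / l1 \<and> Im l1 < 0}"

text \<open>The expression under \<^const>\<open>Re\<close> is real, since the Sym points lie on the unit circle.\<close>

definition sym_mean_curvature :: "spectral_quadruple \<Rightarrow> real" where
  "sym_mean_curvature = (\<lambda>(a, b, l1, l2). Re (\<i> * (l1 + l2) / (l2 - l1)))"

definition spectral_data_plus :: "nat \<Rightarrow> spectral_quadruple set" where
  "spectral_data_plus n = {q \<in> spectral_data n. 0 \<le> sym_mean_curvature q}"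

text \<open>The unimodular roots of $\mu^2 - 1$. The two branches of $\mu$ at $\lambda$ are the values
  of $f\nu + g$ at the points over $\lambda$; they are inverse to each other.\<close>

definition mu_roots :: "complex poly \<Rightarrow> complex poly \<Rightarrow> complex set" where
  "mu_roots a b = {l \<in> sphere 0 1. \<exists>f g. is_mu a b f g \<and>
     (\<forall>\<nu>. (l, \<nu>) \<in> spectral_curve a \<longrightarrow> (f l * \<nu> + g l)\<^sup>2 = 1)}"

text \<open>Families of spectral data with \<open>b\<close> understood up to sign. The products of the coefficients
  of \<open>b\<close> are coordinates on the quotient by the sign change of \<open>b\<close>.\<close>

definition coords_mod_sign ::
  "spectral_quadruple \<Rightarrow> (nat \<Rightarrow> complex) \<times> (nat \<times> nat \<Rightarrow> complex) \<times> complex \<times> complex" where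
  "coords_mod_sign = (\<lambda>(a, b, l1, l2). (coeff a, (\<lambda>(i, j). coeff b i * coeff b j), l1, l2))"

definition parameterised_by ::
  "'p::topological_space set \<Rightarrow> ('p \<Rightarrow> spectral_quadruple) \<Rightarrow> spectral_quadruple set \<Rightarrow> bool" where
  "parameterised_by D \<Phi> M \<longleftrightarrow>
     \<Phi> ` D \<subseteq> M \<and> (\<forall>(a, b, l1, l2) \<in> M. (a, - b, l1, l2) \<in> M) \<and>
     (\<exists>\<Psi>. homeomorphism D (coords_mod_sign ` M) (coords_mod_sign \<circ> \<Phi>) \<Psi>)"

definition add_double_point :: "spectral_quadruple \<Rightarrow> spectral_quadruple" where
  "add_double_point = (\<lambda>(a, b, l1, l2). ([:1, 1:]\<^sup>2 * a, [:1, 1:] * b, l1, l2))"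


section \<open>Mean-convex Alexandrov embedded cylinders in the three-sphere\<close>

text \<open>The three-sphere is the unit sphere of \<^typ>\<open>complex \<times> complex\<close>.\<close>

primrec Ck_on :: "nat \<Rightarrow> ('a::euclidean_space \<Rightarrow> 'b::real_normed_vector) \<Rightarrow> 'a set \<Rightarrow> bool" where
  "Ck_on 0 f U \<longleftrightarrow> continuous_on U f"
| "Ck_on (Suc k) f U \<longleftrightarrow> (\<forall>x\<in>U. f differentiable (at x)) \<and>
     (\<forall>v. Ck_on k (\<lambda>x. frechet_derivative f (at x) v) U)"

definition smooth_on :: "'a set \<Rightarrow> ('a::euclidean_space \<Rightarrow> 'b::real_normed_vector) \<Rightarrow> bool" where
  "smooth_on S f \<longleftrightarrow>
     (\<forall>x\<in>S. \<exists>U g. open U \<and> x \<in> U \<and> (\<forall>k. Ck_on k g U) \<and> (\<forall>y\<in>U \<inter> S. g y = f y))"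

definition half_space :: "(real^3) set" where
  "half_space = {x. 0 \<le> x $ 3}"

definition is_chart :: "'p topology \<Rightarrow> 'p set \<times> ('p \<Rightarrow> real^3) \<Rightarrow> bool" where
  "is_chart X = (\<lambda>(U, \<phi>). openin X U \<and> openin (top_of_set half_space) (\<phi> ` U) \<and>
     homeomorphic_map (subtopology X U) (top_of_set (\<phi> ` U)) \<phi>)"

definition is_atlas :: "'p topology \<Rightarrow> ('p set \<times> ('p \<Rightarrow> real^3)) set \<Rightarrow> bool" where
  "is_atlas X A \<longleftrightarrow> (\<forall>c\<in>A. is_chart X c) \<and> \<Union>(fst ` A) = topspace X \<and>
     (\<forall>(U, \<phi>)\<in>A. \<forall>(V, \<psi>)\<in>A. smooth_on (\<phi> ` (U \<inter> V)) (\<psi> \<circ> inv_into U \<phi>))"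

definition three_manifold_with_boundary ::
  "'p topology \<Rightarrow> ('p set \<times> ('p \<Rightarrow> real^3)) set \<Rightarrow> bool" where
  "three_manifold_with_boundary X A \<longleftrightarrow>
     Hausdorff_space X \<and> second_countable X \<and> is_atlas X A"

definition manifold_boundary ::
  "'p topology \<Rightarrow> ('p set \<times> ('p \<Rightarrow> real^3)) set \<Rightarrow> 'p set" where
  "manifold_boundary X A = {p \<in> topspace X. \<exists>(U, \<phi>)\<in>A. p \<in> U \<and> \<phi> p $ 3 = 0}"

definition immersion_to_S3 ::
  "'p topology \<Rightarrow> ('p set \<times> ('p \<Rightarrow> real^3)) set \<Rightarrow> ('p \<Rightarrow> complex \<times> complex) \<Rightarrow> bool" where
  "immersion_to_S3 X A e \<longleftrightarrow> e ` topspace X \<subseteq> sphere 0 1 \<and>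
     (\<forall>(U, \<phi>)\<in>A. smooth_on (\<phi> ` U) (e \<circ> inv_into U \<phi>) \<and>
        (\<forall>x \<in> \<phi> ` U. \<exists>D. ((e \<circ> inv_into U \<phi>) has_derivative D) (at x within \<phi> ` U) \<and> inj D))"

text \<open>A diffeomorphism of the cylinder $\mathbb{C}/\tau\mathbb{Z}$ onto the boundary, given as a
  map on the complex plane.\<close>

definition boundary_parameterisation ::
  "'p topology \<Rightarrow> ('p set \<times> ('p \<Rightarrow> real^3)) set \<Rightarrow> complex \<Rightarrow> (complex \<Rightarrow> 'p) \<Rightarrow> bool" where
  "boundary_parameterisation X A \<tau> \<iota> \<longleftrightarrow>
     continuous_map euclidean X \<iota> \<and> range \<iota> = manifold_boundary X A \<and>
     (\<forall>z w. \<iota> z = \<iota> w \<longleftrightarrow> (\<exists>k::int. w = z + of_int k * \<tau>)) \<and>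
     (\<forall>(U, \<phi>)\<in>A. smooth_on (\<iota> -` U) (\<phi> \<circ> \<iota>) \<and>
        (\<forall>z \<in> \<iota> -` U. inj (frechet_derivative (\<phi> \<circ> \<iota>) (at z))))"

text \<open>The distance of the metric induced by the immersion \<open>e\<close>. As \<open>e\<close> is a local diffeomorphism
  onto its image, regularity and length of a curve can be read off from its image under \<open>e\<close>.\<close>

definition induced_dist ::
  "'p topology \<Rightarrow> ('p \<Rightarrow> complex \<times> complex) \<Rightarrow> 'p \<Rightarrow> 'p \<Rightarrow> real" where
  "induced_dist X e p q = Inf {L. \<exists>\<gamma>. pathin X \<gamma> \<and> \<gamma> 0 = p \<and> \<gamma> 1 = q \<and>
     (e \<circ> \<gamma>) piecewise_C1_differentiable_on {0..1} \<and>
     ((\<lambda>t. norm (vector_derivative (e \<circ> \<gamma>) (at t))) has_integral L) {0..1}}"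

definition complete_wrt_induced_metric ::
  "'p topology \<Rightarrow> ('p \<Rightarrow> complex \<times> complex) \<Rightarrow> bool" where
  "complete_wrt_induced_metric X e \<longleftrightarrow>
     Metric_space (topspace X) (induced_dist X e) \<and>
     Metric_space.mcomplete (topspace X) (induced_dist X e)"

definition inward_unit_normal ::
  "('p set \<times> ('p \<Rightarrow> real^3)) set \<Rightarrow> ('p \<Rightarrow> complex \<times> complex) \<Rightarrow> (complex \<Rightarrow> 'p) \<Rightarrow>
   (complex \<Rightarrow> complex \<times> complex) \<Rightarrow> bool" where
  "inward_unit_normal A e \<iota> n \<longleftrightarrow> (\<forall>z. norm (n z) = 1 \<and>
     (\<forall>w. n z \<bullet> frechet_derivative (e \<circ> \<iota>) (at z) w = 0) \<and>
     (\<forall>(U, \<phi>)\<in>A. \<iota> z \<in> U \<longrightarrow>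
        (\<exists>D v. ((e \<circ> inv_into U \<phi>) has_derivative D) (at (\<phi> (\<iota> z)) within \<phi> ` U) \<and>
               v $ 3 > 0 \<and> D v = n z)))"

text \<open>Half the trace of the second fundamental form of \<open>f\<close> with respect to \<open>n\<close>; since \<open>n\<close> is
  tangent to the sphere, this is the mean curvature in the sphere.\<close>

definition mean_curvature ::
  "(complex \<Rightarrow> 'b::real_inner) \<Rightarrow> (complex \<Rightarrow> 'b) \<Rightarrow> complex \<Rightarrow> real" where
  "mean_curvature f n z =
     (let d = (\<lambda>u x. frechet_derivative f (at x) u);
          I = (\<lambda>u v. d u z \<bullet> d v z);
          II = (\<lambda>u v. frechet_derivative (d u) (at z) v \<bullet> n z)
      in (I 1 1 * II \<i> \<i> - 2 * I 1 \<i> * II 1 \<i> + I \<i> \<i> * II 1 1) /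
         (2 * (I 1 1 * I \<i> \<i> - (I 1 \<i>)\<^sup>2)))"

text \<open>The map \<open>f\<close> descends to a mean-convex Alexandrov embedded cylinder
  $\mathbb{C}/\tau\mathbb{Z}$ with inward unit normal \<open>n\<close>. The points of the three-manifold are
  taken from a type of the cardinality of the continuum, which is no restriction.\<close>

definition mean_convex_alexandrov_embedded ::
  "complex \<Rightarrow> (complex \<Rightarrow> complex \<times> complex) \<Rightarrow> (complex \<Rightarrow> complex \<times> complex) \<Rightarrow> bool" where
  "mean_convex_alexandrov_embedded \<tau> f n \<longleftrightarrow>
     smooth_on UNIV f \<and> (\<forall>z. inj (frechet_derivative f (at z))) \<and>
     (\<exists>(X :: (complex \<times> real) topology) A e \<iota>.
        three_manifold_with_boundary X A \<and> connected_space X \<and>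
        immersion_to_S3 X A e \<and>
        boundary_parameterisation X A \<tau> \<iota> \<and> (\<forall>z. e (\<iota> z) = f z) \<and>
        inward_unit_normal A e \<iota> n \<and> (\<forall>z. 0 \<le> mean_curvature f n z) \<and>
        complete_wrt_induced_metric X e)"


section \<open>Cylinders with given spectral data\<close>

text \<open>A Laurent polynomial is given by its coefficients.\<close>

type_synonym laurent_matrix = "int \<Rightarrow> complex^2^2"

definition mat2 :: "complex \<Rightarrow> complex \<Rightarrow> complex \<Rightarrow> complex \<Rightarrow> complex^2^2" where
  "mat2 p q r s = vector [vector [p, q], vector [r, s]]"

definition conj_transpose :: "complex^2^2 \<Rightarrow> complex^2^2" where
  "conj_transpose B = (\<chi> i j. cnj (B $ j $ i))"

definition eval_laurent :: "nat \<Rightarrow> laurent_matrix \<Rightarrow> complex \<Rightarrow> complex^2^2" where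
  "eval_laurent n \<xi> l = (\<chi> i j. \<Sum>d\<in>{-1..int n}. \<xi> d $ i $ j * l powi d)"

definition potentials_closure :: "nat \<Rightarrow> laurent_matrix set" where
  "potentials_closure n = {\<xi>. (\<forall>d. d \<notin> {-1..int n} \<longrightarrow> \<xi> d = 0) \<and>
     (\<exists>c. \<xi> (-1) = mat2 0 c 0 0) \<and>
     (\<forall>d\<in>{-1..int n}. \<xi> d = - conj_transpose (\<xi> (int n - 1 - d)) \<and> trace (\<xi> d) = 0)}"

definition potentials :: "nat \<Rightarrow> laurent_matrix set" where
  "potentials n = {\<xi> \<in> potentials_closure n.
     (\<exists>r>0. \<xi> (-1) = mat2 0 (of_real r * \<i>) 0 0) \<and> trace (\<xi> (-1) ** \<xi> 0) \<noteq> 0}"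

text \<open>The value at the parameter \<open>l\<close> and the tangent vector \<open>v\<close> of the matrix-valued form
  $\alpha(\zeta)$.\<close>

definition alpha_form :: "laurent_matrix \<Rightarrow> complex \<Rightarrow> complex \<Rightarrow> complex^2^2" where
  "alpha_form \<zeta> l v =
     (let \<beta> = \<zeta> (-1) $ 1 $ 2; \<alpha>0 = \<zeta> 0 $ 1 $ 1; \<gamma>0 = \<zeta> 0 $ 2 $ 1
      in mat2 (\<alpha>0 * v) (\<beta> * inverse l * v) (\<gamma>0 * v) (- \<alpha>0 * v) -
         mat2 (cnj \<alpha>0 * cnj v) (cnj \<gamma>0 * cnj v) (cnj \<beta> * l * cnj v) (- cnj \<alpha>0 * cnj v))"

definition killing_field :: "nat \<Rightarrow> laurent_matrix \<Rightarrow> (complex \<Rightarrow> laurent_matrix) \<Rightarrow> bool" where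
  "killing_field n \<xi> \<zeta> \<longleftrightarrow> range \<zeta> \<subseteq> potentials_closure n \<and> \<zeta> 0 = \<xi> \<and>
     (\<forall>l z. l \<noteq> 0 \<longrightarrow> ((\<lambda>x. eval_laurent n (\<zeta> x) l) has_derivative
        (\<lambda>v. eval_laurent n (\<zeta> z) l ** alpha_form (\<zeta> z) l v -
             alpha_form (\<zeta> z) l v ** eval_laurent n (\<zeta> z) l)) (at z))"

definition frame :: "(complex \<Rightarrow> laurent_matrix) \<Rightarrow> (complex \<Rightarrow> complex \<Rightarrow> complex^2^2) \<Rightarrow> bool" where
  "frame \<zeta> F \<longleftrightarrow> (\<forall>l. l \<noteq> 0 \<longrightarrow> F l 0 = mat 1 \<and>
     (\<forall>z. (F l has_derivative (\<lambda>v. F l z ** alpha_form (\<zeta> z) l v)) (at z)))"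

text \<open>The first column identifies $\mathrm{SU}_2$ with the three-sphere.\<close>

definition SU2_to_S3 :: "complex^2^2 \<Rightarrow> complex \<times> complex" where
  "SU2_to_S3 B = (B $ 1 $ 1, B $ 2 $ 1)"

definition sym_immersion ::
  "(complex \<Rightarrow> complex \<Rightarrow> complex^2^2) \<Rightarrow> complex \<Rightarrow> complex \<Rightarrow> complex \<Rightarrow> complex \<times> complex" where
  "sym_immersion F l1 l2 z = SU2_to_S3 (F l1 z ** matrix_inv (F l2 z))"

text \<open>The unit normal with respect to which the mean curvature of the immersion is
  $i(\lambda_1+\lambda_2)/(\lambda_2-\lambda_1)$; with respect to the opposite normal it has the
  opposite sign.\<close>

definition sym_normal ::
  "(complex \<Rightarrow> complex \<Rightarrow> complex^2^2) \<Rightarrow> complex \<Rightarrow> complex \<Rightarrow> complex \<Rightarrow> complex \<times> complex" where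
  "sym_normal F l1 l2 z = SU2_to_S3 (F l1 z ** mat2 \<i> 0 0 (- \<i>) ** matrix_inv (F l2 z))"

definition is_period :: "complex poly \<Rightarrow> complex poly \<Rightarrow> complex \<Rightarrow> bool" where
  "is_period a b \<tau> \<longleftrightarrow> \<tau> \<noteq> 0 \<and>
     (\<exists>h. is_h a b h \<and>
        (\<exists>\<epsilon>>0. bounded ((\<lambda>(l, \<nu>). h (l, \<nu>) - \<tau> * \<nu>) ` {(l, \<nu>) \<in> cut_curve a. norm l < \<epsilon>})))"

text \<open>The sign of $H$ in the spectral data refers to \<^const>\<open>sym_normal\<close>, so the inward normal of
  the cylinder is required to be this one. If $H > 0$, this already follows from mean-convexity.
  If $H = 0$, it fixes the side of the surface: both sides of the Clifford torus are
  mean-convex.\<close>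

definition alexandrov_spectral_data :: "nat \<Rightarrow> spectral_quadruple \<Rightarrow> bool" where
  "alexandrov_spectral_data n = (\<lambda>(a, b, l1, l2).
     \<exists>\<tau> \<xi> \<zeta> F. is_period a b \<tau> \<and> \<xi> \<in> potentials n \<and>
       (\<forall>l. l \<noteq> 0 \<longrightarrow> det (eval_laurent n \<xi> l) = - (poly a l / l)) \<and>
       killing_field n \<xi> \<zeta> \<and> frame \<zeta> F \<and>
       mean_convex_alexandrov_embedded \<tau> (sym_immersion F l1 l2) (sym_normal F l1 l2))"

end

theory Submission imports Defs
begin

text \<open>
  Both families are explicit. In spectral genus zero \<open>a = - 1 / 16\<close> and \<open>b = \<beta> - cnj \<beta> * l\<close>, in
  spectral genus one \<open>a = - (l\<^sup>2 + \<alpha> * l + 1) / 16\<close> and \<open>b = c * (1 - l\<^sup>2)\<close> with \<open>2 \<le> \<alpha>\<close>. In both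
  cases \<open>h\<close> is a polynomial \<open>p\<close> in \<open>l\<close> times \<open>\<nu>\<close>, namely \<open>p = 32 * (\<beta> + cnj \<beta> * l)\<close> and \<open>p = 32 * c\<close>.
  No other choice of \<open>h\<close> is possible (\<open>h_unique\<close>): the cut curve is uniformised by a square root
  of \<open>l\<close> over a connected domain, so \<open>h\<close> is determined up to a constant, which vanishes because \<open>h\<close>
  is odd. Hence \<open>g\<close> is an entire function of \<open>h\<^sup>2 = p\<^sup>2 * a / l\<close>, \<open>f\<close> is \<open>p\<close> times such a function, and \<open>\<mu>\<^sup>2 = 1\<close>
  exactly where \<open>h\<^sup>2\<close> is minus the square of an integer multiple of \<open>\<pi>\<close> (\<open>mu_roots_iff\<close>).

  On the unit circle \<open>h\<^sup>2 = - 64 * c\<^sup>2 * (\<alpha> + 2 * Re l)\<close>, where genus zero with real \<open>\<beta> = c\<close>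
  corresponds to \<open>\<alpha> = 2\<close>. If \<open>c\<close> is such that \<open>h\<^sup>2 = - \<pi>\<^sup>2\<close> at the Sym points, then \<open>h\<^sup>2\<close> is \<open>- \<pi>\<^sup>2\<close> times
  \<open>(\<alpha> + 2 * Re l) / (\<alpha> + 2 * Re l1)\<close>. For \<open>0 \<le> H\<close> the real part of \<open>l1\<close> is non-negative, so this
  ratio is smaller than 4, and it is the square of an integer only if it is 1, at the Sym
  points, or 0, at \<open>l = - 1\<close> for \<open>\<alpha> = 2\<close> (\<open>ratio_is_square\<close>).

  In spectral genus zero the Lax equation has only constant solutions and the frame is
  explicit. With \<open>l1 = cis (- (2 * \<delta>))\<close>, \<open>0 < \<delta> \<le> \<pi> / 4\<close>, the surface is congruent to the torus
  \<open>(cos \<delta> * cis Q, sin \<delta> * cis P)\<close> with \<open>P = x * cos \<delta>\<close>, \<open>Q = y * sin \<delta>\<close> (\<open>sym_vacuum\<close>). The prescribed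
  normal points to the circle in which the second coordinate vanishes, at distance \<open>\<delta>\<close>, and
  the members of the family in genus zero have the periods \<open>\<plusminus> 2 * \<pi> / cos \<delta>\<close>, so that \<open>x\<close> runs once around the
  circles \<open>Q = const\<close>. These bound discs, which fill a solid cylinder (\<open>torus_alexandrov_embedded\<close>).

  Conversely let a torus of this kind with some period \<open>\<tau>\<close> have a complete filling. The
  geodesics of the sphere that start on the torus in the direction of the inward normal do not
  meet the torus again before the distance \<open>\<delta>\<close>, and therefore lift to the filling
  (\<open>lift_exists\<close>). Those that start on a circle \<open>Q = const\<close> meet in one focal point. Their lifts end over
  this point, and since the immersion is locally injective, they end in one point of the
  filling. Two lifts of the same geodesic that have the same end also have the same start
  (\<open>focal_closing\<close>). So the circle is closed in the boundary of the filling, and \<open>2 * \<pi> / cos \<delta>\<close> is an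
  integer multiple of \<open>\<tau>\<close> (\<open>alexandrov_torus_period\<close>). Since \<open>\<tau> = 32 * \<beta>\<close>, this makes \<open>\<beta>\<close> real, and
  the condition on \<open>\<mu>\<close> at the Sym points leaves the multiples \<open>1\<close> and \<open>- 1\<close> only (\<open>alexandrov_in_M0\<close>).
\<close>

section \<open>Local inverses of immersions into the three-sphere\<close>

lemma smooth_onD:
  assumes "smooth_on S f" "x \<in> S"
  obtains U g where "open U" "x \<in> U" "\<And>y. y \<in> U \<Longrightarrow> y \<in> S \<Longrightarrow> g y = f y"
    "\<And>y. y \<in> U \<Longrightarrow> (g has_derivative frechet_derivative g (at y)) (at y)"
    "\<And>v. continuous_on U (\<lambda>y. frechet_derivative g (at y) v)"
proof -
  obtain U g where g: "open U" "x \<in> U" "\<forall>k. Ck_on k g U" "\<forall>y\<in>U \<inter> S. g y = f y"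
    using assms unfolding smooth_on_def by blast
  have "Ck_on (Suc 0) g U" using g(3) by blast
  then have "\<forall>x\<in>U. g differentiable (at x)" "\<forall>v. continuous_on U (\<lambda>x. frechet_derivative g (at x) v)"
    by auto
  then show ?thesis using that g by (metis IntI frechet_derivative_works)
qed

text \<open>Derivatives within a relatively open subset of the half space are unique, also at boundary points,
  because along each axis the set can be entered from at least one side.\<close>

lemma half_space_approachable:
  assumes "openin (top_of_set half_space) S" "x \<in> S" "i \<in> Basis" "0 < e"
  shows "\<exists>d. 0 < \<bar>d\<bar> \<and> \<bar>d\<bar> < e \<and> x + d *\<^sub>R i \<in> S"
proof -
  obtain T where T: "open T" "S = half_space \<inter> T" using assms(1) by (auto simp: openin_open)
  obtain r where r: "r > 0" "ball x r \<subseteq> T" using T assms(2) open_contains_ball by blast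
  define d where "d = (if i $ 3 \<ge> 0 then min r e / 2 else - (min r e / 2))"
  have d: "0 < \<bar>d\<bar>" "\<bar>d\<bar> < e" "\<bar>d\<bar> < r" "0 \<le> d * i $ 3"
    using r assms(4) mult_nonneg_nonpos[of "min r e" "i $ 3"]
    by (auto simp: d_def mult_nonneg_nonneg split: if_splits)
  have "dist x (x + d *\<^sub>R i) = \<bar>d\<bar>" using assms(3) by (simp add: dist_norm)
  then have "x + d *\<^sub>R i \<in> T" using r d by auto
  moreover have "x $ 3 \<ge> 0" using assms(2) T by (auto simp: half_space_def)
  then have "x + d *\<^sub>R i \<in> half_space" using d by (simp add: half_space_def)
  ultimately show ?thesis using d T by blast
qed

text \<open>\<open>D\<close> maps onto the hyperplane orthogonal to \<open>y0\<close>, the tangent space of the sphere. The orthogonal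
  projection to this hyperplane, followed by the inverse of \<open>D\<close>, is a left inverse of \<open>D\<close>, and the
  projection is injective on the open hemisphere around \<open>y0\<close>.\<close>

lemma left_inverse_injective_on_sphere:
  fixes D :: "real^3 \<Rightarrow> complex \<times> complex"
  assumes "linear D" "inj D" "\<And>v. y0 \<bullet> D v = 0" "norm y0 = 1"
  obtains L where "linear L" "\<And>v. L (D v) = v"
    "\<And>y z. \<lbrakk>norm y = 1; norm z = 1; y \<bullet> y0 > 0; z \<bullet> y0 > 0; L y = L z\<rbrakk> \<Longrightarrow> y = z"
proof -
  obtain M where M: "linear M" "M \<circ> D = id"
    using linear_injective_left_inverse assms(1,2) by blast
  define p where "p = (\<lambda>y. y - (y \<bullet> y0) *\<^sub>R y0)"
  have linp: "linear p"
    by (rule linearI) (auto simp: p_def algebra_simps)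
  have ran: "range D = {y. y0 \<bullet> y = 0}"
  proof (rule subspace_dim_equal)
    show "subspace (range D)" using assms(1) by (simp add: linear_subspace_image)
    show "subspace {y. y0 \<bullet> y = 0}" by (rule subspace_hyperplane)
    show "range D \<subseteq> {y. y0 \<bullet> y = 0}" using assms(3) by auto
    have "dim (range D) = 3" using dim_image_eq[OF assms(1), of UNIV] assms(2) by simp
    moreover have "y0 \<noteq> 0" using assms(4) by auto
    then have "dim {y. y0 \<bullet> y = 0} = 3" by (simp add: dim_hyperplane)
    ultimately show "dim {y. y0 \<bullet> y = 0} \<le> dim (range D)" by simp
  qed
  have y01: "y0 \<bullet> y0 = 1" using assms(4) by (simp add: dot_square_norm)
  have pin: "p y \<in> range D" for y unfolding ran by (simp add: p_def algebra_simps inner_commute y01)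
  have Minj: "M y = M z \<Longrightarrow> y = z" if "y \<in> range D" "z \<in> range D" for y z
    using that M(2) by (auto simp: fun_eq_iff)
  show ?thesis
  proof (rule that[of "M \<circ> p"])
    show "linear (M \<circ> p)" using linp M(1) by (rule linear_compose)
    show "(M \<circ> p) (D v) = v" for v
      using assms(3)[of v] M(2) by (simp add: p_def inner_commute fun_eq_iff)
    fix y z assume H: "norm y = 1" "norm z = 1" "y \<bullet> y0 > 0" "z \<bullet> y0 > 0" "(M \<circ> p) y = (M \<circ> p) z"
    have "p y = p z" using Minj[OF pin pin] H(5) by simp
    then have yz: "y = z + ((y \<bullet> y0) - (z \<bullet> y0)) *\<^sub>R y0" by (simp add: p_def algebra_simps)
    define c where "c = (y \<bullet> y0) - (z \<bullet> y0)"
    have "1 = y \<bullet> y" using H by (simp add: dot_square_norm)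
    also have "\<dots> = y \<bullet> z + c * (y \<bullet> y0)" using yz by (metis c_def inner_add_right inner_scaleR_right)
    also have "y \<bullet> z = z \<bullet> z + c * (z \<bullet> y0)" using yz by (metis c_def inner_add_right inner_scaleR_right inner_commute)
    also have "z \<bullet> z = 1" using H by (simp add: dot_square_norm)
    finally have "c * (y \<bullet> y0 + z \<bullet> y0) = 0" by (simp add: algebra_simps)
    then have "c = 0" using H by simp
    then show "y = z" using yz c_def by simp
  qed
qed

text \<open>The inverse function theorem for maps between spaces of dimension three applies to \<open>L \<circ> g\<close>, where
  \<open>g\<close> is a smooth extension of \<open>E\<close> across the boundary of the half space and \<open>L\<close> is the left inverse of the
  derivative. The extension may leave the sphere outside the half space; this is why \<open>s\<close> is a
  section of \<open>E\<close> only where its values lie in the half space.\<close>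

lemma local_inverse_of_sphere_immersion:
  fixes E :: "real^3 \<Rightarrow> complex \<times> complex"
  assumes S: "openin (top_of_set half_space) S" and x0: "x0 \<in> S"
    and ES: "E ` S \<subseteq> sphere 0 1" and sm: "smooth_on S E"
    and D: "(E has_derivative D) (at x0 within S)" "inj D"
    and W: "open W" "x0 \<in> W"
  obtains B V s L where "open B" "x0 \<in> B" "B \<subseteq> W" "B \<inter> half_space \<subseteq> S"
    "open V" "E x0 \<in> V" "s ` V \<subseteq> B" "continuous_on V s" "s (E x0) = x0"
    "\<And>x. x \<in> B \<Longrightarrow> x \<in> half_space \<Longrightarrow> E x \<in> V \<and> s (E x) = x"
    "\<And>y. \<lbrakk>y \<in> V; norm y = 1; s y \<in> half_space\<rbrakk> \<Longrightarrow> E (s y) = y"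
    "(s has_derivative L) (at (E x0))" "\<And>v. L (D v) = v"
proof -
  obtain T where T: "open T" "S = half_space \<inter> T" using S by (auto simp: openin_open)
  obtain U g where g: "open U" "x0 \<in> U" "\<And>y. y \<in> U \<Longrightarrow> y \<in> S \<Longrightarrow> g y = E y"
    "\<And>y. y \<in> U \<Longrightarrow> (g has_derivative frechet_derivative g (at y)) (at y)"
    "\<And>v. continuous_on U (\<lambda>y. frechet_derivative g (at y) v)"
    using smooth_onD[OF sm x0] by blast
  define y0 where "y0 = E x0"
  have ny0: "norm y0 = 1" using ES x0 by (auto simp: y0_def)
  have "(g has_derivative D) (at x0 within (U \<inter> S))"
  proof (rule has_derivative_transform[of _ _ g E])
    show "x0 \<in> U \<inter> S" using g x0 by auto
    show "(E has_derivative D) (at x0 within U \<inter> S)" using D(1) by (rule has_derivative_subset) auto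
  qed (use g in auto)
  moreover have "(g has_derivative frechet_derivative g (at x0)) (at x0 within (U \<inter> S))"
    using g(4)[OF g(2)] by (rule has_derivative_at_withinI)
  moreover have US: "openin (top_of_set half_space) (U \<inter> S)" using S g(1) by (metis inf_commute openin_Int_open)
  moreover have "x0 \<in> U \<inter> S" using g(2) x0 by blast
  ultimately have Dg: "frechet_derivative g (at x0) = D"
    by (intro frechet_derivative_unique_within[OF _ _ half_space_approachable]) auto
  have linD: "linear D" using D(1) has_derivative_linear by blast
  have perp: "y0 \<bullet> D v = 0" for v
  proof -
    have 1: "((\<lambda>x. E x \<bullet> E x) has_derivative (\<lambda>v. E x0 \<bullet> D v + D v \<bullet> E x0)) (at x0 within S)"
      by (rule has_derivative_inner[OF D(1) D(1)])
    have 2: "((\<lambda>x. E x \<bullet> E x) has_derivative (\<lambda>v. 0)) (at x0 within S)"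
      by (rule has_derivative_transform[OF x0 _ has_derivative_const[of "1::real"]])
         (use ES in \<open>auto simp: dot_square_norm\<close>)
    have "(\<lambda>v. E x0 \<bullet> D v + D v \<bullet> E x0) = (\<lambda>v. 0)"
      by (rule frechet_derivative_unique_within[OF 1 2]) (rule half_space_approachable[OF S x0])
    then show ?thesis by (auto simp: y0_def inner_commute dest: fun_cong[of _ _ v])
  qed
  obtain L where L: "linear L" "\<And>v. L (D v) = v"
    "\<And>y z. \<lbrakk>norm y = 1; norm z = 1; y \<bullet> y0 > 0; z \<bullet> y0 > 0; L y = L z\<rbrakk> \<Longrightarrow> y = z"
    using left_inverse_injective_on_sphere[OF linD D(2) perp ny0] by blast
  have bL: "bounded_linear L" using L(1) linear_conv_bounded_linear by blast
  define U1 where "U1 = U \<inter> T \<inter> W \<inter> {x \<in> U. g x \<bullet> y0 > 0}"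
  have contg: "continuous_on U g" using g(4) has_derivative_continuous continuous_at_imp_continuous_on by blast
  have openU1: "open U1"
  proof -
    have "open {x \<in> U. g x \<bullet> y0 > 0}"
    proof -
      have "open ((\<lambda>x. g x \<bullet> y0) -` {0<..} \<inter> U)"
        by (rule continuous_on_open_vimage[THEN iffD1, rule_format])
           (auto intro!: continuous_intros contg g(1))
      then show ?thesis by (simp add: vimage_def Int_def conj_commute)
    qed
    then show ?thesis using g T W unfolding U1_def by blast
  qed
  have x0U1: "x0 \<in> U1" using g(2) x0 T W g(3)[OF g(2) x0] ny0
    by (auto simp: U1_def y0_def[symmetric] dot_square_norm)
  define K where "K = L \<circ> g"
  define K' where "K' = (\<lambda>x. Blinfun (L \<circ> frechet_derivative g (at x)))"
  have K'ap: "blinfun_apply (K' x) = L \<circ> frechet_derivative g (at x)" if "x \<in> U" for x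
    unfolding K'_def
    by (rule bounded_linear_Blinfun_apply)
       (use bounded_linear_compose[OF bL] g(4)[OF that] has_derivative_bounded_linear in \<open>auto simp: o_def\<close>)
  have K': "(K has_derivative blinfun_apply (K' x)) (at x)" if "x \<in> U1" for x
  proof -
    have "x \<in> U" using that U1_def by auto
    then show ?thesis unfolding K_def o_def K'ap[unfolded o_def, OF \<open>x \<in> U\<close>]
      using bounded_linear.has_derivative[OF bL g(4)] by blast
  qed
  have cK: "continuous_on U1 K'"
  proof (rule continuous_on_blinfun_componentwise)
    fix i :: "real^3" assume "i \<in> Basis"
    have "continuous_on U1 (\<lambda>x. L (frechet_derivative g (at x) i))"
      using g(5)[of i] by (intro bounded_linear.continuous_on[OF bL]) (auto simp: U1_def intro: continuous_on_subset)
    then show "continuous_on U1 (\<lambda>x. blinfun_apply (K' x) i)"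
      by (rule continuous_on_eq) (auto simp: K'ap U1_def)
  qed
  have inv: "id_blinfun o\<^sub>L K' x0 = id_blinfun"
    by (rule blinfun_eqI) (use g(2) in \<open>simp add: K'ap Dg L(2)\<close>)
  obtain U' V' gi g' where I: "open U'" "U' \<subseteq> U1" "x0 \<in> U'" "open V'" "K x0 \<in> V'" "homeomorphism U' V' K gi"
    "\<And>y. y \<in> V' \<Longrightarrow> (gi has_derivative (g' y)) (at y)"
    "\<And>y. y \<in> V' \<Longrightarrow> g' y = Hilbert_Choice.inv (blinfun_apply (K'(gi y)))"
    using inverse_function_theorem[OF openU1 K' cK x0U1 inv] by metis
  have gx0: "g x0 = E x0" using g x0 by blast
  have gi0: "gi (K x0) = x0" using I by (meson homeomorphism_apply1)
  have g'0: "g' (K x0) = id"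
    using I(8)[OF I(5)] K'ap[OF g(2)] by (simp add: gi0 Dg o_def L(2) id_def[symmetric])
  define V where "V = L -` V' \<inter> {y. y \<bullet> y0 > 0}"
  have contL: "continuous_on UNIV L" by (rule linear_continuous_on[OF bL])
  show ?thesis
  proof (rule that[of U' V "gi \<circ> L" L])
    show "open U'" "x0 \<in> U'" using I by auto
    show "U' \<subseteq> W" "U' \<inter> half_space \<subseteq> S" using I(2) by (auto simp: U1_def T)
    have "open (L -` V')" using contL I(4) by (simp add: continuous_on_open_vimage[OF open_UNIV])
    moreover have "open {y. y \<bullet> y0 > 0}" by (intro open_Collect_less continuous_intros)
    ultimately show "open V" unfolding V_def by blast
    show "E x0 \<in> V" using I(5) gx0 ny0 by (simp add: V_def K_def y0_def dot_square_norm)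
    show "(gi \<circ> L) ` V \<subseteq> U'" using I(6) by (auto simp: V_def homeomorphism_def)
    show "continuous_on V (gi \<circ> L)"
    proof (rule continuous_on_compose)
      show "continuous_on V L" using contL continuous_on_subset by blast
      have "continuous_on V' gi" using I(6) by (simp add: homeomorphism_def)
      then show "continuous_on (L ` V) gi" by (rule continuous_on_subset) (auto simp: V_def)
    qed
    show "(gi \<circ> L) (E x0) = x0" using gi0 gx0 by (simp add: K_def)
    show "E x \<in> V \<and> (gi \<circ> L) (E x) = x" if "x \<in> U'" "x \<in> half_space" for x
    proof -
      have x: "x \<in> U1" "x \<in> S" using that I(2) by (auto simp: U1_def T)
      then have gx: "g x = E x" "E x \<bullet> y0 > 0" using g(3) by (auto simp: U1_def)
      have "K x \<in> V'" "gi (K x) = x" using I(6) that by (auto simp: homeomorphism_def)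
      then show ?thesis using gx by (auto simp: K_def V_def)
    qed
    show "E ((gi \<circ> L) y) = y" if y: "y \<in> V" "norm y = 1" "(gi \<circ> L) y \<in> half_space" for y
    proof -
      let ?x = "gi (L y)"
      have "?x \<in> U'" "K ?x = L y" using I(6) y by (auto simp: homeomorphism_def V_def)
      then have x: "?x \<in> U1" "?x \<in> S" using y I(2) by (auto simp: U1_def T)
      then have gx: "g ?x = E ?x" "E ?x \<bullet> y0 > 0" using g(3) by (auto simp: U1_def)
      have "E ?x = y"
      proof (rule L(3))
        show "norm (E ?x) = 1" using ES x by auto
        show "L (E ?x) = L y" using \<open>K ?x = L y\<close> gx by (simp add: K_def)
      qed (use gx y in \<open>auto simp: V_def\<close>)
      then show ?thesis by simp
    qed
    show "(gi \<circ> L has_derivative L) (at (E x0))"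
    proof -
      have "(L has_derivative L) (at (E x0))" by (rule bounded_linear_imp_has_derivative[OF bL])
      moreover have "(gi has_derivative id) (at (L (E x0)))"
        using I(7)[OF I(5)] g'0 gx0 by (simp add: K_def)
      ultimately show ?thesis using diff_chain_at by fastforce
    qed
    show "L (D v) = v" for v by (rule L(2))
  qed
qed

locale immersed_manifold =
  fixes X :: "'p topology" and A :: "('p set \<times> ('p \<Rightarrow> real^3)) set" and e :: "'p \<Rightarrow> complex \<times> complex"
  assumes manifold: "three_manifold_with_boundary X A"
    and immersion: "immersion_to_S3 X A e"
begin

lemma norm_immersion: assumes "p \<in> topspace X" shows "norm (e p) = 1"
proof -
  have "e ` topspace X \<subseteq> sphere 0 1" using immersion unfolding immersion_to_S3_def by blast
  then have "e p \<in> sphere 0 1" using assms by blast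
  then show ?thesis by (rule mem_sphere_0[THEN iffD1])
qed

lemma chartD:
  assumes "(U, \<phi>) \<in> A"
  shows "openin X U" "openin (top_of_set half_space) (\<phi> ` U)" "inj_on \<phi> U"
    "continuous_map (subtopology X U) (top_of_set (\<phi> ` U)) \<phi>"
    "continuous_map (top_of_set (\<phi> ` U)) X (inv_into U \<phi>)"
    "U \<subseteq> topspace X"
    "smooth_on (\<phi> ` U) (e \<circ> inv_into U \<phi>)"
    "(e \<circ> inv_into U \<phi>) ` \<phi> ` U \<subseteq> sphere 0 1"
    "\<And>x. x \<in> \<phi> ` U \<Longrightarrow> \<exists>D. ((e \<circ> inv_into U \<phi>) has_derivative D) (at x within \<phi> ` U) \<and> inj D"
proof -
  have ch: "is_chart X (U, \<phi>)"
    using manifold assms unfolding three_manifold_with_boundary_def is_atlas_def by blast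
  then show 1: "openin X U" and 2: "openin (top_of_set half_space) (\<phi> ` U)" by (auto simp: is_chart_def)
  show sub: "U \<subseteq> topspace X" using 1 openin_subset by blast
  have hm: "homeomorphic_map (subtopology X U) (top_of_set (\<phi> ` U)) \<phi>" using ch by (simp add: is_chart_def)
  then have "inj_on \<phi> (topspace (subtopology X U))" by (rule homeomorphic_imp_injective_map)
  then show inj: "inj_on \<phi> U" using sub by (simp add: Int_absorb1)
  show "continuous_map (subtopology X U) (top_of_set (\<phi> ` U)) \<phi>"
    using hm by (rule homeomorphic_imp_continuous_map)
  obtain g where g: "homeomorphic_maps (subtopology X U) (top_of_set (\<phi> ` U)) \<phi> g"
    using hm homeomorphic_map_maps by blast
  have "continuous_map (top_of_set (\<phi> ` U)) (subtopology X U) g" using g homeomorphic_maps_def by blast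
  then have "continuous_map (top_of_set (\<phi> ` U)) X g" using continuous_map_in_subtopology by blast
  moreover have "g y = inv_into U \<phi> y" if "y \<in> \<phi> ` U" for y
  proof -
    from that obtain x where x: "x \<in> U" "y = \<phi> x" by blast
    then have "g y = x" using g sub by (auto simp: homeomorphic_maps_def)
    then show ?thesis using x inj by simp
  qed
  ultimately show "continuous_map (top_of_set (\<phi> ` U)) X (inv_into U \<phi>)"
    by (rule continuous_map_eq) auto
  show "smooth_on (\<phi> ` U) (e \<circ> inv_into U \<phi>)"
    "\<And>x. x \<in> \<phi> ` U \<Longrightarrow> \<exists>D. ((e \<circ> inv_into U \<phi>) has_derivative D) (at x within \<phi> ` U) \<and> inj D"
    using immersion assms unfolding immersion_to_S3_def by blast+
  show "(e \<circ> inv_into U \<phi>) ` \<phi> ` U \<subseteq> sphere 0 1"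
  proof
    fix y assume "y \<in> (e \<circ> inv_into U \<phi>) ` \<phi> ` U"
    then obtain q where "q \<in> U" "y = e q" using inj by auto
    then have "norm y = 1" using norm_immersion sub by blast
    then show "y \<in> sphere 0 1" by (rule mem_sphere_0[THEN iffD2])
  qed
qed

lemma chart_at:
  assumes "p \<in> topspace X"
  obtains U \<phi> where "(U, \<phi>) \<in> A" "p \<in> U"
proof -
  have "\<Union>(fst ` A) = topspace X" using manifold unfolding three_manifold_with_boundary_def is_atlas_def by blast
  then show ?thesis using assms that by fastforce
qed

text \<open>A nearby point \<open>y\<close> of the sphere is in the image of the manifold if its chart coordinates \<open>s y\<close>, which
  are also defined beyond the boundary, lie in the half space.\<close>

lemma local_inverse:
  assumes chart: "(U, \<phi>) \<in> A" and p: "p \<in> U" and N: "openin X N" "p \<in> N"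
    and W: "open W" "\<phi> p \<in> W"
    and D: "((e \<circ> inv_into U \<phi>) has_derivative D) (at (\<phi> p) within \<phi> ` U)" "inj D"
  obtains Q B V s L where "openin X Q" "p \<in> Q" "Q \<subseteq> N" "Q \<subseteq> U"
    "Q = {q \<in> U. \<phi> q \<in> B}" "open B" "B \<subseteq> W" "B \<inter> half_space \<subseteq> \<phi> ` U"
    "open V" "e p \<in> V" "continuous_on V s" "s ` V \<subseteq> B" "s (e p) = \<phi> p"
    "\<And>q. q \<in> Q \<Longrightarrow> e q \<in> V \<and> s (e q) = \<phi> q"
    "\<And>y. \<lbrakk>y \<in> V; norm y = 1; s y \<in> half_space\<rbrakk> \<Longrightarrow> inv_into U \<phi> (s y) \<in> Q \<and> e (inv_into U \<phi> (s y)) = y"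
    "(s has_derivative L) (at (e p))" "\<And>v. L (D v) = v"
proof -
  note c = chartD[OF chart]
  have hs: "\<phi> ` U \<subseteq> half_space" using c(2) openin_subset[OF c(2)] by simp
  define NN where "NN = {x \<in> \<phi> ` U. inv_into U \<phi> x \<in> N}"
  have "openin (top_of_set (\<phi> ` U)) NN"
    using openin_continuous_map_preimage[OF c(5) N(1)] by (simp add: NN_def)
  then obtain T where T: "open T" "NN = \<phi> ` U \<inter> T" by (auto simp: openin_open)
  have pT: "\<phi> p \<in> T" using T(2) p N(2) c(3) by (auto simp: NN_def)
  let ?E = "e \<circ> inv_into U \<phi>"
  obtain B V s L where B: "open B" "\<phi> p \<in> B" "B \<subseteq> W \<inter> T" "B \<inter> half_space \<subseteq> \<phi> ` U"
    "open V" "?E (\<phi> p) \<in> V" "s ` V \<subseteq> B" "continuous_on V s" "s (?E (\<phi> p)) = \<phi> p"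
    "\<And>x. x \<in> B \<Longrightarrow> x \<in> half_space \<Longrightarrow> ?E x \<in> V \<and> s (?E x) = x"
    "\<And>y. \<lbrakk>y \<in> V; norm y = 1; s y \<in> half_space\<rbrakk> \<Longrightarrow> ?E (s y) = y"
    "(s has_derivative L) (at (?E (\<phi> p)))" "\<And>v. L (D v) = v"
    using local_inverse_of_sphere_immersion[OF c(2) imageI[OF p] c(8) c(7) D open_Int[OF W(1) T(1)] IntI[OF W(2) pT]]
    by blast
  have ep: "?E (\<phi> p) = e p" using p c(3) by simp
  let ?Q = "{q \<in> U. \<phi> q \<in> B}"
  have oQ: "openin X ?Q"
  proof -
    have "openin (top_of_set (\<phi> ` U)) (\<phi> ` U \<inter> B)" using B(1) by blast
    from openin_continuous_map_preimage[OF c(4) this]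
    have "openin (subtopology X U) {q \<in> U. \<phi> q \<in> B}"
      using c(6) by (simp add: Int_absorb1 conj_commute cong: conj_cong)
    then show ?thesis using c(1) openin_trans_full by blast
  qed
  show ?thesis
  proof (rule that[of ?Q B V s L])
    show "?Q \<subseteq> N"
    proof
      fix q assume q: "q \<in> ?Q"
      then have "\<phi> q \<in> NN" using T B(3) by auto
      then show "q \<in> N" using q c(3) by (simp add: NN_def)
    qed
    show "e q \<in> V \<and> s (e q) = \<phi> q" if "q \<in> ?Q" for q
      using B(10)[of "\<phi> q"] that c(3) hs by auto
    show "inv_into U \<phi> (s y) \<in> ?Q \<and> e (inv_into U \<phi> (s y)) = y"
      if y: "y \<in> V" "norm y = 1" "s y \<in> half_space" for y
    proof -
      have "s y \<in> B" using y B(7) by blast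
      then have "s y \<in> \<phi> ` U" using B(4) y by blast
      then show ?thesis using B(11)[OF y] \<open>s y \<in> B\<close> by (simp add: inv_into_into f_inv_into_f)
    qed
  qed (use B ep p oQ in auto)
qed

lemma continuous_map_immersion: "continuous_map X euclidean e"
  unfolding continuous_map_def
proof (intro conjI allI impI)
  fix T :: "(complex \<times> complex) set" assume "openin euclidean T"
  then have T: "open T" by simp
  show "openin X {x \<in> topspace X. e x \<in> T}"
  proof (subst openin_subopen, intro ballI)
    fix p assume "p \<in> {x \<in> topspace X. e x \<in> T}"
    then have p: "p \<in> topspace X" "e p \<in> T" by auto
    obtain U \<phi> where ch: "(U, \<phi>) \<in> A" "p \<in> U" using chart_at[OF p(1)] by blast
    note c = chartD[OF ch(1)]
    have "continuous_on (\<phi> ` U) (e \<circ> inv_into U \<phi>)"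
      using c(9) by (meson continuous_on_eq_continuous_within has_derivative_continuous)
    then have "continuous_map (top_of_set (\<phi> ` U)) euclidean (e \<circ> inv_into U \<phi>)" by simp
    from continuous_map_compose[OF c(4) this]
    have "continuous_map (subtopology X U) euclidean (e \<circ> inv_into U \<phi> \<circ> \<phi>)" .
    then have "continuous_map (subtopology X U) euclidean e"
      by (rule continuous_map_eq) (use c(3) in auto)
    from openin_continuous_map_preimage[OF this, of T] T
    have "openin (subtopology X U) {x \<in> topspace X. x \<in> U \<and> e x \<in> T}" by (simp add: conj_assoc Int_def)
    then have "openin X {x \<in> topspace X. x \<in> U \<and> e x \<in> T}" using c(1) openin_trans_full by blast
    then show "\<exists>T'. openin X T' \<and> p \<in> T' \<and> T' \<subseteq> {x \<in> topspace X. e x \<in> T}"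
      using p ch by (intro exI[of _ "{x \<in> topspace X. x \<in> U \<and> e x \<in> T}"]) auto
  qed
qed auto

text \<open>Around an interior point the chart coordinates stay in the half space, so the immersion has a section
  over a full neighbourhood in the sphere.\<close>

lemma interior_section:
  assumes p: "p \<in> topspace X" "p \<notin> manifold_boundary X A"
  obtains Q V \<sigma> where "openin X Q" "p \<in> Q" "open V" "e p \<in> V"
    "continuous_map (top_of_set (V \<inter> sphere 0 1)) X \<sigma>"
    "\<And>y. \<lbrakk>y \<in> V; norm y = 1\<rbrakk> \<Longrightarrow> e (\<sigma> y) = y"
    "\<And>q. q \<in> Q \<Longrightarrow> \<sigma> (e q) = q"
proof -
  obtain U \<phi> where ch: "(U, \<phi>) \<in> A" "p \<in> U" using chart_at[OF p(1)] by blast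
  note c = chartD[OF ch(1)]
  have hs: "\<phi> ` U \<subseteq> half_space" using c(2) openin_subset[OF c(2)] by simp
  have "\<phi> p $ 3 \<noteq> 0" using p ch by (auto simp: manifold_boundary_def)
  then have p3: "\<phi> p $ 3 > 0" using hs ch(2) by (force simp: half_space_def)
  define W where "W = {x :: real^3. x $ 3 > 0}"
  have W: "open W" "\<phi> p \<in> W" using p3 by (auto simp: W_def intro!: open_Collect_less continuous_intros)
  obtain D where D: "((e \<circ> inv_into U \<phi>) has_derivative D) (at (\<phi> p) within \<phi> ` U)" "inj D"
    using c(9)[of "\<phi> p"] ch by blast
  obtain Q B V s L where Q: "openin X Q" "p \<in> Q" "Q \<subseteq> topspace X" "Q \<subseteq> U"
    "Q = {q \<in> U. \<phi> q \<in> B}" "open B" "B \<subseteq> W" "B \<inter> half_space \<subseteq> \<phi> ` U"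
    "open V" "e p \<in> V" "continuous_on V s" "s ` V \<subseteq> B" "s (e p) = \<phi> p"
    "\<And>q. q \<in> Q \<Longrightarrow> e q \<in> V \<and> s (e q) = \<phi> q"
    "\<And>y. \<lbrakk>y \<in> V; norm y = 1; s y \<in> half_space\<rbrakk> \<Longrightarrow> inv_into U \<phi> (s y) \<in> Q \<and> e (inv_into U \<phi> (s y)) = y"
    "(s has_derivative L) (at (e p))" "\<And>v. L (D v) = v"
    by (rule local_inverse[OF ch openin_topspace p(1) W D]) blast
  have BH: "B \<subseteq> half_space" using Q(7) by (auto simp: W_def half_space_def)
  show ?thesis
  proof (rule that[of Q V "inv_into U \<phi> \<circ> s"])
    show "continuous_map (top_of_set (V \<inter> sphere 0 1)) X (inv_into U \<phi> \<circ> s)"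
    proof (rule continuous_map_compose[OF _ c(5)])
      show "continuous_map (top_of_set (V \<inter> sphere 0 1)) (top_of_set (\<phi> ` U)) s"
        using Q(8,11,12) BH by (auto simp: continuous_map_in_subtopology intro: continuous_on_subset)
    qed
    show "e ((inv_into U \<phi> \<circ> s) y) = y" if "y \<in> V" "norm y = 1" for y
      using Q(15)[OF that] Q(12) BH that by auto
    show "(inv_into U \<phi> \<circ> s) (e q) = q" if "q \<in> Q" for q
      using Q(14)[OF that] Q(4) that c(3) by auto
  qed (use Q in auto)
qed

lemma locally_injective:
  assumes "p \<in> topspace X"
  obtains Q where "openin X Q" "p \<in> Q" "inj_on e Q"
proof -
  obtain U \<phi> where ch: "(U, \<phi>) \<in> A" "p \<in> U" using chart_at[OF assms] by blast
  note c = chartD[OF ch(1)]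
  obtain D where D: "((e \<circ> inv_into U \<phi>) has_derivative D) (at (\<phi> p) within \<phi> ` U)" "inj D"
    using c(9)[of "\<phi> p"] ch by blast
  obtain Q B V s L where Q: "openin X Q" "p \<in> Q" "Q \<subseteq> topspace X" "Q \<subseteq> U"
    "\<And>q. q \<in> Q \<Longrightarrow> e q \<in> V \<and> s (e q) = \<phi> q"
    by (rule local_inverse[OF ch openin_topspace assms open_UNIV UNIV_I D]) blast
  have "inj_on e Q" using Q(4,5) c(3) by (metis inj_onD inj_onI subsetD)
  then show ?thesis using that Q by blast
qed

text \<open>The set of parameters at which the lifts agree is closed since the manifold is a Hausdorff space, and
  open since the immersion is locally injective.\<close>

lemma lift_unique:
  fixes S :: "'s::topological_space set"
  assumes "continuous_map (top_of_set S) X g1" "continuous_map (top_of_set S) X g2"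
    "connected S" "t0 \<in> S" "g1 t0 = g2 t0" "\<And>t. t \<in> S \<Longrightarrow> e (g1 t) = e (g2 t)" "t \<in> S"
  shows "g1 t = g2 t"
proof -
  let ?T = "{t \<in> S. g1 t = g2 t}"
  have H: "Hausdorff_space X" using manifold by (simp add: three_manifold_with_boundary_def)
  have g: "g1 t \<in> topspace X" "g2 t \<in> topspace X" if "t \<in> S" for t
    using assms(1,2) that by (auto simp: continuous_map_def)
  have cl: "closedin (top_of_set S) ?T"
    using closedin_continuous_maps_eq[OF H assms(1,2)] by simp
  have op: "openin (top_of_set S) ?T"
  proof (subst openin_subopen, intro ballI)
    fix t assume t: "t \<in> ?T"
    obtain Q where Q: "openin X Q" "g1 t \<in> Q" "inj_on e Q" using locally_injective g t by blast
    have "openin (top_of_set S) {t \<in> S. g1 t \<in> Q}" "openin (top_of_set S) {t \<in> S. g2 t \<in> Q}"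
      using openin_continuous_map_preimage[OF assms(1) Q(1)] openin_continuous_map_preimage[OF assms(2) Q(1)] by auto
    then have "openin (top_of_set S) ({t \<in> S. g1 t \<in> Q} \<inter> {t \<in> S. g2 t \<in> Q})" by (rule openin_Int)
    moreover have "t \<in> {t \<in> S. g1 t \<in> Q} \<inter> {t \<in> S. g2 t \<in> Q}" using t Q(2) by auto
    moreover have "{t \<in> S. g1 t \<in> Q} \<inter> {t \<in> S. g2 t \<in> Q} \<subseteq> ?T"
      using Q(3) assms(6) by (auto dest: inj_onD)
    ultimately show "\<exists>T. openin (top_of_set S) T \<and> t \<in> T \<and> T \<subseteq> ?T" by blast
  qed
  have "?T = {} \<or> ?T = S" using assms(3) cl op connected_clopen by blast
  then show ?thesis using assms(4,5,7) by blast
qed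

end

section \<open>The path metric of an immersed manifold\<close>

lemma speed_bounds_chord:
  fixes g :: "real \<Rightarrow> 'a::euclidean_space"
  assumes g: "g piecewise_C1_differentiable_on {0..1}"
    and L: "((\<lambda>t. norm (vector_derivative g (at t))) has_integral L) {0..1}"
    and ab: "0 \<le> a" "a \<le> b" "b \<le> 1"
  shows "norm (g b - g a) \<le> integral {a..b} (\<lambda>t. norm (vector_derivative g (at t)))"
proof -
  obtain S where S: "finite S" "g C1_differentiable_on ({0..1} - S)" "continuous_on {0..1} g"
    using g by (auto simp: piecewise_C1_differentiable_on_def)
  have der: "(g has_vector_derivative vector_derivative g (at x)) (at x)" if "x \<in> {a<..<b} - S" for x
    using S(2) that ab by (auto simp: C1_differentiable_on_eq vector_derivative_works)
  have I: "((\<lambda>x. vector_derivative g (at x)) has_integral (g b - g a)) {a..b}"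
    by (rule fundamental_theorem_of_calculus_interior_strong[OF S(1) ab(2) der])
       (use S(3) ab in \<open>auto intro: continuous_on_subset\<close>)
  have "(\<lambda>t. norm (vector_derivative g (at t))) integrable_on {a..b}"
    by (rule integrable_on_subinterval[of _ "{0..1}"]) (use L ab in auto)
  then show ?thesis
    using integral_norm_bound_integral[of "\<lambda>x. vector_derivative g (at x)" "{a..b}"] I
    by (metis (no_types, lifting) has_integral_integrable integral_unique order_refl)
qed

lemma speed_bounds_chord_total:
  fixes g :: "real \<Rightarrow> 'a::euclidean_space"
  assumes g: "g piecewise_C1_differentiable_on {0..1}"
    and L: "((\<lambda>t. norm (vector_derivative g (at t))) has_integral L) {0..1}"
    and ab: "0 \<le> a" "a \<le> b" "b \<le> 1"
  shows "norm (g b - g a) \<le> L"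
proof -
  have "integral {a..b} (\<lambda>t. norm (vector_derivative g (at t))) \<le> integral {0..1} (\<lambda>t. norm (vector_derivative g (at t)))"
    by (rule integral_subset_le)
       (use L ab in \<open>auto intro: integrable_on_subinterval[of _ "{0..1}"]\<close>)
  then show ?thesis using speed_bounds_chord[OF assms] L by (simp add: integral_unique)
qed

definition path_lengths :: "'p topology \<Rightarrow> ('p \<Rightarrow> complex \<times> complex) \<Rightarrow> 'p \<Rightarrow> 'p \<Rightarrow> real set" where
  "path_lengths X e p q = {L. \<exists>\<gamma>. pathin X \<gamma> \<and> \<gamma> 0 = p \<and> \<gamma> 1 = q \<and>
     (e \<circ> \<gamma>) piecewise_C1_differentiable_on {0..1} \<and>
     ((\<lambda>t. norm (vector_derivative (e \<circ> \<gamma>) (at t))) has_integral L) {0..1}}"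

lemma induced_dist_eq: "induced_dist X e p q = Inf (path_lengths X e p q)"
  unfolding induced_dist_def path_lengths_def ..

lemma path_lengths_nonneg: "L \<in> path_lengths X e p q \<Longrightarrow> 0 \<le> L"
  unfolding path_lengths_def by (auto intro: has_integral_nonneg)

lemma induced_dist_le: "L \<in> path_lengths X e p q \<Longrightarrow> induced_dist X e p q \<le> L"
  unfolding induced_dist_eq by (rule cInf_lower) (auto intro: bdd_belowI path_lengths_nonneg)

context immersed_manifold
begin

text \<open>A path that leaves a small ball around \<open>p\<close> in a chart crosses the boundary sphere of that
  ball, whose image under the immersion has positive distance from the image of \<open>p\<close>.\<close>

lemma paths_leaving_are_long:
  assumes N: "openin X N" "p \<in> N"
  obtains c where "c > 0" "\<And>q L. \<lbrakk>q \<notin> N; L \<in> path_lengths X e p q\<rbrakk> \<Longrightarrow> c \<le> L"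
proof -
  have p: "p \<in> topspace X" using N openin_subset by blast
  obtain U \<phi> where ch: "(U, \<phi>) \<in> A" "p \<in> U" using chart_at[OF p] by blast
  note c = chartD[OF ch(1)]
  have hs: "\<phi> ` U \<subseteq> half_space" using c(2) openin_subset[OF c(2)] by simp
  obtain D where D: "((e \<circ> inv_into U \<phi>) has_derivative D) (at (\<phi> p) within \<phi> ` U)" "inj D"
    using c(9)[of "\<phi> p"] ch by blast
  obtain Q B V s L where Q: "openin X Q" "p \<in> Q" "Q \<subseteq> N" "Q \<subseteq> U"
    "Q = {q \<in> U. \<phi> q \<in> B}" "open B" "B \<inter> half_space \<subseteq> \<phi> ` U"
    "\<And>q. q \<in> Q \<Longrightarrow> e q \<in> V \<and> s (e q) = \<phi> q"
    by (rule local_inverse[OF ch N open_UNIV UNIV_I D]) blast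
  have "\<phi> p \<in> B" using Q by blast
  then obtain r where r: "r > 0" "cball (\<phi> p) r \<subseteq> B" using Q(6) open_contains_cball by blast
  define C where "C = sphere (\<phi> p) r \<inter> half_space"
  define K where "K = cball (\<phi> p) r \<inter> half_space"
  have clh: "closed half_space" unfolding half_space_def by (intro closed_Collect_le continuous_intros)
  have cC: "compact C" and cK: "compact K" unfolding C_def K_def by (auto intro: compact_Int_closed clh)
  have KB: "K \<subseteq> \<phi> ` U" using r Q(7) by (auto simp: K_def)
  have CK: "C \<subseteq> K" by (auto simp: C_def K_def)
  let ?E = "e \<circ> inv_into U \<phi>"
  have contE: "continuous_on (\<phi> ` U) ?E"
    using c(9) by (meson continuous_on_eq_continuous_within has_derivative_continuous)
  have cEC: "closed (?E ` C)"
    using cC contE CK KB by (meson compact_continuous_image compact_imp_closed continuous_on_subset order_trans)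
  have "e p \<notin> ?E ` C"
  proof
    assume "e p \<in> ?E ` C"
    then obtain x where x: "x \<in> C" "e p = ?E x" by blast
    then obtain q where q: "q \<in> U" "x = \<phi> q" using CK KB by blast
    then have "q \<in> Q" using x r Q(5) by (auto simp: C_def)
    then have "\<phi> q = \<phi> p" using Q(8)[of q] Q(8)[OF Q(2)] x q c(3) by simp
    then show False using x q r by (auto simp: C_def)
  qed
  from separate_point_closed[OF cEC this]
  obtain d where d: "d > 0" "\<And>y. y \<in> ?E ` C \<Longrightarrow> d \<le> dist (e p) y"
    by (elim exE conjE) (rule that, auto)
  show ?thesis
  proof (rule that[OF d(1)])
    fix q L assume q: "q \<notin> N" and "L \<in> path_lengths X e p q"
    then obtain \<gamma> where g: "pathin X \<gamma>" "\<gamma> 0 = p" "\<gamma> 1 = q"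
      "(e \<circ> \<gamma>) piecewise_C1_differentiable_on {0..1}"
      "((\<lambda>t. norm (vector_derivative (e \<circ> \<gamma>) (at t))) has_integral L) {0..1}"
      unfolding path_lengths_def by blast
    have cg: "continuous_map (top_of_set {0..1}) X \<gamma>" using g(1) by (simp add: pathin_def)
    define P where "P = {q \<in> U. \<phi> q \<in> ball (\<phi> p) r}"
    define R where "R = inv_into U \<phi> ` K"
    have oP: "openin X P"
    proof -
      have "openin (top_of_set (\<phi> ` U)) (\<phi> ` U \<inter> ball (\<phi> p) r)" by blast
      from openin_continuous_map_preimage[OF c(4) this]
      have "openin (subtopology X U) P"
        using c(6) by (simp add: P_def Int_absorb1 conj_commute cong: conj_cong)
      then show ?thesis using c(1) openin_trans_full by blast
    qed
    have "compactin X R" unfolding R_def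
      by (rule image_compactin[OF _ c(5)]) (use cK KB in \<open>auto simp: compactin_subtopology\<close>)
    then have clR: "closedin X R"
      using compactin_imp_closedin manifold by (auto simp: three_manifold_with_boundary_def)
    have Rq: "R = {q \<in> U. \<phi> q \<in> cball (\<phi> p) r}"
    proof -
      have "x \<in> R" if "x \<in> U" "\<phi> x \<in> cball (\<phi> p) r" for x
        unfolding R_def using that hs c(3) by (intro image_eqI[of _ _ "\<phi> x"]) (auto simp: K_def)
      moreover have "x \<in> U \<and> \<phi> x \<in> cball (\<phi> p) r" if "x \<in> R" for x
        using that KB c(3) unfolding R_def by (auto simp: K_def inv_into_into f_inv_into_f subset_iff)
      ultimately show ?thesis by blast
    qed
    have PR: "P \<subseteq> R" unfolding Rq P_def by auto
    have RN: "R \<subseteq> N" using r Q(3,5) unfolding Rq by blast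
    have "\<exists>t\<in>{0..1}. \<gamma> t \<in> R - P"
    proof (rule ccontr)
      assume "\<not> ?thesis"
      then have "{t \<in> {0..1}. \<gamma> t \<in> P} = {t \<in> {0..1}. \<gamma> t \<in> R}" using PR by blast
      moreover have "openin (top_of_set {0..1::real}) {t \<in> {0..1}. \<gamma> t \<in> P}"
        using openin_continuous_map_preimage[OF cg oP] by simp
      moreover have "closedin (top_of_set {0..1::real}) {t \<in> {0..1}. \<gamma> t \<in> R}"
        using closedin_continuous_map_preimage[OF cg clR] by simp
      moreover have "connected {0..1::real}" by simp
      ultimately have "{t \<in> {0..1}. \<gamma> t \<in> R} = {} \<or> {t \<in> {0..1}. \<gamma> t \<in> R} = {0..1}"
        using connected_clopen by metis
      moreover have "\<gamma> 0 \<in> R" using g(2) ch(2) r by (simp add: Rq)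
      then have "0 \<in> {t \<in> {0..1}. \<gamma> t \<in> R}" by simp
      ultimately have "{t \<in> {0..1}. \<gamma> t \<in> R} = {0..1}" by blast
      moreover have "1 \<in> {0..1::real}" by simp
      ultimately have "\<gamma> 1 \<in> R" by blast
      then show False using g(3) q RN by blast
    qed
    then obtain t where t: "t \<in> {0..1}" "\<gamma> t \<in> U" "\<phi> (\<gamma> t) \<in> sphere (\<phi> p) r"
      by (auto simp: Rq P_def)
    then have "\<phi> (\<gamma> t) \<in> C" using hs by (auto simp: C_def)
    then have "e (\<gamma> t) \<in> ?E ` C" using t(2) c(3) by (intro image_eqI[of _ _ "\<phi> (\<gamma> t)"]) auto
    then have "d \<le> norm (e (\<gamma> t) - e (\<gamma> 0))" using d(2)[of "e (\<gamma> t)"] g(2) by (metis dist_norm dist_commute)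
    also have "\<dots> \<le> L" using speed_bounds_chord_total[OF g(4,5), of 0 t] t(1) by simp
    finally show "d \<le> L" .
  qed
qed

end

locale complete_filling = immersed_manifold +
  fixes \<tau> :: complex and \<iota> :: "complex \<Rightarrow> 'a" and f n :: "complex \<Rightarrow> complex \<times> complex"
  assumes param: "boundary_parameterisation X A \<tau> \<iota>"
    and e_iota: "\<And>z. e (\<iota> z) = f z"
    and normal: "inward_unit_normal A e \<iota> n"
    and complete: "complete_wrt_induced_metric X e"
begin

lemma iota_boundary: "\<iota> z \<in> manifold_boundary X A" "\<iota> z \<in> topspace X"
proof -
  have "range \<iota> = manifold_boundary X A" using param by (simp add: boundary_parameterisation_def)
  then show "\<iota> z \<in> manifold_boundary X A" by blast
  then show "\<iota> z \<in> topspace X" by (simp add: manifold_boundary_def)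
qed

text \<open>Convergence in the path metric implies convergence in the topology of the manifold. This is how
  completeness, a property of the metric, becomes accessible in charts.\<close>

lemma small_balls:
  assumes N: "openin X N" "p \<in> N"
  obtains c where "c > 0" "\<And>q. \<lbrakk>q \<in> topspace X; induced_dist X e p q < c\<rbrakk> \<Longrightarrow> q \<in> N"
proof -
  interpret M: Metric_space "topspace X" "induced_dist X e"
    using complete by (simp add: complete_wrt_induced_metric_def)
  have p: "p \<in> topspace X" using N openin_subset by blast
  obtain c where c: "c > 0" "\<And>q L. \<lbrakk>q \<notin> N; L \<in> path_lengths X e p q\<rbrakk> \<Longrightarrow> c \<le> L"
    using paths_leaving_are_long[OF N] by blast
  \<comment> \<open>a pair of points without a connecting path has the distance \<open>Inf {}\<close>, an unspecified number;
     as a distance it is positive unless the points are equal\<close>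
  define k where "k = (Inf {} :: real)"
  show ?thesis
  proof (rule that[of "if k > 0 then min c k else c"])
    show "(if k > 0 then min c k else c) > 0" using c by simp
    fix q assume q: "q \<in> topspace X" "induced_dist X e p q < (if k > 0 then min c k else c)"
    show "q \<in> N"
    proof (rule ccontr)
      assume n: "q \<notin> N"
      show False
      proof (cases "path_lengths X e p q = {}")
        case True
        then have "induced_dist X e p q = k" by (simp add: induced_dist_eq k_def)
        then have "induced_dist X e p q = 0" using q M.nonneg[of p q] by (auto split: if_splits)
        then have "p = q" using M.zero p q by blast
        then show False using n N by blast
      next
        case False
        then have "c \<le> induced_dist X e p q" unfolding induced_dist_eq by (rule cInf_greatest) (use c n in blast)
        then show False using q by (auto split: if_splits)
      qed
    qed
  qed
qed

end

section \<open>Lifts of normal geodesics to a complete filling\<close>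

text \<open>The rays are the geodesics of the sphere that start on the image of the real axis in the direction of
  the inward normal. They are considered up to the distance \<open>\<delta>\<close>, and must not return to the
  surface before.\<close>

locale normal_rays = complete_filling +
  fixes \<delta> :: real
  assumes delta: "0 < \<delta>"
    and perp: "\<And>x::real. f (of_real x) \<bullet> n (of_real x) = 0"
    and contf: "continuous_on UNIV (\<lambda>x::real. f (of_real x))"
    and contn: "continuous_on UNIV (\<lambda>x::real. n (of_real x))"
    and off_boundary: "\<And>x t. \<lbrakk>0 < t; t \<le> \<delta>\<rbrakk> \<Longrightarrow>
       cos t *\<^sub>R f (of_real x) + sin t *\<^sub>R n (of_real x) \<notin> range f"
begin

definition ray :: "real \<Rightarrow> real \<Rightarrow> complex \<times> complex" where
  "ray x t = cos t *\<^sub>R f (of_real x) + sin t *\<^sub>R n (of_real x)"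

lemma norm_f: "norm (f z) = 1"
  using norm_immersion[OF iota_boundary(2)] by (simp add: e_iota)

lemma norm_n: "norm (n z) = 1"
  using normal by (simp add: inward_unit_normal_def)

lemma norm_comb:
  "norm (a *\<^sub>R f (of_real x) + b *\<^sub>R n (of_real x)) = sqrt (a\<^sup>2 + b\<^sup>2)"
proof -
  let ?F = "f (of_real x)" and ?N = "n (of_real x)"
  have FF: "?F \<bullet> ?F = 1" "?N \<bullet> ?N = 1" by (simp_all add: dot_square_norm norm_f norm_n)
  have NF: "?N \<bullet> ?F = 0" using perp[of x] by (simp add: inner_commute)
  have "(a *\<^sub>R ?F + b *\<^sub>R ?N) \<bullet> (a *\<^sub>R ?F + b *\<^sub>R ?N) = a\<^sup>2 + b\<^sup>2"
    unfolding inner_add_left inner_add_right inner_scaleR_left inner_scaleR_right FF NF perp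
    by (simp add: power2_eq_square)
  then show ?thesis by (simp add: norm_eq_sqrt_inner)
qed

lemma norm_ray: "norm (ray x t) = 1"
  unfolding ray_def norm_comb by (simp add: add.commute)

lemma ray_0: "ray x 0 = f (of_real x)" by (simp add: ray_def)

lemma ray_off: "\<lbrakk>0 < t; t \<le> \<delta>\<rbrakk> \<Longrightarrow> ray x t \<notin> range f"
  unfolding ray_def by (rule off_boundary)

lemma continuous_ray: "continuous_on UNIV (\<lambda>p. ray (fst p) (snd p))"
  unfolding ray_def
  by (intro continuous_intros continuous_on_compose2[OF contf] continuous_on_compose2[OF contn]) auto

lemma ray_near:
  assumes "open V" "ray x0 t0 \<in> V"
  obtains \<eta> where "\<eta> > 0" "\<And>x t. \<lbrakk>\<bar>x - x0\<bar> < \<eta>; \<bar>t - t0\<bar> < \<eta>\<rbrakk> \<Longrightarrow> ray x t \<in> V"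
proof -
  have "open ((\<lambda>p. ray (fst p) (snd p)) -` V)"
    using continuous_ray assms(1) by (simp add: continuous_on_open_vimage[OF open_UNIV])
  moreover have "(x0, t0) \<in> (\<lambda>p. ray (fst p) (snd p)) -` V" using assms by simp
  ultimately obtain r where r: "r > 0" "ball (x0, t0) r \<subseteq> (\<lambda>p. ray (fst p) (snd p)) -` V"
    using open_contains_ball by blast
  show ?thesis
  proof (rule that[of "r / 2"])
    fix x t assume xt: "\<bar>x - x0\<bar> < r / 2" "\<bar>t - t0\<bar> < r / 2"
    have "dist (x0, t0) (x, t) \<le> \<bar>x - x0\<bar> + \<bar>t - t0\<bar>"
      using norm_Pair_le[of "x0 - x" "t0 - t"] by (simp add: dist_norm abs_minus_commute)
    then have "(x, t) \<in> ball (x0, t0) r" using xt by simp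
    then show "ray x t \<in> V" using r by auto
  qed (use r in simp)
qed

lemma ray_deriv: "((\<lambda>t. ray x t) has_vector_derivative
    ((- sin t) *\<^sub>R f (of_real x) + cos t *\<^sub>R n (of_real x))) (at t)"
  unfolding ray_def by (auto intro!: derivative_eq_intros)

text \<open>Rays have unit speed, so the distance of two points on a lifted ray is at most the difference of the
  parameters.\<close>

lemma ray_length:
  assumes ab: "a \<le> b" and g: "continuous_map (top_of_set {a..b}) X \<gamma>"
    and eg: "\<And>t. t \<in> {a..b} \<Longrightarrow> e (\<gamma> t) = ray x t"
  shows "b - a \<in> path_lengths X e (\<gamma> a) (\<gamma> b)"
proof -
  define \<theta> where "\<theta> = (\<lambda>u. a + u * (b - a))"
  have th: "\<theta> u \<in> {a..b}" if "u \<in> {0..1}" for u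
    using ab that mult_left_le_one_le[of "b - a" u] by (auto simp: \<theta>_def mult.commute)
  define R where "R = (\<lambda>u. ray x (\<theta> u))"
  define R' where "R' = (\<lambda>u. (b - a) *\<^sub>R ((- sin (\<theta> u)) *\<^sub>R f (of_real x) + cos (\<theta> u) *\<^sub>R n (of_real x)))"
  have RD: "(R has_vector_derivative R' u) (at u)" for u
  proof -
    have "(\<theta> has_vector_derivative (b - a)) (at u)" unfolding \<theta>_def by (auto intro!: derivative_eq_intros)
    from vector_diff_chain_at[OF this ray_deriv] show ?thesis by (simp add: R_def R'_def o_def)
  qed
  have nR: "norm (R' u) = b - a" for u unfolding R'_def norm_scaleR norm_comb using ab by simp
  have eq: "(e \<circ> (\<gamma> \<circ> \<theta>)) u = R u" if "u \<in> {0..1}" for u using eg[OF th[OF that]] by (simp add: R_def)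
  have D: "((e \<circ> (\<gamma> \<circ> \<theta>)) has_vector_derivative R' u) (at u)" if "u \<in> {0<..<1}" for u
    by (rule has_vector_derivative_transform_within_open[OF RD, of "{0<..<1}"]) (use that eq in auto)
  have "pathin X (\<gamma> \<circ> \<theta>)" unfolding pathin_def
  proof (rule continuous_map_compose[OF _ g])
    show "continuous_map (top_of_set {0..1}) (top_of_set {a..b}) \<theta>"
      using th by (auto simp: continuous_map_in_subtopology \<theta>_def intro!: continuous_intros)
  qed
  moreover have "(e \<circ> (\<gamma> \<circ> \<theta>)) piecewise_C1_differentiable_on {0..1}"
    unfolding piecewise_C1_differentiable_on_def
  proof (intro conjI exI[of _ "{0,1}"])
    have "continuous_on {0..1} R" using RD by (meson continuous_at_imp_continuous_on has_vector_derivative_continuous)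
    then show "continuous_on {0..1} (e \<circ> (\<gamma> \<circ> \<theta>))" by (rule continuous_on_eq) (use eq in auto)
    have "{0..1} - {0,1} = {0<..<1::real}" by auto
    moreover have "continuous_on {0<..<1} R'" unfolding R'_def \<theta>_def by (intro continuous_intros)
    ultimately show "(e \<circ> (\<gamma> \<circ> \<theta>)) C1_differentiable_on {0..1} - {0, 1}"
      using D unfolding C1_differentiable_on_def by metis
  qed auto
  moreover have "((\<lambda>t. norm (vector_derivative (e \<circ> (\<gamma> \<circ> \<theta>)) (at t))) has_integral (b - a)) {0..1}"
  proof (rule has_integral_spike_finite[of "{0,1}" _ _ "\<lambda>_. b - a"])
    show "((\<lambda>_::real. b - a) has_integral b - a) {0..1}" using has_integral_const_real[of "b - a" 0 1] by simp
    fix u :: real assume "u \<in> {0..1} - {0, 1}"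
    then have "u \<in> {0<..<1}" by auto
    from vector_derivative_at[OF D[OF this]] show "norm (vector_derivative (e \<circ> (\<gamma> \<circ> \<theta>)) (at u)) = b - a"
      by (simp add: nR)
  qed auto
  moreover have "(\<gamma> \<circ> \<theta>) 0 = \<gamma> a" "(\<gamma> \<circ> \<theta>) 1 = \<gamma> b" by (auto simp: \<theta>_def)
  ultimately show ?thesis unfolding path_lengths_def by blast
qed

text \<open>The rays with starting points near \<open>x0\<close> are lifted together, so that lifts of neighbouring rays can be
  compared at their ends.\<close>

definition is_lift :: "real \<Rightarrow> real \<Rightarrow> real \<Rightarrow> (real \<times> real \<Rightarrow> 'a) \<Rightarrow> bool" where
  "is_lift x0 \<eta> T G \<longleftrightarrow> 0 < \<eta> \<and>
     continuous_map (top_of_set ({x0 - \<eta><..<x0 + \<eta>} \<times> {0..T})) X G \<and>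
     (\<forall>x t. x \<in> {x0 - \<eta><..<x0 + \<eta>} \<longrightarrow> t \<in> {0..T} \<longrightarrow> e (G (x, t)) = ray x t) \<and>
     (\<forall>x. x \<in> {x0 - \<eta><..<x0 + \<eta>} \<longrightarrow> G (x, 0) = \<iota> (of_real x))"

lemma is_lift_vertical:
  assumes "is_lift x0 \<eta> T G" "x \<in> {x0 - \<eta><..<x0 + \<eta>}"
  shows "continuous_map (top_of_set {0..T}) X (\<lambda>t. G (x, t))"
proof -
  have "continuous_map (top_of_set {0..T}) (top_of_set ({x0 - \<eta><..<x0 + \<eta>} \<times> {0..T})) (\<lambda>t. (x, t))"
    using assms(2) by (auto simp: continuous_map_in_subtopology intro!: continuous_intros)
  from continuous_map_compose[OF this, of X G] assms(1) show ?thesis by (simp add: is_lift_def o_def)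
qed

lemma is_lift_horizontal:
  assumes "is_lift x0 \<eta> T G" "t \<in> {0..T}"
  shows "continuous_map (top_of_set {x0 - \<eta><..<x0 + \<eta>}) X (\<lambda>x. G (x, t))"
proof -
  have "continuous_map (top_of_set {x0 - \<eta><..<x0 + \<eta>}) (top_of_set ({x0 - \<eta><..<x0 + \<eta>} \<times> {0..T})) (\<lambda>x. (x, t))"
    using assms(2) by (auto simp: continuous_map_in_subtopology intro!: continuous_intros)
  from continuous_map_compose[OF this, of X G] assms(1) show ?thesis by (simp add: is_lift_def o_def)
qed

lemma is_lift_mono: "\<lbrakk>is_lift x0 \<eta> T G; T' \<le> T; \<eta>' \<le> \<eta>; 0 < \<eta>'\<rbrakk> \<Longrightarrow> is_lift x0 \<eta>' T' G"
  unfolding is_lift_def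
  by (auto elim!: continuous_map_from_subtopology_mono)

lemma is_lift_shorten: "\<lbrakk>is_lift x0 \<eta> T G; T' \<le> T\<rbrakk> \<Longrightarrow> is_lift x0 \<eta> T' G"
  using is_lift_mono[of x0 \<eta> T G T' \<eta>] by (simp add: is_lift_def)

lemma is_lift_unique:
  assumes "is_lift x0 \<eta> T G" "is_lift x0' \<eta>' T' G'" "x \<in> {x0 - \<eta><..<x0 + \<eta>}" "x \<in> {x0' - \<eta>'<..<x0' + \<eta>'}"
    "0 \<le> t" "t \<le> T" "t \<le> T'"
  shows "G (x, t) = G' (x, t)"
proof -
  have *: "is_lift x0 \<eta> t G" "is_lift x0' \<eta>' t G'"
    using is_lift_mono[of x0 \<eta> T G t \<eta>] is_lift_mono[of x0' \<eta>' T' G' t \<eta>'] assms by (auto simp: is_lift_def)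
  show ?thesis
    by (rule lift_unique[OF is_lift_vertical[OF *(1) assms(3)] is_lift_vertical[OF *(2) assms(4)], of 0 t])
       (use * assms in \<open>auto simp: is_lift_def\<close>)
qed

text \<open>The inward normal points into the half space of a chart, and a ray cannot come back to the boundary
  of the half space, as it does not meet the surface again. So its chart coordinates remain in the
  half space, where the local inverse of the immersion lifts it.\<close>

lemma lift_near_boundary: "\<exists>\<eta> T G. 0 < T \<and> is_lift x0 \<eta> T G"
proof -
  let ?p = "\<iota> (of_real x0)"
  obtain U \<phi> where ch: "(U, \<phi>) \<in> A" "?p \<in> U" using chart_at[OF iota_boundary(2)] by blast
  note c = chartD[OF ch(1)]
  have hs: "\<phi> ` U \<subseteq> half_space" using c(2) openin_subset[OF c(2)] by simp
  have pin: "\<phi> ?p \<in> \<phi> ` U" using ch by blast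
  let ?E = "e \<circ> inv_into U \<phi>"
  obtain D and v :: "real^3" where D: "(?E has_derivative D) (at (\<phi> ?p) within \<phi> ` U)" "v $ 3 > 0" "D v = n (of_real x0)"
    using normal ch unfolding inward_unit_normal_def by blast
  obtain D0 where D0: "(?E has_derivative D0) (at (\<phi> ?p) within \<phi> ` U)" "inj D0"
    using c(9)[OF pin] by blast
  have "D = D0"
    by (rule frechet_derivative_unique_within[OF D(1) D0(1)]) (rule half_space_approachable[OF c(2) pin])
  then have injD: "inj D" using D0 by simp
  obtain Q B V s L where Q: "openin X Q" "?p \<in> Q" "Q \<subseteq> topspace X" "Q \<subseteq> U"
    "Q = {q \<in> U. \<phi> q \<in> B}" "open B" "B \<subseteq> UNIV" "B \<inter> half_space \<subseteq> \<phi> ` U"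
    "open V" "e ?p \<in> V" "continuous_on V s" "s ` V \<subseteq> B" "s (e ?p) = \<phi> ?p"
    "\<And>q. q \<in> Q \<Longrightarrow> e q \<in> V \<and> s (e q) = \<phi> q"
    "\<And>y. \<lbrakk>y \<in> V; norm y = 1; s y \<in> half_space\<rbrakk> \<Longrightarrow> inv_into U \<phi> (s y) \<in> Q \<and> e (inv_into U \<phi> (s y)) = y"
    "(s has_derivative L) (at (e ?p))" "\<And>v. L (D v) = v"
    by (rule local_inverse[OF ch openin_topspace iota_boundary(2) open_UNIV UNIV_I D(1) injD]) blast
  have "ray x0 0 \<in> V" using Q(10) by (simp add: ray_0 e_iota)
  then obtain \<eta>0 where e0: "\<eta>0 > 0" "\<And>x t. \<lbrakk>\<bar>x - x0\<bar> < \<eta>0; \<bar>t\<bar> < \<eta>0\<rbrakk> \<Longrightarrow> ray x t \<in> V"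
    using ray_near[OF Q(9), of x0 0] by auto
  have "continuous_map euclidean X \<iota>" using param by (simp add: boundary_parameterisation_def)
  moreover have "continuous_map euclideanreal euclidean (\<lambda>x. of_real x :: complex)"
    by (auto intro!: continuous_intros)
  ultimately have "continuous_map euclideanreal X (\<iota> \<circ> (\<lambda>x. of_real x))" by (rule continuous_map_compose[rotated])
  from openin_continuous_map_preimage[OF this Q(1)] have "open {x::real. \<iota> (of_real x) \<in> Q}" by simp
  then obtain \<eta>1 where e1: "\<eta>1 > 0" "\<And>x. \<bar>x - x0\<bar> < \<eta>1 \<Longrightarrow> \<iota> (of_real x) \<in> Q"
    using Q(2) by (metis (no_types, lifting) dist_commute dist_real_def mem_Collect_eq open_dist)
  define \<eta> where "\<eta> = min \<eta>0 \<eta>1"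
  define \<epsilon> where "\<epsilon> = min \<eta>0 \<delta>"
  have pos: "\<eta> > 0" "\<epsilon> > 0" using e0 e1 delta by (auto simp: \<eta>_def \<epsilon>_def)
  let ?I = "{x0 - \<eta><..<x0 + \<eta>}"
  define \<xi> where "\<xi> = (\<lambda>p. s (ray (fst p) (snd p)))"
  have rV: "ray x t \<in> V" if "x \<in> ?I" "0 \<le> t" "t < \<epsilon>" for x t
    using e0(2)[of x t] that by (auto simp: \<eta>_def \<epsilon>_def)
  have contxi: "continuous_on (?I \<times> {0..<\<epsilon>}) \<xi>" unfolding \<xi>_def
    by (rule continuous_on_compose2[OF Q(11)]) (use rV continuous_ray in \<open>auto intro: continuous_on_subset\<close>)
  have nz: "\<xi> (x, t) $ 3 \<noteq> 0" if "x \<in> ?I" "0 < t" "t < \<epsilon>" for x t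
  proof
    assume z: "\<xi> (x, t) $ 3 = 0"
    then have h: "s (ray x t) \<in> half_space" by (simp add: \<xi>_def half_space_def)
    have V: "ray x t \<in> V" using rV that by simp
    let ?q = "inv_into U \<phi> (s (ray x t))"
    have q: "?q \<in> Q" "e ?q = ray x t" using Q(15)[OF V norm_ray h] by auto
    have "s (ray x t) \<in> \<phi> ` U" using Q(8,12) V h by blast
    then have "\<phi> ?q $ 3 = 0" using z by (simp add: f_inv_into_f \<xi>_def)
    then have "?q \<in> manifold_boundary X A" using q(1) Q(3,4) ch(1) by (auto simp: manifold_boundary_def)
    then have "?q \<in> range \<iota>" using param by (simp add: boundary_parameterisation_def)
    then obtain z where "?q = \<iota> z" by blast
    then have "ray x t = f z" using q(2) e_iota[of z] by simp
    then have "ray x t \<in> range f" by blast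
    then show False using ray_off[of t x] that by (simp add: \<epsilon>_def)
  qed
  have "\<exists>t1. 0 < t1 \<and> t1 < \<epsilon> \<and> \<xi> (x0, t1) $ 3 > 0"
  proof -
    have "((\<lambda>t. s (ray x0 t)) has_vector_derivative L (n (of_real x0))) (at 0)"
    proof -
      have "(s has_derivative L) (at (ray x0 0))" using Q(16) by (simp add: ray_0 e_iota)
      moreover have "(ray x0 has_derivative (\<lambda>h. h *\<^sub>R n (of_real x0))) (at 0)"
        using ray_deriv[of x0 0] by (simp add: has_vector_derivative_def)
      ultimately have "((\<lambda>t. s (ray x0 t)) has_derivative (\<lambda>h. L (h *\<^sub>R n (of_real x0)))) (at 0)"
        by (rule has_derivative_compose[rotated])
      moreover have "linear L" using Q(16) has_derivative_linear by blast
      ultimately show ?thesis by (simp add: has_vector_derivative_def linear_cmul)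
    qed
    moreover have "bounded_linear (\<lambda>x::real^3. x $ 3)" by (rule bounded_linear_vec_nth)
    ultimately have "((\<lambda>t. s (ray x0 t) $ 3) has_vector_derivative (L (n (of_real x0))) $ 3) (at 0)"
      using bounded_linear.has_vector_derivative by blast
    moreover have "L (n (of_real x0)) = v" using D(3) Q(17) by metis
    ultimately have "((\<lambda>t. s (ray x0 t) $ 3) has_field_derivative v $ 3) (at 0)"
      by (simp add: has_real_derivative_iff_has_vector_derivative)
    from DERIV_pos_inc_right[OF this D(2)]
    have "\<exists>d>0. \<forall>h>0. h < d \<longrightarrow> s (ray x0 0) $ 3 < s (ray x0 h) $ 3" by (simp only: add_0)
    then obtain d where d: "d > 0" "\<forall>h>0. h < d \<longrightarrow> s (ray x0 0) $ 3 < s (ray x0 h) $ 3" by (elim exE conjE)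
    have "s (ray x0 0) \<in> half_space" using Q(13) hs pin by (auto simp: ray_0 e_iota)
    then have "s (ray x0 0) $ 3 \<ge> 0" by (simp add: half_space_def)
    moreover have "0 < min d \<epsilon> / 2" "min d \<epsilon> / 2 < d" "min d \<epsilon> / 2 < \<epsilon>" using d(1) pos by auto
    ultimately show ?thesis using d(2)[rule_format, of "min d \<epsilon> / 2"]
      by (intro exI[of _ "min d \<epsilon> / 2"]) (auto simp: \<xi>_def)
  qed
  then obtain t1 where t1: "0 < t1" "t1 < \<epsilon>" "\<xi> (x0, t1) $ 3 > 0" by blast
  \<comment> \<open>the third coordinate has no zero for positive \<open>t\<close>, so its sign is that at \<open>t1\<close>\<close>
  have pos3: "\<xi> (x, t) $ 3 > 0" if xt: "x \<in> ?I" "0 < t" "t < \<epsilon>" for x t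
  proof (rule ccontr)
    assume n: "\<not> ?thesis"
    let ?S = "(\<lambda>p. \<xi> p $ 3) ` (?I \<times> {0<..<\<epsilon>})"
    have "connected (?I \<times> {0<..<\<epsilon>})" by (intro connected_Times) auto
    moreover have "continuous_on (?I \<times> {0<..<\<epsilon>}) (\<lambda>p. \<xi> p $ 3)"
      by (intro continuous_intros continuous_on_subset[OF contxi]) auto
    ultimately have "connected ?S" by (rule connected_continuous_image[rotated])
    moreover have "\<xi> (x, t) $ 3 \<in> ?S" "\<xi> (x0, t1) $ 3 \<in> ?S" using xt t1 pos by auto
    ultimately have "0 \<in> ?S" using connectedD_interval[of ?S "\<xi> (x, t) $ 3" "\<xi> (x0, t1) $ 3" 0] n t1 by simp
    then show False using nz by auto
  qed
  have half: "\<xi> (x, t) \<in> half_space" if "x \<in> ?I" "0 \<le> t" "t < \<epsilon>" for x t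
  proof (cases "t = 0")
    case True
    have "\<iota> (of_real x) \<in> Q" using e1(2)[of x] that by (auto simp: \<eta>_def)
    then have "\<xi> (x, t) = \<phi> (\<iota> (of_real x))" "\<iota> (of_real x) \<in> U"
      using Q(14)[of "\<iota> (of_real x)"] Q(4) True by (auto simp: \<xi>_def ray_0 e_iota)
    then show ?thesis using hs by auto
  next
    case False
    then show ?thesis using pos3[of x t] that by (simp add: half_space_def)
  qed
  have xiU: "\<xi> (x, t) \<in> \<phi> ` U" if "x \<in> ?I" "0 \<le> t" "t < \<epsilon>" for x t
    using half[OF that] rV[OF that] Q(8,12) by (auto simp: \<xi>_def)
  have "is_lift x0 \<eta> (\<epsilon> / 2) (inv_into U \<phi> \<circ> \<xi>)"
    unfolding is_lift_def
  proof (intro conjI allI impI)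
    show "continuous_map (top_of_set (?I \<times> {0..\<epsilon> / 2})) X (inv_into U \<phi> \<circ> \<xi>)"
    proof (rule continuous_map_compose[OF _ c(5)])
      show "continuous_map (top_of_set (?I \<times> {0..\<epsilon> / 2})) (top_of_set (\<phi> ` U)) \<xi>"
        unfolding continuous_map_in_subtopology
        using continuous_on_subset[OF contxi, of "?I \<times> {0..\<epsilon> / 2}"] xiU pos by fastforce
    qed
    show "e ((inv_into U \<phi> \<circ> \<xi>) (x, t)) = ray x t" if "x \<in> ?I" "t \<in> {0..\<epsilon> / 2}" for x t
      using Q(15)[of "ray x t"] rV[of x t] half[of x t] norm_ray that pos by (auto simp: \<xi>_def)
    show "(inv_into U \<phi> \<circ> \<xi>) (x, 0) = \<iota> (of_real x)" if "x \<in> ?I" for x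
    proof -
      have "\<iota> (of_real x) \<in> Q" using e1(2)[of x] that by (auto simp: \<eta>_def)
      then have "\<xi> (x, 0) = \<phi> (\<iota> (of_real x))" "\<iota> (of_real x) \<in> U"
        using Q(14)[of "\<iota> (of_real x)"] Q(4) by (auto simp: \<xi>_def ray_0 e_iota)
      then show ?thesis using c(3) by simp
    qed
  qed (use pos in auto)
  then show ?thesis using pos by (intro exI[of _ \<eta>] exI[of _ "\<epsilon> / 2"]) auto
qed

text \<open>Lifts on all shorter intervals give a Cauchy sequence on the central ray. Its limit lies over
  \<open>ray x0 T\<close>, which is not on the surface, so it is an interior point, and a local section of the immersion
  there extends the lift beyond \<open>T\<close>.\<close>

lemma extend_lift:
  assumes T: "0 < T" "T \<le> \<delta>" and sh: "\<And>T'. \<lbrakk>0 < T'; T' < T\<rbrakk> \<Longrightarrow> \<exists>\<eta> G. is_lift x0 \<eta> T' G"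
  shows "\<exists>T2 \<eta> G. T < T2 \<and> is_lift x0 \<eta> T2 G"
proof -
  interpret M: Metric_space "topspace X" "induced_dist X e"
    using complete by (simp add: complete_wrt_induced_metric_def)
  obtain \<eta>f Gf where Gf: "\<And>T'. \<lbrakk>0 < T'; T' < T\<rbrakk> \<Longrightarrow> is_lift x0 (\<eta>f T') T' (Gf T')"
    using sh by metis
  define \<gamma> where "\<gamma> = (\<lambda>t. Gf t (x0, t))"
  have x0in: "x0 \<in> {x0 - \<eta><..<x0 + \<eta>}" if "is_lift x0 \<eta> T' G" for \<eta> T' G
    using that by (auto simp: is_lift_def)
  have g: "G (x0, t) = \<gamma> t" if "is_lift x0 \<eta> T' G" "0 < t" "t \<le> T'" "t < T" for \<eta> T' G t
    unfolding \<gamma>_def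
    by (rule is_lift_unique[OF that(1) Gf x0in[OF that(1)] x0in[OF Gf]]) (use that in auto)
  have top: "\<gamma> t \<in> topspace X" "e (\<gamma> t) = ray x0 t" if "0 < t" "t < T" for t
    using Gf[OF that] x0in[OF Gf[OF that]] that unfolding is_lift_def \<gamma>_def continuous_map_def by auto
  have dist: "induced_dist X e (\<gamma> a) (\<gamma> b) \<le> \<bar>b - a\<bar>" if ab: "0 < a" "a < T" "0 < b" "b < T" for a b
  proof -
    have *: "induced_dist X e (\<gamma> a) (\<gamma> b) \<le> b - a" if ab: "0 < a" "a \<le> b" "b < T" for a b
    proof -
      have b: "0 < b" using ab by simp
      have L: "is_lift x0 (\<eta>f b) b (Gf b)" by (rule Gf) (use ab in auto)
      have "continuous_map (top_of_set {a..b}) X \<gamma>"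
      proof (rule continuous_map_eq)
        show "continuous_map (top_of_set {a..b}) X (\<lambda>t. Gf b (x0, t))"
          by (rule continuous_map_from_subtopology_mono[OF is_lift_vertical[OF L x0in[OF L]]]) (use ab in auto)
        show "Gf b (x0, t) = \<gamma> t" if "t \<in> topspace (top_of_set {a..b})" for t
          by (rule g[OF L]) (use that ab in auto)
      qed
      then have "b - a \<in> path_lengths X e (\<gamma> a) (\<gamma> b)"
        by (rule ray_length[OF ab(2)]) (use top(2) ab in auto)
      then show ?thesis by (rule induced_dist_le)
    qed
    show ?thesis using *[of a b] *[of b a] ab by (cases "a \<le> b") (auto simp: M.commute)
  qed
  \<comment> \<open>a sequence in the open interval from \<open>0\<close> to \<open>T\<close> with limit \<open>T\<close>\<close>
  define t where "t = (\<lambda>k::nat. T - T / (real k + 2))"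
  have t: "0 < t k" "t k < T" for k
  proof -
    have "T * 1 < T * (real k + 2)" using T by (intro mult_strict_left_mono) auto
    then show "0 < t k" by (simp add: t_def divide_less_eq)
    show "t k < T" using T by (simp add: t_def)
  qed
  have tlim: "t \<longlonglongrightarrow> T" unfolding t_def by real_asymp
  have "M.MCauchy (\<lambda>k. \<gamma> (t k))" unfolding M.MCauchy_def
  proof (intro conjI allI impI)
    show "range (\<lambda>k. \<gamma> (t k)) \<subseteq> topspace X" using top t by blast
    fix \<epsilon> :: real assume "\<epsilon> > 0"
    moreover have "Cauchy t" using tlim by (simp add: LIMSEQ_imp_Cauchy)
    ultimately obtain N where "\<And>m k. m \<ge> N \<Longrightarrow> k \<ge> N \<Longrightarrow> \<bar>t m - t k\<bar> < \<epsilon>"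
      by (metis Cauchy_def dist_real_def)
    then show "\<exists>N. \<forall>k k'. N \<le> k \<longrightarrow> N \<le> k' \<longrightarrow> induced_dist X e (\<gamma> (t k)) (\<gamma> (t k')) < \<epsilon>"
      using dist[OF t t] by (metis order_le_less_trans)
  qed
  then obtain p where "limitin M.mtopology (\<lambda>k. \<gamma> (t k)) p sequentially"
    using complete by (auto simp: complete_wrt_induced_metric_def M.mcomplete_def)
  then have p: "p \<in> topspace X" and pl: "\<And>\<epsilon>. \<epsilon> > 0 \<Longrightarrow> \<forall>\<^sub>F k in sequentially. induced_dist X e (\<gamma> (t k)) p < \<epsilon>"
    by (auto simp: M.limitin_metric elim: eventually_mono)
  have near: "\<forall>\<^sub>F k in sequentially. \<gamma> (t k) \<in> N" if N: "openin X N" "p \<in> N" for N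
  proof -
    obtain c where c: "c > 0" "\<And>q. \<lbrakk>q \<in> topspace X; induced_dist X e p q < c\<rbrakk> \<Longrightarrow> q \<in> N"
      using small_balls[OF N] by blast
    show ?thesis using pl[OF c(1)]
      by eventually_elim (use c(2) top(1) t M.commute in metis)
  qed
  have ep: "e p = ray x0 T"
  proof (rule LIMSEQ_unique)
    show "(\<lambda>k. ray x0 (t k)) \<longlonglongrightarrow> ray x0 T"
      by (rule isCont_tendsto_compose[OF has_vector_derivative_continuous[OF ray_deriv] tlim])
    have "(\<lambda>k. e (\<gamma> (t k))) \<longlonglongrightarrow> e p"
    proof (rule topological_tendstoI)
      fix S assume S: "open S" "e p \<in> S"
      have "openin X {x \<in> topspace X. e x \<in> S}"
        using openin_continuous_map_preimage[OF continuous_map_immersion] S by simp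
      from near[OF this] show "\<forall>\<^sub>F k in sequentially. e (\<gamma> (t k)) \<in> S"
        using S p by (auto elim: eventually_mono)
    qed
    then show "(\<lambda>k. ray x0 (t k)) \<longlonglongrightarrow> e p" using top(2) t by simp
  qed
  have "p \<notin> manifold_boundary X A"
  proof
    assume "p \<in> manifold_boundary X A"
    then have "p \<in> range \<iota>" using param by (simp add: boundary_parameterisation_def)
    then have "e p \<in> range f" using e_iota by auto
    then show False using ray_off[of T x0] T ep by simp
  qed
  then obtain Q V \<sigma> where Q: "openin X Q" "p \<in> Q" "open V" "e p \<in> V"
    "continuous_map (top_of_set (V \<inter> sphere 0 1)) X \<sigma>"
    "\<And>y. \<lbrakk>y \<in> V; norm y = 1\<rbrakk> \<Longrightarrow> e (\<sigma> y) = y" "\<And>q. q \<in> Q \<Longrightarrow> \<sigma> (e q) = q"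
    using interior_section[OF p] by blast
  obtain \<epsilon> where eps: "\<epsilon> > 0" "\<And>x t. \<lbrakk>\<bar>x - x0\<bar> < \<epsilon>; \<bar>t - T\<bar> < \<epsilon>\<rbrakk> \<Longrightarrow> ray x t \<in> V"
    using ray_near[OF Q(3)] Q(4) ep by metis
  have "\<forall>\<^sub>F k in sequentially. \<bar>t k - T\<bar> < \<epsilon>"
    using tlim eps(1) by (auto simp: tendsto_iff dist_real_def)
  from eventually_conj[OF this near[OF Q(1,2)]]
  obtain k where k: "\<bar>t k - T\<bar> < \<epsilon>" "\<gamma> (t k) \<in> Q" by (auto dest: eventually_happens)
  let ?t0 = "t k"
  obtain \<eta> G where L: "is_lift x0 \<eta> ?t0 G" using Gf[OF t] by blast
  have eta: "\<eta> > 0" using L by (simp add: is_lift_def)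
  have "G (x0, ?t0) \<in> Q" using g[OF L, of ?t0] t[of k] k by simp
  have t0in: "?t0 \<in> {0..?t0}" using t[of k] by simp
  have "openin (top_of_set {x0 - \<eta><..<x0 + \<eta>}) {x \<in> {x0 - \<eta><..<x0 + \<eta>}. G (x, ?t0) \<in> Q}"
    using openin_continuous_map_preimage[OF is_lift_horizontal[OF L t0in] Q(1)] by simp
  then have "open {x \<in> {x0 - \<eta><..<x0 + \<eta>}. G (x, ?t0) \<in> Q}" by (rule openin_open_trans) simp
  moreover have "x0 \<in> {x \<in> {x0 - \<eta><..<x0 + \<eta>}. G (x, ?t0) \<in> Q}" using eta \<open>G (x0, ?t0) \<in> Q\<close> by simp
  ultimately obtain \<eta>2 where eta2: "\<eta>2 > 0"
    "\<And>x. \<bar>x - x0\<bar> < \<eta>2 \<Longrightarrow> x \<in> {x \<in> {x0 - \<eta><..<x0 + \<eta>}. G (x, ?t0) \<in> Q}"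
    by (metis open_dist dist_real_def)
  define \<eta>3 where "\<eta>3 = min \<epsilon> (min \<eta> \<eta>2)"
  define T2 where "T2 = T + \<epsilon> / 2"
  let ?I = "{x0 - \<eta>3<..<x0 + \<eta>3}"
  have I: "\<bar>x - x0\<bar> < \<epsilon> \<and> \<bar>x - x0\<bar> < \<eta> \<and> \<bar>x - x0\<bar> < \<eta>2" if "x \<in> ?I" for x using that by (auto simp: \<eta>3_def)
  define G' where "G' = (\<lambda>p. if snd p \<le> ?t0 then G p else \<sigma> (ray (fst p) (snd p)))"
  have inV: "ray x s \<in> V" if "x \<in> ?I" "?t0 \<le> s" "s \<le> T2" for x s
    using eps(2)[of x s] I[OF that(1)] that k eps(1) by (auto simp: T2_def)
  have glue: "G (x, ?t0) = \<sigma> (ray x ?t0)" if "x \<in> ?I" for x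
  proof -
    have "G (x, ?t0) \<in> Q" "x \<in> {x0 - \<eta><..<x0 + \<eta>}" using eta2(2) I[OF that] by auto
    moreover have "e (G (x, ?t0)) = ray x ?t0" using L calculation(2) t0in by (auto simp: is_lift_def)
    ultimately show ?thesis using Q(7) by metis
  qed
  have "is_lift x0 \<eta>3 T2 G'" unfolding is_lift_def
  proof (intro conjI allI impI)
    show "\<eta>3 > 0" using eps eta eta2 by (simp add: \<eta>3_def)
    let ?Y = "top_of_set (?I \<times> {0..T2})"
    show "continuous_map ?Y X G'" unfolding G'_def
    proof (rule continuous_map_cases_le)
      show "continuous_map ?Y euclideanreal snd" "continuous_map ?Y euclideanreal (\<lambda>_. ?t0)"
        by (auto intro!: continuous_intros)
      show "continuous_map (subtopology ?Y {x \<in> topspace ?Y. snd x \<le> ?t0}) X G"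
        unfolding subtopology_subtopology
        by (rule continuous_map_from_subtopology_mono[of _ "{x0 - \<eta><..<x0 + \<eta>} \<times> {0..?t0}"])
           (use L in \<open>auto simp: is_lift_def \<eta>3_def\<close>)
      have "continuous_map (top_of_set (?I \<times> {?t0..T2})) (top_of_set (V \<inter> sphere 0 1)) (\<lambda>p. ray (fst p) (snd p))"
        using inV norm_ray continuous_on_subset[OF continuous_ray]
        by (auto simp: continuous_map_in_subtopology mem_sphere_0 simp del: mem_sphere)
      from continuous_map_compose[OF this Q(5)]
      have "continuous_map (top_of_set (?I \<times> {?t0..T2})) X (\<lambda>p. \<sigma> (ray (fst p) (snd p)))" by (simp add: o_def)
      then show "continuous_map (subtopology ?Y {x \<in> topspace ?Y. ?t0 \<le> snd x}) X (\<lambda>p. \<sigma> (ray (fst p) (snd p)))"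
        unfolding subtopology_subtopology
        by (rule continuous_map_from_subtopology_mono) auto
      show "G p = \<sigma> (ray (fst p) (snd p))" if "p \<in> topspace ?Y" "snd p = ?t0" for p
        using glue[of "fst p"] that by (cases p) auto
    qed
    show "e (G' (x, s)) = ray x s" if x: "x \<in> ?I" and s: "s \<in> {0..T2}" for x s
    proof (cases "s \<le> ?t0")
      case True
      have "x \<in> {x0 - \<eta><..<x0 + \<eta>}" using x by (auto simp: \<eta>3_def)
      then show ?thesis using L True s by (auto simp: is_lift_def G'_def)
    next
      case False
      then show ?thesis using Q(6)[OF inV[OF x] norm_ray] s by (simp add: G'_def)
    qed
    show "G' (x, 0) = \<iota> (of_real x)" if x: "x \<in> ?I" for x
    proof -
      have "x \<in> {x0 - \<eta><..<x0 + \<eta>}" using x by (auto simp: \<eta>3_def)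
      then show ?thesis using L t[of k] by (auto simp: is_lift_def G'_def)
    qed
  qed
  moreover have "T < T2" using eps(1) by (simp add: T2_def)
  ultimately show ?thesis by blast
qed

lemma lift_exists: "\<exists>\<eta> G. is_lift x0 \<eta> \<delta> G"
proof -
  define S where "S = {T. 0 < T \<and> T \<le> \<delta> \<and> (\<exists>\<eta> G. is_lift x0 \<eta> T G)}"
  have dc: "T' \<in> S" if "T \<in> S" "0 < T'" "T' \<le> T" for T T'
  proof -
    obtain \<eta> G where L: "is_lift x0 \<eta> T G" "T \<le> \<delta>" using \<open>T \<in> S\<close> by (auto simp: S_def)
    then have "is_lift x0 \<eta> T' G" using is_lift_shorten that by blast
    then show ?thesis using that L by (auto simp: S_def)
  qed
  obtain \<eta> T G where "0 < T" "is_lift x0 \<eta> T G" using lift_near_boundary by blast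
  then have "is_lift x0 \<eta> (min T \<delta>) G" using is_lift_shorten by simp
  then have S0: "min T \<delta> \<in> S" using \<open>0 < T\<close> delta by (auto simp: S_def)
  have bdd: "bdd_above S" by (auto simp: S_def intro: bdd_aboveI[of _ \<delta>])
  define T1 where "T1 = Sup S"
  have T1: "0 < T1" "T1 \<le> \<delta>"
  proof -
    have "min T \<delta> \<le> T1" unfolding T1_def by (rule cSup_upper[OF S0 bdd])
    then show "0 < T1" using \<open>0 < T\<close> delta by simp
    show "T1 \<le> \<delta>" unfolding T1_def
    proof (rule cSup_least)
      show "S \<noteq> {}" using S0 by blast
    qed (simp add: S_def)
  qed
  have "\<exists>\<eta> G. is_lift x0 \<eta> T' G" if T': "0 < T'" "T' < T1" for T'
  proof -
    obtain T where "T \<in> S" "T' < T" using less_cSupE[of T' S] T' S0 unfolding T1_def by blast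
    then have "T' \<in> S" using dc T' by auto
    then show ?thesis by (simp add: S_def)
  qed
  from extend_lift[OF T1 this]
  obtain T2 \<eta> G where T2: "T1 < T2" "is_lift x0 \<eta> T2 G" by blast
  show ?thesis
  proof (cases "T2 \<le> \<delta>")
    case True
    then have "T2 \<in> S" using T2 T1 by (auto simp: S_def)
    then show ?thesis using cSup_upper[OF _ bdd] T2 by (force simp: T1_def)
  next
    case False
    then have "is_lift x0 \<eta> \<delta> G" using T2 is_lift_shorten by simp
    then show ?thesis by blast
  qed
qed

text \<open>All rays meet in one focal point. The ends of their lifts lie over this point and, the immersion being
  locally injective, do not depend on the starting point. Rays with the same image then have lifts with the
  same end, so the lifts agree and start in the same point.\<close>

theorem focal_closing:
  assumes focal: "\<And>x x'. ray x \<delta> = ray x' \<delta>"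
    and same: "f (of_real x1) = f (of_real x2)" "n (of_real x1) = n (of_real x2)"
  shows "\<iota> (of_real x1) = \<iota> (of_real x2)"
proof -
  obtain \<eta> G where L: "\<And>x. is_lift x (\<eta> x) \<delta> (G x)" using lift_exists by metis
  have eta: "\<eta> x > 0" for x using L[of x] by (simp add: is_lift_def)
  define c where "c = (\<lambda>x. G x (x, \<delta>))"
  have din: "\<delta> \<in> {0..\<delta>}" using delta by simp
  have loc: "c x0 = c x" if x: "\<bar>x - x0\<bar> < \<eta> x0" for x x0
  proof -
    let ?I = "{x0 - \<eta> x0<..<x0 + \<eta> x0}"
    have xI: "x \<in> ?I" "x0 \<in> ?I" using x eta[of x0] by auto
    have "G x0 (x, \<delta>) = G x (x, \<delta>)"
      by (rule is_lift_unique[OF L L xI(1)]) (use eta[of x] delta in auto)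
    moreover have "G x0 (x, \<delta>) = (\<lambda>_. G x0 (x0, \<delta>)) x"
    proof (rule lift_unique[OF is_lift_horizontal[OF L din] _ _ xI(2) _ _ xI(1)])
      have "G x0 (x0, \<delta>) \<in> topspace X"
        using is_lift_horizontal[OF L[of x0] din] xI(2) by (auto simp: continuous_map_def)
      then show "continuous_map (top_of_set ?I) X (\<lambda>_. G x0 (x0, \<delta>))" by simp
      show "e (G x0 (t, \<delta>)) = e (G x0 (x0, \<delta>))" if "t \<in> ?I" for t
        using L[of x0] that xI(2) din focal unfolding is_lift_def by metis
    qed auto
    ultimately show ?thesis by (simp add: c_def)
  qed
  have "c x1 = c x2"
  proof (rule connected_local_const[of UNIV])
    show "\<forall>a\<in>UNIV. \<forall>\<^sub>F b in at a. c a = c b"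
    proof
      fix a
      show "\<forall>\<^sub>F b in at a. c a = c b"
        unfolding eventually_at using loc[of _ a] eta[of a] by (intro exI[of _ "\<eta> a"]) (auto simp: dist_real_def)
    qed
  qed auto
  have v: "x \<in> {x - \<eta> x<..<x + \<eta> x}" for x using eta[of x] by simp
  have "G x1 (x1, 0) = G x2 (x2, 0)"
  proof (rule lift_unique[OF is_lift_vertical[OF L v[of x1]] is_lift_vertical[OF L v[of x2]], of \<delta>])
    show "G x1 (x1, \<delta>) = G x2 (x2, \<delta>)" using \<open>c x1 = c x2\<close> by (simp add: c_def)
    show "e (G x1 (x1, t)) = e (G x2 (x2, t))" if "t \<in> {0..\<delta>}" for t
    proof -
      have "e (G x1 (x1, t)) = ray x1 t" "e (G x2 (x2, t)) = ray x2 t"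
        using L[of x1] L[of x2] v that unfolding is_lift_def by blast+
      then show ?thesis using same by (simp add: ray_def)
    qed
  qed (use delta in auto)
  moreover have "G x1 (x1, 0) = \<iota> (of_real x1)" "G x2 (x2, 0) = \<iota> (of_real x2)"
    using L[of x1] L[of x2] v unfolding is_lift_def by blast+
  ultimately show ?thesis by simp
qed

end

section \<open>Frames of spectral genus zero\<close>

lemma mat2_nth [simp]:
  "mat2 p q r s $ 1 $ 1 = p" "mat2 p q r s $ 1 $ 2 = q" "mat2 p q r s $ 2 $ 1 = r" "mat2 p q r s $ 2 $ 2 = s"
  by (simp_all add: mat2_def)

lemma mat2_eqI:
  fixes A B :: "complex^2^2"
  assumes "A $ 1 $ 1 = B $ 1 $ 1" "A $ 1 $ 2 = B $ 1 $ 2" "A $ 2 $ 1 = B $ 2 $ 1" "A $ 2 $ 2 = B $ 2 $ 2"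
  shows "A = B"
  using assms by (simp add: vec_eq_iff forall_2)

lemma mat2_mult: "mat2 p q r s ** mat2 p' q' r' s' =
    mat2 (p * p' + q * r') (p * q' + q * s') (r * p' + s * r') (r * q' + s * s')"
  by (rule mat2_eqI) (simp_all add: matrix_matrix_mult_def sum_2)

lemma mat2_minus: "mat2 p q r s - mat2 p' q' r' s' = mat2 (p - p') (q - q') (r - r') (s - s')"
  by (rule mat2_eqI) simp_all

lemma mat2_one: "mat 1 = mat2 1 0 0 1"
  by (rule mat2_eqI) (simp_all add: mat_def)

lemma det_mat2: "det (mat2 p q r s) = p * s - q * r"
  by (simp add: det_2)

lemma matrix_inv_mat2:
  assumes "p * s - q * r = 1"
  shows "matrix_inv (mat2 p q r s) = mat2 s (- q) (- r) p"
proof -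
  let ?A = "mat2 p q r s" and ?B = "mat2 s (- q) (- r) p"
  have AB: "?A ** ?B = mat 1" "?B ** ?A = mat 1"
    using assms by (auto simp: mat2_mult mat2_one algebra_simps)
  then have "?A ** matrix_inv ?A = mat 1"
    unfolding matrix_inv_def by (rule_tac someI2[of _ ?B]) auto
  then have "?B ** (?A ** matrix_inv ?A) = ?B" by simp
  then show ?thesis unfolding matrix_mul_assoc AB by simp
qed

lemma has_derivative_mat2:
  assumes "(p has_derivative p') (at x within S)" "(q has_derivative q') (at x within S)"
    "(r has_derivative r') (at x within S)" "(s has_derivative s') (at x within S)"
  shows "((\<lambda>x. mat2 (p x) (q x) (r x) (s x)) has_derivative (\<lambda>v. mat2 (p' v) (q' v) (r' v) (s' v))) (at x within S)"
proof -
  let ?m = "\<lambda>w::complex \<times> complex \<times> complex \<times> complex. mat2 (fst w) (fst (snd w)) (fst (snd (snd w))) (snd (snd (snd w)))"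
  have "linear ?m"
    by (rule linearI) (auto intro!: mat2_eqI)
  then have "bounded_linear ?m" by (simp add: linear_conv_bounded_linear)
  from bounded_linear.has_derivative[OF this has_derivative_Pair[OF assms(1) has_derivative_Pair[OF assms(2) has_derivative_Pair[OF assms(3,4)]]]]
  show ?thesis by simp
qed

lemma bounded_bilinear_mat2_mult:
  "bounded_bilinear ((**) :: complex^2^2 \<Rightarrow> complex^2^2 \<Rightarrow> complex^2^2)"
proof -
  have "bilinear ((**) :: complex^2^2 \<Rightarrow> complex^2^2 \<Rightarrow> complex^2^2)"
    unfolding bilinear_def
    by (intro conjI allI linearI; rule mat2_eqI; simp add: matrix_matrix_mult_def sum_2 algebra_simps)
  then show ?thesis by (simp add: bilinear_conv_bounded_bilinear)
qed

text \<open>The only potential of spectral genus zero for \<open>a = - 1 / 16\<close>.\<close>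

definition vacuum :: laurent_matrix where
  "vacuum = (\<lambda>d. if d = -1 then mat2 0 (\<i> / 4) 0 0 else if d = 0 then mat2 0 0 (\<i> / 4) 0 else 0)"

lemma potentials_closure_0:
  "\<xi> \<in> potentials_closure 0 \<longleftrightarrow> (\<exists>c. \<xi> = (\<lambda>d. if d = -1 then mat2 0 c 0 0 else if d = 0 then mat2 0 0 (- cnj c) 0 else 0))"
proof
  have I: "{-1..int 0} = {-1, 0}" by auto
  assume x: "\<xi> \<in> potentials_closure 0"
  then have 1: "\<exists>c. \<xi> (-1) = mat2 0 c 0 0" "\<forall>d. d \<notin> {-1, 0} \<longrightarrow> \<xi> d = 0"
    "\<forall>d\<in>{-1, 0}. \<xi> d = - conj_transpose (\<xi> (int 0 - 1 - d)) \<and> trace (\<xi> d) = 0"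
    unfolding potentials_closure_def I by blast+
  from 1(1) obtain c where c: "\<xi> (-1) = mat2 0 c 0 0" by blast
  have "\<xi> 0 = - conj_transpose (\<xi> (int 0 - 1 - 0))" using 1(3) by blast
  then have "\<xi> 0 = - conj_transpose (mat2 0 c 0 0)" by (simp add: c)
  also have "\<dots> = mat2 0 0 (- cnj c) 0" by (rule mat2_eqI) (simp_all add: conj_transpose_def)
  finally have x0: "\<xi> 0 = mat2 0 0 (- cnj c) 0" .
  have rest: "\<xi> d = 0" if "d \<noteq> -1" "d \<noteq> 0" for d using 1(2) that by simp
  show "\<exists>c. \<xi> = (\<lambda>d. if d = -1 then mat2 0 c 0 0 else if d = 0 then mat2 0 0 (- cnj c) 0 else 0)"
  proof (intro exI[of _ c] ext)
    fix d show "\<xi> d = (if d = -1 then mat2 0 c 0 0 else if d = 0 then mat2 0 0 (- cnj c) 0 else 0)"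
      using c x0 rest by (cases "d = -1"; cases "d = 0") simp_all
  qed
next
  have I: "{-1..int 0} = {-1, 0}" by auto
  assume "\<exists>c. \<xi> = (\<lambda>d. if d = -1 then mat2 0 c 0 0 else if d = 0 then mat2 0 0 (- cnj c) 0 else 0)"
  then obtain c where c: "\<xi> = (\<lambda>d. if d = -1 then mat2 0 c 0 0 else if d = 0 then mat2 0 0 (- cnj c) 0 else 0)" by blast
  show "\<xi> \<in> potentials_closure 0"
    unfolding potentials_closure_def I c
    by (auto intro!: mat2_eqI simp: conj_transpose_def trace_def sum_2)
qed

lemma eval_laurent_0:
  "eval_laurent 0 (\<lambda>d. if d = -1 then mat2 0 c 0 0 else if d = 0 then mat2 0 0 c' 0 else 0) l = mat2 0 (c / l) c' 0"
proof -
  have I: "{-1..int 0} = {-1, 0}" by auto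
  show ?thesis unfolding eval_laurent_def I
    by (auto intro!: mat2_eqI simp: power_int_minus field_simps)
qed

text \<open>In spectral genus zero the commutator vanishes, so the solution of the Lax equation is
  constant, and the normalisation of \<open>a\<close> leaves a single potential.\<close>

lemma killing_field_0:
  assumes "killing_field 0 \<xi> \<zeta>" "\<xi> \<in> potentials 0"
    and det: "\<And>l. l \<noteq> 0 \<Longrightarrow> det (eval_laurent 0 \<xi> l) = 1 / (16 * l)"
  shows "\<zeta> z = vacuum"
proof -
  have xi: "\<xi> \<in> potentials_closure 0" "\<exists>r>0. \<xi> (-1) = mat2 0 (of_real r * \<i>) 0 0"
    using assms(2) unfolding potentials_def by blast+
  then obtain c0 where c0: "\<xi> = (\<lambda>d. if d = -1 then mat2 0 c0 0 0 else if d = 0 then mat2 0 0 (- cnj c0) 0 else 0)"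
    using potentials_closure_0 by blast
  obtain r where r: "r > 0" "\<xi> (-1) = mat2 0 (of_real r * \<i>) 0 0" using xi(2) by blast
  have "\<xi> (-1) $ 1 $ 2 = of_real r * \<i>" using r(2) by simp
  then have c0r: "c0 = of_real r * \<i>" by (simp add: c0)
  have "of_real (r\<^sup>2) = (1 / 16 :: complex)"
    using det[of 1] by (simp add: c0 eval_laurent_0 det_mat2 c0r power2_eq_square algebra_simps)
  then have "complex_of_real (r\<^sup>2) = of_real ((1 / 4)\<^sup>2)" by (simp add: power2_eq_square)
  then have "r\<^sup>2 = (1 / 4)\<^sup>2" unfolding of_real_eq_iff .
  then have r4: "r = 1 / 4" using r(1) power2_eq_imp_eq[of r "1/4"] by simp
  have xiv: "\<xi> = vacuum" by (auto simp: c0 c0r r4 vacuum_def)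
  have "\<zeta> z \<in> potentials_closure 0" for z using assms(1) unfolding killing_field_def by blast
  then have "\<forall>z. \<exists>c. \<zeta> z = (\<lambda>d. if d = -1 then mat2 0 c 0 0 else if d = 0 then mat2 0 0 (- cnj c) 0 else 0)"
    unfolding potentials_closure_0 by blast
  from choice[OF this] obtain c where c: "\<And>z. \<zeta> z = (\<lambda>d. if d = -1 then mat2 0 (c z) 0 0 else if d = 0 then mat2 0 0 (- cnj (c z)) 0 else 0)" by blast
  have ev: "eval_laurent 0 (\<zeta> x) 1 = mat2 0 (c x) (- cnj (c x)) 0" for x by (simp add: c eval_laurent_0)
  have "((\<lambda>x. eval_laurent 0 (\<zeta> x) 1) has_derivative (\<lambda>v. 0)) (at x)" for x
  proof -
    have "((\<lambda>x. eval_laurent 0 (\<zeta> x) 1) has_derivative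
        (\<lambda>v. eval_laurent 0 (\<zeta> x) 1 ** alpha_form (\<zeta> x) 1 v - alpha_form (\<zeta> x) 1 v ** eval_laurent 0 (\<zeta> x) 1)) (at x)"
      using assms(1) unfolding killing_field_def by simp
    moreover have "eval_laurent 0 (\<zeta> x) 1 ** alpha_form (\<zeta> x) 1 v - alpha_form (\<zeta> x) 1 v ** eval_laurent 0 (\<zeta> x) 1 = 0" for v
      unfolding ev alpha_form_def Let_def by (auto intro!: mat2_eqI simp: c mat2_mult mat2_minus algebra_simps)
    ultimately show ?thesis by simp
  qed
  then have "eval_laurent 0 (\<zeta> z) 1 = eval_laurent 0 (\<zeta> 0) 1"
    using has_derivative_zero_unique[of UNIV "\<lambda>x. eval_laurent 0 (\<zeta> x) 1"] by auto
  then have "mat2 0 (c z) (- cnj (c z)) 0 $ 1 $ 2 = mat2 0 (c 0) (- cnj (c 0)) 0 $ 1 $ 2" unfolding ev by simp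
  then have "c z = c 0" by simp
  then have "\<zeta> z = \<zeta> 0" unfolding c by (simp only:)
  also have "\<dots> = vacuum" using assms(1) xiv by (simp add: killing_field_def)
  finally show ?thesis .
qed

lemma alpha_form_vacuum:
  "l \<noteq> 0 \<Longrightarrow> alpha_form vacuum l v = mat2 0 (\<i> / 4 * (v + l * cnj v) / l) (\<i> / 4 * (v + l * cnj v)) 0"
  by (auto intro!: mat2_eqI simp: alpha_form_def vacuum_def Let_def field_simps)

text \<open>The exponential of the constant connection form integrated from \<open>0\<close> to \<open>z\<close>, at the spectral parameter
  \<open>s\<^sup>2\<close>; its eigenvalues are \<open>exp (\<i> * u)\<close> and \<open>exp (- \<i> * u)\<close>.\<close>

definition vacuum_frame :: "complex \<Rightarrow> complex \<Rightarrow> complex^2^2" where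
  "vacuum_frame s z = (let u = (z + s\<^sup>2 * cnj z) / (4 * s) in
     mat2 (cos u) (\<i> * sin u / s) (\<i> * s * sin u) (cos u))"

lemma has_derivative_vacuum_frame:
  assumes "s \<noteq> 0"
  shows "(vacuum_frame s has_derivative (\<lambda>v. vacuum_frame s z ** alpha_form vacuum (s\<^sup>2) v)) (at z)"
proof -
  define u where "u = (\<lambda>z. (z + s\<^sup>2 * cnj z) / (4 * s))"
  have u: "(u has_derivative u) (at z)"
    unfolding u_def using assms by (auto intro!: derivative_eq_intros simp: field_simps)
  have cs: "((\<lambda>z. cos (u z)) has_derivative (\<lambda>v. - sin (u z) * u v)) (at z)"
    "((\<lambda>z. sin (u z)) has_derivative (\<lambda>v. cos (u z) * u v)) (at z)"
    using has_derivative_compose[OF u DERIV_cos[unfolded has_field_derivative_def]]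
      has_derivative_compose[OF u DERIV_sin[unfolded has_field_derivative_def]] by (simp_all add: o_def)
  have "vacuum_frame s = (\<lambda>z. mat2 (cos (u z)) (\<i> / s * sin (u z)) (\<i> * s * sin (u z)) (cos (u z)))"
    by (rule ext) (simp add: vacuum_frame_def u_def Let_def)
  moreover have "((\<lambda>z. mat2 (cos (u z)) (\<i> / s * sin (u z)) (\<i> * s * sin (u z)) (cos (u z))) has_derivative
     (\<lambda>v. mat2 (- sin (u z) * u v) (\<i> / s * (cos (u z) * u v)) (\<i> * s * (cos (u z) * u v)) (- sin (u z) * u v))) (at z)"
    by (intro has_derivative_mat2 cs has_derivative_mult_right)
  moreover have "mat2 (- sin (u z) * u v) (\<i> / s * (cos (u z) * u v)) (\<i> * s * (cos (u z) * u v)) (- sin (u z) * u v)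
      = vacuum_frame s z ** alpha_form vacuum (s\<^sup>2) v" for v
  proof -
    have s2: "s\<^sup>2 \<noteq> 0" using assms by simp
    have w: "v + s\<^sup>2 * cnj v = 4 * s * u v" using assms by (simp add: u_def)
    have "vacuum_frame s z = mat2 (cos (u z)) (\<i> / s * sin (u z)) (\<i> * s * sin (u z)) (cos (u z))"
      by (simp add: vacuum_frame_def u_def Let_def)
    moreover have "alpha_form vacuum (s\<^sup>2) v = mat2 0 (\<i> * u v / s) (\<i> * s * u v) 0"
      unfolding alpha_form_vacuum[OF s2] w using assms by (simp add: power2_eq_square mult.assoc)
    moreover have "\<i> * (x * (\<i> * y)) = - (x * y)" for x y
    proof -
      have "\<i> * (x * (\<i> * y)) = (\<i> * \<i>) * (x * y)" by (simp only: mult_ac)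
      then show ?thesis by simp
    qed
    ultimately show ?thesis using assms
      by (auto intro!: mat2_eqI simp: mat2_mult)
  qed
  ultimately show ?thesis by simp
qed

lemma vacuum_frame_0: "vacuum_frame s 0 = mat 1"
  by (simp add: vacuum_frame_def mat2_one)

lemma vacuum_frame_inverse: "s \<noteq> 0 \<Longrightarrow> vacuum_frame s z ** vacuum_frame s (- z) = mat 1"
  "s \<noteq> 0 \<Longrightarrow> vacuum_frame s (- z) ** vacuum_frame s z = mat 1"
proof -
  assume s: "s \<noteq> 0"
  define u where "u = (z + s\<^sup>2 * cnj z) / (4 * s)"
  have "vacuum_frame s z = mat2 (cos u) (\<i> * sin u / s) (\<i> * s * sin u) (cos u)"
    by (simp add: vacuum_frame_def u_def Let_def)
  moreover have "- z + s\<^sup>2 * cnj (- z) = - (z + s\<^sup>2 * cnj z)" by simp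
  then have "(- z + s\<^sup>2 * cnj (- z)) / (4 * s) = - u" unfolding u_def by (simp only: minus_divide_left)
  then have "vacuum_frame s (- z) = mat2 (cos u) (- (\<i> * sin u / s)) (- (\<i> * s * sin u)) (cos u)"
    unfolding vacuum_frame_def Let_def by simp
  moreover have "cos u * cos u + sin u * sin u = 1" using sin_cos_squared_add[of u] by (simp add: power2_eq_square add.commute)
  ultimately show "vacuum_frame s z ** vacuum_frame s (- z) = mat 1" "vacuum_frame s (- z) ** vacuum_frame s z = mat 1"
    using s by (auto simp: mat2_mult mat2_one field_simps)
qed

text \<open>The product of the frame with the inverse of \<open>vacuum_frame s z\<close> has derivative zero.\<close>

lemma frame_vacuum_unique:
  assumes F: "frame \<zeta> F" and z: "\<And>z. \<zeta> z = vacuum" and s: "s \<noteq> 0"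
  shows "F (s\<^sup>2) z = vacuum_frame s z"
proof -
  interpret B: bounded_bilinear "(**) :: complex^2^2 \<Rightarrow> complex^2^2 \<Rightarrow> complex^2^2" by (rule bounded_bilinear_mat2_mult)
  let ?l = "s\<^sup>2"
  have l: "?l \<noteq> 0" using s by simp
  have dF: "(F ?l has_derivative (\<lambda>v. F ?l x ** alpha_form vacuum ?l v)) (at x)" and F0: "F ?l 0 = mat 1" for x
    using F l z unfolding frame_def by auto
  have a: "alpha_form vacuum ?l (- v) = - alpha_form vacuum ?l v" for v
    using l by (auto intro!: mat2_eqI simp: alpha_form_vacuum field_simps)
  have comm: "vacuum_frame s x ** alpha_form vacuum ?l v = alpha_form vacuum ?l v ** vacuum_frame s x" for x v
    using s by (auto intro!: mat2_eqI simp: vacuum_frame_def Let_def alpha_form_vacuum mat2_mult field_simps power2_eq_square)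
  define Y where "Y = (\<lambda>x. F ?l x ** vacuum_frame s (- x))"
  have "(Y has_derivative (\<lambda>v. 0)) (at x)" for x
  proof -
    have "((\<lambda>x. vacuum_frame s (- x)) has_derivative (\<lambda>v. vacuum_frame s (- x) ** alpha_form vacuum ?l (- v))) (at x)"
      using has_derivative_compose[OF has_derivative_minus[OF has_derivative_ident] has_derivative_vacuum_frame[OF s]] by simp
    from B.FDERIV[OF dF this] show ?thesis
      unfolding Y_def a B.minus_right comm by (simp add: matrix_mul_assoc)
  qed
  then have "Y z = Y 0" using has_derivative_zero_unique[of UNIV Y] by auto
  also have "Y 0 = mat 1" by (simp add: Y_def F0 vacuum_frame_0)
  finally have "F ?l z ** vacuum_frame s (- z) ** vacuum_frame s z = vacuum_frame s z" by (simp add: Y_def)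
  then show ?thesis using vacuum_frame_inverse[OF s] by (simp add: matrix_mul_assoc[symmetric])
qed

section \<open>The tori of spectral genus zero\<close>

text \<open>An isometry of the three-sphere that brings the surfaces into the standard position of a torus of
  revolution.\<close>

definition isom :: "real \<Rightarrow> complex \<times> complex \<Rightarrow> complex \<times> complex" where
  "isom \<delta> p = (cis \<delta> * Complex (Re (fst p)) (- Re (snd p)), Complex (Im (snd p)) (- Im (fst p)))"

definition torus :: "real \<Rightarrow> complex \<Rightarrow> complex \<times> complex" where
  "torus \<delta> z = isom \<delta> (cos \<delta> *\<^sub>R cis (Im z * sin \<delta>), sin \<delta> *\<^sub>R cis (Re z * cos \<delta>))"

text \<open>This normal points to the circle of the standard position on which the second coordinate vanishes.\<close>

definition torus_normal :: "real \<Rightarrow> complex \<Rightarrow> complex \<times> complex" where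
  "torus_normal \<delta> z = isom \<delta> (sin \<delta> *\<^sub>R cis (Im z * sin \<delta>), - (cos \<delta> *\<^sub>R cis (Re z * cos \<delta>)))"

lemma vacuum_frame_cis:
  "vacuum_frame (cis b) z = (let u = of_real ((Re z * cos b + Im z * sin b) / 2) in
     mat2 (cos u) (\<i> * cis (- b) * sin u) (\<i> * cis b * sin u) (cos u))"
proof -
  have "(z + (cis b)\<^sup>2 * cnj z) / (4 * cis b) = of_real ((Re z * cos b + Im z * sin b) / 2)"
  proof -
    have "(z + (cis b)\<^sup>2 * cnj z) / (4 * cis b) = (z * cis (- b) + cis b * cnj z) / 4"
      by (simp add: cis_inverse[symmetric] power2_eq_square field_simps)
    also have "\<dots> = of_real ((Re z * cos b + Im z * sin b) / 2)"
      by (rule complex_eqI) (simp_all add: algebra_simps)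
    finally show ?thesis .
  qed
  then show ?thesis
    by (simp add: vacuum_frame_def Let_def cis_inverse[symmetric] field_simps del: of_real_divide of_real_add of_real_mult)
qed

text \<open>At the square roots \<open>cis (- \<delta>)\<close> and \<open>cis \<delta>\<close> of the Sym points the argument \<open>u\<close> of the frame is real: half the
  difference, respectively half the sum, of the two angles of the torus.\<close>

lemma sym_vacuum:
  assumes F: "frame \<zeta> F" and z: "\<And>z. \<zeta> z = vacuum" and l: "l1 = cis (- (2 * \<delta>))" "l2 = cis (2 * \<delta>)"
  shows "sym_immersion F l1 l2 = torus \<delta>" "sym_normal F l1 l2 = torus_normal \<delta>"
proof -
  have "F l1 x = vacuum_frame (cis (- \<delta>)) x" "F l2 x = vacuum_frame (cis \<delta>) x" for x
    using frame_vacuum_unique[OF F z, of "cis (- \<delta>)"] frame_vacuum_unique[OF F z, of "cis \<delta>"]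
    by (simp_all add: l power2_eq_square cis_mult)
  define p where "p = (\<lambda>z. (Re z * cos \<delta> - Im z * sin \<delta>) / 2)"
  define q where "q = (\<lambda>z. (Re z * cos \<delta> + Im z * sin \<delta>) / 2)"
  have F1: "F l1 x = mat2 (cos (p x)) (\<i> * cis \<delta> * sin (p x)) (\<i> * cis (- \<delta>) * sin (p x)) (cos (p x))" for x
    unfolding \<open>F l1 x = _\<close> vacuum_frame_cis by (simp add: Let_def p_def cos_of_real sin_of_real del: of_real_divide of_real_diff of_real_mult)
  have F2: "F l2 x = mat2 (cos (q x)) (\<i> * cis (- \<delta>) * sin (q x)) (\<i> * cis \<delta> * sin (q x)) (cos (q x))" for x
    unfolding \<open>F l2 x = _\<close> vacuum_frame_cis by (simp add: Let_def q_def cos_of_real sin_of_real del: of_real_divide of_real_add of_real_mult)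
  have c1: "cis (- \<delta>) * cis \<delta> = 1" "cis \<delta> * cis (- \<delta>) = 1" by (simp_all add: cis_mult)
  have det: "complex_of_real (cos (q x)) * cos (q x) - \<i> * cis (- \<delta>) * sin (q x) * (\<i> * cis \<delta> * sin (q x)) = 1" for x
  proof -
    have "\<i> * cis (- \<delta>) * sin (q x) * (\<i> * cis \<delta> * sin (q x)) = - (cis (- \<delta>) * cis \<delta>) * (sin (q x) * sin (q x))"
      by (simp add: algebra_simps)
    moreover have "complex_of_real (cos (q x)) * cos (q x) + sin (q x) * sin (q x) = of_real 1"
      unfolding of_real_mult[symmetric] of_real_add[symmetric] sin_cos_squared_add3 ..
    ultimately show ?thesis unfolding c1 by simp
  qed
  have inv2: "matrix_inv (F l2 x) = mat2 (cos (q x)) (- (\<i> * cis (- \<delta>) * sin (q x))) (- (\<i> * cis \<delta> * sin (q x))) (cos (q x))" for x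
    unfolding F2 by (rule matrix_inv_mat2[OF det])
  have PQ: "Re z * cos \<delta> = p z + q z" "Im z * sin \<delta> = q z - p z" for z by (simp_all add: p_def q_def field_simps)
  have one: "sin \<delta> * sin \<delta> = 1 - cos \<delta> * cos \<delta>" using sin_cos_squared_add3[of \<delta>] by linarith
  have two: "sin \<delta> * (sin \<delta> * x) = x - cos \<delta> * (cos \<delta> * x)" for x
    unfolding mult.assoc[symmetric] one by (simp add: algebra_simps)
  show "sym_immersion F l1 l2 = torus \<delta>"
  proof
    fix z show "sym_immersion F l1 l2 z = torus \<delta> z"
      unfolding sym_immersion_def F1 inv2 mat2_mult SU2_to_S3_def torus_def isom_def PQ
      by (simp add: complex_eq_iff cos_add sin_add cos_diff sin_diff) (simp add: algebra_simps one two)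
  qed
  show "sym_normal F l1 l2 = torus_normal \<delta>"
  proof
    fix z show "sym_normal F l1 l2 z = torus_normal \<delta> z"
      unfolding sym_normal_def F1 inv2 mat2_mult SU2_to_S3_def torus_normal_def isom_def PQ
      by (simp add: complex_eq_iff cos_add sin_add cos_diff sin_diff) (simp add: algebra_simps one two)
  qed
qed

lemma isom_linear: "linear (isom \<delta>)"
  by (rule linearI) (auto simp: isom_def complex_eq_iff algebra_simps prod_eq_iff)

lemma inner_isom: "isom \<delta> p \<bullet> isom \<delta> q = p \<bullet> q"
proof -
  have c2: "cos \<delta> * cos \<delta> = 1 - sin \<delta> * sin \<delta>" using sin_cos_squared_add3[of \<delta>] by linarith
  have two: "cos \<delta> * (cos \<delta> * x) = x - sin \<delta> * (sin \<delta> * x)" for x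
    unfolding mult.assoc[symmetric] c2 by (simp add: algebra_simps)
  show ?thesis
    by (simp add: isom_def inner_prod_def inner_complex_def algebra_simps two)
qed

lemma norm_isom: "norm (isom \<delta> p) = norm p"
  by (simp add: norm_eq_sqrt_inner inner_isom)

lemma isom_eq_iff: "isom \<delta> p = isom \<delta> q \<longleftrightarrow> p = q"
proof -
  have "isom \<delta> p - isom \<delta> q = isom \<delta> (p - q)" using linear_diff[OF isom_linear] by metis
  then have "norm (isom \<delta> p - isom \<delta> q) = norm (p - q)" by (simp add: norm_isom)
  then show ?thesis by auto
qed

text \<open>The geodesics in the normal direction pass through the tori parallel to the given one and contract its
  second coordinate to zero at \<open>t = \<delta>\<close>.\<close>

lemma torus_ray:
  "cos t *\<^sub>R torus \<delta> z + sin t *\<^sub>R torus_normal \<delta> z =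
     isom \<delta> (cos (\<delta> - t) *\<^sub>R cis (Im z * sin \<delta>), sin (\<delta> - t) *\<^sub>R cis (Re z * cos \<delta>))"
proof -
  have "cos t *\<^sub>R torus \<delta> z + sin t *\<^sub>R torus_normal \<delta> z =
    isom \<delta> (cos t *\<^sub>R (cos \<delta> *\<^sub>R cis (Im z * sin \<delta>), sin \<delta> *\<^sub>R cis (Re z * cos \<delta>)) +
            sin t *\<^sub>R (sin \<delta> *\<^sub>R cis (Im z * sin \<delta>), - (cos \<delta> *\<^sub>R cis (Re z * cos \<delta>))))"
    unfolding torus_def torus_normal_def linear_add[OF isom_linear] linear_cmul[OF isom_linear] ..
  also have "cos t *\<^sub>R (cos \<delta> *\<^sub>R cis (Im z * sin \<delta>), sin \<delta> *\<^sub>R cis (Re z * cos \<delta>)) +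
            sin t *\<^sub>R (sin \<delta> *\<^sub>R cis (Im z * sin \<delta>), - (cos \<delta> *\<^sub>R cis (Re z * cos \<delta>))) =
     (cos (\<delta> - t) *\<^sub>R cis (Im z * sin \<delta>), sin (\<delta> - t) *\<^sub>R cis (Re z * cos \<delta>))"
    by (simp add: cos_diff sin_diff algebra_simps)
  finally show ?thesis .
qed

lemma torus_perp: "torus \<delta> z \<bullet> torus_normal \<delta> z = 0"
  unfolding torus_def torus_normal_def inner_isom by (simp add: dot_square_norm)

text \<open>Before the focal distance \<open>\<delta>\<close> the rays lie on tori with a smaller second radius, so they do not return. The
  starting points \<open>0\<close> and \<open>2 * pi / cos \<delta>\<close> have the same image and the same normal.\<close>

theorem alexandrov_torus_period:
  assumes d: "0 < \<delta>" "\<delta> \<le> pi / 4"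
    and alex: "mean_convex_alexandrov_embedded \<tau> (torus \<delta>) (torus_normal \<delta>)"
  shows "\<exists>j::int. of_real (2 * pi / cos \<delta>) = of_int j * \<tau>"
proof -
  obtain X :: "(complex \<times> real) topology" and A e \<iota> where
    H: "three_manifold_with_boundary X A" "immersion_to_S3 X A e" "boundary_parameterisation X A \<tau> \<iota>"
      "\<And>z. e (\<iota> z) = torus \<delta> z" "inward_unit_normal A e \<iota> (torus_normal \<delta>)" "complete_wrt_induced_metric X e"
    using alex unfolding mean_convex_alexandrov_embedded_def by blast
  have dpi: "\<delta> < pi / 2" using d pi_gt_zero by linarith
  interpret normal_rays X A e \<tau> \<iota> "torus \<delta>" "torus_normal \<delta>" \<delta>
  proof
    show "continuous_on UNIV (\<lambda>x. torus \<delta> (of_real x))" "continuous_on UNIV (\<lambda>x. torus_normal \<delta> (of_real x))"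
      unfolding torus_def torus_normal_def
      by (intro linear_continuous_on_compose[OF _ isom_linear] continuous_intros)+
    show "cos t *\<^sub>R torus \<delta> (of_real x) + sin t *\<^sub>R torus_normal \<delta> (of_real x) \<notin> range (torus \<delta>)"
      if t: "0 < t" "t \<le> \<delta>" for x t
    proof
      assume "cos t *\<^sub>R torus \<delta> (of_real x) + sin t *\<^sub>R torus_normal \<delta> (of_real x) \<in> range (torus \<delta>)"
      then obtain z where "cos t *\<^sub>R torus \<delta> (of_real x) + sin t *\<^sub>R torus_normal \<delta> (of_real x) = torus \<delta> z" by blast
      then have "sin (\<delta> - t) *\<^sub>R cis (x * cos \<delta>) = sin \<delta> *\<^sub>R cis (Re z * cos \<delta>)"
        unfolding torus_ray unfolding torus_def isom_eq_iff by simp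
      then have "norm (sin (\<delta> - t) *\<^sub>R cis (x * cos \<delta>)) = norm (sin \<delta> *\<^sub>R cis (Re z * cos \<delta>))" by metis
      then have "\<bar>sin (\<delta> - t)\<bar> = \<bar>sin \<delta>\<bar>" by (simp add: norm_scaleR)
      moreover have "0 \<le> sin (\<delta> - t)" using t d dpi by (intro sin_ge_zero) auto
      moreover have "sin (\<delta> - t) < sin \<delta>" using t d dpi by (intro sin_monotone_2pi) auto
      ultimately show False by linarith
    qed
  qed (use H d torus_perp in auto)
  have cd: "cos \<delta> > 0" using d dpi by (intro cos_gt_zero) auto
  let ?x = "2 * pi / cos \<delta>"
  have "\<iota> (of_real 0) = \<iota> (of_real ?x)"
  proof (rule focal_closing)
    show "ray x \<delta> = ray x' \<delta>" for x x' unfolding ray_def torus_ray by simp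
    have x: "?x * cos \<delta> = 2 * pi" using cd by simp
    have "cis (?x * cos \<delta>) = cis 0" unfolding x by simp
    then show "torus \<delta> (of_real 0) = torus \<delta> (of_real ?x)" "torus_normal \<delta> (of_real 0) = torus_normal \<delta> (of_real ?x)"
      unfolding torus_def torus_normal_def Re_complex_of_real Im_complex_of_real by simp_all
  qed
  then have "\<exists>k::int. of_real ?x = of_real 0 + of_int k * \<tau>"
    using H(3) unfolding boundary_parameterisation_def by blast
  then show ?thesis by simp
qed

section \<open>Uniqueness of the multivalued function \<open>h\<close>\<close>

text \<open>The cut curve is parameterised by a square root \<open>s\<close> of \<open>l\<close>: its points are
  \<open>(s\<^sup>2, W s / s)\<close>, where \<open>W\<close> is an even branch of the square root of \<open>a (s\<^sup>2)\<close>.\<close>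

locale uniformised_curve =
  fixes a b :: "complex poly" and W :: "complex \<Rightarrow> complex" and S :: "complex set"
  assumes S_def: "S = {s. s \<noteq> 0 \<and> s\<^sup>2 \<notin> segments a}"
    and open_S: "open S" and connected_S: "connected S"
    and W_holo: "W holomorphic_on S"
    and W_sq: "\<And>s. s \<in> S \<Longrightarrow> (W s)\<^sup>2 = poly a (s\<^sup>2)"
    and W_even: "\<And>s. s \<in> S \<Longrightarrow> W (- s) = W s"
    and S_nonempty: "S \<noteq> {}"
begin

lemma S_minus: "s \<in> S \<Longrightarrow> - s \<in> S" by (simp add: S_def)

lemma cut_curve_param:
  assumes "(l, \<nu>) \<in> cut_curve a"
  obtains s where "s \<in> S" "l = s\<^sup>2" "\<nu> = W s / s"
proof -
  have l: "l \<noteq> 0" "l \<notin> segments a" "\<nu>\<^sup>2 = poly a l / l"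
    using assms by (auto simp: cut_curve_def spectral_curve_def)
  have s: "(csqrt l)\<^sup>2 = l" "csqrt l \<noteq> 0" using l by auto
  then have sS: "csqrt l \<in> S" using l by (simp add: S_def)
  have "\<nu>\<^sup>2 = (W (csqrt l) / csqrt l)\<^sup>2"
    using l(3) W_sq[OF sS] s by (simp add: power_divide)
  then consider "\<nu> = W (csqrt l) / csqrt l" | "\<nu> = - (W (csqrt l) / csqrt l)"
    using power2_eq_iff by blast
  then show ?thesis
  proof cases
    case 1 then show ?thesis using that[OF sS] s by simp
  next
    case 2 then show ?thesis using that[OF S_minus[OF sS]] s W_even[OF sS] by simp
  qed
qed

lemma param_in_cut_curve: "s \<in> S \<Longrightarrow> (s\<^sup>2, W s / s) \<in> cut_curve a"
  using W_sq[of s] by (auto simp: cut_curve_def spectral_curve_def S_def power_divide)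

text \<open>In the coordinate \<open>s\<close> the local branches of \<open>\<nu>\<close> become restrictions of the single function
  \<open>W s / s\<close>.\<close>

lemma h_pullback_deriv:
  assumes h: "is_h a b h" and s: "s0 \<in> S"
  shows "((\<lambda>s. h (s\<^sup>2, W s / s)) has_field_derivative poly b (s0\<^sup>2) / (W s0 / s0 * (s0\<^sup>2)\<^sup>2) * (2 * s0)) (at s0)"
proof -
  have s0: "s0 \<noteq> 0" using s by (simp add: S_def)
  obtain r0 where r0: "r0 > 0" "ball s0 r0 \<subseteq> S" using open_S s open_contains_ball by blast
  \<comment> \<open>near \<open>s0\<close> the square is injective; \<open>q\<close> is its inverse\<close>
  define q where "q = (\<lambda>l. s0 * csqrt (l / s0\<^sup>2))"
  define U where "U = {l. l / s0\<^sup>2 \<notin> \<real>\<^sub>\<le>\<^sub>0} \<inter> q -` ball s0 r0"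
  have q_holo: "q holomorphic_on {l. l / s0\<^sup>2 \<notin> \<real>\<^sub>\<le>\<^sub>0}" unfolding q_def by (intro holomorphic_intros) auto
  have open1: "open {l. l / s0\<^sup>2 \<notin> \<real>\<^sub>\<le>\<^sub>0}"
  proof -
    have "open ((\<lambda>l. l / s0\<^sup>2) -` (- \<real>\<^sub>\<le>\<^sub>0))"
      by (rule open_vimage) (use closed_nonpos_Reals_complex s0 in \<open>auto intro!: continuous_intros\<close>)
    then show ?thesis by (simp add: vimage_def)
  qed
  have openU: "open U" unfolding U_def
    using continuous_open_preimage[OF holomorphic_on_imp_continuous_on[OF q_holo] open1 open_ball] .
  have q2: "(q l)\<^sup>2 = l" for l using s0 by (simp add: q_def power_mult_distrib)
  have qS: "q l \<in> S" if "l \<in> U" for l using that r0 by (auto simp: U_def)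
  have qs: "q (s0\<^sup>2) = s0" using s0 by (simp add: q_def)
  have s0U: "s0\<^sup>2 \<in> U" using s0 r0 by (simp add: U_def qs)
  define \<nu> where "\<nu> = (\<lambda>l. W (q l) / q l)"
  have q_nz: "q l \<noteq> 0" if "l \<in> U" for l using qS[OF that] by (simp add: S_def)
  have nu_holo: "\<nu> holomorphic_on U" unfolding \<nu>_def
  proof (intro holomorphic_intros)
    have qU: "q holomorphic_on U" using q_holo by (rule holomorphic_on_subset) (auto simp: U_def)
    then show "q holomorphic_on U" .
    show "(\<lambda>l. W (q l)) holomorphic_on U"
      using holomorphic_on_compose_gen[OF qU W_holo] qS by (auto simp: o_def)
  qed (use q_nz in auto)
  have nu_sq: "(\<nu> l)\<^sup>2 = poly a l / l" if "l \<in> U" for l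
    using W_sq[OF qS[OF that]] by (simp add: \<nu>_def power_divide q2)
  have "0 \<notin> U" using q_nz[of 0] by (auto simp: q_def)
  moreover have "l \<notin> segments a" if "l \<in> U" for l using qS[OF that] by (simp add: S_def q2)
  ultimately have "U \<inter> ({0} \<union> segments a) = {}" by blast
  then have D: "((\<lambda>x. h (x, \<nu> x)) has_field_derivative poly b (s0\<^sup>2) / (\<nu> (s0\<^sup>2) * (s0\<^sup>2)\<^sup>2)) (at (s0\<^sup>2))"
    using h openU nu_holo nu_sq s0U unfolding is_h_def by blast
  have nus: "\<nu> (s0\<^sup>2) = W s0 / s0" by (simp add: \<nu>_def qs)
  have "((\<lambda>s. s\<^sup>2) has_field_derivative 2 * s0) (at s0)" by (auto intro!: derivative_eq_intros)
  from DERIV_chain2[OF D this]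
  have C: "((\<lambda>s. h (s\<^sup>2, \<nu> (s\<^sup>2))) has_field_derivative poly b (s0\<^sup>2) / (W s0 / s0 * (s0\<^sup>2)\<^sup>2) * (2 * s0)) (at s0)"
    by (simp add: nus)
  define B where "B = {s. s / s0 \<in> {z. Re z > 0}} \<inter> (\<lambda>s. s\<^sup>2) -` U"
  have "open B" unfolding B_def
    using s0 openU
    by (intro open_Int open_vimage open_Collect_less[of "\<lambda>_. 0", simplified])
       (auto intro!: continuous_intros open_Collect_less)
  moreover have "s0 \<in> B" using s0 s0U by (simp add: B_def)
  moreover have "q (s\<^sup>2) = s" if "s \<in> B" for s
  proof -
    have "csqrt ((s / s0)\<^sup>2) = s / s0" using that by (intro csqrt_square) (auto simp: B_def)
    then show ?thesis using s0 by (simp add: q_def power_divide)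
  qed
  then have "\<nu> (s\<^sup>2) = W s / s" if "s \<in> B" for s using that by (simp add: \<nu>_def)
  ultimately show ?thesis
    by (intro has_field_derivative_transform_within_open[OF C, of B]) auto
qed

text \<open>The difference of two such functions is constant on the connected set \<open>S\<close>, and it is odd under
  \<open>s \<mapsto> - s\<close>, which exchanges the sheets of the curve.\<close>

lemma h_unique:
  assumes "is_h a b h" "is_h a b h'" "P \<in> cut_curve a"
  shows "h' P = h P"
proof -
  define D where "D = (\<lambda>s. h' (s\<^sup>2, W s / s) - h (s\<^sup>2, W s / s))"
  have "(D has_field_derivative 0) (at s)" if "s \<in> S" for s
    using DERIV_diff[OF h_pullback_deriv[OF assms(2) that] h_pullback_deriv[OF assms(1) that]]
    by (simp add: D_def)
  then have "D constant_on S"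
    by (intro has_field_derivative_0_imp_constant_on open_S connected_S)
  then obtain c where c: "\<And>s. s \<in> S \<Longrightarrow> D s = c" by (auto simp: constant_on_def)
  have odd: "g (l, - \<nu>) = - g (l, \<nu>)" if "is_h a b g" "(l, \<nu>) \<in> cut_curve a" for g l \<nu>
    using that unfolding is_h_def by blast
  obtain s1 where s1: "s1 \<in> S" using S_nonempty by blast
  have "D (- s1) = - D s1"
    using odd[OF assms(1) param_in_cut_curve[OF s1]] odd[OF assms(2) param_in_cut_curve[OF s1]]
    by (simp add: D_def W_even[OF s1])
  then have "c = - c" using c[OF s1] c[OF S_minus[OF s1]] by simp
  then have "c = 0" by simp
  obtain l \<nu> where P: "P = (l, \<nu>)" by (cases P)
  then obtain s where "s \<in> S" "l = s\<^sup>2" "\<nu> = W s / s" using cut_curve_param assms(3) by blast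
  then show ?thesis using c[of s] \<open>c = 0\<close> by (simp add: D_def P)
qed

end

text \<open>The two half planes joined by the disc form a connected set that is dense in the plane, and every set
  between a connected set and its closure is connected.\<close>

lemma connected_of_half_planes_and_disc:
  assumes "{s. Re s > 0} \<subseteq> S" "{s. Re s < 0} \<subseteq> S" "ball z r \<subseteq> S" "r > 0" "Re z = 0"
  shows "connected S"
proof (rule connected_intermediate_closure)
  let ?R = "{s. Re s > 0} :: complex set" and ?L = "{s. Re s < 0} :: complex set" and ?B = "ball z r"
  have cv: "convex ?R" "convex ?L" by (auto simp: convex_halfspace_Re_gt convex_halfspace_Re_lt)
  have "of_real (r / 2) + z \<in> ?R \<inter> ?B" "of_real (- (r / 2)) + z \<in> ?L \<inter> ?B"
    using assms(4,5) by (auto simp: dist_norm norm_minus_commute)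
  then have "?R \<inter> ?B \<noteq> {}" "(?R \<union> ?B) \<inter> ?L \<noteq> {}" by blast+
  then show "connected (?R \<union> ?B \<union> ?L)"
    using cv by (intro connected_Un convex_connected convex_ball) auto
  show "?R \<union> ?B \<union> ?L \<subseteq> S" using assms by blast
  have "s \<in> closure (?R \<union> ?B \<union> ?L)" for s
  proof -
    have "closure ?R = {s. Re s \<ge> 0}" "closure ?L = {s. Re s \<le> 0}"
      using closure_halfspace_gt[of "1::complex" 0] closure_halfspace_lt[of "1::complex" 0]
      by (simp_all add: inner_complex_def)
    then have "s \<in> closure ?R \<union> closure ?L" by auto
    then show ?thesis using closure_mono[of ?R "?R \<union> ?B \<union> ?L"] closure_mono[of ?L "?R \<union> ?B \<union> ?L"] by blast
  qed
  then show "S \<subseteq> closure (?R \<union> ?B \<union> ?L)" by blast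
qed

section \<open>The entire functions \<open>cosh (sqrt u)\<close> and \<open>sinh (sqrt u) / sqrt u\<close>\<close>

definition cosh_sqrt :: "complex \<Rightarrow> complex" where
  "cosh_sqrt u = cosh (csqrt u)"

definition sinhc_sqrt :: "complex \<Rightarrow> complex" where
  "sinhc_sqrt u = (if u = 0 then 1 else sinh (csqrt u) / csqrt u)"

lemma csqrt_sq_cases: "csqrt (z\<^sup>2) = z \<or> csqrt (z\<^sup>2) = - z"
  by (metis power2_csqrt power2_eq_iff)

lemma cosh_sqrt_square: "cosh_sqrt (z\<^sup>2) = cosh z"
  using csqrt_sq_cases[of z] by (auto simp: cosh_sqrt_def)

lemma sinhc_sqrt_square: "z * sinhc_sqrt (z\<^sup>2) = sinh z"
  using csqrt_sq_cases[of z] by (auto simp: sinhc_sqrt_def)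

lemma exp_via_sqrt: "z * sinhc_sqrt (z\<^sup>2) + cosh_sqrt (z\<^sup>2) = exp z"
  by (simp add: cosh_sqrt_square sinhc_sqrt_square sinh_plus_cosh)

text \<open>The power series of \<open>cosh\<close> has only even powers.\<close>

lemma cosh_sqrt_holomorphic: "cosh_sqrt holomorphic_on T"
proof -
  have s: "(\<lambda>n. u ^ n / fact (2 * n)) sums cosh_sqrt u" for u
  proof -
    have "(\<lambda>n. if even n then csqrt u ^ n /\<^sub>R fact n else 0) sums cosh (csqrt u)" by (rule cosh_converges)
    then have "(\<lambda>n. (if even (2 * n) then csqrt u ^ (2 * n) /\<^sub>R fact (2 * n) else 0)) sums cosh (csqrt u)"
      by (subst sums_mono_reindex[of "\<lambda>n. 2 * n"]) (auto simp: strict_mono_def image_iff elim: evenE)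
    moreover have "csqrt u ^ (2 * n) = u ^ n" for n by (simp only: power_mult power2_csqrt)
    then have "csqrt u ^ (2 * n) /\<^sub>R fact (2 * n) = u ^ n / fact (2 * n)" for n
      by (simp only: scaleR_conv_of_real of_real_inverse of_real_fact divide_inverse mult.commute)
    ultimately show ?thesis by (simp add: cosh_sqrt_def)
  qed
  have "cosh_sqrt holomorphic_on ball 0 r" for r
    by (rule power_series_holomorphic[of 0 r "\<lambda>n. 1 / fact (2 * n)"]) (use s in simp)
  then have "cosh_sqrt field_differentiable at x" for x
    by (metis holomorphic_on_imp_differentiable_at open_ball gt_ex mem_ball_0)
  then show ?thesis by (simp add: holomorphic_on_def field_differentiable_at_within)
qed

lemma sinhc_sqrt_holomorphic: "sinhc_sqrt holomorphic_on T"
proof -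
  have s: "(\<lambda>n. u ^ n / fact (2 * n + 1)) sums sinhc_sqrt u" for u
  proof (cases "u = 0")
    case True
    have "(\<lambda>n. u ^ n / fact (2 * n + 1)) sums (\<Sum>n\<in>{0}. u ^ n / fact (2 * n + 1))"
      by (rule sums_finite) (use True in auto)
    then show ?thesis using True by (simp add: sinhc_sqrt_def)
  next
    case False
    have "(\<lambda>n. if even n then 0 else csqrt u ^ n /\<^sub>R fact n) sums sinh (csqrt u)" by (rule sinh_converges)
    then have "(\<lambda>n. (if even (2 * n + 1) then 0 else csqrt u ^ (2 * n + 1) /\<^sub>R fact (2 * n + 1))) sums sinh (csqrt u)"
      by (subst sums_mono_reindex[of "\<lambda>n. 2 * n + 1"]) (auto simp: strict_mono_def image_iff elim: oddE)
    then have "(\<lambda>n. (if even (2 * n + 1) then 0 else csqrt u ^ (2 * n + 1) /\<^sub>R fact (2 * n + 1)) / csqrt u) sums (sinh (csqrt u) / csqrt u)"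
      by (rule sums_divide)
    moreover have "(if even (2 * n + 1) then 0 else csqrt u ^ (2 * n + 1) /\<^sub>R fact (2 * n + 1)) / csqrt u = u ^ n / fact (2 * n + 1)" for n
    proof -
      have "csqrt u ^ (2 * n + 1) = u ^ n * csqrt u" by (simp add: power_mult)
      moreover have "csqrt u \<noteq> 0" using False by simp
      ultimately show ?thesis by (simp add: scaleR_conv_of_real divide_inverse del: fact_Suc power_Suc)
    qed
    ultimately show ?thesis using False by (simp add: sinhc_sqrt_def del: fact_Suc)
  qed
  have "sinhc_sqrt holomorphic_on ball 0 r" for r
    by (rule power_series_holomorphic[of 0 r "\<lambda>n. 1 / fact (2 * n + 1)"]) (use s in simp)
  then have "sinhc_sqrt field_differentiable at x" for x
    by (metis holomorphic_on_imp_differentiable_at open_ball gt_ex mem_ball_0)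
  then show ?thesis by (simp add: holomorphic_on_def field_differentiable_at_within)
qed

section \<open>Spectral data whose function \<open>h\<close> is a polynomial multiple of \<open>\<nu>\<close>\<close>

lemma branch_derivative:
  fixes \<nu> R :: "complex \<Rightarrow> complex"
  assumes "\<nu> holomorphic_on U" "open U" "l \<in> U" "\<And>x. x \<in> U \<Longrightarrow> (\<nu> x)\<^sup>2 = R x" "(R has_field_derivative R') (at l)" "R l \<noteq> 0"
  shows "(\<nu> has_field_derivative R' / (2 * \<nu> l)) (at l)"
proof -
  have d: "(\<nu> has_field_derivative deriv \<nu> l) (at l)" using assms(1-3) holomorphic_derivI by blast
  have "((\<lambda>x. (\<nu> x)\<^sup>2) has_field_derivative 2 * \<nu> l * deriv \<nu> l) (at l)"
    by (auto intro!: derivative_eq_intros d)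
  then have "(R has_field_derivative 2 * \<nu> l * deriv \<nu> l) (at l)"
    by (rule has_field_derivative_transform_within_open[OF _ assms(2,3)]) (use assms(4) in auto)
  then have "R' = 2 * \<nu> l * deriv \<nu> l" using assms(5) DERIV_unique by blast
  moreover have "\<nu> l \<noteq> 0" using assms(3,4,6) by force
  ultimately show ?thesis using d by simp
qed

lemma poly_meromorphic [meromorphic_intros]:
  "f meromorphic_on A \<Longrightarrow> (\<lambda>x. poly p (f x)) meromorphic_on A"
  by (induction p) (auto intro!: meromorphic_intros)

lemma holomorphic_on_ball_meromorphic:
  fixes w :: "complex \<Rightarrow> complex"
  assumes "0 < r" "w holomorphic_on ball 0 r"
  shows "w meromorphic_on {0}"
proof -
  have "w analytic_on ball 0 r" using assms by (simp add: analytic_on_open)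
  then have "w analytic_on {0}" by (rule analytic_on_subset) (use assms in auto)
  then show ?thesis by (rule analytic_on_imp_meromorphic_on)
qed

text \<open>By \<open>\<nu>\<^sup>2 = a / l\<close> the assumption \<open>dh\<close> says that the differential of \<open>\<nu> * p\<close> is the one prescribed for \<open>h\<close>:
  it is this equation multiplied by \<open>\<nu> * l\<^sup>2\<close>, in which \<open>\<nu>\<close> no longer occurs.\<close>

locale polynomial_h = uniformised_curve +
  fixes p :: "complex poly"
  assumes dh: "\<And>l. (l * poly (pderiv a) l - poly a l) * poly p l / 2 + l * poly a l * poly (pderiv p) l = poly b l"
    and segments_real: "segments a \<subseteq> \<real>"
begin

text \<open>The square of \<open>h\<close>, a function of \<open>l\<close> alone.\<close>

definition hsq :: "complex \<Rightarrow> complex" where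
  "hsq l = (poly p l)\<^sup>2 * poly a l / l"

lemma is_h_product: "is_h a b (\<lambda>(l, \<nu>). \<nu> * poly p l)"
  unfolding is_h_def
proof (intro conjI allI impI ballI)
  fix U \<nu> l assume H: "open U \<and> U \<inter> ({0} \<union> segments a) = {} \<and> \<nu> holomorphic_on U \<and> (\<forall>l\<in>U. (\<nu> l)\<^sup>2 = poly a l / l)"
    and l: "l \<in> U"
  have l0: "l \<noteq> 0" "poly a l \<noteq> 0" using H l unfolding segments_def by auto
  define R' where "R' = (poly (pderiv a) l * l - poly a l) / (l * l)"
  have R: "((\<lambda>x. poly a x / x) has_field_derivative R') (at l)"
    unfolding R'_def using l0 by (auto intro!: derivative_eq_intros)
  have sq: "(\<nu> l)\<^sup>2 = poly a l / l" using H l by blast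
  then have nz: "\<nu> l \<noteq> 0" using l0 by auto
  have D: "(\<nu> has_field_derivative R' / (2 * \<nu> l)) (at l)"
    by (rule branch_derivative[of _ U _ "\<lambda>x. poly a x / x"]) (use H l R l0 in auto)
  have "((\<lambda>x. \<nu> x * poly p x) has_field_derivative R' / (2 * \<nu> l) * poly p l + poly (pderiv p) l * \<nu> l) (at l)"
    by (rule DERIV_mult[OF D poly_DERIV])
  moreover have "R' / (2 * \<nu> l) * poly p l + poly (pderiv p) l * \<nu> l = poly b l / (\<nu> l * l\<^sup>2)"
  proof -
    have e: "\<nu> l * \<nu> l * l = poly a l" using sq l0 by (simp add: power2_eq_square)
    have "(R' / (2 * \<nu> l) * poly p l + poly (pderiv p) l * \<nu> l) * (\<nu> l * l\<^sup>2) =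
      (poly (pderiv a) l * l - poly a l) * poly p l / 2 + poly (pderiv p) l * (\<nu> l * \<nu> l * l) * l"
      using nz l0 by (simp add: R'_def field_simps power2_eq_square)
    also have "\<dots> = poly b l" unfolding e dh[of l, symmetric] by (simp add: algebra_simps)
    finally show ?thesis using nz l0 by (simp add: field_simps)
  qed
  ultimately show "((\<lambda>x. case (x, \<nu> x) of (l, \<nu>) \<Rightarrow> \<nu> * poly p l) has_field_derivative poly b l / (\<nu> l * l\<^sup>2)) (at l)"
    by simp
next
  fix r :: real and w :: "complex \<Rightarrow> complex"
  assume "0 < r \<and> w holomorphic_on ball 0 r \<and> (\<forall>s\<in>ball 0 r. (w s)\<^sup>2 = poly a (s\<^sup>2))"
  then have "w meromorphic_on {0}" using holomorphic_on_ball_meromorphic by blast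
  then show "(\<lambda>s. case (s\<^sup>2, w s / s) of (l, \<nu>) \<Rightarrow> \<nu> * poly p l) meromorphic_on {0}"
    by (auto intro!: meromorphic_intros)
next
  fix r :: real and w :: "complex \<Rightarrow> complex"
  assume "0 < r \<and> w holomorphic_on ball 0 r \<and> (\<forall>s\<in>ball 0 r. (w s)\<^sup>2 = poly (reflect_poly a) (s\<^sup>2))"
  then have "w meromorphic_on {0}" using holomorphic_on_ball_meromorphic by blast
  then show "(\<lambda>s. case (1 / s\<^sup>2, s * w s / s ^ degree a) of (l, \<nu>) \<Rightarrow> \<nu> * poly p l) meromorphic_on {0}"
    by (auto intro!: meromorphic_intros)
qed auto

lemma h_eq: "\<lbrakk>is_h a b h; (l, \<nu>) \<in> cut_curve a\<rbrakk> \<Longrightarrow> h (l, \<nu>) = \<nu> * poly p l"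
  using h_unique[OF is_h_product] by fastforce

text \<open>The product \<open>\<nu> * p\<close> is continuous across the cuts and vanishes at the roots of \<open>a\<close>.\<close>

lemma h_condition_product: "h_condition a b"
proof -
  have "extends_to_boundary a (\<lambda>(l, \<nu>). \<nu> * poly p l)"
    unfolding extends_to_boundary_def
  proof (intro ballI impI)
    fix P assume P: "P \<in> spectral_curve a" "fst P \<in> segments a"
    show "\<exists>\<epsilon>>0. \<forall>C\<in>components (cut_curve a \<inter> ball P \<epsilon>). \<exists>c. ((\<lambda>(l, \<nu>). \<nu> * poly p l) \<longlongrightarrow> c) (at P within C) \<and>
            (poly a (fst P) = 0 \<longrightarrow> (\<exists>k::int. c = of_real pi * \<i> * of_int k))"
    proof (intro exI[of _ "1::real"] conjI ballI exI[of _ "snd P * poly p (fst P)"] impI)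
      fix C
      have "isCont (\<lambda>Q. snd Q * poly p (fst Q)) P" by (intro continuous_intros)
      then have "((\<lambda>Q. snd Q * poly p (fst Q)) \<longlongrightarrow> snd P * poly p (fst P)) (at P within C)"
        using continuous_at_imp_continuous_at_within continuous_within by blast
      then show "((\<lambda>(l, \<nu>). \<nu> * poly p l) \<longlongrightarrow> snd P * poly p (fst P)) (at P within C)"
        by (simp add: case_prod_unfold)
      assume "poly a (fst P) = 0"
      then have "snd P = 0" using P(1) by (auto simp: spectral_curve_def)
      then show "\<exists>k::int. snd P * poly p (fst P) = of_real pi * \<i> * of_int k" by (intro exI[of _ 0]) simp
    qed simp
  qed
  then show ?thesis unfolding h_condition_def using is_h_product h_unique[OF is_h_product] by blast
qed

text \<open>The decomposition of \<open>exp h\<close> into its even and its odd part in \<open>\<nu>\<close>.\<close>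

lemma is_mu_product: "is_mu a b (\<lambda>l. poly p l * sinhc_sqrt (hsq l)) (\<lambda>l. cosh_sqrt (hsq l))"
  unfolding is_mu_def
proof (intro conjI exI[of _ "\<lambda>(l, \<nu>). \<nu> * poly p l"] is_h_product ballI)
  have hs: "hsq holomorphic_on - {0}" unfolding hsq_def by (intro holomorphic_intros) auto
  show "(\<lambda>l. poly p l * sinhc_sqrt (hsq l)) holomorphic_on - {0}"
    by (intro holomorphic_intros holomorphic_on_compose_gen[OF hs sinhc_sqrt_holomorphic[of UNIV], unfolded o_def]) auto
  show "(\<lambda>l. cosh_sqrt (hsq l)) holomorphic_on - {0}"
    by (intro holomorphic_on_compose_gen[OF hs cosh_sqrt_holomorphic[of UNIV], unfolded o_def]) auto
  fix P assume "P \<in> cut_curve a"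
  then obtain l \<nu> where P: "P = (l, \<nu>)" "\<nu>\<^sup>2 = poly a l / l"
    by (cases P) (auto simp: cut_curve_def spectral_curve_def)
  have "hsq l = (\<nu> * poly p l)\<^sup>2" by (simp add: hsq_def P power_mult_distrib)
  then show "case P of (l, \<nu>) \<Rightarrow> exp (case (l, \<nu>) of (l, \<nu>) \<Rightarrow> \<nu> * poly p l) = poly p l * sinhc_sqrt (hsq l) * \<nu> + cosh_sqrt (hsq l)"
    using exp_via_sqrt[of "\<nu> * poly p l"] by (simp add: P mult_ac)
qed

lemma is_mu_unique_generic:
  assumes "is_mu a b f g" "l \<noteq> 0" "l \<notin> segments a"
  shows "f l = poly p l * sinhc_sqrt (hsq l)" "g l = cosh_sqrt (hsq l)"
proof -
  obtain \<nu> where nu: "\<nu>\<^sup>2 = poly a l / l" using power2_csqrt by blast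
  have "poly a l \<noteq> 0" using assms(3) unfolding segments_def by auto
  then have nz: "\<nu> \<noteq> 0" using nu assms(2) by auto
  have in_cc: "(l, \<nu>) \<in> cut_curve a" "(l, - \<nu>) \<in> cut_curve a"
    using nu assms by (auto simp: cut_curve_def spectral_curve_def)
  have *: "exp (\<nu> * poly p l) = F l * \<nu> + G l \<and> exp (- \<nu> * poly p l) = F l * (- \<nu>) + G l" if "is_mu a b F G" for F G
  proof -
    from that obtain h where h: "is_h a b h" "\<forall>(l, \<nu>) \<in> cut_curve a. exp (h (l, \<nu>)) = F l * \<nu> + G l"
      unfolding is_mu_def by blast
    then show ?thesis using h_eq[OF h(1) in_cc(1)] h_eq[OF h(1) in_cc(2)] in_cc by fastforce
  qed
  let ?F = "\<lambda>l. poly p l * sinhc_sqrt (hsq l)" and ?G = "\<lambda>l. cosh_sqrt (hsq l)"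
  have e: "f l * \<nu> + g l = ?F l * \<nu> + ?G l" "f l * (- \<nu>) + g l = ?F l * (- \<nu>) + ?G l"
    using *[OF assms(1)] *[OF is_mu_product] by simp_all
  have "2 * g l = (f l * \<nu> + g l) + (f l * (- \<nu>) + g l)" by simp
  also have "\<dots> = 2 * ?G l" unfolding e by simp
  finally show g: "g l = ?G l" by simp
  then have "f l * \<nu> = ?F l * \<nu>" using e(1) by simp
  then show "f l = ?F l" using nz by simp
qed

text \<open>Outside the cuts \<open>f\<close> and \<open>g\<close> are determined by \<open>h\<close>; on the cuts they follow by continuity.\<close>

lemma is_mu_unique:
  assumes "is_mu a b f g" "l \<noteq> 0"
  shows "f l = poly p l * sinhc_sqrt (hsq l)" "g l = cosh_sqrt (hsq l)"
proof -
  have gen: "F l = G l" if H: "F holomorphic_on - {0}" "G holomorphic_on - {0}"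
    "\<And>l. l \<noteq> 0 \<Longrightarrow> l \<notin> segments a \<Longrightarrow> F l = G l" for F G
  proof (cases "l \<in> segments a")
    case False then show ?thesis using H(3) assms(2) by blast
  next
    case True
    then have real: "l \<in> \<real>" using segments_real by blast
    define s where "s = (\<lambda>n. l + of_real (inverse (real (Suc n))) * \<i>)"
    have "s \<longlonglongrightarrow> l + of_real 0 * \<i>" unfolding s_def
      by (intro tendsto_intros LIMSEQ_inverse_real_of_nat)
    then have s: "s \<longlonglongrightarrow> l" by simp
    have im: "Im (s n) \<noteq> 0" for n
      using real by (simp add: s_def complex_is_Real_iff del: of_nat_Suc)
    then have "s n \<noteq> 0 \<and> s n \<notin> segments a" for n
      using segments_real complex_is_Real_iff by (metis subsetD zero_complex.sel(2))
    then have "F (s n) = G (s n)" for n using H(3) by blast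
    moreover have "isCont F l" "isCont G l"
      by (intro field_differentiable_imp_continuous_at holomorphic_on_imp_differentiable_at[of _ "-{0}"];
          use H(1,2) assms(2) in auto)+
    then have "(\<lambda>n. F (s n)) \<longlonglongrightarrow> F l" "(\<lambda>n. G (s n)) \<longlonglongrightarrow> G l"
      using isCont_tendsto_compose s by blast+
    ultimately show ?thesis using LIMSEQ_unique by simp
  qed
  have h1: "f holomorphic_on - {0}" "g holomorphic_on - {0}" using assms(1) unfolding is_mu_def by auto
  have h2: "(\<lambda>l. poly p l * sinhc_sqrt (hsq l)) holomorphic_on - {0}" "(\<lambda>l. cosh_sqrt (hsq l)) holomorphic_on - {0}"
    using is_mu_product unfolding is_mu_def by auto
  show "f l = poly p l * sinhc_sqrt (hsq l)"
    using gen[OF h1(1) h2(1)] is_mu_unique_generic(1)[OF assms(1)] by blast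
  show "g l = cosh_sqrt (hsq l)"
    using gen[OF h1(2) h2(2)] is_mu_unique_generic(2)[OF assms(1)] by blast
qed

lemma mu_square_eq_1_iff:
  assumes "is_mu a b f g" "l \<noteq> 0" "(l, \<nu>) \<in> spectral_curve a"
  shows "(f l * \<nu> + g l)\<^sup>2 = 1 \<longleftrightarrow> (\<exists>k::int. hsq l = - of_real ((pi * of_int k)\<^sup>2))"
proof -
  let ?z = "\<nu> * poly p l"
  have nu: "\<nu>\<^sup>2 = poly a l / l" using assms(3) by (simp add: spectral_curve_def)
  have z: "hsq l = ?z\<^sup>2" by (simp add: hsq_def nu power_mult_distrib)
  have "f l * \<nu> + g l = exp ?z"
    using exp_via_sqrt[of ?z] unfolding is_mu_unique[OF assms(1,2)] z[symmetric] by (simp add: mult_ac)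
  then have "(f l * \<nu> + g l)\<^sup>2 = exp (2 * ?z)" by (simp add: exp_double)
  moreover have E: "exp (2 * ?z) = 1 \<longleftrightarrow> (\<exists>k::int. ?z = of_real (pi * of_int k) * \<i>)"
  proof -
    define z where "z = ?z"
    have "exp (2 * z) = 1 \<longleftrightarrow> Re z = 0 \<and> (\<exists>k::int. Im z = of_int k * pi)"
      unfolding exp_eq_1 by auto
    also have "\<dots> \<longleftrightarrow> (\<exists>k::int. z = of_real (pi * of_int k) * \<i>)"
      unfolding complex_eq_iff by (auto simp: mult.commute)
    finally show ?thesis unfolding z_def .
  qed
  moreover have K: "?z\<^sup>2 = - of_real ((pi * of_int k)\<^sup>2) \<longleftrightarrow> ?z = of_real (pi * of_int k) * \<i> \<or> ?z = of_real (pi * of_int (- k)) * \<i>" for k :: int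
  proof -
    have "- of_real ((pi * of_int k)\<^sup>2) = (of_real (pi * of_int k) * \<i>)\<^sup>2" by (simp add: power_mult_distrib)
    then show ?thesis by (simp only: power2_eq_iff) simp
  qed
  have "(\<exists>k::int. ?z = of_real (pi * of_int k) * \<i>) \<longleftrightarrow> (\<exists>k::int. ?z\<^sup>2 = - of_real ((pi * of_int k)\<^sup>2))"
    unfolding K by (rule iffI; elim exE disjE; rule exI; (rule disjI1)?; assumption)
  ultimately show ?thesis unfolding z by (simp only:)
qed

lemma mu_roots_iff:
  "l \<in> mu_roots a b \<longleftrightarrow> norm l = 1 \<and> (\<exists>k::int. hsq l = - of_real ((pi * of_int k)\<^sup>2))"
proof (cases "norm l = 1")
  case True
  then have l0: "l \<noteq> 0" by auto
  obtain \<nu> where nu: "\<nu>\<^sup>2 = poly a l / l" using power2_csqrt by blast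
  have sc: "(l, \<nu>) \<in> spectral_curve a" using nu l0 by (simp add: spectral_curve_def)
  have "l \<in> mu_roots a b \<longleftrightarrow> (\<exists>f g. is_mu a b f g \<and> (\<forall>\<nu>. (l, \<nu>) \<in> spectral_curve a \<longrightarrow> (f l * \<nu> + g l)\<^sup>2 = 1))"
    using True by (simp add: mu_roots_def)
  also have "\<dots> \<longleftrightarrow> (\<exists>k::int. hsq l = - of_real ((pi * of_int k)\<^sup>2))"
  proof
    assume "\<exists>f g. is_mu a b f g \<and> (\<forall>\<nu>. (l, \<nu>) \<in> spectral_curve a \<longrightarrow> (f l * \<nu> + g l)\<^sup>2 = 1)"
    then obtain f g where fg: "is_mu a b f g" "\<forall>\<nu>. (l, \<nu>) \<in> spectral_curve a \<longrightarrow> (f l * \<nu> + g l)\<^sup>2 = 1" by blast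
    show "\<exists>k::int. hsq l = - of_real ((pi * of_int k)\<^sup>2)"
      using mu_square_eq_1_iff[OF fg(1) l0 sc] fg(2) sc by simp
  next
    assume k: "\<exists>k::int. hsq l = - of_real ((pi * of_int k)\<^sup>2)"
    show "\<exists>f g. is_mu a b f g \<and> (\<forall>\<nu>. (l, \<nu>) \<in> spectral_curve a \<longrightarrow> (f l * \<nu> + g l)\<^sup>2 = 1)"
    proof (intro exI conjI allI impI)
      show "is_mu a b (\<lambda>l. poly p l * sinhc_sqrt (hsq l)) (\<lambda>l. cosh_sqrt (hsq l))" by (rule is_mu_product)
      fix \<nu> assume "(l, \<nu>) \<in> spectral_curve a"
      from mu_square_eq_1_iff[OF is_mu_product l0 this] k
      show "(poly p l * sinhc_sqrt (hsq l) * \<nu> + cosh_sqrt (hsq l))\<^sup>2 = 1" by (simp only:)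
    qed
  qed
  finally show ?thesis using True by blast
qed (simp add: mu_roots_def)

lemma mu_condition_product:
  assumes "hsq l1 = - of_real (pi\<^sup>2)" "hsq l2 = - of_real (pi\<^sup>2)"
  shows "mu_condition a b l1 l2"
proof -
  have e: "- complex_of_real (pi\<^sup>2) = (of_real pi * \<i>)\<^sup>2" by (simp add: power_mult_distrib)
  have "sinh (of_real pi * \<i>) = 0" "cosh (of_real pi * \<i> :: complex) = -1"
    by (simp_all add: sinh_field_def cosh_field_def exp_minus mult.commute[of _ \<i>])
  then have v: "sinhc_sqrt (- complex_of_real (pi\<^sup>2)) = 0" "cosh_sqrt (- complex_of_real (pi\<^sup>2)) = -1"
    using sinhc_sqrt_square[of "of_real pi * \<i>"] cosh_sqrt_square[of "of_real pi * \<i>"] unfolding e by auto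
  have "cosh_sqrt (hsq \<alpha>) = 1" if "poly a \<alpha> = 0" for \<alpha>
    using that by (simp add: hsq_def cosh_sqrt_def)
  then show ?thesis unfolding mu_condition_def using is_mu_product v assms
    by (intro exI[of _ "\<lambda>l. poly p l * sinhc_sqrt (hsq l)"] exI[of _ "\<lambda>l. cosh_sqrt (hsq l)"]) auto
qed

lemma mu_condition_hsq:
  assumes "mu_condition a b l1 l2" "l1 \<noteq> 0"
  shows "\<exists>k::int. hsq l1 = - of_real ((pi * of_int k)\<^sup>2)"
proof -
  obtain f g where fg: "is_mu a b f g" "f l1 = 0" "g l1 \<in> {1, -1}" using assms(1) unfolding mu_condition_def by blast
  obtain \<nu> where nu: "\<nu>\<^sup>2 = poly a l1 / l1" using power2_csqrt by blast
  then have "(l1, \<nu>) \<in> spectral_curve a" using assms(2) by (simp add: spectral_curve_def)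
  from mu_square_eq_1_iff[OF fg(1) assms(2) this] fg show ?thesis by auto
qed

end

section \<open>The function \<open>h\<close> in spectral genus zero\<close>

definition a0 :: "complex poly" where "a0 = [:-1/16:]"

definition b0_poly :: "complex \<Rightarrow> complex poly" where "b0_poly \<beta> = [:\<beta>, - cnj \<beta>:]"

lemma segments_a0: "segments a0 = {}"
  by (auto simp: segments_def a0_def)

interpretation genus0: polynomial_h a0 "b0_poly \<beta>" "\<lambda>_. \<i> / 4" "- {0}" "[:32 * \<beta>, 32 * cnj \<beta>:]" for \<beta>
proof
  show "connected (- {0 :: complex})" by (rule connected_punctured_universe) simp
  show "(\<i> / 4)\<^sup>2 = poly a0 (s\<^sup>2)" for s by (simp add: a0_def power_divide)
  show "(l * poly (pderiv a0) l - poly a0 l) * poly [:32 * \<beta>, 32 * cnj \<beta>:] l / 2 +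
      l * poly a0 l * poly (pderiv [:32 * \<beta>, 32 * cnj \<beta>:]) l = poly (b0_poly \<beta>) l" for l
    by (simp add: a0_def b0_poly_def pderiv_pCons algebra_simps)
qed (auto simp: segments_a0)

lemma genus0_hsq: "norm l = 1 \<Longrightarrow> genus0.hsq (of_real r) l = - of_real (64 * r\<^sup>2 * (2 + 2 * Re l))"
proof -
  assume n: "norm l = 1"
  then have l0: "l \<noteq> 0" by auto
  have "l * cnj l = 1" using complex_norm_square[of l] n by simp
  then have il: "1 / l = cnj l" using l0 by (simp add: field_simps)
  have "genus0.hsq (of_real r) l = - 64 * of_real (r\<^sup>2) * (2 + l + 1 / l)"
    unfolding genus0.hsq_def using l0 by (simp add: a0_def field_simps power2_eq_square)
  also have "\<dots> = - 64 * of_real (r\<^sup>2) * (2 + 2 * of_real (Re l))"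
    unfolding il by (simp add: complex_eq_iff)
  finally show ?thesis by (simp add: algebra_simps)
qed

section \<open>The function \<open>h\<close> in spectral genus one\<close>

definition a1 :: "real \<Rightarrow> complex poly" where "a1 \<alpha> = [:-1/16, - of_real \<alpha> / 16, -1/16:]"

definition b1 :: "real \<Rightarrow> complex poly" where "b1 c = [:of_real c, 0, - of_real c:]"

text \<open>The roots of \<open>a1 \<alpha>\<close> are \<open>- root_of \<alpha>\<close> and its inverse.\<close>

definition root_of :: "real \<Rightarrow> real" where "root_of \<alpha> = (\<alpha> + sqrt (\<alpha>\<^sup>2 - 4)) / 2"

lemma root_of:
  assumes "2 \<le> \<alpha>"
  shows "1 \<le> root_of \<alpha>" "root_of \<alpha> + 1 / root_of \<alpha> = \<alpha>" "1 / root_of \<alpha> \<le> root_of \<alpha>"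
proof -
  have "4 \<le> \<alpha>\<^sup>2" using power_mono[of 2 \<alpha> 2] assms by simp
  then have s: "(sqrt (\<alpha>\<^sup>2 - 4))\<^sup>2 = \<alpha>\<^sup>2 - 4" "0 \<le> sqrt (\<alpha>\<^sup>2 - 4)" by auto
  have "1 \<le> (\<alpha> + t) / 2" if "0 \<le> t" for t using assms that by simp
  from this[OF s(2)] show 1: "1 \<le> root_of \<alpha>" by (simp only: root_of_def)
  have "1 * 1 \<le> root_of \<alpha> * root_of \<alpha>" using 1 by (intro mult_mono) auto
  then show "1 / root_of \<alpha> \<le> root_of \<alpha>" using 1 by (simp add: pos_divide_le_eq)
  have "root_of \<alpha> * root_of \<alpha> + 1 = \<alpha> * root_of \<alpha>"
    using s(1) by (simp add: root_of_def power2_eq_square field_simps)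
  then show "root_of \<alpha> + 1 / root_of \<alpha> = \<alpha>" using 1 by (simp add: field_simps)
qed

lemma poly_a1:
  assumes "2 \<le> \<alpha>"
  shows "poly (a1 \<alpha>) l = - 1 / 16 * (l + of_real (root_of \<alpha>)) * (l + of_real (1 / root_of \<alpha>))"
proof -
  have r: "root_of \<alpha> \<noteq> 0" using root_of[OF assms] by auto
  define p q where "p = complex_of_real (root_of \<alpha>)" and "q = complex_of_real (1 / root_of \<alpha>)"
  have "complex_of_real \<alpha> = p + q"
    unfolding p_def q_def of_real_add[symmetric] root_of(2)[OF assms] ..
  moreover have "p * q = 1"
    unfolding p_def q_def of_real_mult[symmetric] using r by simp
  moreover have "- 1 / 16 * (l + p) * (l + q) = - 1 / 16 * (p * q + l * (p + q) + l * l)" by (simp add: algebra_simps)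
  ultimately show ?thesis unfolding p_def[symmetric] q_def[symmetric] a1_def by (simp add: algebra_simps add_divide_distrib diff_divide_distrib)
qed

lemma poly_a1_eq_0:
  assumes "2 \<le> \<alpha>"
  shows "poly (a1 \<alpha>) l = 0 \<longleftrightarrow> l = of_real (- root_of \<alpha>) \<or> l = of_real (- (1 / root_of \<alpha>))"
  unfolding poly_a1[OF assms] by (simp add: eq_neg_iff_add_eq_0)

lemma segments_a1:
  assumes "2 \<le> \<alpha>"
  shows "segments (a1 \<alpha>) = of_real ` {- root_of \<alpha>..- (1 / root_of \<alpha>)}"
proof -
  let ?P = "root_of \<alpha>"
  have P: "1 \<le> ?P" using root_of[OF assms] by simp
  have le: "- ?P \<le> - (1 / ?P)" using root_of(3)[OF assms] by linarith
  have "segments (a1 \<alpha>) = closed_segment (of_real (- ?P)) (of_real (- (1 / ?P)))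
     \<union> closed_segment (of_real (- (1 / ?P))) (of_real (- ?P))"
  proof -
    have "{l. l = of_real (- ?P) \<or> l = of_real (- (1 / ?P))} = {complex_of_real (- ?P), of_real (- (1 / ?P))}" by auto
    moreover have "1 / cnj (of_real (- ?P)) = of_real (- (1 / ?P))" "1 / cnj (of_real (- (1 / ?P))) = of_real (- ?P)" by simp_all
    ultimately show ?thesis unfolding segments_def poly_a1_eq_0[OF assms] by (simp only: UN_insert UN_empty Un_empty_right)
  qed
  also have "\<dots> = closed_segment (of_real (- ?P)) (of_real (- (1 / ?P)))" by (simp add: closed_segment_commute)
  also have "\<dots> = of_real ` closed_segment (- ?P) (- (1 / ?P))" by (rule closed_segment_linear_image) (auto intro!: linearI simp: scaleR_conv_of_real)
  finally show ?thesis using le by (simp add: closed_segment_eq_real_ivl)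
qed

text \<open>Outside of the cut the quotient under the root avoids the closed negative real axis, so the principal branch
  of the root is holomorphic there.\<close>

definition W1 :: "real \<Rightarrow> complex \<Rightarrow> complex" where
  "W1 \<alpha> s = \<i> / 4 * (s\<^sup>2 + of_real (root_of \<alpha>)) * csqrt ((s\<^sup>2 + of_real (1 / root_of \<alpha>)) / (s\<^sup>2 + of_real (root_of \<alpha>)))"

lemma genus1_locale:
  assumes al: "2 \<le> \<alpha>"
  shows "polynomial_h (a1 \<alpha>) (b1 c) (W1 \<alpha>) {s. s \<noteq> 0 \<and> s\<^sup>2 \<notin> segments (a1 \<alpha>)} [:32 * of_real c:]"
proof -
  let ?S = "{s. s \<noteq> 0 \<and> s\<^sup>2 \<notin> segments (a1 \<alpha>)}" and ?P = "root_of \<alpha>"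
  have P: "1 \<le> ?P" using root_of[OF al] by simp
  have Pm: "of_real (- ?P) \<in> segments (a1 \<alpha>)"
    unfolding segments_a1[OF al] using root_of(3)[OF al] by (intro imageI) auto
  have seg: "Re x \<le> - (1 / ?P) \<and> Im x = 0" if "x \<in> segments (a1 \<alpha>)" for x
    using that unfolding segments_a1[OF al] by auto
  have nz: "s\<^sup>2 + of_real ?P \<noteq> 0" if "s \<in> ?S" for s
    using that Pm by (metis (mono_tags, lifting) add_eq_0_iff2 mem_Collect_eq of_real_minus)
  have arg: "(s\<^sup>2 + of_real (1 / ?P)) / (s\<^sup>2 + of_real ?P) \<notin> \<real>\<^sub>\<le>\<^sub>0" if s: "s \<in> ?S" for s
  proof
    assume "(s\<^sup>2 + of_real (1 / ?P)) / (s\<^sup>2 + of_real ?P) \<in> \<real>\<^sub>\<le>\<^sub>0"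
    then obtain t where t: "t \<ge> 0" "(s\<^sup>2 + of_real (1 / ?P)) / (s\<^sup>2 + of_real ?P) = of_real (- t)"
      by (metis nonpos_Reals_cases neg_0_le_iff_le minus_minus)
    have "s\<^sup>2 + of_real (1 / ?P) = of_real (- t) * (s\<^sup>2 + of_real ?P)"
      by (rule nonzero_divide_eq_eq[THEN iffD1, OF nz[OF s] t(2)])
    then have e: "s\<^sup>2 * of_real (1 + t) = of_real (- (1 / ?P + t * ?P))" by (simp add: algebra_simps add_eq_0_iff)
    have "s\<^sup>2 = of_real (- (1 / ?P + t * ?P)) / of_real (1 + t)"
      unfolding e[symmetric] using t(1) by (simp del: of_real_add)
    then have s2: "s\<^sup>2 = of_real (- (1 / ?P + t * ?P) / (1 + t))" by simp
    have iP: "1 / ?P \<le> ?P" by (rule root_of(3)[OF al])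
    have "t * (1 / ?P) \<le> t * ?P" using iP t(1) by (intro mult_left_mono)
    then have "- ?P \<le> - (1 / ?P + t * ?P) / (1 + t)" "- (1 / ?P + t * ?P) / (1 + t) \<le> - (1 / ?P)"
      using t(1) iP by (simp_all add: pos_le_divide_eq pos_divide_le_eq algebra_simps add_nonneg_pos add_divide_distrib)
    then have "s\<^sup>2 \<in> segments (a1 \<alpha>)" unfolding segments_a1[OF al] s2 by (intro imageI) simp
    then show False using s by simp
  qed
  show ?thesis
  proof
    have "closed (segments (a1 \<alpha>))" unfolding segments_a1[OF al]
      by (intro compact_imp_closed compact_continuous_image continuous_intros) auto
    then have "open ((\<lambda>s. s\<^sup>2) -` (- segments (a1 \<alpha>)) \<inter> - {0})"
      by (intro open_Int open_vimage continuous_intros) auto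
    then show "open ?S" by (simp add: vimage_def Int_def conj_commute)
    show "connected ?S"
    proof (rule connected_of_half_planes_and_disc[of _ "\<i> / of_real (2 * ?P)" "1 / (2 * ?P)"])
      have *: "s \<in> ?S" if "Re s \<noteq> 0" for s
      proof -
        have "s\<^sup>2 \<notin> segments (a1 \<alpha>)"
        proof
          assume "s\<^sup>2 \<in> segments (a1 \<alpha>)"
          then have i: "Im (s\<^sup>2) = 0" and r: "Re (s\<^sup>2) \<le> - (1 / ?P)" using seg by auto
          have "Im s = 0" using i that by (simp add: power2_eq_square)
          then have "0 \<le> Re (s\<^sup>2)" by (simp add: power2_eq_square)
          moreover have "0 < 1 / ?P" using P by simp
          ultimately show False using r by linarith
        qed
        then show ?thesis using that by auto
      qed
      then show "{s. Re s > 0} \<subseteq> ?S" "{s. Re s < 0} \<subseteq> ?S" by auto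
      \<comment> \<open>in the coordinate \<open>s\<close> the cut consists of two segments of the imaginary axis at the distance
         \<open>1 / sqrt ?P\<close> from \<open>0\<close>; the disc lies between \<open>0\<close> and \<open>\<i> / ?P\<close>\<close>
      show "ball (\<i> / of_real (2 * ?P)) (1 / (2 * ?P)) \<subseteq> ?S"
      proof
        fix s assume s: "s \<in> ball (\<i> / of_real (2 * ?P)) (1 / (2 * ?P))"
        let ?z = "\<i> / complex_of_real (2 * ?P)"
        have nz: "norm ?z = 1 / (2 * ?P)" using P by (simp add: norm_divide)
        have d: "norm (?z - s) < 1 / (2 * ?P)" using s by (simp add: dist_norm)
        have "s \<noteq> 0" using d nz by auto
        have "norm s \<le> norm ?z + norm (?z - s)" by (metis norm_triangle_sub add.commute norm_minus_commute)
        then have "norm s < 1 / (2 * ?P) + 1 / (2 * ?P)" using d nz by linarith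
        then have ns: "norm s < 1 / ?P" by (simp add: field_simps)
        have "1 / ?P \<le> 1" using P by simp
        then have "norm s * norm s \<le> norm s * 1" using ns by (intro mult_left_mono) auto
        then have "norm s * norm s < 1 / ?P" using ns by simp
        moreover have "\<bar>Re (s\<^sup>2)\<bar> \<le> norm s * norm s"
          using abs_Re_le_cmod[of "s\<^sup>2"] unfolding norm_power power2_eq_square[of "norm s"] .
        ultimately have "s\<^sup>2 \<notin> segments (a1 \<alpha>)" using seg[of "s\<^sup>2"] by auto
        then show "s \<in> ?S" using \<open>s \<noteq> 0\<close> by simp
      qed
    qed (use P in auto)
    show "W1 \<alpha> holomorphic_on ?S" unfolding W1_def
      by (intro holomorphic_intros) (use nz arg in auto)
    show "(W1 \<alpha> s)\<^sup>2 = poly (a1 \<alpha>) (s\<^sup>2)" if "s \<in> ?S" for s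
    proof -
      have "(\<i> / 4 * x * csqrt (y / x))\<^sup>2 = - 1 / 16 * (x * y)" if "x \<noteq> 0" for x y
        using that by (simp add: power_mult_distrib power_divide) (simp add: power2_eq_square)
      from this[OF nz[OF that]]
      have "(W1 \<alpha> s)\<^sup>2 = - 1 / 16 * ((s\<^sup>2 + of_real ?P) * (s\<^sup>2 + of_real (1 / ?P)))" unfolding W1_def .
      then show ?thesis unfolding poly_a1[OF al] by (simp only: mult.assoc)
    qed
    show "W1 \<alpha> (- s) = W1 \<alpha> s" for s by (simp add: W1_def)
    have "1 \<in> ?S" using seg[of 1] P by (auto simp: field_simps)
    then show "?S \<noteq> {}" by blast
    show "(l * poly (pderiv (a1 \<alpha>)) l - poly (a1 \<alpha>) l) * poly [:32 * of_real c:] l / 2 +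
        l * poly (a1 \<alpha>) l * poly (pderiv [:32 * of_real c:]) l = poly (b1 c) l" for l
      by (simp add: a1_def b1_def pderiv_pCons algebra_simps diff_divide_distrib)
    show "segments (a1 \<alpha>) \<subseteq> \<real>" unfolding segments_a1[OF al] by auto
  qed simp
qed

lemma genus1_hsq:
  assumes "2 \<le> \<alpha>" "norm l = 1"
  shows "polynomial_h.hsq (a1 \<alpha>) [:32 * of_real c:] l = - of_real (64 * c\<^sup>2 * (\<alpha> + 2 * Re l))"
proof -
  interpret polynomial_h "a1 \<alpha>" "b1 c" "W1 \<alpha>" "{s. s \<noteq> 0 \<and> s\<^sup>2 \<notin> segments (a1 \<alpha>)}" "[:32 * of_real c:]"
    by (rule genus1_locale[OF assms(1)])
  have l0: "l \<noteq> 0" using assms(2) by auto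
  have "l * cnj l = 1" using complex_norm_square[of l] assms(2) by simp
  then have il: "1 / l = cnj l" using l0 by (simp add: field_simps)
  have "hsq l = - 64 * of_real (c\<^sup>2) * (of_real \<alpha> + l + 1 / l)"
    unfolding hsq_def using l0 by (simp add: a1_def field_simps power2_eq_square)
  also have "\<dots> = - 64 * of_real (c\<^sup>2) * (of_real \<alpha> + 2 * of_real (Re l))"
    unfolding il by (simp add: complex_eq_iff)
  finally show ?thesis by (simp add: algebra_simps)
qed

section \<open>The two families of spectral data\<close>

text \<open>The Sym point on the lower half circle for which the mean curvature is \<open>H\<close>.\<close>

definition sym1 :: "real \<Rightarrow> complex" where
  "sym1 H = Complex (H / sqrt (1 + H\<^sup>2)) (- 1 / sqrt (1 + H\<^sup>2))"

text \<open>The factor for which \<open>h\<^sup>2 = - \<pi>\<^sup>2\<close> at the Sym points.\<close>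

definition coef :: "real \<Rightarrow> real \<Rightarrow> real" where
  "coef H \<alpha> = pi / (8 * sqrt (\<alpha> + 2 * Re (sym1 H)))"

definition Phi0 :: "real \<Rightarrow> spectral_quadruple" where
  "Phi0 H = (a0, b0_poly (of_real (coef H 2)), sym1 H, cnj (sym1 H))"

definition Phi1 :: "real \<times> real \<Rightarrow> spectral_quadruple" where
  "Phi1 = (\<lambda>(H, \<alpha>). (a1 \<alpha>, b1 (coef H \<alpha>), sym1 H, cnj (sym1 H)))"

definition sign_closure :: "spectral_quadruple set \<Rightarrow> spectral_quadruple set" where
  "sign_closure M = M \<union> {(a, - b, l1, l2) | a b l1 l2. (a, b, l1, l2) \<in> M}"

definition M0 :: "spectral_quadruple set" where "M0 = sign_closure (Phi0 ` {0..})"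

definition M1 :: "spectral_quadruple set" where "M1 = sign_closure (Phi1 ` ({0..} \<times> {2..}))"

lemma sqrt_pos: "0 < sqrt (1 + H\<^sup>2)" for H :: real
  by (simp add: add_pos_nonneg)

lemma sym1_norm: "norm (sym1 H) = 1"
proof -
  have "(norm (sym1 H))\<^sup>2 = (H\<^sup>2 + 1) / (1 + H\<^sup>2)"
    unfolding cmod_power2 by (simp add: sym1_def power_divide add_divide_distrib)
  also have "\<dots> = 1" using sqrt_pos[of H] by (simp add: add.commute)
  finally show ?thesis using power2_eq_imp_eq[of "norm (sym1 H)" 1] by simp
qed

lemma sym1_Im: "Im (sym1 H) < 0"
  using sqrt_pos[of H] by (simp add: sym1_def)

lemma sym1_Re: "0 \<le> H \<Longrightarrow> 0 \<le> Re (sym1 H)"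
  by (simp add: sym1_def)

lemma cnj_inverse: "norm l = 1 \<Longrightarrow> cnj l = 1 / l"
  using complex_norm_square[of l] by (cases "l = 0") (auto simp: field_simps)

lemma sym1_ratio: "- Re (sym1 H) / Im (sym1 H) = H"
  using sqrt_pos[of H] by (simp add: sym1_def)

lemma mean_curvature_of_sym_points:
  "Im l < 0 \<Longrightarrow> sym_mean_curvature (a, b, l, cnj l) = - Re l / Im l"
proof -
  assume "Im l < 0"
  have "\<i> * (l + cnj l) / (cnj l - l) = of_real (- Re l / Im l)"
    using \<open>Im l < 0\<close> by (simp add: complex_eq_iff Re_divide Im_divide power2_eq_square)
  then show ?thesis by (simp add: sym_mean_curvature_def)
qed

lemma sym1_unique:
  assumes "norm l = 1" "Im l < 0"
  shows "l = sym1 (- Re l / Im l)"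
proof -
  define H where "H = - Re l / Im l"
  have n: "(Re l)\<^sup>2 + (Im l)\<^sup>2 = 1" using assms(1) by (metis cmod_power2 power_one)
  have "1 + H\<^sup>2 = 1 / (Im l)\<^sup>2"
  proof -
    have "1 + H\<^sup>2 = ((Re l)\<^sup>2 + (Im l)\<^sup>2) / (Im l)\<^sup>2" using assms(2) by (simp add: H_def power_divide add_divide_distrib)
    then show ?thesis unfolding n .
  qed
  then have "sqrt (1 + H\<^sup>2) = 1 / \<bar>Im l\<bar>" by (simp add: real_sqrt_divide)
  then have s: "sqrt (1 + H\<^sup>2) = - 1 / Im l" using assms(2) by simp
  have "sym1 H = l" unfolding sym1_def s using assms(2) by (simp add: complex_eq_iff H_def)
  then show ?thesis by (simp add: H_def)
qed

lemma coef_pos: "\<lbrakk>0 \<le> H; 2 \<le> \<alpha>\<rbrakk> \<Longrightarrow> 0 < coef H \<alpha>"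
  using sym1_Re[of H] by (simp add: coef_def)

lemma coef_sq:
  assumes "0 \<le> H" "2 \<le> \<alpha>"
  shows "64 * (coef H \<alpha>)\<^sup>2 * (\<alpha> + 2 * x) = pi\<^sup>2 * ((\<alpha> + 2 * x) / (\<alpha> + 2 * Re (sym1 H)))"
proof -
  define d where "d = \<alpha> + 2 * Re (sym1 H)"
  have "d > 0" using sym1_Re[OF assms(1)] assms(2) by (simp add: d_def)
  then have "(coef H \<alpha>)\<^sup>2 = pi\<^sup>2 / (64 * d)"
    by (simp add: coef_def d_def[symmetric] power_divide power_mult_distrib)
  then show ?thesis unfolding d_def[symmetric] by simp
qed

lemma Re_eq_sym1:
  assumes "norm l = 1" "Re l = Re (sym1 H)"
  shows "l = sym1 H \<or> l = cnj (sym1 H)"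
proof -
  have "(Im l)\<^sup>2 = (Im (sym1 H))\<^sup>2"
    using assms sym1_norm[of H] cmod_power2[of l] cmod_power2[of "sym1 H"] by simp
  then show ?thesis using assms(2) by (auto simp: complex_eq_iff power2_eq_iff)
qed

text \<open>On the unit circle \<open>h\<^sup>2\<close> is \<open>- \<pi>\<^sup>2\<close> times this ratio. It is smaller than \<open>4\<close> because the real part of the Sym
  points is non-negative for \<open>0 \<le> H\<close>, so \<open>0\<close> and \<open>1\<close> are the only squares among its values.\<close>

lemma ratio_is_square:
  assumes H: "0 \<le> H" and al: "2 \<le> \<alpha>" and l: "norm l = 1"
    and k: "(\<alpha> + 2 * Re l) / (\<alpha> + 2 * Re (sym1 H)) = (of_int k)\<^sup>2"
  shows "l = sym1 H \<or> l = cnj (sym1 H) \<or> (\<alpha> = 2 \<and> l = -1)"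
proof -
  have r: "Re l \<le> 1" "-1 \<le> Re l" using abs_Re_le_cmod[of l] l by auto
  have p: "0 \<le> Re (sym1 H)" using sym1_Re[OF H] .
  then have e: "\<alpha> + 2 * Re l = (of_int k)\<^sup>2 * (\<alpha> + 2 * Re (sym1 H))"
    using k al by (simp add: field_simps)
  have "\<bar>k\<bar> < 2"
  proof (rule ccontr)
    assume "\<not> \<bar>k\<bar> < 2"
    then have "2 \<le> \<bar>real_of_int k\<bar>" by linarith
    then have "2\<^sup>2 \<le> \<bar>real_of_int k\<bar>\<^sup>2" by (intro power_mono) auto
    then have "4 \<le> (real_of_int k)\<^sup>2" by simp
    then have "4 * (\<alpha> + 2 * Re (sym1 H)) \<le> \<alpha> + 2 * Re l" unfolding e using p al by (intro mult_right_mono) auto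
    moreover have False if "4 * (x + 2 * y) \<le> x + 2 * z" "z \<le> 1" "0 \<le> y" "2 \<le> x" for x y z :: real
      using that by simp
    ultimately show False using r(1) p al by blast
  qed
  then consider "k = 0" | "k = 1 \<or> k = -1" by linarith
  then show ?thesis
  proof cases
    case 1
    then have "\<alpha> + 2 * Re l = 0" using e by simp
    then have "\<alpha> = 2" "Re l = -1" using r al by linarith+
    moreover have "(Im l)\<^sup>2 = 0" using cmod_power2[of l] l \<open>Re l = -1\<close> by simp
    ultimately show ?thesis by (simp add: complex_eq_iff)
  next
    case 2
    then have "Re l = Re (sym1 H)" using e by auto
    then show ?thesis using Re_eq_sym1[OF l] by blast
  qed
qed

lemma hsq_roots:
  assumes H: "0 \<le> H" and al: "2 \<le> \<alpha>" and l: "norm l = 1" and c: "c\<^sup>2 = (coef H \<alpha>)\<^sup>2"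
  shows "(\<exists>k::int. - complex_of_real (64 * c\<^sup>2 * (\<alpha> + 2 * Re l)) = - of_real ((pi * of_int k)\<^sup>2)) \<longleftrightarrow>
    l = sym1 H \<or> l = cnj (sym1 H) \<or> (\<alpha> = 2 \<and> l = -1)"
proof -
  let ?r = "(\<alpha> + 2 * Re l) / (\<alpha> + 2 * Re (sym1 H))"
  have p: "\<alpha> + 2 * Re (sym1 H) > 0" using sym1_Re[OF H] al by simp
  have "- complex_of_real (64 * c\<^sup>2 * (\<alpha> + 2 * Re l)) = - of_real ((pi * of_int k)\<^sup>2) \<longleftrightarrow> ?r = (of_int k)\<^sup>2" for k :: int
    unfolding c coef_sq[OF H al] neg_equal_iff_equal of_real_eq_iff power_mult_distrib mult_cancel_left by simp
  then have "(\<exists>k::int. - complex_of_real (64 * c\<^sup>2 * (\<alpha> + 2 * Re l)) = - of_real ((pi * of_int k)\<^sup>2)) \<longleftrightarrow> (\<exists>k::int. ?r = (of_int k)\<^sup>2)"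
    by simp
  also have "\<dots> \<longleftrightarrow> l = sym1 H \<or> l = cnj (sym1 H) \<or> (\<alpha> = 2 \<and> l = -1)"
  proof
    assume "\<exists>k::int. ?r = (of_int k)\<^sup>2"
    then show "l = sym1 H \<or> l = cnj (sym1 H) \<or> (\<alpha> = 2 \<and> l = -1)" using ratio_is_square[OF H al l] by blast
  next
    assume "l = sym1 H \<or> l = cnj (sym1 H) \<or> (\<alpha> = 2 \<and> l = -1)"
    then consider "Re l = Re (sym1 H)" | "\<alpha> = 2" "l = -1" by auto
    then show "\<exists>k::int. ?r = (of_int k)\<^sup>2"
      by cases (use p in \<open>auto intro: exI[of _ 1] exI[of _ 0]\<close>)
  qed
  finally show ?thesis .
qed

lemma genus0_mu_roots:
  assumes H: "0 \<le> H" and c: "c\<^sup>2 = (coef H 2)\<^sup>2"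
  shows "mu_roots a0 (b0_poly (of_real c)) = {sym1 H, cnj (sym1 H), -1}"
proof (rule set_eqI)
  fix l
  show "l \<in> mu_roots a0 (b0_poly (of_real c)) \<longleftrightarrow> l \<in> {sym1 H, cnj (sym1 H), -1}"
  proof (cases "norm l = 1")
    case True
    show ?thesis unfolding genus0.mu_roots_iff genus0_hsq[OF True] hsq_roots[OF H order_refl True c] using True by simp
  next
    case False
    then show ?thesis unfolding genus0.mu_roots_iff using sym1_norm[of H] by auto
  qed
qed

lemma genus1_mu_roots:
  assumes H: "0 \<le> H" and al: "2 < \<alpha>"
  shows "mu_roots (a1 \<alpha>) (b1 (coef H \<alpha>)) = {sym1 H, cnj (sym1 H)}"
proof (rule set_eqI)
  fix l
  have al2: "2 \<le> \<alpha>" using al by simp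
  show "l \<in> mu_roots (a1 \<alpha>) (b1 (coef H \<alpha>)) \<longleftrightarrow> l \<in> {sym1 H, cnj (sym1 H)}"
  proof (cases "norm l = 1")
    case True
    show ?thesis
      unfolding polynomial_h.mu_roots_iff[OF genus1_locale[OF al2]] genus1_hsq[OF al2 True] hsq_roots[OF H al2 True refl]
      using True al by simp
  next
    case False
    then show ?thesis unfolding polynomial_h.mu_roots_iff[OF genus1_locale[OF al2]] using sym1_norm[of H] by auto
  qed
qed

lemma genus0_spectral_data:
  assumes H: "0 \<le> H" and c: "c\<^sup>2 = (coef H 2)\<^sup>2"
  shows "(a0, b0_poly (of_real c), sym1 H, cnj (sym1 H)) \<in> spectral_data 0"
proof -
  have c0: "c \<noteq> 0" using c coef_pos[OF H, of 2] by auto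
  have ci: "cnj (sym1 H) = 1 / sym1 H" by (rule cnj_inverse[OF sym1_norm])
  have "reality_condition 0 a0 (b0_poly (of_real c))"
    unfolding reality_condition_def
  proof (intro conjI allI impI ballI)
    fix l :: complex assume "l \<noteq> 0"
    then show "l ^ (2 * 0) * cnj (poly a0 (1 / cnj l)) = poly a0 l"
      "l ^ (0 + 1) * cnj (poly (b0_poly (complex_of_real c)) (1 / cnj l)) = - poly (b0_poly (complex_of_real c)) l"
      by (simp_all add: a0_def b0_poly_def field_simps)
  next
    fix l :: complex
    have "- (1/16) \<in> (\<real>\<^sub>\<le>\<^sub>0 :: complex set)" by (simp add: complex_nonpos_Reals_iff)
    then show "poly a0 l / l ^ 0 \<in> \<real>\<^sub>\<le>\<^sub>0" by (simp add: a0_def)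
  qed
  moreover have "period_condition a0 (b0_poly (of_real c))" by (simp add: period_condition_def a0_def)
  moreover have "h_condition a0 (b0_poly (of_real c))" by (rule genus0.h_condition_product)
  moreover have "mu_condition a0 (b0_poly (of_real c)) (sym1 H) (cnj (sym1 H))"
  proof (rule genus0.mu_condition_product)
    have "64 * c\<^sup>2 * (2 + 2 * Re (sym1 H)) = pi\<^sup>2"
      unfolding c coef_sq[OF H order_refl] using sym1_Re[OF H] by simp
    then show "genus0.hsq (complex_of_real c) (sym1 H) = - of_real (pi\<^sup>2)"
      "genus0.hsq (complex_of_real c) (cnj (sym1 H)) = - of_real (pi\<^sup>2)"
      using genus0_hsq[of "sym1 H" c] genus0_hsq[of "cnj (sym1 H)" c] sym1_norm[of H] by (simp_all only: complex_mod_cnj cnj.simps)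
  qed
  moreover have "sym1 H \<noteq> cnj (sym1 H)" using sym1_Im[of H] by (simp add: complex_eq_iff)
  moreover have "degree a0 = 0" "degree (b0_poly (of_real c)) = 1" "norm (poly a0 0) = 1 / 16"
    using c0 by (auto simp: a0_def b0_poly_def norm_divide)
  ultimately show ?thesis
    using sym1_norm[of H] sym1_Im[of H] unfolding spectral_data_def ci by (simp add: norm_divide)
qed

text \<open>A continuous square root of a differentiable path is differentiable where it does not vanish.\<close>

lemma sqrt_path_derivative:
  fixes y R :: "real \<Rightarrow> complex"
  assumes t: "t \<in> {0<..<1}" and y: "continuous_on {0..1} y" and sq: "\<And>u. u \<in> {0..1} \<Longrightarrow> (y u)\<^sup>2 = R u"
    and R: "(R has_vector_derivative R') (at t)" and nz: "R t \<noteq> 0"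
  shows "(y has_vector_derivative R' / (2 * y t)) (at t)"
proof -
  have yt: "y t \<noteq> 0" using nz sq[of t] t by auto
  have cy: "isCont y t" using y t by (intro continuous_on_interior[of "{0..1}"]) auto
  have "((\<lambda>u. R u / R t) has_vector_derivative R' / R t) (at t)"
    using R by (rule has_vector_derivative_divide)
  moreover have "(csqrt has_field_derivative (1 / 2)) (at (R t / R t))"
    using nz has_field_derivative_csqrt[of 1] by simp
  ultimately have "((csqrt \<circ> (\<lambda>u. R u / R t)) has_vector_derivative (R' / R t * (1 / 2))) (at t)"
    by (rule field_vector_diff_chain_at)
  then have "((\<lambda>u. y t * csqrt (R u / R t)) has_vector_derivative (y t * (R' / R t * (1 / 2)))) (at t)"
    unfolding o_def by (rule has_vector_derivative_mult_right)
  moreover have "y t * (R' / R t * (1 / 2)) = R' / (2 * y t)"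
    using sq[of t] t yt by (simp add: power2_eq_square field_simps flip: sq)
  ultimately have D: "((\<lambda>u. y t * csqrt (R u / R t)) has_vector_derivative (R' / (2 * y t))) (at t)" by simp
  have "((\<lambda>u. Re (y u / y t)) \<longlongrightarrow> Re (y t / y t)) (at t)"
    by (intro tendsto_intros) (use cy yt in \<open>auto simp: isCont_def\<close>)
  moreover have "Re (y t / y t) > 0" using yt by simp
  ultimately have "\<forall>\<^sub>F u in at t. Re (y u / y t) > 0"
    using order_tendstoD(1) by blast
  then obtain d where d: "d > 0" "\<And>u. u \<noteq> t \<Longrightarrow> dist u t < d \<Longrightarrow> Re (y u / y t) > 0"
    unfolding eventually_at by auto
  define B where "B = ball t d \<inter> {0<..<1}"
  show ?thesis
  proof (rule has_vector_derivative_transform_within_open[OF D, of B])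
    show "open B" "t \<in> B" using d t by (auto simp: B_def)
    fix u assume u: "u \<in> B"
    then have u01: "u \<in> {0..1}" "t \<in> {0..1}" using t by (auto simp: B_def)
    have "R u / R t = (y u / y t)\<^sup>2" using sq u01 by (simp add: power_divide)
    moreover have "Re (y u / y t) > 0"
      using u d(2)[of u] yt by (cases "u = t") (auto simp: B_def dist_commute)
    then have "csqrt ((y u / y t)\<^sup>2) = y u / y t" by (intro csqrt_square) auto
    ultimately show "y t * csqrt (R u / R t) = y u" using yt by simp
  qed
qed

text \<open>For every continuous branch \<open>\<nu>\<close> on the segment, \<open>32 * c * \<nu>\<close> is a primitive of the integrand that vanishes at
  both ends.\<close>

lemma genus1_period_condition:
  assumes al: "2 \<le> \<alpha>"
  shows "period_condition (a1 \<alpha>) (b1 c)"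
  unfolding period_condition_def
proof (intro allI impI)
  fix A \<nu> assume H: "poly (a1 \<alpha>) A = 0 \<and> continuous_on (closed_segment A (1 / cnj A)) \<nu> \<and>
            (\<forall>l\<in>closed_segment A (1 / cnj A). (\<nu> l)\<^sup>2 = poly (a1 \<alpha>) l / l)"
  let ?P = "root_of \<alpha>"
  let ?B = "1 / cnj A"
  have P: "1 \<le> ?P" "1 / ?P \<le> ?P" using root_of[OF al] by auto
  have A: "A = of_real (- ?P) \<or> A = of_real (- (1 / ?P))" using H poly_a1_eq_0[OF al] by blast
  obtain x where x: "A = of_real x" "x = - ?P \<or> x = - (1 / ?P)" using A by blast
  have x0: "x < 0" using x P by auto
  have B: "?B = of_real (1 / x)" using x by simp
  have rootB: "poly (a1 \<alpha>) ?B = 0" unfolding poly_a1_eq_0[OF al] B using x by auto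
  let ?g = "linepath A ?B"
  define \<gamma> where "\<gamma> = (\<lambda>t::real. (1 - t) * x + t * (1 / x))"
  have g: "?g t = of_real (\<gamma> t)" for t unfolding linepath_def x(1) B[unfolded x(1)] by (simp add: \<gamma>_def scaleR_conv_of_real)
  define f where "f = (\<lambda>l. poly (b1 c) l / (\<nu> l * l\<^sup>2))"
  have "((\<lambda>t. f (?g t) * (?B - A)) has_integral (32 * of_real c * \<nu> (?g 1) - 32 * of_real c * \<nu> (?g 0))) {0..1}"
  \<comment> \<open>for \<open>\<alpha> = 2\<close> the segment is a point\<close>
  proof (cases "x = 1 / x")
    case True
    then have "?B = A" using x(1) B by simp
    moreover have "?g 1 = ?g 0" using calculation by (simp add: linepath_def)
    ultimately show ?thesis by simp
  next
    case False
    define y where "y = (\<lambda>t. \<nu> (?g t))"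
    define R where "R = (\<lambda>t. poly (a1 \<alpha>) (?g t) / ?g t)"
    have gs: "?g t \<in> closed_segment A ?B" if "t \<in> {0..1}" for t
      using that by (metis image_eqI linepath_image_01)
    have conty: "continuous_on {0..1} y" unfolding y_def
      by (rule continuous_on_compose2[of "closed_segment A ?B" \<nu>]) (use H gs in \<open>auto intro: continuous_on_linepath\<close>)
    have sq: "(y t)\<^sup>2 = R t" if "t \<in> {0..1}" for t using H gs[OF that] by (simp add: y_def R_def)
    have inner: "poly (a1 \<alpha>) (?g t) \<noteq> 0 \<and> ?g t \<noteq> 0" if t: "t \<in> {0<..<1}" for t
    proof -
      have xx: "x = - ?P \<and> 1 / x = - (1 / ?P) \<or> x = - (1 / ?P) \<and> 1 / x = - ?P" using x(2) P by auto
      have "\<gamma> t \<noteq> x" "\<gamma> t \<noteq> 1 / x"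
      proof -
        have "\<gamma> t - x = t * (1 / x - x)" "\<gamma> t - 1 / x = (1 - t) * (x - 1 / x)" by (simp_all add: \<gamma>_def algebra_simps diff_divide_distrib)
        moreover have "1 / x - x \<noteq> 0" "x - 1 / x \<noteq> 0" "t \<noteq> 0" "1 - t \<noteq> 0" using False t by simp_all
        ultimately have "\<gamma> t - x \<noteq> 0" "\<gamma> t - 1 / x \<noteq> 0" by (simp_all only: mult_eq_0_iff not_False_eq_True simp_thms)
        then show "\<gamma> t \<noteq> x" "\<gamma> t \<noteq> 1 / x" by (simp_all only: right_minus_eq not_False_eq_True)
      qed
      moreover have "(1 - t) * x < 0" "t * (1 / x) < 0" using t x0 by (auto simp: mult_pos_neg divide_pos_neg)
      then have "\<gamma> t < 0" by (simp add: \<gamma>_def)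
      ultimately show ?thesis unfolding poly_a1_eq_0[OF al] g of_real_eq_iff using xx by auto
    qed
    have D: "((\<lambda>t. 32 * of_real c * y t) has_vector_derivative f (?g t) * (?B - A)) (at t)" if t: "t \<in> {0<..<1}" for t
    proof -
      define l where "l = ?g t"
      have l: "poly (a1 \<alpha>) l \<noteq> 0" "l \<noteq> 0" using inner[OF t] by (auto simp: l_def)
      define d where "d = (poly (pderiv (a1 \<alpha>)) l * l - poly (a1 \<alpha>) l) / (l * l)"
      have "((\<lambda>l. poly (a1 \<alpha>) l / l) has_field_derivative d) (at l)"
        unfolding d_def using l by (auto intro!: derivative_eq_intros)
      moreover have "(?g has_vector_derivative (?B - A)) (at t)" by (rule has_vector_derivative_linepath_within)
      ultimately have "(R has_vector_derivative (?B - A) * d) (at t)"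
        using field_vector_diff_chain_at[of ?g "?B - A" t "\<lambda>l. poly (a1 \<alpha>) l / l" d]
        by (simp add: R_def o_def l_def)
      moreover have "R t \<noteq> 0" using l by (simp add: R_def l_def)
      ultimately have "(y has_vector_derivative (?B - A) * d / (2 * y t)) (at t)"
        using sqrt_path_derivative[OF t conty sq] by blast
      then have "((\<lambda>t. 32 * of_real c * y t) has_vector_derivative 32 * of_real c * ((?B - A) * d / (2 * y t))) (at t)"
        by (rule has_vector_derivative_mult_right)
      moreover have "32 * of_real c * ((?B - A) * d / (2 * y t)) = f (?g t) * (?B - A)"
      proof -
        have "y t \<noteq> 0" using sq[of t] \<open>R t \<noteq> 0\<close> t by auto
        moreover have pb: "poly (b1 c) l = 16 * of_real c * (poly (pderiv (a1 \<alpha>)) l * l - poly (a1 \<alpha>) l)"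
          by (simp add: a1_def b1_def pderiv_pCons algebra_simps)
        moreover have "32 * C * (D * (X / (l * l)) / (2 * u)) = 16 * C * X / (u * l\<^sup>2) * D" if "u \<noteq> 0" for C D X u
          using that l by (simp add: field_simps power2_eq_square)
        ultimately show ?thesis unfolding f_def d_def l_def[symmetric] y_def pb by blast
      qed
      ultimately show ?thesis by simp
    qed
    have "((\<lambda>t. f (?g t) * (?B - A)) has_integral (32 * of_real c * y 1 - 32 * of_real c * y 0)) {0..1}"
      by (rule fundamental_theorem_of_calculus_interior) (use D conty in \<open>auto intro!: continuous_intros\<close>)
    then show ?thesis by (simp add: y_def)
  qed
  moreover have "\<nu> (?g 1) = 0" "\<nu> (?g 0) = 0"
  proof -
    have "(\<nu> l)\<^sup>2 = 0" if "l = A \<or> l = ?B" for l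
    proof -
      have "l \<in> closed_segment A ?B" "poly (a1 \<alpha>) l = 0" using that H rootB by auto
      then show ?thesis using H by (metis div_0)
    qed
    then have "\<nu> A = 0" "\<nu> ?B = 0" by (metis zero_eq_power2)+
    then show "\<nu> (?g 1) = 0" "\<nu> (?g 0) = 0" by (simp_all only: linepath_1' linepath_0')
  qed
  ultimately have "(f has_contour_integral 0) (linepath A ?B)"
    by (simp add: has_contour_integral_linepath)
  then show "\<exists>I. ((\<lambda>l. poly (b1 c) l / (\<nu> l * l\<^sup>2)) has_contour_integral I) (linepath A ?B) \<and> Re I = 0"
    unfolding f_def by (intro exI[of _ 0]) simp
qed

lemma genus1_spectral_data:
  assumes H: "0 \<le> H" and al: "2 \<le> \<alpha>" and c: "c\<^sup>2 = (coef H \<alpha>)\<^sup>2"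
  shows "(a1 \<alpha>, b1 c, sym1 H, cnj (sym1 H)) \<in> spectral_data 1"
proof -
  interpret polynomial_h "a1 \<alpha>" "b1 c" "W1 \<alpha>" "{s. s \<noteq> 0 \<and> s\<^sup>2 \<notin> segments (a1 \<alpha>)}" "[:32 * of_real c:]"
    by (rule genus1_locale[OF al])
  have c0: "c \<noteq> 0" using c coef_pos[OF H al] by auto
  have ci: "cnj (sym1 H) = 1 / sym1 H" by (rule cnj_inverse[OF sym1_norm])
  have "reality_condition 1 (a1 \<alpha>) (b1 c)"
    unfolding reality_condition_def
  proof (intro conjI allI impI ballI)
    fix l :: complex assume "l \<noteq> 0"
    then show "l ^ (2 * 1) * cnj (poly (a1 \<alpha>) (1 / cnj l)) = poly (a1 \<alpha>) l"
      "l ^ (1 + 1) * cnj (poly (b1 c) (1 / cnj l)) = - poly (b1 c) l"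
      by (simp_all add: a1_def b1_def field_simps power2_eq_square)
  next
    fix l :: complex assume "l \<in> sphere 0 1"
    then have n: "norm l = 1" by simp
    then have "poly (a1 \<alpha>) l / l ^ 1 = - (of_real \<alpha> + (l + 1 / l)) / 16"
      by (cases "l = 0") (auto simp: a1_def field_simps)
    also have "\<dots> = of_real (- (\<alpha> + 2 * Re l) / 16)"
      unfolding cnj_inverse[OF n, symmetric] by (simp add: complex_eq_iff)
    finally have "poly (a1 \<alpha>) l / l ^ 1 = of_real (- (\<alpha> + 2 * Re l) / 16)" .
    moreover have "-1 \<le> Re l" using abs_Re_le_cmod[of l] n by auto
    then have "- (\<alpha> + 2 * Re l) / 16 \<le> 0" using al by simp
    ultimately show "poly (a1 \<alpha>) l / l ^ 1 \<in> \<real>\<^sub>\<le>\<^sub>0" by (simp only: nonpos_Reals_of_real_iff)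
  qed
  moreover have "mu_condition (a1 \<alpha>) (b1 c) (sym1 H) (cnj (sym1 H))"
  proof (rule mu_condition_product)
    have "64 * c\<^sup>2 * (\<alpha> + 2 * Re (sym1 H)) = pi\<^sup>2"
      unfolding c coef_sq[OF H al] using sym1_Re[OF H] al by simp
    then show "hsq (sym1 H) = - of_real (pi\<^sup>2)" "hsq (cnj (sym1 H)) = - of_real (pi\<^sup>2)"
      using genus1_hsq[OF al, of "sym1 H" c] genus1_hsq[OF al, of "cnj (sym1 H)" c] sym1_norm[of H]
      by (simp_all only: complex_mod_cnj cnj.simps)
  qed
  moreover have "sym1 H \<noteq> cnj (sym1 H)" using sym1_Im[of H] by (simp add: complex_eq_iff)
  moreover have "degree (a1 \<alpha>) = 2" "degree (b1 c) = 2" "norm (poly (a1 \<alpha>) 0) = 1 / 16"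
    using c0 by (auto simp: a1_def b1_def norm_divide)
  ultimately show ?thesis
    using sym1_norm[of H] sym1_Im[of H] h_condition_product genus1_period_condition[OF al, of c]
    unfolding spectral_data_def ci by (simp add: norm_divide)
qed

section \<open>Parameterisation of the families\<close>

lemma continuous_on_sym1 [continuous_intros]:
  "continuous_on T f \<Longrightarrow> continuous_on T (\<lambda>x. sym1 (f x))"
  unfolding sym1_def Complex_eq using sqrt_pos[THEN less_imp_neq]
  by (intro continuous_intros) (auto simp: add_nonneg_eq_0_iff)

lemma continuous_on_coef:
  assumes "continuous_on T f" "continuous_on T g" "\<And>x. x \<in> T \<Longrightarrow> 0 \<le> f x \<and> 2 \<le> g x"
  shows "continuous_on T (\<lambda>x. coef (f x) (g x))"
  unfolding coef_def
proof (intro continuous_intros assms(1,2) ballI)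
  fix x assume "x \<in> T"
  then show "8 * sqrt (g x + 2 * Re (sym1 (f x))) \<noteq> 0" using assms(3) sym1_Re[of "f x"] by force
qed

lemma coords_minus: "coords_mod_sign (a, - b, l1, l2) = coords_mod_sign (a, b, l1, l2)"
  by (simp add: coords_mod_sign_def)

text \<open>Adding the quadruples with the opposite sign of \<open>b\<close> does not change the image under
  \<^const>\<open>coords_mod_sign\<close>, so a continuous left inverse on the image of \<open>\<Phi>\<close> is enough.\<close>

lemma parameterised_by_sign_closure:
  fixes \<Phi> :: "'p::topological_space \<Rightarrow> spectral_quadruple"
  assumes cont: "continuous_on D (coords_mod_sign \<circ> \<Phi>)"
    and inv: "continuous_on (coords_mod_sign ` \<Phi> ` D) \<Psi>" "\<And>x. x \<in> D \<Longrightarrow> \<Psi> (coords_mod_sign (\<Phi> x)) = x"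
  shows "parameterised_by D \<Phi> (sign_closure (\<Phi> ` D))"
  unfolding parameterised_by_def
proof (intro conjI)
  show "\<Phi> ` D \<subseteq> sign_closure (\<Phi> ` D)" by (auto simp: sign_closure_def)
  show "\<forall>(a, b, l1, l2)\<in>sign_closure (\<Phi> ` D). (a, - b, l1, l2) \<in> sign_closure (\<Phi> ` D)"
    unfolding sign_closure_def by fastforce
  have img: "coords_mod_sign ` sign_closure (\<Phi> ` D) = coords_mod_sign ` \<Phi> ` D"
  proof
    show "coords_mod_sign ` sign_closure (\<Phi> ` D) \<subseteq> coords_mod_sign ` \<Phi> ` D"
    proof
      fix y assume "y \<in> coords_mod_sign ` sign_closure (\<Phi> ` D)"
      then consider q where "q \<in> \<Phi> ` D" "y = coords_mod_sign q"
        | a b l1 l2 where "(a, b, l1, l2) \<in> \<Phi> ` D" "y = coords_mod_sign (a, - b, l1, l2)"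
        unfolding sign_closure_def by blast
      then show "y \<in> coords_mod_sign ` \<Phi> ` D" by cases (auto simp: coords_minus)
    qed
  qed (auto simp: sign_closure_def)
  have "homeomorphism D (coords_mod_sign ` \<Phi> ` D) (coords_mod_sign \<circ> \<Phi>) \<Psi>"
    using cont inv unfolding homeomorphism_def by (auto simp: image_comp[symmetric] image_image)
  then show "\<exists>\<Psi>. homeomorphism D (coords_mod_sign ` sign_closure (\<Phi> ` D)) (coords_mod_sign \<circ> \<Phi>) \<Psi>"
    unfolding img by blast
qed

lemma continuous_on_quadruple:
  assumes "\<And>i. continuous_on D (\<lambda>x. coeff (A x) i)" "\<And>i. continuous_on D (\<lambda>x. coeff (B x) i)"
    "continuous_on D l1" "continuous_on D l2"
  shows "continuous_on D (coords_mod_sign \<circ> (\<lambda>x. (A x, B x, l1 x, l2 x)))"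
proof -
  have e: "coords_mod_sign \<circ> (\<lambda>x. (A x, B x, l1 x, l2 x)) =
    (\<lambda>x. (coeff (A x), (\<lambda>(i, j). coeff (B x) i * coeff (B x) j), l1 x, l2 x))"
    by (auto simp: coords_mod_sign_def)
  have "continuous_on D (\<lambda>x. (case p of (i, j) \<Rightarrow> coeff (B x) i * coeff (B x) j))" for p
    by (cases p) (auto intro!: continuous_intros assms)
  then show ?thesis unfolding e
    by (intro continuous_on_Pair continuous_on_coordinatewise_then_product assms)
qed

lemma continuous_on_coeff_pCons:
  assumes "continuous_on D f" "\<And>i. continuous_on D (\<lambda>x. coeff (P x) i)"
  shows "continuous_on D (\<lambda>x. coeff (pCons (f x) (P x)) i)"
  using assms by (cases i) auto

lemma ratio_continuous:
  assumes "\<And>q. q \<in> Q \<Longrightarrow> Im (fst (snd (snd q))) < 0"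
  shows "continuous_on Q (\<lambda>q :: (nat \<Rightarrow> complex) \<times> (nat \<times> nat \<Rightarrow> complex) \<times> complex \<times> complex.
     - Re (fst (snd (snd q))) / Im (fst (snd (snd q))))"
  using assms by (intro continuous_intros) force

lemma M0_parameterised: "parameterised_by {0..} Phi0 M0"
  unfolding M0_def
proof (rule parameterised_by_sign_closure)
  have cr: "continuous_on {0..} (\<lambda>H. coef H 2)"
    by (rule continuous_on_coef) (auto intro: continuous_intros)
  have "continuous_on {0..} (\<lambda>H. coeff (b0_poly (of_real (coef H 2))) i)" for i
    unfolding b0_poly_def complex_cnj_complex_of_real
    by (intro continuous_on_coeff_pCons continuous_intros cr)
  then show "continuous_on {0..} (coords_mod_sign \<circ> Phi0)"
    unfolding Phi0_def by (intro continuous_on_quadruple continuous_intros) auto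
  show "continuous_on (coords_mod_sign ` Phi0 ` {0..}) (\<lambda>q. - Re (fst (snd (snd q))) / Im (fst (snd (snd q))))"
    by (rule ratio_continuous) (auto simp: coords_mod_sign_def Phi0_def sym1_Im)
  show "- Re (fst (snd (snd (coords_mod_sign (Phi0 H))))) / Im (fst (snd (snd (coords_mod_sign (Phi0 H))))) = H" for H
    using sym1_ratio[of H] by (simp add: coords_mod_sign_def Phi0_def)
qed

lemma M1_parameterised: "parameterised_by ({0..} \<times> {2..}) Phi1 M1"
  unfolding M1_def
proof (rule parameterised_by_sign_closure)
  let ?D = "{0..} \<times> {2..} :: (real \<times> real) set"
  have cr: "continuous_on ?D (\<lambda>x. coef (fst x) (snd x))"
    by (rule continuous_on_coef) (auto intro: continuous_intros)
  have "continuous_on ?D (\<lambda>x. coeff (b1 (coef (fst x) (snd x))) i)" for i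
    unfolding b1_def by (intro continuous_on_coeff_pCons continuous_intros cr)
  moreover have "continuous_on ?D (\<lambda>x. coeff (a1 (snd x)) i)" for i
    unfolding a1_def by (intro continuous_on_coeff_pCons continuous_intros) auto
  ultimately show "continuous_on ?D (coords_mod_sign \<circ> Phi1)"
    unfolding Phi1_def case_prod_unfold by (intro continuous_on_quadruple continuous_intros)
  \<comment> \<open>\<open>\<alpha>\<close> is recovered from the coefficient \<open>- \<alpha> / 16\<close> of \<open>a1 \<alpha>\<close>\<close>
  let ?\<Psi> = "(\<lambda>q. (- Re (fst (snd (snd q))) / Im (fst (snd (snd q))), - 16 * Re (fst q 1)))
     :: (nat \<Rightarrow> complex) \<times> (nat \<times> nat \<Rightarrow> complex) \<times> complex \<times> complex \<Rightarrow> real \<times> real"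
  show "continuous_on (coords_mod_sign ` Phi1 ` ?D) ?\<Psi>"
  proof (intro continuous_on_Pair continuous_on_mult continuous_on_const continuous_on_Re)
    show "continuous_on (coords_mod_sign ` Phi1 ` ?D) (\<lambda>q. - Re (fst (snd (snd q))) / Im (fst (snd (snd q))))"
      by (rule ratio_continuous) (auto simp: coords_mod_sign_def Phi1_def sym1_Im)
    have "continuous_on UNIV (\<lambda>q :: (nat \<Rightarrow> complex) \<times> (nat \<times> nat \<Rightarrow> complex) \<times> complex \<times> complex. fst q 1)"
      by (rule continuous_on_compose2[OF continuous_on_product_coordinates]) (auto intro: continuous_intros)
    then show "continuous_on (coords_mod_sign ` Phi1 ` ?D) (\<lambda>q. fst q 1)" using continuous_on_subset by blast
  qed
  show "?\<Psi> (coords_mod_sign (Phi1 x)) = x" for x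
    using sym1_ratio[of "fst x"] by (cases x) (simp add: coords_mod_sign_def Phi1_def a1_def)
qed

lemma M0_cases:
  assumes "q \<in> M0"
  obtains H c where "0 \<le> H" "c\<^sup>2 = (coef H 2)\<^sup>2" "q = (a0, b0_poly (of_real c), sym1 H, cnj (sym1 H))"
proof -
  consider H where "0 \<le> H" "q = Phi0 H" | H where "0 \<le> H" "q = (a0, - b0_poly (of_real (coef H 2)), sym1 H, cnj (sym1 H))"
    using assms unfolding M0_def sign_closure_def Phi0_def by auto
  then show ?thesis
  proof cases
    case 1 then show ?thesis using that[of H "coef H 2"] by (simp add: Phi0_def)
  next
    case 2
    moreover have "- b0_poly (of_real (coef H 2)) = b0_poly (of_real (- coef H 2))" by (simp add: b0_poly_def)
    ultimately show ?thesis using that[of H "- coef H 2"] by simp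
  qed
qed

lemma M0_I:
  assumes "0 \<le> H" "c\<^sup>2 = (coef H 2)\<^sup>2"
  shows "(a0, b0_poly (of_real c), sym1 H, cnj (sym1 H)) \<in> M0"
proof -
  consider "c = coef H 2" | "c = - coef H 2" using assms(2) power2_eq_iff by blast
  then show ?thesis
  proof cases
    case 1 then show ?thesis using assms(1) by (auto simp: M0_def sign_closure_def Phi0_def)
  next
    case 2
    then have "b0_poly (of_real c) = - b0_poly (of_real (coef H 2))" by (simp add: b0_poly_def)
    moreover have "(a0, b0_poly (of_real (coef H 2)), sym1 H, cnj (sym1 H)) \<in> Phi0 ` {0..}" using assms(1) by (auto simp: Phi0_def)
    ultimately show ?thesis unfolding M0_def sign_closure_def by blast
  qed
qed

lemma M1_cases:
  assumes "q \<in> M1"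
  obtains H \<alpha> c where "0 \<le> H" "2 \<le> \<alpha>" "c\<^sup>2 = (coef H \<alpha>)\<^sup>2" "q = (a1 \<alpha>, b1 c, sym1 H, cnj (sym1 H))"
proof -
  consider H \<alpha> where "0 \<le> H" "2 \<le> \<alpha>" "q = Phi1 (H, \<alpha>)"
    | H \<alpha> where "0 \<le> H" "2 \<le> \<alpha>" "q = (a1 \<alpha>, - b1 (coef H \<alpha>), sym1 H, cnj (sym1 H))"
    using assms unfolding M1_def sign_closure_def Phi1_def by auto
  then show ?thesis
  proof cases
    case 1 then show ?thesis using that[of H \<alpha> "coef H \<alpha>"] by (simp add: Phi1_def)
  next
    case 2
    moreover have "- b1 (coef H \<alpha>) = b1 (- coef H \<alpha>)" by (simp add: b1_def)
    ultimately show ?thesis using that[of H \<alpha> "- coef H \<alpha>"] by simp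
  qed
qed

lemma sym_H: "sym_mean_curvature (a, b, sym1 H, cnj (sym1 H)) = H"
  using mean_curvature_of_sym_points[OF sym1_Im] sym1_ratio by simp

lemma M0_plus: "M0 \<subseteq> spectral_data_plus 0"
proof
  fix q assume "q \<in> M0"
  then obtain H c where "0 \<le> H" "c\<^sup>2 = (coef H 2)\<^sup>2" "q = (a0, b0_poly (of_real c), sym1 H, cnj (sym1 H))" by (rule M0_cases)
  then show "q \<in> spectral_data_plus 0"
    using genus0_spectral_data by (simp add: spectral_data_plus_def sym_H)
qed

lemma M1_plus: "M1 \<subseteq> spectral_data_plus 1"
proof
  fix q assume "q \<in> M1"
  then obtain H \<alpha> c where "0 \<le> H" "2 \<le> \<alpha>" "c\<^sup>2 = (coef H \<alpha>)\<^sup>2" "q = (a1 \<alpha>, b1 c, sym1 H, cnj (sym1 H))" by (rule M1_cases)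
  then show "q \<in> spectral_data_plus 1"
    using genus1_spectral_data by (simp add: spectral_data_plus_def sym_H)
qed

lemma Phi1_at_2: "Phi1 (H, 2) = add_double_point (Phi0 H)"
  by (simp add: Phi1_def Phi0_def add_double_point_def a0_def a1_def b0_poly_def b1_def power2_eq_square)

lemma add_double_point_M0: "add_double_point ` M0 \<subseteq> M1"
proof
  fix q assume "q \<in> add_double_point ` M0"
  then obtain q0 where q0: "q0 \<in> M0" "q = add_double_point q0" by blast
  then consider H where "0 \<le> H" "q0 = Phi0 H" | H where "0 \<le> H" "q0 = (a0, - b0_poly (of_real (coef H 2)), sym1 H, cnj (sym1 H))"
    unfolding M0_def sign_closure_def Phi0_def by auto
  then show "q \<in> M1"
  proof cases
    case 1
    then show ?thesis using q0 Phi1_at_2[of H, symmetric] by (auto simp: M1_def sign_closure_def)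
  next
    case 2
    then have "q = (a1 2, - b1 (coef H 2), sym1 H, cnj (sym1 H))"
      using q0 Phi1_at_2[of H] by (simp add: add_double_point_def Phi0_def Phi1_def)
    moreover have "(a1 2, b1 (coef H 2), sym1 H, cnj (sym1 H)) \<in> Phi1 ` ({0..} \<times> {2..})"
      using 2 by (auto simp: Phi1_def intro!: image_eqI[of _ _ "(H, 2)"])
    ultimately show ?thesis unfolding M1_def sign_closure_def by blast
  qed
qed

section \<open>Classification in spectral genus zero\<close>

lemma genus0_polynomials:
  assumes "(a, b, l1, l2) \<in> spectral_data 0"
  shows "a = a0" "\<exists>\<beta>. b = b0_poly \<beta>"
proof -
  have d: "degree a = 0" "degree b = 1" "reality_condition 0 a b" "norm (poly a 0) = 1 / 16"
    using assms by (auto simp: spectral_data_def)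
  obtain x where x: "a = [:x:]" using d(1) degree_eq_zeroE by blast
  have "poly a 1 / 1 ^ 0 \<in> \<real>\<^sub>\<le>\<^sub>0" using d(3) unfolding reality_condition_def by force
  then have "x \<in> \<real>\<^sub>\<le>\<^sub>0" by (simp add: x)
  then have "Re x \<le> 0" "Im x = 0" by (auto simp: complex_nonpos_Reals_iff)
  moreover have "norm x = 1 / 16" using d(4) by (simp add: x)
  ultimately have "x = - 1 / 16" by (simp add: complex_eq_iff cmod_def)
  then show "a = a0" by (simp add: x a0_def)
  define y z where "y = coeff b 0" and "z = coeff b 1"
  have b: "b = [:y, z:]"
  proof (rule poly_eqI)
    fix n show "coeff b n = coeff [:y, z:] n"
      using coeff_eq_0[of b n] d(2) by (cases n; cases "n - 1") (auto simp: y_def z_def coeff_pCons split: nat.splits)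
  qed
  have r: "l * cnj (poly b (1 / cnj l)) = - poly b l" if "l \<noteq> 0" for l
    using d(3) that unfolding reality_condition_def by simp
  have "z = - cnj y"
    using r[of 1] r[of "-1"] unfolding b by (auto simp: complex_eq_iff)
  then show "\<exists>\<beta>. b = b0_poly \<beta>" using b by (auto simp: b0_poly_def)
qed

text \<open>Near \<open>l = 0\<close> the function \<open>h\<close> differs from \<open>32 * \<beta> * \<nu>\<close> by a bounded function, and \<open>\<nu>\<close> is
  unbounded.\<close>

lemma genus0_period:
  assumes "is_period a0 (b0_poly \<beta>) \<tau>"
  shows "\<tau> = 32 * \<beta>"
proof (rule ccontr)
  assume ne: "\<tau> \<noteq> 32 * \<beta>"
  obtain h \<epsilon> where h: "is_h a0 (b0_poly \<beta>) h" "\<epsilon> > 0"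
    "bounded ((\<lambda>(l, \<nu>). h (l, \<nu>) - \<tau> * \<nu>) ` {(l, \<nu>) \<in> cut_curve a0. norm l < \<epsilon>})"
    using assms unfolding is_period_def by blast
  then obtain M where M: "\<And>l \<nu>. (l, \<nu>) \<in> cut_curve a0 \<Longrightarrow> norm l < \<epsilon> \<Longrightarrow> norm (h (l, \<nu>) - \<tau> * \<nu>) \<le> M"
    unfolding bounded_iff by fastforce
  define C where "C = norm (32 * \<beta> - \<tau>)"
  have C: "C > 0" using ne by (simp add: C_def)
  \<comment> \<open>at the point with \<open>l = s\<^sup>2\<close>, \<open>\<nu> = \<i> / (4 * s)\<close> for small positive \<open>s\<close>\<close>
  define s where "s = min (min 1 (\<epsilon> / 2)) (C / (4 * (\<bar>M\<bar> + 32 * norm \<beta> + 1)))"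
  have s: "0 < s" "s \<le> 1" "s \<le> \<epsilon> / 2" "s \<le> C / (4 * (\<bar>M\<bar> + 32 * norm \<beta> + 1))"
  proof -
    have "s \<le> min 1 (\<epsilon> / 2)" unfolding s_def by (rule min.cobounded1)
    then show "s \<le> 1" "s \<le> \<epsilon> / 2" by simp_all
    show "s \<le> C / (4 * (\<bar>M\<bar> + 32 * norm \<beta> + 1))" unfolding s_def by (rule min.cobounded2)
    have "0 < \<bar>M\<bar> + 32 * norm \<beta> + 1" by (intro add_nonneg_pos) auto
    then show "0 < s" using h(2) C by (simp add: s_def)
  qed
  let ?l = "complex_of_real (s\<^sup>2)" and ?n = "\<i> / (4 * complex_of_real s)"
  have cc: "(?l, ?n) \<in> cut_curve a0"
    using s(1) unfolding cut_curve_def segments_a0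
    by (simp add: spectral_curve_def a0_def power_divide power_mult_distrib)
  have "norm ?l = s * s" by (simp add: norm_mult power2_eq_square)
  also have "\<dots> \<le> s * 1" using s by (intro mult_left_mono) auto
  finally have nl: "norm ?l \<le> s" by simp
  then have "norm (h (?l, ?n) - \<tau> * ?n) \<le> M" using M[OF cc] s h(2) by simp
  moreover have "h (?l, ?n) = ?n * (32 * \<beta> + 32 * cnj \<beta> * ?l)"
    using genus0.h_eq[OF h(1) cc] by (simp add: algebra_simps)
  then have "h (?l, ?n) - \<tau> * ?n = ?n * (32 * \<beta> - \<tau>) + ?n * (32 * cnj \<beta> * ?l)"
    by (simp add: algebra_simps)
  ultimately have 1: "norm (?n * (32 * \<beta> - \<tau>) + ?n * (32 * cnj \<beta> * ?l)) \<le> M" by simp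
  have nn: "norm ?n = 1 / (4 * s)" using s by (simp add: norm_divide norm_mult)
  have "norm (?n * (32 * \<beta> - \<tau>)) \<le> norm (?n * (32 * \<beta> - \<tau>) + ?n * (32 * cnj \<beta> * ?l)) + norm (?n * (32 * cnj \<beta> * ?l))"
    using norm_triangle_ineq4[of "?n * (32 * \<beta> - \<tau>) + ?n * (32 * cnj \<beta> * ?l)" "?n * (32 * cnj \<beta> * ?l)"]
    by (simp only: add_diff_cancel_right')
  also have "norm (?n * (32 * cnj \<beta> * ?l)) = 8 * norm \<beta> * s"
    using s(1) by (simp add: norm_mult nn norm_power power2_eq_square)
  also have "8 * norm \<beta> * s \<le> 32 * norm \<beta>" using s mult_left_mono[of s 4 "8 * norm \<beta>"] by simp
  finally have "norm (?n * (32 * \<beta> - \<tau>)) \<le> M + 32 * norm \<beta>" using 1 by linarith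
  then have "1 / (4 * s) * C \<le> M + 32 * norm \<beta>" unfolding norm_mult nn C_def[symmetric] .
  then have "C / (4 * s) \<le> M + 32 * norm \<beta>" by simp
  also have "\<dots> < \<bar>M\<bar> + 32 * norm \<beta> + 1" by linarith
  finally have "C < (\<bar>M\<bar> + 32 * norm \<beta> + 1) * (4 * s)" using s(1) by (simp add: pos_divide_less_eq)
  moreover have "s * (4 * (\<bar>M\<bar> + 32 * norm \<beta> + 1)) \<le> C"
    using s(4) by (subst (asm) pos_le_divide_eq) (auto intro!: add_nonneg_pos)
  ultimately show False by (simp add: algebra_simps)
qed

text \<open>In terms of half the angle between the real axis and the Sym points, \<open>32 * coef H 2\<close> is the length of the
  interval on the real axis that the torus map wraps once around a circle.\<close>

lemma sym1_cis:
  assumes "0 \<le> H"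
  obtains \<delta> where "0 < \<delta>" "\<delta> \<le> pi / 4" "sym1 H = cis (- (2 * \<delta>))" "cnj (sym1 H) = cis (2 * \<delta>)"
    "coef H 2 = pi / (16 * cos \<delta>)"
proof -
  define \<delta> where "\<delta> = arccos (Re (sym1 H)) / 2"
  have r: "0 \<le> Re (sym1 H)" "Re (sym1 H) < 1"
  proof -
    show "0 \<le> Re (sym1 H)" using sym1_Re[OF assms] .
    have "(Re (sym1 H))\<^sup>2 + (Im (sym1 H))\<^sup>2 = 1" using sym1_norm[of H] cmod_power2[of "sym1 H"] by simp
    moreover have "0 < (Im (sym1 H))\<^sup>2" using sym1_Im[of H] by simp
    ultimately have "(Re (sym1 H))\<^sup>2 < 1" by linarith
    then have "(Re (sym1 H))\<^sup>2 < 1\<^sup>2" by simp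
    then show "Re (sym1 H) < 1" by (rule power2_less_imp_less) simp
  qed
  have c: "cos (2 * \<delta>) = Re (sym1 H)" using r by (simp add: \<delta>_def)
  have s: "sin (2 * \<delta>) = - Im (sym1 H)"
  proof -
    have "(sin (2 * \<delta>))\<^sup>2 = (Im (sym1 H))\<^sup>2"
      using sin_cos_squared_add[of "2 * \<delta>"] sym1_norm[of H] cmod_power2[of "sym1 H"] by (simp add: c)
    moreover have "0 \<le> sin (2 * \<delta>)" using r arccos_lbound[of "Re (sym1 H)"] arccos_ubound[of "Re (sym1 H)"]
      by (intro sin_ge_zero) (auto simp: \<delta>_def)
    ultimately show ?thesis using sym1_Im[of H] by (auto simp: power2_eq_iff)
  qed
  have d: "0 < \<delta>" "\<delta> \<le> pi / 4"
    using r arccos_lt_bounded[of "Re (sym1 H)"] arccos_le_pi2[of "Re (sym1 H)"] by (auto simp: \<delta>_def)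
  show ?thesis
  proof (rule that[OF d])
    show "sym1 H = cis (- (2 * \<delta>))" "cnj (sym1 H) = cis (2 * \<delta>)" by (simp_all add: complex_eq_iff c s)
    have cp: "cos \<delta> > 0" using d by (intro cos_gt_zero) auto
    have e: "2 + 2 * Re (sym1 H) = (2 * cos \<delta>)\<^sup>2" unfolding c[symmetric] by (simp add: cos_double_cos power_mult_distrib)
    show "coef H 2 = pi / (16 * cos \<delta>)" unfolding coef_def e real_sqrt_abs using cp by simp
  qed
qed

text \<open>The filling makes \<open>2 * pi / cos \<delta>\<close> a multiple \<open>j * \<tau>\<close> of the period \<open>\<tau> = 32 * \<beta>\<close>. So \<open>\<beta>\<close> is real, and it is the
  coefficient of the family divided by \<open>j\<close>. In that case \<open>h\<close> takes the value \<open>\<plusminus> \<i> * \<pi> / j\<close> at the Sym points, which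
  is an integer multiple of \<open>\<i> * \<pi>\<close> only for \<open>j = 1\<close> and \<open>j = - 1\<close>.\<close>

lemma alexandrov_in_M0:
  assumes q: "q \<in> spectral_data_plus 0" and alex: "alexandrov_spectral_data 0 q"
  shows "q \<in> M0"
proof -
  obtain a b l1 l2 where q': "q = (a, b, l1, l2)" by (cases q)
  have sd: "(a, b, l1, l2) \<in> spectral_data 0" and Hq: "0 \<le> sym_mean_curvature (a, b, l1, l2)"
    using q by (auto simp: spectral_data_plus_def q')
  have l: "norm l1 = 1" "l2 = 1 / l1" "Im l1 < 0" "mu_condition a b l1 l2"
    using sd by (auto simp: spectral_data_def)
  have a: "a = a0" using genus0_polynomials[OF sd] by blast
  obtain \<beta> where b: "b = b0_poly \<beta>" using genus0_polynomials[OF sd] by blast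
  define H where "H = - Re l1 / Im l1"
  have l1: "l1 = sym1 H" unfolding H_def by (rule sym1_unique[OF l(1,3)])
  have l2: "l2 = cnj (sym1 H)" using cnj_inverse[OF l(1)] l(2) l1 by simp
  have H: "0 \<le> H" using Hq by (simp add: l1 l2 sym_H)
  obtain \<delta> where d: "0 < \<delta>" "\<delta> \<le> pi / 4" "sym1 H = cis (- (2 * \<delta>))" "cnj (sym1 H) = cis (2 * \<delta>)"
    "coef H 2 = pi / (16 * cos \<delta>)" using sym1_cis[OF H] by blast
  have cd: "cos \<delta> > 0" using d by (intro cos_gt_zero) auto
  obtain \<tau> \<xi> \<zeta> F where A: "is_period a b \<tau>" "\<xi> \<in> potentials 0"
     "\<And>l. l \<noteq> 0 \<Longrightarrow> det (eval_laurent 0 \<xi> l) = - (poly a l / l)"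
     "killing_field 0 \<xi> \<zeta>" "frame \<zeta> F" "mean_convex_alexandrov_embedded \<tau> (sym_immersion F l1 l2) (sym_normal F l1 l2)"
    using alex unfolding alexandrov_spectral_data_def q' by blast
  have zeta: "\<zeta> z = vacuum" for z
    by (rule killing_field_0[OF A(4,2)]) (use A(3) in \<open>simp add: a a0_def\<close>)
  have tor: "sym_immersion F l1 l2 = torus \<delta>" "sym_normal F l1 l2 = torus_normal \<delta>"
    using sym_vacuum[OF A(5) zeta] d(3,4) l1 l2 by auto
  obtain j :: int where j: "of_real (2 * pi / cos \<delta>) = of_int j * \<tau>"
    using alexandrov_torus_period[OF d(1,2)] A(6) unfolding tor by blast
  have tau: "\<tau> = 32 * \<beta>" using genus0_period A(1) a b by blast
  have "complex_of_real (2 * pi / cos \<delta>) \<noteq> 0" using cd by simp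
  then have j0: "j \<noteq> 0" using j by auto
  define r where "r = pi / (16 * cos \<delta> * of_int j)"
  have beta: "\<beta> = of_real r"
  proof -
    have "of_int j * (32 * \<beta>) = complex_of_real (2 * pi / cos \<delta>)" using j tau by simp
    also have "\<dots> = of_int j * (32 * of_real r)" using cd j0 by (simp add: r_def)
    finally show ?thesis using j0 by simp
  qed
  \<comment> \<open>the condition on \<open>\<mu>\<close> at the Sym points excludes multiple covers\<close>
  have "\<exists>k::int. genus0.hsq \<beta> l1 = - of_real ((pi * of_int k)\<^sup>2)"
    by (rule genus0.mu_condition_hsq[of _ _ l2]) (use l in \<open>auto simp: a[symmetric] b[symmetric]\<close>)
  then obtain k :: int where "genus0.hsq (of_real r) l1 = - of_real ((pi * of_int k)\<^sup>2)" unfolding beta by blast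
  then have "64 * r\<^sup>2 * (2 + 2 * Re (sym1 H)) = (pi * of_int k)\<^sup>2"
    unfolding genus0_hsq[OF l(1)] neg_equal_iff_equal of_real_eq_iff unfolding l1 .
  moreover have rc: "r = coef H 2 / of_int j" by (simp add: r_def d(5))
  ultimately have "64 * (coef H 2)\<^sup>2 * (2 + 2 * Re (sym1 H)) = (pi * of_int k)\<^sup>2 * (of_int j)\<^sup>2"
    using j0 by (simp add: power_divide field_simps)
  then have "pi\<^sup>2 = (pi * of_int k)\<^sup>2 * (of_int j)\<^sup>2"
    unfolding coef_sq[OF H order_refl] using sym1_Re[OF H] by simp
  then have "(of_int (k * j))\<^sup>2 = (1::real)" by (simp add: power_mult_distrib)
  then have "(k * j)\<^sup>2 = 1" by (metis of_int_1 of_int_eq_iff of_int_power)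
  then have "j = 1 \<or> j = -1" by (auto simp: power2_eq_1_iff zmult_eq_1_iff zmult_eq_neg1_iff)
  then have "r\<^sup>2 = (coef H 2)\<^sup>2" using rc by auto
  then show ?thesis unfolding q' a b beta l1 l2 by (intro M0_I H)
qed

section \<open>Smooth functions\<close>

lemma Ck_on_cong:
  assumes "open U" "\<And>x. x \<in> U \<Longrightarrow> f x = g x"
  shows "Ck_on k f U \<longleftrightarrow> Ck_on k g U"
  using assms(2)
proof (induction k arbitrary: f g)
  case 0
  then show ?case by (auto cong: continuous_on_cong)
next
  case (Suc k)
  have der: "(f has_derivative D) (at x) \<longleftrightarrow> (g has_derivative D) (at x)" if "x \<in> U" for x D
    using has_derivative_transform_within_open[OF _ assms(1) that] Suc.prems by metis
  then have "f differentiable (at x) \<longleftrightarrow> g differentiable (at x)" if "x \<in> U" for x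
    using that by (simp add: differentiable_def)
  moreover have fd: "frechet_derivative f (at x) = frechet_derivative g (at x)" if "x \<in> U" for x
    using der[OF that] by (simp add: frechet_derivative_def)
  then have "Ck_on k (\<lambda>x. frechet_derivative f (at x) v) U \<longleftrightarrow> Ck_on k (\<lambda>x. frechet_derivative g (at x) v) U" for v
    by (intro Suc.IH) simp
  ultimately show ?case by simp
qed

lemma Ck_on_SucI:
  assumes "open U" "\<And>x. x \<in> U \<Longrightarrow> (f has_derivative f' x) (at x)" "\<And>v. Ck_on k (\<lambda>x. f' x v) U"
  shows "Ck_on (Suc k) f U"
proof -
  have "frechet_derivative f (at x) = f' x" if "x \<in> U" for x
    using frechet_derivative_at[OF assms(2)[OF that]] by simp
  then have "Ck_on k (\<lambda>x. frechet_derivative f (at x) v) U" for v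
    using Ck_on_cong[OF assms(1), of "\<lambda>x. frechet_derivative f (at x) v" "\<lambda>x. f' x v" k] assms(3) by simp
  then show ?thesis using assms(2) by (auto simp: differentiable_def)
qed

lemma Ck_on_SucD:
  assumes "Ck_on (Suc k) f U"
  shows "\<And>x. x \<in> U \<Longrightarrow> (f has_derivative frechet_derivative f (at x)) (at x)"
    "\<And>v. Ck_on k (\<lambda>x. frechet_derivative f (at x) v) U"
  using assms frechet_derivative_works by auto

lemma Ck_on_mono_Suc: "Ck_on (Suc k) f U \<Longrightarrow> Ck_on k f U"
proof (induction k arbitrary: f)
  case 0
  then show ?case using differentiable_imp_continuous_within
    by (auto intro!: continuous_at_imp_continuous_on)
next
  case (Suc k)
  then show ?case by simp
qed

lemma Ck_on_continuous: "Ck_on k f U \<Longrightarrow> continuous_on U f"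
  by (induction k) (auto dest: Ck_on_mono_Suc simp del: Ck_on.simps(2))

lemma Ck_on_subset: "\<lbrakk>Ck_on k f U; V \<subseteq> U\<rbrakk> \<Longrightarrow> Ck_on k f V"
  by (induction k arbitrary: f) (auto intro: continuous_on_subset)

lemma Ck_on_const: "open U \<Longrightarrow> Ck_on k (\<lambda>x. c) U"
proof (induction k arbitrary: c)
  case (Suc k)
  show ?case by (rule Ck_on_SucI[where f' = "\<lambda>x v. 0"]) (use Suc in auto)
qed simp

lemma Ck_on_linear: "\<lbrakk>open U; bounded_linear f\<rbrakk> \<Longrightarrow> Ck_on k f U"
proof (cases k)
  case 0
  assume "bounded_linear f"
  then show ?thesis using 0 linear_continuous_on by auto
next
  case (Suc j)
  assume H: "open U" "bounded_linear f"
  show ?thesis unfolding Suc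
    by (rule Ck_on_SucI[where f' = "\<lambda>x. f"]) (use H in \<open>auto intro: Ck_on_const bounded_linear_imp_has_derivative\<close>)
qed

lemma Ck_on_add:
  assumes U: "open U"
  shows "\<lbrakk>Ck_on k f U; Ck_on k g U\<rbrakk> \<Longrightarrow> Ck_on k (\<lambda>x. f x + g x) U"
proof (induction k arbitrary: f g)
  case (Suc k)
  show ?case
  proof (rule Ck_on_SucI[OF U])
    show "((\<lambda>x. f x + g x) has_derivative (\<lambda>v. frechet_derivative f (at x) v + frechet_derivative g (at x) v)) (at x)" if "x \<in> U" for x
      using has_derivative_add Ck_on_SucD(1)[OF Suc.prems(1) that] Ck_on_SucD(1)[OF Suc.prems(2) that] by blast
    show "Ck_on k (\<lambda>x. frechet_derivative f (at x) v + frechet_derivative g (at x) v) U" for v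
      by (rule Suc.IH[OF Ck_on_SucD(2)[OF Suc.prems(1)] Ck_on_SucD(2)[OF Suc.prems(2)]])
  qed
qed (auto intro: continuous_on_add)

lemma Ck_on_bilinear:
  fixes B :: "'b::real_normed_vector \<Rightarrow> 'c::real_normed_vector \<Rightarrow> 'd::real_normed_vector"
  assumes B: "bounded_bilinear B" and U: "open U"
  shows "\<lbrakk>Ck_on k f U; Ck_on k g U\<rbrakk> \<Longrightarrow> Ck_on k (\<lambda>x. B (f x) (g x)) U"
proof (induction k arbitrary: f g)
  case 0
  then show ?case using bounded_bilinear.continuous_on[OF B] by auto
next
  case (Suc k)
  show ?case
  proof (rule Ck_on_SucI[OF U])
    show "((\<lambda>x. B (f x) (g x)) has_derivative (\<lambda>v. B (f x) (frechet_derivative g (at x) v) + B (frechet_derivative f (at x) v) (g x))) (at x)" if "x \<in> U" for x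
      using bounded_bilinear.FDERIV[OF B Ck_on_SucD(1)[OF Suc.prems(1) that] Ck_on_SucD(1)[OF Suc.prems(2) that]] .
    show "Ck_on k (\<lambda>x. B (f x) (frechet_derivative g (at x) v) + B (frechet_derivative f (at x) v) (g x)) U" for v
      by (intro Ck_on_add U Suc.IH Ck_on_SucD(2)[OF Suc.prems(1)] Ck_on_SucD(2)[OF Suc.prems(2)]
          Ck_on_mono_Suc[OF Suc.prems(1)] Ck_on_mono_Suc[OF Suc.prems(2)])
  qed
qed

lemma Ck_on_sum:
  assumes "open U" "\<And>i. i \<in> I \<Longrightarrow> Ck_on k (f i) U"
  shows "Ck_on k (\<lambda>x. \<Sum>i\<in>I. f i x) U"
  using assms(2) by (induction I rule: infinite_finite_induct) (auto intro: Ck_on_const Ck_on_add assms(1))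

text \<open>Over a basis the chain rule is a sum of products of the partial derivatives of the outer map, composed
  with the inner map, and the coordinates of the derivative of the inner map; the induction
  hypothesis covers both factors.\<close>

lemma Ck_on_compose:
  fixes f :: "'a::euclidean_space \<Rightarrow> 'b::euclidean_space" and g :: "'b \<Rightarrow> 'c::real_normed_vector"
  assumes U: "open U" and V: "open V"
  shows "\<lbrakk>Ck_on k f U; Ck_on k g V; f ` U \<subseteq> V\<rbrakk> \<Longrightarrow> Ck_on k (\<lambda>x. g (f x)) U"
proof (induction k arbitrary: f g)
  case 0
  then show ?case by (auto intro: continuous_on_compose2)
next
  case (Suc k)
  note f = Ck_on_SucD[OF Suc.prems(1)] and g = Ck_on_SucD[OF Suc.prems(2)]
  define D where "D = (\<lambda>x v. \<Sum>b\<in>Basis. (frechet_derivative f (at x) v \<bullet> b) *\<^sub>R frechet_derivative g (at (f x)) b)"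
  show ?case
  proof (rule Ck_on_SucI[OF U])
    fix x assume x: "x \<in> U"
    then have fx: "f x \<in> V" using Suc.prems(3) by blast
    have D: "((\<lambda>x. g (f x)) has_derivative (\<lambda>v. frechet_derivative g (at (f x)) (frechet_derivative f (at x) v))) (at x)"
      by (rule has_derivative_compose[OF f(1)[OF x] g(1)[OF fx]])
    have lin: "frechet_derivative g (at (f x)) w = (\<Sum>b\<in>Basis. (w \<bullet> b) *\<^sub>R frechet_derivative g (at (f x)) b)" for w
    proof -
      have "linear (frechet_derivative g (at (f x)))" using g(1)[OF fx] has_derivative_linear by blast
      moreover have "frechet_derivative g (at (f x)) w = frechet_derivative g (at (f x)) (\<Sum>b\<in>Basis. (w \<bullet> b) *\<^sub>R b)"
        by (simp only: euclidean_representation)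
      ultimately show ?thesis by (simp only: linear_sum linear_cmul)
    qed
    have "D x = (\<lambda>v. frechet_derivative g (at (f x)) (frechet_derivative f (at x) v))"
      unfolding D_def by (rule ext) (rule lin[symmetric])
    then show "((\<lambda>x. g (f x)) has_derivative D x) (at x)" using D by (simp only:)
  next
    fix v
    have gk: "Ck_on k (\<lambda>x. frechet_derivative g (at (f x)) b) U" for b
      by (rule Suc.IH[OF Ck_on_mono_Suc[OF Suc.prems(1)] g(2) Suc.prems(3)])
    have "Ck_on k (\<lambda>x. frechet_derivative f (at x) v \<bullet> b) U" for b
      by (rule Ck_on_bilinear[OF bounded_bilinear_inner U f(2) Ck_on_const[OF U]])
    then show "Ck_on k (\<lambda>x. D x v) U" unfolding D_def
      by (intro Ck_on_sum U Ck_on_bilinear[OF bounded_bilinear_scaleR U] gk)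
  qed
qed

definition smooth :: "'a::euclidean_space set \<Rightarrow> ('a \<Rightarrow> 'b::real_normed_vector) \<Rightarrow> bool" where
  "smooth U f \<longleftrightarrow> open U \<and> (\<forall>k. Ck_on k f U)"

lemma smooth_imp_smooth_on: "\<lbrakk>smooth U g; S \<subseteq> U; \<And>y. y \<in> S \<Longrightarrow> g y = f y\<rbrakk> \<Longrightarrow> smooth_on S f"
  unfolding smooth_on_def smooth_def by blast

lemma smooth_const: "open U \<Longrightarrow> smooth U (\<lambda>x. c)"
  by (simp add: smooth_def Ck_on_const)

lemma smooth_linear: "\<lbrakk>open U; bounded_linear f\<rbrakk> \<Longrightarrow> smooth U f"
  by (simp add: smooth_def Ck_on_linear)

lemma smooth_linear_compose:
  fixes f :: "'a::euclidean_space \<Rightarrow> 'b::euclidean_space"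
  shows "\<lbrakk>bounded_linear g; smooth U f\<rbrakk> \<Longrightarrow> smooth U (\<lambda>x. g (f x))"
  unfolding smooth_def using Ck_on_compose[of U UNIV _ f g] Ck_on_linear[of UNIV g] by auto

lemma smooth_bilinear: "\<lbrakk>bounded_bilinear B; smooth U f; smooth U g\<rbrakk> \<Longrightarrow> smooth U (\<lambda>x. B (f x) (g x))"
  by (simp add: smooth_def Ck_on_bilinear)

lemma smooth_add: "\<lbrakk>smooth U f; smooth U g\<rbrakk> \<Longrightarrow> smooth U (\<lambda>x. f x + g x)"
  by (simp add: smooth_def Ck_on_add)

lemma smooth_compose:
  fixes f :: "'a::euclidean_space \<Rightarrow> 'b::euclidean_space"
  shows "\<lbrakk>smooth V g; smooth U f; f ` U \<subseteq> V\<rbrakk> \<Longrightarrow> smooth U (\<lambda>x. g (f x))"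
  unfolding smooth_def using Ck_on_compose by blast

lemma smooth_subset: "\<lbrakk>smooth U f; open V; V \<subseteq> U\<rbrakk> \<Longrightarrow> smooth V f"
  unfolding smooth_def using Ck_on_subset by blast

lemma smooth_Pair:
  fixes f :: "'a::euclidean_space \<Rightarrow> 'b::euclidean_space" and g :: "'a \<Rightarrow> 'c::euclidean_space"
  assumes "smooth U f" "smooth U g"
  shows "smooth U (\<lambda>x. (f x, g x))"
proof -
  have bl: "bounded_linear (\<lambda>y::'b. (y, 0::'c))" "bounded_linear (\<lambda>y::'c. (0::'b, y))"
    by (intro bounded_linear_Pair bounded_linear_ident bounded_linear_zero)+
  then have "smooth U (\<lambda>x. (f x, 0) + (0, g x))"
    by (intro smooth_add smooth_linear_compose[OF bl(1) assms(1)] smooth_linear_compose[OF bl(2) assms(2)])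
  then show ?thesis by simp
qed

lemma smooth_has_derivative:
  "\<lbrakk>smooth U f; x \<in> U\<rbrakk> \<Longrightarrow> (f has_derivative frechet_derivative f (at x)) (at x)"
proof -
  assume f: "smooth U f" and x: "x \<in> U"
  have c: "Ck_on (Suc 0) f U" using f unfolding smooth_def by blast
  show "(f has_derivative frechet_derivative f (at x)) (at x)" by (rule Ck_on_SucD(1)[OF c x])
qed

lemma smooth_continuous: "smooth U f \<Longrightarrow> continuous_on U f"
  unfolding smooth_def using Ck_on_continuous by blast

lemma left_inverse_derivative:
  assumes "smooth U f" "smooth V g" "x \<in> U" "f x \<in> V" "\<And>y. y \<in> U \<Longrightarrow> g (f y) = y"
  shows "frechet_derivative g (at (f x)) (frechet_derivative f (at x) v) = v"
proof -
  have "((\<lambda>y. g (f y)) has_derivative (\<lambda>v. frechet_derivative g (at (f x)) (frechet_derivative f (at x) v))) (at x)"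
    by (rule has_derivative_compose[OF smooth_has_derivative[OF assms(1,3)] smooth_has_derivative[OF assms(2,4)]])
  moreover have "((\<lambda>y. g (f y)) has_derivative (\<lambda>v. v)) (at x)"
    by (rule has_derivative_transform_within_open[OF has_derivative_ident _ assms(3)])
       (use assms in \<open>auto simp: smooth_def\<close>)
  ultimately show ?thesis using has_derivative_unique by (metis (no_types))
qed

text \<open>The derivative of each of the following three functions is a polynomial expression in the function
  itself, so differentiability of one order implies differentiability of the next.\<close>

lemma smooth_inverse: "smooth (- {0}) (inverse :: complex \<Rightarrow> complex)"
proof -
  have o: "open (- {0 :: complex})" by auto
  have "Ck_on k (inverse :: complex \<Rightarrow> complex) (- {0})" for k
  proof (induction k)
    case 0
    then show ?case by (auto intro!: continuous_intros)
  next
    case (Suc k)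
    show ?case
    proof (rule Ck_on_SucI[OF o])
      show "(inverse has_derivative (\<lambda>v. - (inverse x * v * inverse x))) (at x)" if "x \<in> - {0}" for x :: complex
        using has_derivative_inverse'[of x] that by simp
      have "Ck_on k (\<lambda>x. - v * (inverse x * inverse x)) (- {0})" for v :: complex
        by (intro Ck_on_bilinear[OF bounded_bilinear_mult o] Ck_on_const o Suc)
      then show "Ck_on k (\<lambda>x. - (inverse x * v * inverse x)) (- {0})" for v :: complex
        by (simp add: mult_ac)
    qed
  qed
  then show ?thesis using o by (simp add: smooth_def)
qed

lemma smooth_cis: "smooth UNIV cis"
proof -
  have "Ck_on k cis UNIV" for k
  proof (induction k)
    case 0
    then show ?case by (auto intro!: continuous_intros)
  next
    case (Suc k)
    show ?case
    proof (rule Ck_on_SucI[OF open_UNIV])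
      show "(cis has_derivative (\<lambda>v. (of_real v * \<i>) * cis x)) (at x)" for x
        using has_derivative_cis[OF has_derivative_ident, of x UNIV]
        by (simp add: scaleR_conv_of_real mult.assoc)
      show "Ck_on k (\<lambda>x. (of_real v * \<i>) * cis x) UNIV" for v
        by (intro Ck_on_bilinear[OF bounded_bilinear_mult open_UNIV] Ck_on_const open_UNIV Suc)
    qed
  qed
  then show ?thesis by (simp add: smooth_def)
qed

lemma smooth_inverse_sqrt: "smooth {0<..} (\<lambda>x::real. inverse (sqrt x))"
proof -
  have o: "open {0::real<..}" by auto
  have "Ck_on k (\<lambda>x::real. inverse (sqrt x)) {0<..}" for k
  proof (induction k)
    case 0
    then show ?case by (auto intro!: continuous_intros)
  next
    case (Suc k)
    let ?r = "\<lambda>x::real. inverse (sqrt x)"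
    show ?case
    proof (rule Ck_on_SucI[OF o])
      show "(?r has_derivative (\<lambda>v. (- v / 2) * (?r x * (?r x * ?r x)))) (at x)" if "x \<in> {0<..}" for x
      proof -
        have x: "x > 0" using that by simp
        have "(?r has_field_derivative - (1 / 2) * (?r x * (?r x * ?r x))) (at x)"
          using x by (auto intro!: derivative_eq_intros simp: field_simps)
        from this[unfolded has_field_derivative_def] show ?thesis
          by (rule has_derivative_eq_rhs) (simp add: fun_eq_iff)
      qed
      show "Ck_on k (\<lambda>x. (- v / 2) * (?r x * (?r x * ?r x))) {0<..}" for v
        by (intro Ck_on_bilinear[OF bounded_bilinear_mult o] Ck_on_const o Suc)
    qed
  qed
  then show ?thesis using o by (simp add: smooth_def)
qed

section \<open>Completeness of path metrics\<close>

lemma length_reversepath: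
  assumes "valid_path g" "((\<lambda>t. norm (vector_derivative g (at t))) has_integral L) {0..1}"
  shows "((\<lambda>t. norm (vector_derivative (reversepath g) (at t))) has_integral L) {0..1}"
proof -
  obtain S where S: "finite S" "g C1_differentiable_on {0..1} - S"
    using assms(1) by (auto simp: valid_path_def piecewise_C1_differentiable_on_def)
  have "((\<lambda>t. norm (vector_derivative g (at (1 - t)))) has_integral L) {0..1}"
    using has_integral_affinity01[where m = "-1" and c = 1, OF assms(2)] by simp
  then show ?thesis
  proof (rule has_integral_spike_finite[rotated 2])
    show "finite ((\<lambda>x. 1 - x) ` S)" using S by simp
    fix x assume x: "x \<in> {0..1} - (\<lambda>x. 1 - x) ` S"
    then have "1 - x \<in> {0..1} - S" by (auto simp: image_iff)
    moreover obtain D0 where "\<forall>x\<in>{0..1} - S. (g has_vector_derivative D0 x) (at x)"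
      using S(2) unfolding C1_differentiable_on_def by blast
    ultimately obtain D where D: "(g has_vector_derivative D) (at (1 - x))" by blast
    have "((\<lambda>x. 1 - x) has_vector_derivative -1) (at x)" by (auto intro!: derivative_eq_intros)
    from vector_diff_chain_at[OF this D]
    have "(reversepath g has_vector_derivative - D) (at x)" by (simp add: o_def reversepath_def)
    then show "norm (vector_derivative (reversepath g) (at x)) = norm (vector_derivative g (at (1 - x)))"
      using D by (simp add: vector_derivative_at)
  qed
qed

lemma length_joinpaths:
  assumes "valid_path g1" "((\<lambda>t. norm (vector_derivative g1 (at t))) has_integral L1) {0..1}"
    and "valid_path g2" "((\<lambda>t. norm (vector_derivative g2 (at t))) has_integral L2) {0..1}"
  shows "((\<lambda>t. norm (vector_derivative (g1 +++ g2) (at t))) has_integral (L1 + L2)) {0..1}"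
proof -
  have D: "\<exists>S. finite S \<and> (\<forall>x\<in>{0..1} - S. (g has_vector_derivative vector_derivative g (at x)) (at x))"
    if "valid_path g" for g :: "real \<Rightarrow> 'a"
  proof -
    obtain S where "finite S" "g C1_differentiable_on {0..1} - S"
      using \<open>valid_path g\<close> by (auto simp: valid_path_def piecewise_C1_differentiable_on_def)
    then show ?thesis by (auto simp: C1_differentiable_on_eq vector_derivative_works)
  qed
  obtain S1 where S1: "finite S1" "\<forall>x\<in>{0..1} - S1. (g1 has_vector_derivative vector_derivative g1 (at x)) (at x)"
    using D[OF assms(1)] by blast
  obtain S2 where S2: "finite S2" "\<forall>x\<in>{0..1} - S2. (g2 has_vector_derivative vector_derivative g2 (at x)) (at x)"
    using D[OF assms(3)] by blast
  have i1: "((\<lambda>x. 2 * norm (vector_derivative g1 (at (2 * x)))) has_integral L1) {0..1/2}"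
    and i2: "((\<lambda>x. 2 * norm (vector_derivative g2 (at (2 * x - 1)))) has_integral L2) {1/2..1}"
    using has_integral_affinity01[OF assms(2), where m = 2 and c = 0, THEN has_integral_cmul[where c = 2]]
      has_integral_affinity01[OF assms(4), where m = 2 and c = "-1", THEN has_integral_cmul[where c = 2]]
    by (simp_all only: image_affinity_atLeastAtMost_div_diff) simp_all
  have "((\<lambda>t. norm (vector_derivative (g1 +++ g2) (at t))) has_integral L1) {0..1/2}"
  proof (rule has_integral_spike_finite[OF _ _ i1])
    show "finite (insert (1/2) ((*) 2 -` S1))"
      using S1 by (force intro: finite_vimageI[where h = "(*) 2"] inj_onI)
    fix x :: real assume x: "x \<in> {0..1/2} - insert (1/2) ((*) 2 -` S1)"
    then have "2 * x \<in> {0..1} - S1" by auto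
    then have d: "(g1 has_vector_derivative vector_derivative g1 (at (2 * x))) (at (2 * x))" using S1 by blast
    have "((*) 2 has_vector_derivative 2) (at x)" by (auto intro!: derivative_eq_intros)
    from vector_diff_chain_at[OF this d]
    have "((\<lambda>x. g1 (2 * x)) has_vector_derivative 2 *\<^sub>R vector_derivative g1 (at (2 * x))) (at x)" by (simp add: o_def)
    then have "((g1 +++ g2) has_vector_derivative 2 *\<^sub>R vector_derivative g1 (at (2 * x))) (at x)"
      by (rule has_vector_derivative_transform_within_open[of _ _ _ "{..<1/2}"]) (use x in \<open>auto simp: joinpaths_def\<close>)
    then show "norm (vector_derivative (g1 +++ g2) (at x)) = 2 * norm (vector_derivative g1 (at (2 * x)))"
      by (simp add: vector_derivative_at)
  qed
  moreover have "((\<lambda>t. norm (vector_derivative (g1 +++ g2) (at t))) has_integral L2) {1/2..1}"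
  proof (rule has_integral_spike_finite[OF _ _ i2])
    show "finite (insert (1/2) ((\<lambda>x. 2 * x - 1) -` S2))"
      using S2 by (force intro: finite_vimageI[where h = "\<lambda>x. 2 * x - 1"] inj_onI)
    fix x :: real assume x: "x \<in> {1/2..1} - insert (1/2) ((\<lambda>x. 2 * x - 1) -` S2)"
    then have "2 * x - 1 \<in> {0..1} - S2" by auto
    then have d: "(g2 has_vector_derivative vector_derivative g2 (at (2 * x - 1))) (at (2 * x - 1))" using S2 by blast
    have "((\<lambda>x. 2 * x - 1) has_vector_derivative 2) (at x)" by (auto intro!: derivative_eq_intros)
    from vector_diff_chain_at[OF this d]
    have "((\<lambda>x. g2 (2 * x - 1)) has_vector_derivative 2 *\<^sub>R vector_derivative g2 (at (2 * x - 1))) (at x)" by (simp add: o_def)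
    then have "((g1 +++ g2) has_vector_derivative 2 *\<^sub>R vector_derivative g2 (at (2 * x - 1))) (at x)"
      by (rule has_vector_derivative_transform_within_open[of _ _ _ "{1/2<..}"]) (use x in \<open>auto simp: joinpaths_def\<close>)
    then show "norm (vector_derivative (g1 +++ g2) (at x)) = 2 * norm (vector_derivative g2 (at (2 * x - 1)))"
      by (simp add: vector_derivative_at)
  qed
  ultimately show ?thesis by (simp add: has_integral_combine[where c = "1/2"])
qed

lemma path_lengths_valid_path:
  "L \<in> path_lengths (top_of_set N) e p q \<longleftrightarrow> (\<exists>\<gamma>. path \<gamma> \<and> path_image \<gamma> \<subseteq> N \<and> pathstart \<gamma> = p \<and> pathfinish \<gamma> = q \<and>
     valid_path (e \<circ> \<gamma>) \<and> ((\<lambda>t. norm (vector_derivative (e \<circ> \<gamma>) (at t))) has_integral L) {0..1})"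
  unfolding path_lengths_def valid_path_def pathin_canon_iff path_image_def pathstart_def pathfinish_def image_subset_iff_funcset
  by auto

lemma path_lengths_reverse:
  assumes "L \<in> path_lengths (top_of_set N) e p q"
  shows "L \<in> path_lengths (top_of_set N) e q p"
proof -
  obtain \<gamma> where g: "path \<gamma>" "path_image \<gamma> \<subseteq> N" "pathstart \<gamma> = p" "pathfinish \<gamma> = q"
     "valid_path (e \<circ> \<gamma>)" "((\<lambda>t. norm (vector_derivative (e \<circ> \<gamma>) (at t))) has_integral L) {0..1}"
    using assms unfolding path_lengths_valid_path by blast
  have c: "e \<circ> reversepath \<gamma> = reversepath (e \<circ> \<gamma>)" by (auto simp: reversepath_def)
  show ?thesis unfolding path_lengths_valid_path
    by (rule exI[of _ "reversepath \<gamma>"]) (use g length_reversepath[OF g(5,6)] in \<open>simp add: c\<close>)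
qed

lemma path_lengths_join:
  assumes "L1 \<in> path_lengths (top_of_set N) e p q" "L2 \<in> path_lengths (top_of_set N) e q r"
  shows "L1 + L2 \<in> path_lengths (top_of_set N) e p r"
proof -
  obtain \<gamma> where g: "path \<gamma>" "path_image \<gamma> \<subseteq> N" "pathstart \<gamma> = p" "pathfinish \<gamma> = q"
     "valid_path (e \<circ> \<gamma>)" "((\<lambda>t. norm (vector_derivative (e \<circ> \<gamma>) (at t))) has_integral L1) {0..1}"
    using assms(1) unfolding path_lengths_valid_path by blast
  obtain \<beta> where h: "path \<beta>" "path_image \<beta> \<subseteq> N" "pathstart \<beta> = q" "pathfinish \<beta> = r"
     "valid_path (e \<circ> \<beta>)" "((\<lambda>t. norm (vector_derivative (e \<circ> \<beta>) (at t))) has_integral L2) {0..1}"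
    using assms(2) unfolding path_lengths_valid_path by blast
  have c: "e \<circ> (\<gamma> +++ \<beta>) = (e \<circ> \<gamma>) +++ (e \<circ> \<beta>)" by (auto simp: joinpaths_def)
  have j: "pathfinish (e \<circ> \<gamma>) = pathstart (e \<circ> \<beta>)" using g h by (simp add: pathfinish_def pathstart_def)
  show ?thesis unfolding path_lengths_valid_path
    by (rule exI[of _ "\<gamma> +++ \<beta>"])
       (use g h j length_joinpaths[OF g(5,6) h(5,6)] valid_path_join[OF g(5) h(5) j] in \<open>simp add: c path_image_join\<close>)
qed

text \<open>The path is divided into pieces whose ends have distance at most \<open>r\<close>; the assumption compares each piece with
  its chord in the image, which is not longer than the piece of the image path.\<close>

lemma path_length_lower_bound:
  fixes e :: "'p::euclidean_space \<Rightarrow> complex \<times> complex"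
  assumes r: "r > 0" and C: "C \<ge> 0"
    and low: "\<And>p q. \<lbrakk>p \<in> N; q \<in> N; dist p q \<le> r\<rbrakk> \<Longrightarrow> dist p q \<le> C * norm (e p - e q)"
    and L: "L \<in> path_lengths (top_of_set N) e p q"
  shows "dist p q \<le> C * L"
proof -
  obtain \<gamma> where g: "path \<gamma>" "path_image \<gamma> \<subseteq> N" "pathstart \<gamma> = p" "pathfinish \<gamma> = q"
     "(e \<circ> \<gamma>) piecewise_C1_differentiable_on {0..1}" "((\<lambda>t. norm (vector_derivative (e \<circ> \<gamma>) (at t))) has_integral L) {0..1}"
    using L unfolding path_lengths_valid_path valid_path_def by blast
  let ?s = "\<lambda>t. norm (vector_derivative (e \<circ> \<gamma>) (at t))"
  have gN: "\<gamma> t \<in> N" if "t \<in> {0..1}" for t using g(2) that by (auto simp: path_image_def)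
  have "uniformly_continuous_on {0..1} \<gamma>" using g(1) compact_uniformly_continuous by (auto simp: path_def)
  then obtain d where d: "d > 0" "\<And>s t. \<lbrakk>s \<in> {0..1}; t \<in> {0..1}; dist s t < d\<rbrakk> \<Longrightarrow> dist (\<gamma> s) (\<gamma> t) < r"
    unfolding uniformly_continuous_on_def using r by metis
  obtain n :: nat where n: "n > 0" "1 / real n < d"
    using d(1) by (metis nat_approx_posE zero_less_Suc)
  have int: "?s integrable_on {a..b}" if "0 \<le> a" "b \<le> 1" for a b
    by (rule integrable_on_subinterval[of _ "{0..1}"]) (use g(6) that in auto)
  have "dist p (\<gamma> (real i / real n)) \<le> C * integral {0..real i / real n} ?s" if "i \<le> n" for i
    using that
  proof (induction i)
    case 0
    then show ?case using g(3) by (simp add: pathstart_def)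
  next
    case (Suc i)
    let ?a = "real i / real n" and ?b = "real (Suc i) / real n"
    have ab: "0 \<le> ?a" "?a \<le> ?b" "?b \<le> 1" "?b - ?a = 1 / real n" using Suc.prems n(1) by (auto simp: field_simps)
    then have "dist ?a ?b < d" using n(2) by (simp add: dist_real_def)
    then have near: "dist (\<gamma> ?a) (\<gamma> ?b) < r" using d(2)[of ?a ?b] ab by auto
    have "dist (\<gamma> ?a) (\<gamma> ?b) \<le> C * norm (e (\<gamma> ?a) - e (\<gamma> ?b))"
      by (rule low) (use near gN ab in auto)
    also have "norm (e (\<gamma> ?a) - e (\<gamma> ?b)) \<le> integral {?a..?b} ?s"
      using speed_bounds_chord[OF g(5,6) ab(1-3)] by (simp add: norm_minus_commute)
    finally have s: "dist (\<gamma> ?a) (\<gamma> ?b) \<le> C * integral {?a..?b} ?s" using C by (simp add: mult_left_mono)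
    have "dist p (\<gamma> ?b) \<le> dist p (\<gamma> ?a) + dist (\<gamma> ?a) (\<gamma> ?b)" by (rule dist_triangle)
    also have "\<dots> \<le> C * integral {0..?a} ?s + C * integral {?a..?b} ?s"
      by (rule add_mono[OF Suc.IH[OF Suc_leD[OF Suc.prems]] s])
    also have "\<dots> = C * integral {0..?b} ?s"
      using Henstock_Kurzweil_Integration.integral_combine[OF ab(1,2) int[OF order_refl ab(3)]] by (simp add: distrib_left[symmetric])
    finally show ?case .
  qed
  from this[of n] show ?thesis using n(1) g(4,6) by (simp add: pathfinish_def integral_unique)
qed

lemma segment_path_length:
  fixes e :: "'p::euclidean_space \<Rightarrow> complex \<times> complex"
  assumes N: "convex N" "p \<in> N" "q \<in> N"
    and D: "\<And>x. (e has_derivative e' x) (at x)" "\<And>v. continuous_on UNIV (\<lambda>x. e' x v)"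
    and B: "\<And>x v. x \<in> N \<Longrightarrow> norm (e' x v) \<le> B * norm v"
  shows "\<exists>L \<in> path_lengths (top_of_set N) e p q. L \<le> B * dist p q"
proof -
  let ?g = "linepath p q"
  have seg: "path_image ?g \<subseteq> N" using N by (simp add: closed_segment_subset)
  define R where "R = (\<lambda>t. e' (?g t) (q - p))"
  have d: "((e \<circ> ?g) has_vector_derivative R t) (at t)" for t
  proof -
    have "(?g has_derivative (\<lambda>h. h *\<^sub>R (q - p))) (at t)"
      using has_vector_derivative_linepath_within[of p q t UNIV] by (simp add: has_vector_derivative_def)
    from has_derivative_compose[OF this D(1)]
    have "((\<lambda>t. e (?g t)) has_derivative (\<lambda>h. e' (?g t) (h *\<^sub>R (q - p)))) (at t)" .
    moreover have "linear (e' (?g t))" using D(1) has_derivative_linear by blast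
    ultimately show ?thesis by (simp add: has_vector_derivative_def R_def linear_cmul o_def)
  qed
  have contR: "continuous_on {0..1} R" unfolding R_def
    by (rule continuous_on_compose2[OF D(2)]) (auto intro: continuous_on_linepath)
  have "(e \<circ> ?g) C1_differentiable_on {0..1}" using d contR unfolding C1_differentiable_on_def by blast
  then have v: "valid_path (e \<circ> ?g)" by (simp add: valid_path_def C1_differentiable_imp_piecewise)
  have vd: "vector_derivative (e \<circ> ?g) (at t) = R t" for t using d vector_derivative_at by blast
  have i: "((\<lambda>t. norm (R t)) has_integral integral {0..1} (\<lambda>t. norm (R t))) {0..1}"
    by (intro integrable_integral integrable_continuous_interval continuous_on_norm contR)
  have "norm (R t) \<le> B * dist p q" if "t \<in> {0..1}" for t
  proof -
    have "?g t \<in> N" using seg that by (auto simp: path_image_def)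
    then show ?thesis using B[of "?g t" "q - p"] by (simp add: R_def dist_norm norm_minus_commute)
  qed
  then have "integral {0..1} (\<lambda>t. norm (R t)) \<le> integral {0..1::real} (\<lambda>t. B * dist p q)"
    by (intro integral_le integrable_continuous_interval continuous_intros contR) auto
  then have "integral {0..1} (\<lambda>t. norm (R t)) \<le> B * dist p q" by simp
  moreover have "integral {0..1} (\<lambda>t. norm (R t)) \<in> path_lengths (top_of_set N) e p q"
    unfolding path_lengths_valid_path
    by (rule exI[of _ ?g]) (use v i seg in \<open>simp add: vd\<close>)
  ultimately show ?thesis by blast
qed

lemma path_lengths_homeomorphic:
  assumes h: "homeomorphic_maps X Y \<beta> \<beta>'" and p: "p \<in> topspace X" "q \<in> topspace X"
  shows "path_lengths X (e \<circ> \<beta>) p q = path_lengths Y e (\<beta> p) (\<beta> q)"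
proof
  have c: "continuous_map X Y \<beta>" "continuous_map Y X \<beta>'"
    and i: "\<And>x. x \<in> topspace X \<Longrightarrow> \<beta>' (\<beta> x) = x" "\<And>y. y \<in> topspace Y \<Longrightarrow> \<beta> (\<beta>' y) = y"
    using h by (auto simp: homeomorphic_maps_def)
  show "path_lengths X (e \<circ> \<beta>) p q \<subseteq> path_lengths Y e (\<beta> p) (\<beta> q)"
  proof
    fix L assume "L \<in> path_lengths X (e \<circ> \<beta>) p q"
    then obtain \<gamma> where g: "pathin X \<gamma>" "\<gamma> 0 = p" "\<gamma> 1 = q" "(e \<circ> \<beta> \<circ> \<gamma>) piecewise_C1_differentiable_on {0..1}"
      "((\<lambda>t. norm (vector_derivative (e \<circ> \<beta> \<circ> \<gamma>) (at t))) has_integral L) {0..1}"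
      unfolding path_lengths_def by blast
    show "L \<in> path_lengths Y e (\<beta> p) (\<beta> q)" unfolding path_lengths_def mem_Collect_eq
      by (rule exI[of _ "\<beta> \<circ> \<gamma>"]) (use g pathin_compose[OF g(1) c(1)] in \<open>simp add: comp_assoc\<close>)
  qed
  show "path_lengths Y e (\<beta> p) (\<beta> q) \<subseteq> path_lengths X (e \<circ> \<beta>) p q"
  proof
    fix L assume "L \<in> path_lengths Y e (\<beta> p) (\<beta> q)"
    then obtain \<gamma> where g: "pathin Y \<gamma>" "\<gamma> 0 = \<beta> p" "\<gamma> 1 = \<beta> q" "(e \<circ> \<gamma>) piecewise_C1_differentiable_on {0..1}"
      "((\<lambda>t. norm (vector_derivative (e \<circ> \<gamma>) (at t))) has_integral L) {0..1}"
      unfolding path_lengths_def by blast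
    have e: "(e \<circ> \<beta> \<circ> (\<beta>' \<circ> \<gamma>)) t = (e \<circ> \<gamma>) t" if "t \<in> {0..1}" for t
      using g(1) i(2) that by (auto simp: pathin_def continuous_map_def Pi_iff)
    obtain S where S: "finite S" "(e \<circ> \<gamma>) C1_differentiable_on {0..1} - S" "continuous_on {0..1} (e \<circ> \<gamma>)"
      using g(4) by (auto simp: piecewise_C1_differentiable_on_def)
    obtain D where D: "\<And>t. t \<in> {0..1} - S \<Longrightarrow> ((e \<circ> \<gamma>) has_vector_derivative D t) (at t)" "continuous_on ({0..1} - S) D"
      using S(2) unfolding C1_differentiable_on_def by blast
    \<comment> \<open>the parameters \<open>0\<close> and \<open>1\<close> are excluded, as the two maps may differ outside the unit interval\<close>
    have D': "((e \<circ> \<beta> \<circ> (\<beta>' \<circ> \<gamma>)) has_vector_derivative D t) (at t)" if "t \<in> {0..1} - (S \<union> {0, 1})" for t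
      by (rule has_vector_derivative_transform_within_open[OF D(1), of t "{0<..<1}"])
         (use that e in \<open>auto simp del: comp_apply\<close>)
    have "(e \<circ> \<beta> \<circ> (\<beta>' \<circ> \<gamma>)) piecewise_C1_differentiable_on {0..1}"
      unfolding piecewise_C1_differentiable_on_def
    proof (intro conjI exI[of _ "S \<union> {0, 1}"])
      show "continuous_on {0..1} (e \<circ> \<beta> \<circ> (\<beta>' \<circ> \<gamma>))"
        by (rule continuous_on_eq[OF S(3)]) (use e in \<open>simp del: comp_apply\<close>)
      show "(e \<circ> \<beta> \<circ> (\<beta>' \<circ> \<gamma>)) C1_differentiable_on {0..1} - (S \<union> {0, 1})"
        unfolding C1_differentiable_on_def
        using D' continuous_on_subset[OF D(2), of "{0..1} - (S \<union> {0, 1})"] by blast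
    qed (use S in simp)
    moreover have "((\<lambda>t. norm (vector_derivative (e \<circ> \<beta> \<circ> (\<beta>' \<circ> \<gamma>)) (at t))) has_integral L) {0..1}"
    proof (rule has_integral_spike_finite[OF _ _ g(5)])
      show "finite (S \<union> {0, 1})" using S by simp
      fix t assume t: "t \<in> {0..1} - (S \<union> {0, 1})"
      then show "norm (vector_derivative (e \<circ> \<beta> \<circ> (\<beta>' \<circ> \<gamma>)) (at t)) = norm (vector_derivative (e \<circ> \<gamma>) (at t))"
        using vector_derivative_at[OF D'[OF t]] vector_derivative_at[OF D(1), of t] by simp
    qed
    ultimately show "L \<in> path_lengths X (e \<circ> \<beta>) p q" unfolding path_lengths_def mem_Collect_eq
      by (intro exI[of _ "\<beta>' \<circ> \<gamma>"] conjI pathin_compose[OF g(1) c(2)]) (use g i(1) p in simp_all)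
  qed
qed

text \<open>By the two estimates above the path metric is equivalent to the Euclidean metric on the closed convex
  set \<open>N\<close>. The manifold is carried over to a topology whose points form a whole type, because the axioms
  in \<^locale>\<open>Metric_space\<close> partly refer to all points of the type, and for points outside of the carrier the
  infimum of lengths is unspecified.\<close>

theorem complete_path_metric:
  fixes e :: "'p::euclidean_space \<Rightarrow> complex \<times> complex"
  assumes N: "closed N" "convex N"
    and D: "\<And>x. (e has_derivative e' x) (at x)" "\<And>v. continuous_on UNIV (\<lambda>x. e' x v)"
    and B: "\<And>x v. x \<in> N \<Longrightarrow> norm (e' x v) \<le> B * norm v" "B \<ge> 0"
    and r: "r > 0" and C: "C > 0"
    and low: "\<And>p q. \<lbrakk>p \<in> N; q \<in> N; dist p q \<le> r\<rbrakk> \<Longrightarrow> dist p q \<le> C * norm (e p - e q)"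
    and X: "topspace X = UNIV" "homeomorphic_maps X (top_of_set N) \<beta> \<beta>'"
  shows "complete_wrt_induced_metric X (e \<circ> \<beta>)"
proof -
  let ?d = "induced_dist (top_of_set N) e" and ?P = "path_lengths (top_of_set N) e"
  have ne: "?P p q \<noteq> {}" and up: "?d p q \<le> B * dist p q" if "p \<in> N" "q \<in> N" for p q
  proof -
    obtain L where "L \<in> ?P p q" "L \<le> B * dist p q"
      using segment_path_length[OF N(2) \<open>p \<in> N\<close> \<open>q \<in> N\<close> D B(1)] by blast
    then show "?P p q \<noteq> {}" "?d p q \<le> B * dist p q"
      using induced_dist_le[of L "top_of_set N" e p q] by auto
  qed
  have lb: "dist p q \<le> C * ?d p q" if "p \<in> N" "q \<in> N" for p q
  proof -
    have "dist p q / C \<le> ?d p q" unfolding induced_dist_eq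
    proof (rule cInf_greatest[OF ne[OF that]])
      fix L assume "L \<in> ?P p q"
      then have "dist p q \<le> C * L" using path_length_lower_bound[OF r _ low] C by auto
      then show "dist p q / C \<le> L" using C by (simp add: field_simps)
    qed
    then show ?thesis using C by (simp add: field_simps)
  qed
  have nonneg: "0 \<le> ?d p q" if "p \<in> N" "q \<in> N" for p q
    unfolding induced_dist_eq by (rule cInf_greatest[OF ne[OF that]]) (rule path_lengths_nonneg)
  have sym: "?d p q = ?d q p" for p q
  proof -
    have "?P p q = ?P q p" using path_lengths_reverse by blast
    then show ?thesis by (simp add: induced_dist_eq)
  qed
  have tri: "?d x z \<le> ?d x y + ?d y z" if xyz: "x \<in> N" "y \<in> N" "z \<in> N" for x y z
  proof (rule field_le_epsilon)
    fix \<epsilon> :: real assume "\<epsilon> > 0"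
    then have h: "?d x y < ?d x y + \<epsilon> / 2" "?d y z < ?d y z + \<epsilon> / 2" by simp_all
    obtain L1 where L1: "L1 \<in> ?P x y" "L1 < ?d x y + \<epsilon> / 2"
      using cInf_lessD[OF ne[OF xyz(1,2)]] h(1) unfolding induced_dist_eq by blast
    obtain L2 where L2: "L2 \<in> ?P y z" "L2 < ?d y z + \<epsilon> / 2"
      using cInf_lessD[OF ne[OF xyz(2,3)]] h(2) unfolding induced_dist_eq by blast
    have "?d x z \<le> L1 + L2" by (rule induced_dist_le[OF path_lengths_join[OF L1(1) L2(1)]])
    then show "?d x z \<le> ?d x y + ?d y z + \<epsilon>" using L1 L2 by linarith
  qed
  have zero: "?d x y = 0 \<longleftrightarrow> x = y" if "x \<in> N" "y \<in> N" for x y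
  proof
    assume "?d x y = 0"
    then show "x = y" using lb[OF that] by simp
  next
    assume "x = y"
    then show "?d x y = 0" using up[OF that] nonneg[OF that] by simp
  qed
  have bN: "\<beta> x \<in> N" and inv: "\<beta>' (\<beta> x) = x" for x
    using X by (auto simp: homeomorphic_maps_def continuous_map_def)
  have surj: "\<beta> (\<beta>' y) = y" if "y \<in> N" for y using X(2) that by (auto simp: homeomorphic_maps_def)
  let ?d' = "induced_dist X (e \<circ> \<beta>)"
  have d': "?d' x y = ?d (\<beta> x) (\<beta> y)" for x y
    using path_lengths_homeomorphic[OF X(2), of x y e] X(1) by (simp add: induced_dist_eq)
  interpret M: Metric_space UNIV ?d'
  proof
    show "?d' x y = 0 \<longleftrightarrow> x = y" for x y unfolding d' zero[OF bN bN] using inv by metis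
  qed (use nonneg sym tri bN in \<open>auto simp: d'\<close>)
  have "M.mcomplete" unfolding M.mcomplete_def
  proof (intro allI impI)
    fix \<sigma> assume s: "M.MCauchy \<sigma>"
    have "Cauchy (\<lambda>k. \<beta> (\<sigma> k))" unfolding Cauchy_def
    proof (intro allI impI)
      fix \<epsilon> :: real assume "\<epsilon> > 0"
      then have "\<epsilon> / C > 0" using C by simp
      then obtain K where K: "\<And>m k. K \<le> m \<Longrightarrow> K \<le> k \<Longrightarrow> ?d' (\<sigma> m) (\<sigma> k) < \<epsilon> / C"
        using s unfolding M.MCauchy_def by blast
      show "\<exists>K. \<forall>m\<ge>K. \<forall>k\<ge>K. dist (\<beta> (\<sigma> m)) (\<beta> (\<sigma> k)) < \<epsilon>"
      proof (intro exI[of _ K] allI impI)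
        fix m k assume "K \<le> m" "K \<le> k"
        from K[OF this] have "C * ?d (\<beta> (\<sigma> m)) (\<beta> (\<sigma> k)) < \<epsilon>" using C by (simp add: field_simps d')
        then show "dist (\<beta> (\<sigma> m)) (\<beta> (\<sigma> k)) < \<epsilon>" using lb[OF bN bN, of "\<sigma> m" "\<sigma> k"] by linarith
      qed
    qed
    then have "convergent (\<lambda>k. \<beta> (\<sigma> k))" by (rule Cauchy_convergent)
    then obtain p where p: "(\<lambda>k. \<beta> (\<sigma> k)) \<longlonglongrightarrow> p" unfolding convergent_def by blast
    have pN: "p \<in> N" by (rule closed_sequentially[OF N(1) _ p]) (rule bN)
    have "(\<lambda>k. dist (\<beta> (\<sigma> k)) p) \<longlonglongrightarrow> 0" using p by (rule tendsto_dist_iff[THEN iffD1])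
    then have "(\<lambda>k. B * dist (\<beta> (\<sigma> k)) p) \<longlonglongrightarrow> B * 0" by (intro tendsto_intros)
    then have "(\<lambda>k. B * dist (\<beta> (\<sigma> k)) p) \<longlonglongrightarrow> 0" by simp
    then have lim: "(\<lambda>k. ?d (\<beta> (\<sigma> k)) p) \<longlonglongrightarrow> 0"
    proof (rule Lim_null_comparison[rotated], intro always_eventually allI)
      show "norm (?d (\<beta> (\<sigma> k)) p) \<le> B * dist (\<beta> (\<sigma> k)) p" for k
        using nonneg[OF bN pN, of "\<sigma> k"] up[OF bN pN, of "\<sigma> k"] by simp
    qed
    have "limitin M.mtopology \<sigma> (\<beta>' p) sequentially"
      unfolding M.limitin_metric_dist_null using lim by (simp add: d' surj[OF pN])
    then show "\<exists>x. limitin M.mtopology \<sigma> x sequentially" by blast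
  qed
  then show ?thesis using M.Metric_space_axioms by (simp add: complete_wrt_induced_metric_def X(1))
qed

section \<open>Coordinates of the filling\<close>

text \<open>The Moebius transformation that exchanges the unit disc and the right half plane.\<close>

definition cayley :: "complex \<Rightarrow> complex" where "cayley w = (1 - w) * inverse (1 + w)"

lemma cayley_involution: "w \<noteq> -1 \<Longrightarrow> cayley (cayley w) = w" "w \<noteq> -1 \<Longrightarrow> cayley w \<noteq> -1"
proof -
  assume w: "w \<noteq> -1"
  then have n: "1 + w \<noteq> 0" by (metis add_eq_0_iff minus_minus)
  have p: "1 + cayley w = 2 * inverse (1 + w)" using n by (simp add: cayley_def field_simps)
  then have p0: "1 + cayley w \<noteq> 0" using n by simp
  then show "cayley w \<noteq> -1" by auto
  have m: "1 - cayley w = 2 * w * inverse (1 + w)" using n by (simp add: cayley_def field_simps)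
  show "cayley (cayley w) = w" unfolding cayley_def[of "cayley w"] p m using n by simp
qed

lemma cayley_derivative:
  "w \<noteq> -1 \<Longrightarrow> (cayley has_field_derivative (- 2 / (1 + w)\<^sup>2)) (at w)"
proof -
  assume w: "w \<noteq> -1"
  then have n: "1 + w \<noteq> 0" by (metis add_eq_0_iff minus_minus)
  show ?thesis unfolding cayley_def[abs_def]
    using n by (auto intro!: derivative_eq_intros simp: field_simps power2_eq_square)
qed

lemma Re_cayley: "w \<noteq> -1 \<Longrightarrow> Re (cayley w) = (1 - (norm w)\<^sup>2) / (norm (1 + w))\<^sup>2"
  unfolding cayley_def divide_inverse[symmetric] Re_divide cmod_power2
  by (simp add: power2_eq_square algebra_simps)

lemma Re_cayley_nonneg_iff: "w \<noteq> -1 \<Longrightarrow> 0 \<le> Re (cayley w) \<longleftrightarrow> norm w \<le> 1"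
proof -
  assume w: "w \<noteq> -1"
  then have "0 < (norm (1 + w))\<^sup>2" by (simp add: add_eq_0_iff)
  then have "0 \<le> Re (cayley w) \<longleftrightarrow> (norm w)\<^sup>2 \<le> 1" unfolding Re_cayley[OF w] by (simp add: zero_le_divide_iff)
  then show ?thesis by (simp add: power_le_one_iff abs_square_le_1)
qed

lemma Re_cayley_zero_iff: "w \<noteq> -1 \<Longrightarrow> Re (cayley w) = 0 \<longleftrightarrow> norm w = 1"
proof -
  assume w: "w \<noteq> -1"
  then have "0 < (norm (1 + w))\<^sup>2" by (simp add: add_eq_0_iff)
  then have "Re (cayley w) = 0 \<longleftrightarrow> (norm w)\<^sup>2 = 1" unfolding Re_cayley[OF w] by auto
  then show ?thesis using power2_eq_imp_eq[of "norm w" 1] by auto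
qed

lemma smooth_cayley: "smooth (- {-1}) cayley"
proof -
  have o: "open (- {-1 :: complex})" by auto
  have a: "smooth (- {-1 :: complex}) (\<lambda>w. 1 + w)" "smooth (- {-1 :: complex}) (\<lambda>w. 1 + (- w))"
    by (intro smooth_add smooth_const smooth_linear o bounded_linear_ident bounded_linear_minus)+
  have "smooth (- {-1 :: complex}) (\<lambda>w. inverse (1 + w))"
    by (rule smooth_compose[OF smooth_inverse a(1)]) (auto simp: add_eq_0_iff)
  from smooth_bilinear[OF bounded_bilinear_mult a(2) this]
  have "smooth (- {-1 :: complex}) (\<lambda>w. (1 + - w) * inverse (1 + w))" .
  then show ?thesis unfolding cayley_def[abs_def] by simp
qed

text \<open>The real part becomes the third coordinate, which distinguishes the half space.\<close>

definition vec3 :: "complex \<times> real \<Rightarrow> real^3" where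
  "vec3 p = (\<chi> i. if i = 1 then Im (fst p) else if i = 2 then snd p else Re (fst p))"

definition unvec3 :: "real^3 \<Rightarrow> complex \<times> real" where
  "unvec3 y = (Complex (y $ 3) (y $ 1), y $ 2)"

lemma vec3_nth [simp]: "vec3 p $ 1 = Im (fst p)" "vec3 p $ 2 = snd p" "vec3 p $ 3 = Re (fst p)"
  by (simp_all add: vec3_def)

lemma vec3_unvec3 [simp]: "unvec3 (vec3 p) = p" "vec3 (unvec3 y) = y"
  by (simp_all add: unvec3_def prod_eq_iff vec_eq_iff forall_3)

lemma bounded_linear_vec3: "bounded_linear vec3" "bounded_linear unvec3"
proof -
  have "linear vec3" by (rule linearI) (simp_all add: vec_eq_iff forall_3)
  moreover have "linear unvec3" by (rule linearI) (simp_all add: unvec3_def prod_eq_iff complex_eq_iff)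
  ultimately show "bounded_linear vec3" "bounded_linear unvec3" by (simp_all add: linear_conv_bounded_linear)
qed

definition solid :: "(complex \<times> real) set" where "solid = cball 0 1 \<times> UNIV"

text \<open>The two charts of the solid cylinder, for \<open>c = 1\<close> and \<open>c = - 1\<close>, each omit the line over one point of the unit
  circle, where the transformation has its pole.\<close>

definition chart_dom :: "complex \<Rightarrow> (complex \<times> real) set" where "chart_dom c = {p. c * fst p \<noteq> -1}"

definition chart :: "complex \<Rightarrow> complex \<times> real \<Rightarrow> real^3" where
  "chart c p = vec3 (cayley (c * fst p), snd p)"

definition unchart :: "complex \<Rightarrow> real^3 \<Rightarrow> complex \<times> real" where
  "unchart c y = (c * cayley (fst (unvec3 y)), snd (unvec3 y))"

definition unchart_dom :: "(real^3) set" where "unchart_dom = {y. - 1 < y $ 3}"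

lemma open_chart_dom: "open (chart_dom c)"
  unfolding chart_dom_def by (intro open_Collect_neq continuous_intros)

lemma open_unchart_dom: "open unchart_dom"
  unfolding unchart_dom_def by (intro open_Collect_less continuous_intros)

lemma half_space_subset: "half_space \<subseteq> unchart_dom"
  by (auto simp: half_space_def unchart_dom_def)

lemma unvec3_dom: "y \<in> unchart_dom \<Longrightarrow> fst (unvec3 y) \<noteq> -1"
  by (auto simp: unchart_dom_def unvec3_def complex_eq_iff)

lemma smooth_chart: "smooth (chart_dom c) (chart c)"
proof -
  have l: "smooth (chart_dom c) (\<lambda>p. c * fst p)"
    by (rule smooth_linear[OF open_chart_dom]) (intro bounded_linear_const_mult bounded_linear_fst)
  have "smooth (chart_dom c) (\<lambda>p. cayley (c * fst p))"
    by (rule smooth_compose[OF smooth_cayley l]) (auto simp: chart_dom_def)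
  moreover have "smooth (chart_dom c) (\<lambda>p. snd p)" by (rule smooth_linear[OF open_chart_dom bounded_linear_snd])
  ultimately have "smooth (chart_dom c) (\<lambda>p. (cayley (c * fst p), snd p))" by (rule smooth_Pair)
  from smooth_linear_compose[OF bounded_linear_vec3(1) this] show ?thesis unfolding chart_def[abs_def] .
qed

lemma smooth_unchart: "smooth unchart_dom (unchart c)"
proof -
  have l: "smooth unchart_dom (\<lambda>y. fst (unvec3 y))" "smooth unchart_dom (\<lambda>y. snd (unvec3 y))"
    by (rule smooth_linear[OF open_unchart_dom bounded_linear_compose[OF bounded_linear_fst bounded_linear_vec3(2)]])
       (rule smooth_linear[OF open_unchart_dom bounded_linear_compose[OF bounded_linear_snd bounded_linear_vec3(2)]])
  have "smooth unchart_dom (\<lambda>y. cayley (fst (unvec3 y)))"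
    by (rule smooth_compose[OF smooth_cayley l(1)]) (auto dest: unvec3_dom)
  then have "smooth unchart_dom (\<lambda>y. c * cayley (fst (unvec3 y)))"
    by (rule smooth_linear_compose[OF bounded_linear_mult_right])
  from smooth_Pair[OF this l(2)] show ?thesis unfolding unchart_def[abs_def] .
qed

lemma sign_square: "c \<in> {1, -1} \<Longrightarrow> c * c = (1::complex)" "c \<in> {1, -1} \<Longrightarrow> norm c = 1"
  by auto

lemma unchart_chart: "\<lbrakk>c \<in> {1, -1}; p \<in> chart_dom c\<rbrakk> \<Longrightarrow> unchart c (chart c p) = p"
  using sign_square(1)[of c] cayley_involution(1)[of "c * fst p"]
  by (simp add: unchart_def chart_def chart_dom_def prod_eq_iff mult.assoc[symmetric])

lemma chart_unchart:
  assumes "c \<in> {1, -1}" "y \<in> unchart_dom"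
  shows "unchart c y \<in> chart_dom c" "chart c (unchart c y) = y"
proof -
  have c: "c * (c * x) = x" for x using sign_square(1)[OF assms(1)] by (simp add: mult.assoc[symmetric])
  show "unchart c y \<in> chart_dom c"
    using cayley_involution(2)[OF unvec3_dom[OF assms(2)]] by (simp add: chart_dom_def unchart_def c)
  show "chart c (unchart c y) = y"
    using cayley_involution(1)[OF unvec3_dom[OF assms(2)]] by (simp add: chart_def unchart_def c)
qed

lemma unchart_in_solid: "\<lbrakk>c \<in> {1, -1}; y \<in> half_space\<rbrakk> \<Longrightarrow> unchart c y \<in> solid"
proof -
  assume c: "c \<in> {1, -1}" and y: "y \<in> half_space"
  define v where "v = fst (unvec3 y)"
  have v: "v \<noteq> -1" using unvec3_dom half_space_subset y by (auto simp: v_def)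
  have "0 \<le> Re (cayley (cayley v))" using y v cayley_involution(1)[OF v] by (simp add: v_def unvec3_def half_space_def)
  then have "norm (cayley v) \<le> 1" using Re_cayley_nonneg_iff[OF cayley_involution(2)[OF v]] by simp
  then show "unchart c y \<in> solid" using sign_square(2)[OF c] by (simp add: solid_def unchart_def v_def[symmetric] norm_mult)
qed

lemma chart_in_half_space:
  "\<lbrakk>c \<in> {1, -1}; p \<in> solid; p \<in> chart_dom c\<rbrakk> \<Longrightarrow> chart c p \<in> half_space"
  using Re_cayley_nonneg_iff[of "c * fst p"] sign_square(2)[of c]
  by (auto simp: half_space_def chart_def chart_dom_def solid_def norm_mult)

lemma chart_boundary_iff:
  "\<lbrakk>c \<in> {1, -1}; p \<in> chart_dom c\<rbrakk> \<Longrightarrow> chart c p $ 3 = 0 \<longleftrightarrow> norm (fst p) = 1"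
  using Re_cayley_zero_iff[of "c * fst p"] sign_square(2)[of c]
  by (auto simp: chart_def chart_dom_def norm_mult)

text \<open>The topology of the solid cylinder is transported along a bijection with the whole type. It exists
  because the solid cylinder contains a bijective copy of the type.\<close>

lemma solid_bijection:
  obtains \<beta> \<beta>' :: "complex \<times> real \<Rightarrow> complex \<times> real"
  where "\<And>x. \<beta> x \<in> solid" "\<And>x. \<beta>' (\<beta> x) = x" "\<And>y. y \<in> solid \<Longrightarrow> \<beta> (\<beta>' y) = y"
proof -
  define g where "g = (\<lambda>p :: complex \<times> real. (fst p / of_real (1 + norm (fst p)), snd p))"
  have pos: "1 + norm w > 0" for w :: complex by (simp add: add_pos_nonneg)
  have n: "norm (w / of_real (1 + norm w)) = norm w / (1 + norm w)" for w :: complex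
    using pos[of w] by (simp add: norm_divide del: of_real_add)
  have inj: "inj g"
  proof (rule injI)
    fix p q assume e: "g p = g q"
    let ?v = "fst p" and ?w = "fst q"
    have e1: "?v / of_real (1 + norm ?v) = ?w / of_real (1 + norm ?w)" and e2: "snd p = snd q"
      using e by (auto simp: g_def)
    then have "norm ?v / (1 + norm ?v) = norm ?w / (1 + norm ?w)" using n by metis
    then have "norm ?v = norm ?w" using pos[of ?v] pos[of ?w] by (simp add: field_simps)
    moreover have "complex_of_real (1 + norm ?w) \<noteq> 0" using pos[of ?w] by (simp del: of_real_add)
    ultimately have "?v = ?w" using e1 by (simp del: of_real_add)
    then show "p = q" using e2 by (simp add: prod_eq_iff)
  qed
  have "g p \<in> solid" for p
    using n[of "fst p"] pos[of "fst p"] by (simp add: g_def solid_def del: of_real_add)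
  then have "g ` UNIV \<subseteq> solid" by blast
  then have "\<exists>h :: complex \<times> real \<Rightarrow> complex \<times> real. bij_betw h UNIV solid"
    using Schroeder_Bernstein[of g UNIV solid id] inj by simp
  then obtain \<beta> :: "complex \<times> real \<Rightarrow> complex \<times> real" where b: "bij_betw \<beta> UNIV solid" by blast
  show ?thesis
  proof (rule that[of \<beta> "inv_into UNIV \<beta>"])
    show "\<beta> x \<in> solid" for x using b by (auto simp: bij_betw_def)
    show "inv_into UNIV \<beta> (\<beta> x) = x" for x using b by (simp add: bij_betw_def)
    show "\<beta> (inv_into UNIV \<beta> y) = y" if "y \<in> solid" for y
      using b that by (simp add: bij_betw_def f_inv_into_f)
  qed
qed

section \<open>The filling of the torus\<close>

lemma cis_eq_iff: "cis a = cis b \<longleftrightarrow> (\<exists>k::int. b = a + 2 * pi * of_int k)"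
proof
  assume "cis a = cis b"
  then have "sin a = sin b \<and> cos a = cos b" by (simp add: complex_eq_iff)
  then obtain n :: int where "a = b + 2 * pi * of_int n" unfolding sin_cos_eq_iff by blast
  then have "b = a + 2 * pi * of_int (- n)" by simp
  then show "\<exists>k::int. b = a + 2 * pi * of_int k" by blast
next
  assume "\<exists>k::int. b = a + 2 * pi * of_int k"
  then obtain k :: int where "b = a + 2 * pi * of_int k" by blast
  then have "sin b = sin a \<and> cos b = cos a" unfolding sin_cos_eq_iff by blast
  then show "cis a = cis b" by (simp add: complex_eq_iff)
qed

lemma abs_le_2_cis:
  assumes "\<bar>x - y\<bar> \<le> 1"
  shows "\<bar>x - y\<bar> \<le> 2 * norm (cis x - cis y)"
proof -
  have *: "t \<le> 2 * sin t" if "0 \<le> t" "t \<le> 1" for t :: real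
  proof (cases "t = 0")
    case False
    then have t: "0 < t" using that by simp
    obtain z where z: "0 < z" "z < t" "sin t - sin 0 = (t - 0) * cos z"
      using MVT2[OF t, of sin cos] by (auto intro: DERIV_sin)
    have "cos (pi / 3) \<le> cos z" using z that pi_gt3 by (intro cos_monotone_0_pi_le) auto
    then have "1 / 2 \<le> cos z" by (simp add: cos_60)
    then have "t * (1 / 2) \<le> t * cos z" using t by (intro mult_left_mono) auto
    then show ?thesis using z(3) by simp
  qed simp
  have "norm (cis x - cis y) = norm (cis y * (cis (x - y) - 1))" by (simp add: algebra_simps cis_mult)
  also have "\<dots> = norm (cis (x - y) - 1)" by (simp add: norm_mult)
  also have "\<dots> \<ge> \<bar>sin (x - y)\<bar>" using abs_Im_le_cmod[of "cis (x - y) - 1"] by simp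
  finally have "\<bar>sin (x - y)\<bar> \<le> norm (cis x - cis y)" .
  moreover have "\<bar>x - y\<bar> \<le> 2 * \<bar>sin (x - y)\<bar>"
  proof (cases "0 \<le> x - y")
    case True
    then show ?thesis using *[of "x - y"] assms by auto
  next
    case False
    have "sin (x - y) = - sin (y - x)" using sin_minus[of "y - x"] by simp
    then show ?thesis using *[of "y - x"] assms False by auto
  qed
  ultimately show ?thesis by linarith
qed

locale torus_filling =
  fixes \<delta> :: real
  assumes delta: "0 < \<delta>" "\<delta> \<le> pi / 4"
begin

definition k :: real where "k = tan \<delta>"

lemma cos_pos: "0 < cos \<delta>" and sin_pos: "0 < sin \<delta>"
  using delta pi_gt_zero by (auto intro!: cos_gt_zero sin_gt_zero)

lemma k_pos: "0 < k"
  using cos_pos sin_pos by (simp add: k_def tan_def)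

lemma k_eq: "k = sin \<delta> / cos \<delta>" by (simp add: k_def tan_def)

definition rad :: "complex \<Rightarrow> real" where "rad w = inverse (sqrt (1 + k\<^sup>2 * (w \<bullet> w)))"

lemma arg_pos: "0 < 1 + k\<^sup>2 * (w \<bullet> w)"
  by (simp add: add_pos_nonneg)

lemma rad_pos: "0 < rad w" and rad_le_1: "rad w \<le> 1"
  using arg_pos[of w] by (auto simp: rad_def inverse_le_1_iff)

lemma rad_unit: "norm w = 1 \<Longrightarrow> rad w = cos \<delta>"
proof -
  assume "norm w = 1"
  then have "1 + k\<^sup>2 * (w \<bullet> w) = (1 / cos \<delta>)\<^sup>2"
    using cos_pos sin_cos_squared_add[of \<delta>] by (simp add: dot_square_norm k_eq power_divide field_simps)
  then show ?thesis unfolding rad_def using cos_pos by (simp add: real_sqrt_divide)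
qed

lemma rad_lower: "norm w \<le> 1 \<Longrightarrow> cos \<delta> \<le> rad w"
proof -
  assume "norm w \<le> 1"
  then have "w \<bullet> w \<le> 1" by (simp add: dot_square_norm power_le_one)
  then have "1 + k\<^sup>2 * (w \<bullet> w) \<le> 1 + k\<^sup>2 * (1 \<bullet> (1::complex))" by (simp add: mult_left_le)
  then have "rad 1 \<le> rad w" unfolding rad_def using arg_pos[of w] by (intro le_imp_inverse_le) auto
  then show ?thesis using rad_unit[of 1] by simp
qed

text \<open>The torus lies over the unit circle. For fixed \<open>snd p\<close> the values at the unit disc form a totally geodesic disc
  that is bounded by a circle on the torus.\<close>

definition fill :: "complex \<times> real \<Rightarrow> complex \<times> complex" where
  "fill p = isom \<delta> (rad (fst p) *\<^sub>R cis (snd p), rad (fst p) *\<^sub>R (k *\<^sub>R fst p))"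

definition fill_deriv :: "complex \<times> real \<Rightarrow> complex \<times> real \<Rightarrow> complex \<times> complex" where
  "fill_deriv p v = (let r = rad (fst p); r' = - (k\<^sup>2 * r ^ 3 * (fst p \<bullet> fst v)) in
     isom \<delta> (r' *\<^sub>R cis (snd p) + r *\<^sub>R (snd v *\<^sub>R (\<i> * cis (snd p))), r' *\<^sub>R (k *\<^sub>R fst p) + r *\<^sub>R (k *\<^sub>R fst v)))"

lemma bounded_linear_isom: "bounded_linear (isom \<delta>)"
  using isom_linear linear_conv_bounded_linear by blast

lemma norm_fill: "norm (fill p) = 1"
proof -
  have "norm (rad (fst p) *\<^sub>R cis (snd p), rad (fst p) *\<^sub>R (k *\<^sub>R fst p)) = norm (rad (fst p) *\<^sub>R (cis (snd p), k *\<^sub>R fst p))" by simp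
  also have "\<dots> = rad (fst p) * sqrt (1 + k\<^sup>2 * (fst p \<bullet> fst p))"
    using rad_pos[of "fst p"] by (simp add: norm_Pair power_mult_distrib dot_square_norm del: scaleR_Pair)
  also have "\<dots> = 1" using arg_pos[of "fst p"] by (simp add: rad_def)
  finally show ?thesis by (simp add: fill_def norm_isom)
qed

lemma smooth_fill: "smooth UNIV fill"
proof -
  have g: "smooth UNIV (\<lambda>p::complex \<times> real. 1 + k\<^sup>2 * (fst p \<bullet> fst p))"
    by (intro smooth_add smooth_const smooth_linear_compose[OF bounded_linear_mult_right]
        smooth_bilinear[OF bounded_bilinear_inner] smooth_linear bounded_linear_fst open_UNIV)
  have r: "smooth UNIV (\<lambda>p::complex \<times> real. rad (fst p))" unfolding rad_def
    by (rule smooth_compose[OF smooth_inverse_sqrt g]) (use arg_pos in auto)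
  have c: "smooth UNIV (\<lambda>p::complex \<times> real. cis (snd p))"
    by (rule smooth_compose[OF smooth_cis smooth_linear[OF open_UNIV bounded_linear_snd]]) auto
  have f: "smooth UNIV (\<lambda>p::complex \<times> real. k *\<^sub>R fst p)"
    by (rule smooth_linear[OF open_UNIV]) (rule bounded_linear_compose[OF bounded_linear_scaleR_right bounded_linear_fst])
  show ?thesis unfolding fill_def[abs_def]
    by (intro smooth_linear_compose[OF bounded_linear_isom] smooth_Pair smooth_bilinear[OF bounded_bilinear_scaleR] r c f)
qed

lemma fill_has_derivative: "(fill has_derivative fill_deriv p) (at p)"
proof -
  let ?w = "fst p" and ?r = "rad (fst p)"
  have s: "((\<lambda>x::real. inverse (sqrt x)) has_field_derivative - (inverse (sqrt x) ^ 3 / 2)) (at x)" if "x > 0" for x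
    using that by (auto intro!: derivative_eq_intros simp: field_simps power3_eq_cube)
  have g: "((\<lambda>p::complex \<times> real. 1 + k\<^sup>2 * (fst p \<bullet> fst p)) has_derivative (\<lambda>v. 2 * k\<^sup>2 * (?w \<bullet> fst v))) (at p)"
    by (auto intro!: derivative_eq_intros simp: inner_commute algebra_simps)
  from has_derivative_compose[OF g s[OF arg_pos, unfolded has_field_derivative_def]]
  have "((\<lambda>p. rad (fst p)) has_derivative (\<lambda>v. - (?r ^ 3 / 2) * (2 * k\<^sup>2 * (?w \<bullet> fst v)))) (at p)"
    by (simp add: rad_def)
  then have r: "((\<lambda>p. rad (fst p)) has_derivative (\<lambda>v. - (k\<^sup>2 * ?r ^ 3 * (?w \<bullet> fst v)))) (at p)"
    by (rule has_derivative_eq_rhs) (auto simp: algebra_simps)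
  have "(snd has_derivative snd) (at p)" by (rule bounded_linear_imp_has_derivative[OF bounded_linear_snd])
  from has_derivative_cis[OF this]
  have c: "((\<lambda>p::complex \<times> real. cis (snd p)) has_derivative (\<lambda>v. snd v *\<^sub>R (\<i> * cis (snd p)))) (at p)" by simp
  have f: "((\<lambda>p::complex \<times> real. k *\<^sub>R fst p) has_derivative (\<lambda>v. k *\<^sub>R fst v)) (at p)"
    by (auto intro!: derivative_eq_intros)
  have "(fill has_derivative (\<lambda>v. isom \<delta> (?r *\<^sub>R (snd v *\<^sub>R (\<i> * cis (snd p))) + (- (k\<^sup>2 * ?r ^ 3 * (?w \<bullet> fst v))) *\<^sub>R cis (snd p),
      ?r *\<^sub>R (k *\<^sub>R fst v) + (- (k\<^sup>2 * ?r ^ 3 * (?w \<bullet> fst v))) *\<^sub>R (k *\<^sub>R ?w)))) (at p)"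
    unfolding fill_def[abs_def]
    by (intro bounded_linear.has_derivative[OF bounded_linear_isom] has_derivative_Pair has_derivative_scaleR r c f)
  then show ?thesis
    by (rule has_derivative_eq_rhs) (auto simp: fill_deriv_def Let_def add.commute)
qed

lemma frechet_fill: "frechet_derivative fill (at p) = fill_deriv p"
  using frechet_derivative_at[OF fill_has_derivative] by simp

lemma inj_fill_deriv: "inj (fill_deriv p)"
proof -
  have lin: "linear (fill_deriv p)" using fill_has_derivative has_derivative_linear by blast
  have "v = 0" if "fill_deriv p v = 0" for v
  proof -
    let ?r = "rad (fst p)"
    define r' where "r' = - (k\<^sup>2 * ?r ^ 3 * (fst p \<bullet> fst v))"
    have "isom \<delta> 0 = 0" using linear_0[OF isom_linear] .
    then have "isom \<delta> (r' *\<^sub>R cis (snd p) + ?r *\<^sub>R (snd v *\<^sub>R (\<i> * cis (snd p))), r' *\<^sub>R (k *\<^sub>R fst p) + ?r *\<^sub>R (k *\<^sub>R fst v)) = isom \<delta> 0"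
      using that by (simp add: fill_deriv_def Let_def r'_def)
    then have e: "r' *\<^sub>R cis (snd p) + ?r *\<^sub>R (snd v *\<^sub>R (\<i> * cis (snd p))) = 0" "r' *\<^sub>R (k *\<^sub>R fst p) + ?r *\<^sub>R (k *\<^sub>R fst v) = 0"
      unfolding isom_eq_iff by (simp_all add: zero_prod_def)
    have "(of_real r' + of_real (?r * snd v) * \<i>) * cis (snd p) = 0" using e(1) by (simp add: scaleR_conv_of_real algebra_simps)
    then have "of_real r' + of_real (?r * snd v) * \<i> = (0::complex)" using cis_neq_zero by simp
    then have "r' = 0" "?r * snd v = 0" by (auto simp: complex_eq_iff)
    then show "v = 0" using e(2) rad_pos[of "fst p"] k_pos by (auto simp: prod_eq_iff)
  qed
  then show ?thesis using linear_injective_0[OF lin] by blast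
qed

definition boundary_map :: "complex \<Rightarrow> complex \<times> real" where
  "boundary_map z = (cis (Re z * cos \<delta>), Im z * sin \<delta>)"

lemma fill_boundary: "fill (boundary_map z) = torus \<delta> z"
  using cos_pos by (simp add: fill_def boundary_map_def torus_def rad_unit k_eq)

lemma smooth_boundary_map: "smooth UNIV boundary_map"
  unfolding boundary_map_def[abs_def]
  by (intro smooth_Pair smooth_compose[OF smooth_cis] smooth_linear open_UNIV subset_UNIV
      bounded_linear_compose[OF bounded_linear_mult_left bounded_linear_Re]
      bounded_linear_compose[OF bounded_linear_mult_left bounded_linear_Im])

text \<open>The normal of the torus is the image of a vector that points to the axis of the solid cylinder.\<close>

lemma fill_normal:
  "fill_deriv (boundary_map z) (- ((1 / (sin \<delta> * cos \<delta>)) *\<^sub>R cis (Re z * cos \<delta>)), 0) = torus_normal \<delta> z"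
proof -
  let ?w = "cis (Re z * cos \<delta>)"
  define \<kappa> where "\<kappa> = 1 / (sin \<delta> * cos \<delta>)"
  have r: "rad ?w = cos \<delta>" by (rule rad_unit) simp
  have i: "?w \<bullet> ?w = 1" by (simp add: dot_square_norm)
  have one: "sin \<delta> ^ 2 + cos \<delta> ^ 2 = 1" by simp
  have "k\<^sup>2 * cos \<delta> ^ 3 * \<kappa> = sin \<delta>"
    using cos_pos sin_pos by (simp add: \<kappa>_def k_eq field_simps power2_eq_square power3_eq_cube)
  then have r': "- (k\<^sup>2 * cos \<delta> ^ 3 * (?w \<bullet> - (\<kappa> *\<^sub>R ?w))) = sin \<delta>"
    unfolding inner_minus_right inner_scaleR_right i by simp
  have "sin \<delta> * k - cos \<delta> * (k * \<kappa>) = ((sin \<delta>)\<^sup>2 - 1) / cos \<delta>"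
    using cos_pos sin_pos by (simp add: \<kappa>_def k_eq field_simps power2_eq_square)
  also have "(sin \<delta>)\<^sup>2 - 1 = - (cos \<delta>)\<^sup>2" using one by linarith
  finally have c: "sin \<delta> * k - cos \<delta> * (k * \<kappa>) = - cos \<delta>" using cos_pos by (simp add: power2_eq_square)
  have "sin \<delta> *\<^sub>R (k *\<^sub>R ?w) + cos \<delta> *\<^sub>R (k *\<^sub>R - (\<kappa> *\<^sub>R ?w)) = (sin \<delta> * k - cos \<delta> * (k * \<kappa>)) *\<^sub>R ?w"
    by (simp add: algebra_simps)
  then have "fill_deriv (boundary_map z) (- (\<kappa> *\<^sub>R ?w), 0) =
    isom \<delta> (sin \<delta> *\<^sub>R cis (Im z * sin \<delta>), (- cos \<delta>) *\<^sub>R ?w)"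
    unfolding fill_deriv_def Let_def boundary_map_def fst_conv snd_conv r r' c by simp
  then show ?thesis by (simp add: torus_normal_def \<kappa>_def)
qed

lemma fill_norm_bound:
  assumes "fst p \<in> cball 0 1"
  shows "norm (fill_deriv p v) \<le> (k\<^sup>2 + 1 + k ^ 3 + k) * norm v"
proof -
  let ?w = "fst p" and ?r = "rad (fst p)"
  define r' where "r' = - (k\<^sup>2 * ?r ^ 3 * (?w \<bullet> fst v))"
  have w: "norm ?w \<le> 1" using assms by simp
  have v: "norm (fst v) \<le> norm v" "\<bar>snd v\<bar> \<le> norm v"
    using norm_fst_le[of "fst v" "snd v"] norm_snd_le[of "snd v" "fst v"] by simp_all
  have r: "0 < ?r" "?r \<le> 1" by (rule rad_pos, rule rad_le_1)
  have r3: "?r ^ 3 \<le> 1" "0 \<le> ?r ^ 3" using r by (simp_all add: power_le_one)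
  have "\<bar>?w \<bullet> fst v\<bar> \<le> norm ?w * norm (fst v)" by (rule Cauchy_Schwarz_ineq2)
  also have "\<dots> \<le> 1 * norm v" using w v by (intro mult_mono) auto
  finally have "\<bar>?w \<bullet> fst v\<bar> \<le> norm v" by simp
  then have "k\<^sup>2 * ?r ^ 3 * \<bar>?w \<bullet> fst v\<bar> \<le> k\<^sup>2 * 1 * norm v" using r3 by (intro mult_mono) auto
  then have r': "\<bar>r'\<bar> \<le> k\<^sup>2 * norm v" using r3 by (simp add: r'_def abs_mult)
  have "norm (fill_deriv p v) \<le> norm (r' *\<^sub>R cis (snd p) + ?r *\<^sub>R (snd v *\<^sub>R (\<i> * cis (snd p)))) + norm (r' *\<^sub>R (k *\<^sub>R ?w) + ?r *\<^sub>R (k *\<^sub>R fst v))"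
    unfolding fill_deriv_def Let_def norm_isom r'_def by (rule norm_Pair_le)
  also have "\<dots> \<le> (\<bar>r'\<bar> + \<bar>snd v\<bar>) + (\<bar>r'\<bar> * k + k * norm (fst v))"
  proof (rule add_mono)
    have "norm (?r *\<^sub>R (snd v *\<^sub>R (\<i> * cis (snd p)))) \<le> \<bar>snd v\<bar>" using r by (simp add: norm_mult abs_mult mult_left_le_one_le)
    then show "norm (r' *\<^sub>R cis (snd p) + ?r *\<^sub>R (snd v *\<^sub>R (\<i> * cis (snd p)))) \<le> \<bar>r'\<bar> + \<bar>snd v\<bar>"
      by (intro norm_triangle_le add_mono) simp_all
    have "norm (r' *\<^sub>R (k *\<^sub>R ?w)) \<le> \<bar>r'\<bar> * k"
      using mult_left_mono[OF w, of "\<bar>r'\<bar> * k"] k_pos by (simp add: abs_mult mult.assoc)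
    moreover have "norm (?r *\<^sub>R (k *\<^sub>R fst v)) \<le> k * norm (fst v)" using r k_pos by (simp add: mult_left_le_one_le)
    ultimately show "norm (r' *\<^sub>R (k *\<^sub>R ?w) + ?r *\<^sub>R (k *\<^sub>R fst v)) \<le> \<bar>r'\<bar> * k + k * norm (fst v)"
      by (intro norm_triangle_le add_mono)
  qed
  also have "\<dots> \<le> (k\<^sup>2 * norm v + norm v) + (k\<^sup>2 * norm v * k + k * norm v)"
    using r' v k_pos by (intro add_mono mult_right_mono mult_left_mono) auto
  finally show ?thesis by (simp add: algebra_simps power2_eq_square power3_eq_cube)
qed

text \<open>The radius \<open>rad\<close> is recovered as the norm of the first coordinate of the image, and division by it
  recovers \<open>cis (snd p)\<close> and \<open>fst p\<close>. This controls the angle \<open>snd p\<close> only for nearby points, as the filling is periodic in this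
  angle.\<close>

lemma fill_lower:
  assumes p: "p \<in> solid" and q: "q \<in> solid" and pq: "dist p q \<le> 1"
  shows "dist p q \<le> (2 + 1 / k) * (1 / cos \<delta> + 1 / (cos \<delta>)\<^sup>2) * norm (fill p - fill q)"
proof -
  let ?c = "cos \<delta>"
  define E where "E = norm (fill p - fill q)"
  define rp rq where "rp = rad (fst p)" and "rq = rad (fst q)"
  have r: "?c \<le> rp" "?c \<le> rq" "rp \<le> 1" "rq \<le> 1"
    using p q rad_lower rad_le_1 by (auto simp: rp_def rq_def solid_def)
  have rpos: "0 < rp" "0 < rq" using r cos_pos by linarith+
  define Xp Xq Yp Yq where "Xp = rp *\<^sub>R cis (snd p)" and "Xq = rq *\<^sub>R cis (snd q)"
    and "Yp = rp *\<^sub>R (k *\<^sub>R fst p)" and "Yq = rq *\<^sub>R (k *\<^sub>R fst q)"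
  have "fill p - fill q = isom \<delta> ((Xp, Yp) - (Xq, Yq))"
    unfolding linear_diff[OF isom_linear] by (simp add: fill_def Xp_def Xq_def Yp_def Yq_def rp_def rq_def)
  then have E: "E = norm (Xp - Xq, Yp - Yq)" by (simp add: E_def norm_isom)
  have EX: "norm (Xp - Xq) \<le> E" and EY: "norm (Yp - Yq) \<le> E"
    unfolding E by (rule norm_fst_le, rule norm_snd_le)
  have E0: "0 \<le> E" by (simp add: E_def)
  have "\<bar>rp - rq\<bar> = \<bar>norm Xp - norm Xq\<bar>" using rpos by (simp add: Xp_def Xq_def)
  also have "\<dots> \<le> E" using norm_triangle_ineq3[of Xp Xq] EX by linarith
  finally have dr: "\<bar>rp - rq\<bar> \<le> E" .
  \<comment> \<open>both coordinates are quotients by the radius\<close>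
  have quot: "norm (x - y) \<le> E * (1 / ?c + 1 / ?c\<^sup>2)"
    if "norm (rp *\<^sub>R x - rq *\<^sub>R y) \<le> E" "norm (rq *\<^sub>R y) \<le> 1" for x y :: complex
  proof -
    have "x - y = (1 / rp) *\<^sub>R (rp *\<^sub>R x - rq *\<^sub>R y) + ((rq - rp) / (rp * rq)) *\<^sub>R (rq *\<^sub>R y)"
      using rpos by (simp add: scaleR_right_diff_distrib divide_simps flip: scaleR_left_diff_distrib)
    then have "norm (x - y) \<le> norm ((1 / rp) *\<^sub>R (rp *\<^sub>R x - rq *\<^sub>R y)) + norm (((rq - rp) / (rp * rq)) *\<^sub>R (rq *\<^sub>R y))"
      by (metis norm_triangle_ineq)
    also have "\<dots> = (1 / rp) * norm (rp *\<^sub>R x - rq *\<^sub>R y) + (\<bar>rp - rq\<bar> / (rp * rq)) * norm (rq *\<^sub>R y)"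
      unfolding norm_scaleR using rpos by (simp add: abs_minus_commute abs_mult)
    also have "\<dots> \<le> (1 / ?c) * E + (E / (?c * ?c)) * 1"
      using that r rpos cos_pos dr E0 by (intro add_mono mult_mono frac_le) auto
    finally show ?thesis by (simp add: power2_eq_square algebra_simps)
  qed
  have nY: "norm Yq \<le> 1"
  proof -
    have "norm (fill q) = norm (Xq, Yq)" unfolding fill_def Xq_def Yq_def rq_def norm_isom ..
    then show ?thesis using norm_fill[of q] norm_snd_le[of Yq Xq] by linarith
  qed
  have 1: "norm (cis (snd p) - cis (snd q)) \<le> E * (1 / ?c + 1 / ?c\<^sup>2)"
    using EX r rpos by (intro quot) (auto simp: Xp_def Xq_def)
  have 2: "norm (k *\<^sub>R fst p - k *\<^sub>R fst q) \<le> E * (1 / ?c + 1 / ?c\<^sup>2)"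
    using EY nY by (intro quot) (auto simp: Yp_def Yq_def)
  have "norm (k *\<^sub>R fst p - k *\<^sub>R fst q) = k * norm (fst p - fst q)"
    using k_pos by (simp flip: scaleR_right_diff_distrib)
  then have 3: "norm (fst p - fst q) \<le> 1 / k * (E * (1 / ?c + 1 / ?c\<^sup>2))"
    using 2 k_pos by (simp add: field_simps)
  have "\<bar>snd p - snd q\<bar> \<le> 1" using dist_snd_le[of p q] pq by (simp add: dist_real_def)
  from abs_le_2_cis[OF this] have 4: "\<bar>snd p - snd q\<bar> \<le> 2 * (E * (1 / ?c + 1 / ?c\<^sup>2))" using 1 by linarith
  have "dist p q \<le> norm (fst p - fst q) + \<bar>snd p - snd q\<bar>"
    using norm_Pair_le[of "fst p - fst q" "snd p - snd q"] by (cases p; cases q) (simp add: dist_norm)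
  also have "\<dots> \<le> 1 / k * (E * (1 / ?c + 1 / ?c\<^sup>2)) + 2 * (E * (1 / ?c + 1 / ?c\<^sup>2))" using 3 4 by linarith
  finally show ?thesis unfolding E_def by (simp add: algebra_simps add_divide_distrib)
qed

lemma angles_derivative:
  "((\<lambda>z. Im z * sin \<delta>) has_derivative (\<lambda>u. Im u * sin \<delta>)) (at z)"
  "((\<lambda>z. Re z * cos \<delta>) has_derivative (\<lambda>u. Re u * cos \<delta>)) (at z)"
  by (intro has_derivative_mult_left has_derivative_Im has_derivative_Re has_derivative_ident)+

lemma torus_has_derivative:
  "(torus \<delta> has_derivative (\<lambda>u. isom \<delta> ((cos \<delta> * (Im u * sin \<delta>)) *\<^sub>R (\<i> * cis (Im z * sin \<delta>)),
      (sin \<delta> * (Re u * cos \<delta>)) *\<^sub>R (\<i> * cis (Re z * cos \<delta>))))) (at z)"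
proof -
  have "(torus \<delta> has_derivative (\<lambda>u. isom \<delta> (cos \<delta> *\<^sub>R ((Im u * sin \<delta>) *\<^sub>R (\<i> * cis (Im z * sin \<delta>))),
      sin \<delta> *\<^sub>R ((Re u * cos \<delta>) *\<^sub>R (\<i> * cis (Re z * cos \<delta>)))))) (at z)"
    unfolding torus_def[abs_def]
    by (intro bounded_linear.has_derivative[OF bounded_linear_isom] has_derivative_Pair has_derivative_scaleR_right
        has_derivative_cis[OF angles_derivative(1)] has_derivative_cis[OF angles_derivative(2)])
  then show ?thesis by simp
qed

lemma frechet_torus: "frechet_derivative (torus \<delta>) (at z) =
    (\<lambda>u. isom \<delta> ((cos \<delta> * (Im u * sin \<delta>)) *\<^sub>R (\<i> * cis (Im z * sin \<delta>)),
      (sin \<delta> * (Re u * cos \<delta>)) *\<^sub>R (\<i> * cis (Re z * cos \<delta>))))"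
  using frechet_derivative_at[OF torus_has_derivative] by simp

lemma i_cis_inner: "(\<i> * cis x) \<bullet> cis x = 0" "(\<i> * cis x) \<bullet> (\<i> * cis x) = 1" "cis x \<bullet> cis x = 1"
proof -
  show "(\<i> * cis x) \<bullet> cis x = 0" by (simp add: inner_complex_def mult.commute)
  show "(\<i> * cis x) \<bullet> (\<i> * cis x) = 1" "cis x \<bullet> cis x = 1" by (simp_all add: dot_square_norm norm_mult)
qed

lemma torus_tangent_normal: "torus_normal \<delta> z \<bullet> frechet_derivative (torus \<delta>) (at z) w = 0"
proof -
  have c: "cis x \<bullet> (\<i> * cis x) = 0" for x using i_cis_inner(1)[of x] by (simp add: inner_commute)
  show ?thesis unfolding frechet_torus torus_normal_def inner_isom
    by (simp only: inner_Pair inner_scaleR_left inner_scaleR_right inner_minus_left c)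
qed

text \<open>The curvatures of the torus in the direction of the normal are \<open>cot \<delta>\<close> and \<open>- tan \<delta>\<close>, and \<open>\<delta> \<le> pi / 4\<close>.\<close>

lemma mean_curvature_torus: "0 \<le> mean_curvature (torus \<delta>) (torus_normal \<delta>) z"
proof -
  let ?s = "sin \<delta>" and ?c = "cos \<delta>"
  have d: "frechet_derivative (torus \<delta>) (at x) u = isom \<delta> ((?c * (Im u * ?s)) *\<^sub>R (\<i> * cis (Im x * ?s)), (?s * (Re u * ?c)) *\<^sub>R (\<i> * cis (Re x * ?c)))" for x u
    by (simp add: frechet_torus)
  have I: "frechet_derivative (torus \<delta>) (at z) u \<bullet> frechet_derivative (torus \<delta>) (at z) v = ?s\<^sup>2 * ?c\<^sup>2 * (Im u * Im v + Re u * Re v)" for u v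
    unfolding d inner_isom inner_Pair inner_scaleR_left inner_scaleR_right i_cis_inner
    by (simp add: power2_eq_square algebra_simps)
  have DD: "((\<lambda>x. frechet_derivative (torus \<delta>) (at x) u) has_derivative
     (\<lambda>v. isom \<delta> ((?c * (Im u * ?s)) *\<^sub>R (\<i> * ((Im v * ?s) *\<^sub>R (\<i> * cis (Im z * ?s)))),
       (?s * (Re u * ?c)) *\<^sub>R (\<i> * ((Re v * ?c) *\<^sub>R (\<i> * cis (Re z * ?c))))))) (at z)" for u
    unfolding d
    by (intro bounded_linear.has_derivative[OF bounded_linear_isom] has_derivative_Pair has_derivative_scaleR_right has_derivative_mult_right
        has_derivative_cis[OF angles_derivative(1)] has_derivative_cis[OF angles_derivative(2)])
  have dd: "frechet_derivative (\<lambda>x. frechet_derivative (torus \<delta>) (at x) u) (at z) v =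
     isom \<delta> ((- (?c * (Im u * ?s) * (Im v * ?s))) *\<^sub>R cis (Im z * ?s), (- (?s * (Re u * ?c) * (Re v * ?c))) *\<^sub>R cis (Re z * ?c))" for u v
    unfolding frechet_derivative_at[OF DD, symmetric] isom_eq_iff by (simp add: complex_eq_iff)
  have II: "frechet_derivative (\<lambda>x. frechet_derivative (torus \<delta>) (at x) u) (at z) v \<bullet> torus_normal \<delta> z =
     ?s * ?c * (?c\<^sup>2 * (Re u * Re v) - ?s\<^sup>2 * (Im u * Im v))" for u v
    unfolding dd torus_normal_def inner_isom inner_Pair inner_scaleR_left inner_scaleR_right inner_minus_right i_cis_inner
    by (simp add: power2_eq_square algebra_simps)
  have "mean_curvature (torus \<delta>) (torus_normal \<delta>) z =
    (?s\<^sup>2 * ?c\<^sup>2 * (- (?s * ?c * ?s\<^sup>2)) + ?s\<^sup>2 * ?c\<^sup>2 * (?s * ?c * ?c\<^sup>2)) / (2 * (?s\<^sup>2 * ?c\<^sup>2 * (?s\<^sup>2 * ?c\<^sup>2)))"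
    unfolding mean_curvature_def Let_def I II by simp
  also have "\<dots> = (?s\<^sup>2 * ?c\<^sup>2 * (?s * ?c) * (?c\<^sup>2 - ?s\<^sup>2)) / (2 * (?s\<^sup>2 * ?c\<^sup>2 * (?s\<^sup>2 * ?c\<^sup>2)))"
    by (simp add: algebra_simps)
  also have "0 \<le> \<dots>"
  proof -
    have "0 \<le> cos (2 * \<delta>)" using delta by (intro cos_ge_zero) auto
    then have "0 \<le> ?c\<^sup>2 - ?s\<^sup>2" by (simp add: cos_double)
    then show ?thesis using cos_pos sin_pos by (intro divide_nonneg_nonneg mult_nonneg_nonneg) auto
  qed
  finally show ?thesis .
qed

text \<open>In the chart the inward radial vector becomes \<open>2 * \<kappa> * x / (1 + x)\<^sup>2\<close> with \<open>x\<close> on the unit circle, which is a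
  positive real number.\<close>

lemma chart_inward:
  assumes c: "c \<in> {1, -1}" and z: "boundary_map z \<in> chart_dom c" and \<kappa>: "\<kappa> > 0"
  shows "frechet_derivative (chart c) (at (boundary_map z)) (- (\<kappa> *\<^sub>R cis (Re z * cos \<delta>)), 0) $ 3 > 0"
proof -
  let ?b = "boundary_map z" and ?w = "cis (Re z * cos \<delta>)"
  define x where "x = c * ?w"
  have x: "x \<noteq> -1" "norm x = 1" using z sign_square(2)[OF c] by (auto simp: x_def chart_dom_def boundary_map_def norm_mult)
  have 1: "((\<lambda>p. c * fst p) has_derivative (\<lambda>v. c * fst v)) (at ?b)" by (auto intro!: derivative_eq_intros)
  have "c * fst ?b = x" by (simp add: x_def boundary_map_def)
  then have "(cayley has_derivative (*) (- 2 / (1 + x)\<^sup>2)) (at (c * fst ?b))"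
    using cayley_derivative[OF x(1), unfolded has_field_derivative_def] by (simp only:)
  from has_derivative_compose[OF 1 this]
  have "((\<lambda>p. cayley (c * fst p)) has_derivative (\<lambda>v. - 2 / (1 + x)\<^sup>2 * (c * fst v))) (at ?b)" .
  from bounded_linear.has_derivative[OF bounded_linear_vec3(1) has_derivative_Pair[OF this has_derivative_snd[OF has_derivative_ident]]]
  have "(chart c has_derivative (\<lambda>v. vec3 (- 2 / (1 + x)\<^sup>2 * (c * fst v), snd v))) (at ?b)"
    by (simp add: chart_def[abs_def])
  from frechet_derivative_at[OF this, symmetric]
  have "frechet_derivative (chart c) (at ?b) = (\<lambda>v. vec3 (- 2 / (1 + x)\<^sup>2 * (c * fst v), snd v))" .
  then have "frechet_derivative (chart c) (at ?b) (- (\<kappa> *\<^sub>R ?w), 0) $ 3 = Re (2 * of_real \<kappa> * (x / (1 + x)\<^sup>2))"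
    by (simp add: x_def scaleR_conv_of_real mult_ac)
  also have "x / (1 + x)\<^sup>2 = of_real (1 / (2 + 2 * Re x))"
  proof -
    have xx: "x * cnj x = 1" using complex_norm_square[of x] x(2) by simp
    have "(1 + x)\<^sup>2 = x * (cnj x + 2 + x)" unfolding distrib_left xx by (simp add: power2_eq_square algebra_simps)
    also have "cnj x + 2 + x = of_real (2 + 2 * Re x)" by (simp add: complex_eq_iff)
    finally have e: "(1 + x)\<^sup>2 = x * of_real (2 + 2 * Re x)" .
    have "x \<noteq> 0" using x(2) by auto
    then show ?thesis unfolding e by (simp add: divide_simps del: of_real_add of_real_mult)
  qed
  also have "Re (2 * of_real \<kappa> * of_real (1 / (2 + 2 * Re x))) = 2 * \<kappa> / (2 + 2 * Re x)" by simp
  also have "\<dots> > 0"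
  proof -
    have "-1 \<le> Re x" using abs_Re_le_cmod[of x] x(2) by auto
    moreover have "Re x \<noteq> -1"
    proof
      assume "Re x = -1"
      then have "(Im x)\<^sup>2 = 0" using cmod_power2[of x] x(2) by simp
      then show False using x(1) \<open>Re x = -1\<close> by (simp add: complex_eq_iff)
    qed
    ultimately show ?thesis using \<kappa> by simp
  qed
  finally show ?thesis .
qed

lemma boundary_map_eq_iff:
  assumes "\<tau> = of_real (2 * pi / cos \<delta>) \<or> \<tau> = - of_real (2 * pi / cos \<delta>)"
  shows "boundary_map z = boundary_map w \<longleftrightarrow> (\<exists>k::int. w = z + of_int k * \<tau>)"
proof -
  obtain s :: int where s: "s = 1 \<or> s = -1" "\<tau> = of_real (of_int s * (2 * pi / cos \<delta>))"
    using assms by (metis mult_1 mult_minus1 of_int_1 of_int_minus of_real_minus)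
  have "boundary_map z = boundary_map w \<longleftrightarrow> (\<exists>k::int. Re w * cos \<delta> = Re z * cos \<delta> + 2 * pi * of_int k) \<and> Im z = Im w"
    unfolding boundary_map_def using sin_pos by (simp add: cis_eq_iff)
  also have "\<dots> \<longleftrightarrow> (\<exists>k::int. w = z + of_int k * \<tau>)"
  proof
    assume "(\<exists>k::int. Re w * cos \<delta> = Re z * cos \<delta> + 2 * pi * of_int k) \<and> Im z = Im w"
    then obtain k :: int where k: "Re w * cos \<delta> = Re z * cos \<delta> + 2 * pi * of_int k" "Im z = Im w" by blast
    then have "Re w = Re z + of_int (s * k) * (of_int s * (2 * pi / cos \<delta>))"
      using cos_pos s(1) by (auto simp: field_simps)
    then have "w = z + of_int (s * k) * \<tau>" unfolding s(2) using k(2) by (simp add: complex_eq_iff)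
    then show "\<exists>k::int. w = z + of_int k * \<tau>" by blast
  next
    assume "\<exists>k::int. w = z + of_int k * \<tau>"
    then obtain k :: int where k: "w = z + of_int k * \<tau>" by blast
    then have "Re w = Re z + of_int k * (of_int s * (2 * pi / cos \<delta>))" "Im w = Im z" unfolding s(2) by simp_all
    then have "Re w * cos \<delta> = Re z * cos \<delta> + 2 * pi * of_int (k * s)" using cos_pos by (simp add: field_simps)
    then show "(\<exists>k::int. Re w * cos \<delta> = Re z * cos \<delta> + 2 * pi * of_int k) \<and> Im z = Im w"
      using \<open>Im w = Im z\<close> by metis
  qed
  finally show ?thesis .
qed

lemma boundary_map_range: "range boundary_map = {p. norm (fst p) = 1}"
proof
  show "{p. norm (fst p) = 1} \<subseteq> range boundary_map"
  proof
    fix p :: "complex \<times> real" assume "p \<in> {p. norm (fst p) = 1}"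
    then have n: "norm (fst p) = 1" by simp
    then have "fst p = cis (Arg (fst p))" by (metis cis_Arg sgn_div_norm inverse_1 scaleR_one norm_zero zero_neq_one)
    then have "p = boundary_map (Complex (Arg (fst p) / cos \<delta>) (snd p / sin \<delta>))"
      using cos_pos sin_pos by (simp add: boundary_map_def prod_eq_iff)
    then show "p \<in> range boundary_map" by blast
  qed
qed (auto simp: boundary_map_def)

lemma boundary_map_solid: "boundary_map z \<in> solid"
  by (simp add: boundary_map_def solid_def)

lemma inj_boundary_map_derivative: "inj (frechet_derivative boundary_map (at z))"
proof -
  have D: "(boundary_map has_derivative (\<lambda>u. ((Re u * cos \<delta>) *\<^sub>R (\<i> * cis (Re z * cos \<delta>)), Im u * sin \<delta>))) (at z)"
    unfolding boundary_map_def[abs_def]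
    by (intro has_derivative_Pair has_derivative_cis angles_derivative)
  have lin: "linear (frechet_derivative boundary_map (at z))"
    unfolding frechet_derivative_at[OF D, symmetric] by (rule has_derivative_linear[OF D])
  have "u = 0" if "frechet_derivative boundary_map (at z) u = 0" for u
  proof -
    have "((Re u * cos \<delta>) *\<^sub>R (\<i> * cis (Re z * cos \<delta>)), Im u * sin \<delta>) = (0, 0)"
      using that unfolding frechet_derivative_at[OF D, symmetric] zero_prod_def .
    then have "(Re u * cos \<delta>) *\<^sub>R (\<i> * cis (Re z * cos \<delta>)) = 0" "Im u * sin \<delta> = 0" by simp_all
    then have "Re u = 0" "Im u = 0" using cos_pos sin_pos cis_neq_zero[of "Re z * cos \<delta>"] by auto
    then show "u = 0" by (simp add: complex_eq_iff)
  qed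
  then show ?thesis using linear_injective_0[OF lin] by blast
qed

text \<open>The torus map wraps one period once around a circle that bounds a disc of the filling, so the boundary of
  the solid cylinder is the cylinder with this period.\<close>

theorem torus_alexandrov_embedded:
  assumes tau: "\<tau> = of_real (2 * pi / cos \<delta>) \<or> \<tau> = - of_real (2 * pi / cos \<delta>)"
  shows "mean_convex_alexandrov_embedded \<tau> (torus \<delta>) (torus_normal \<delta>)"
proof -
  obtain \<beta> \<beta>' :: "complex \<times> real \<Rightarrow> complex \<times> real"
    where b: "\<And>x. \<beta> x \<in> solid" "\<And>x. \<beta>' (\<beta> x) = x" "\<And>y. y \<in> solid \<Longrightarrow> \<beta> (\<beta>' y) = y"
    using solid_bijection by blast
  define X where "X = pullback_topology UNIV \<beta> (top_of_set solid)"
  define U where "U = (\<lambda>c. {x. \<beta> x \<in> chart_dom c})"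
  define \<phi> where "\<phi> = (\<lambda>c. chart c \<circ> \<beta>)"
  define A where "A = (\<lambda>c. (U c, \<phi> c)) ` {1, -1}"
  define e where "e = fill \<circ> \<beta>"
  define \<iota> where "\<iota> = \<beta>' \<circ> boundary_map"
  have topX: "topspace X = UNIV" using b(1) by (auto simp: X_def topspace_pullback_topology)
  have cb: "continuous_map X (top_of_set solid) \<beta>"
    using continuous_map_pullback[OF continuous_map_id, of UNIV \<beta> "top_of_set solid"] by (simp add: X_def)
  have cb': "continuous_map (top_of_set solid) X \<beta>'" unfolding X_def
  proof (rule continuous_map_pullback')
    show "continuous_map (top_of_set solid) (top_of_set solid) (\<beta> \<circ> \<beta>')"
      by (rule continuous_map_eq[OF continuous_map_id]) (use b(3) in auto)
  qed auto
  have hom: "homeomorphic_maps X (top_of_set solid) \<beta> \<beta>'"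
    unfolding homeomorphic_maps_def using cb cb' b by auto
  then have hsp: "top_of_set solid homeomorphic_space X"
    using homeomorphic_space_def homeomorphic_space_sym by blast
  have hs_img: "\<phi> c ` U c = half_space" if c: "c \<in> {1, -1}" for c
  proof
    show "\<phi> c ` U c \<subseteq> half_space"
      using chart_in_half_space[OF c b(1)] unfolding \<phi>_def U_def o_def by blast
    show "half_space \<subseteq> \<phi> c ` U c"
    proof
      fix y assume y: "y \<in> half_space"
      then have "y \<in> unchart_dom" using half_space_subset by blast
      from chart_unchart[OF c this] unchart_in_solid[OF c y]
      show "y \<in> \<phi> c ` U c" using b(3)
        by (intro image_eqI[of _ _ "\<beta>' (unchart c y)"]) (auto simp: \<phi>_def U_def)
    qed
  qed
  have phi_inv: "\<beta>' (unchart c (\<phi> c x)) = x" if c: "c \<in> {1, -1}" and "x \<in> U c" for c x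
    using unchart_chart[OF c, of "\<beta> x"] that b(2) by (simp add: \<phi>_def U_def)
  have inj: "inj_on (\<phi> c) (U c)" if c: "c \<in> {1, -1}" for c
    using phi_inv[OF c] by (metis inj_onI)
  have inv: "inv_into (U c) (\<phi> c) y = \<beta>' (unchart c y)" if c: "c \<in> {1, -1}" and y: "y \<in> half_space" for c y
  proof -
    obtain x where "x \<in> U c" "y = \<phi> c x" using hs_img[OF c] y by blast
    then show ?thesis using phi_inv[OF c] inj[OF c] by simp
  qed
  have binv: "\<beta> (inv_into (U c) (\<phi> c) y) = unchart c y" if c: "c \<in> {1, -1}" and y: "y \<in> half_space" for c y
    using inv[OF c y] b(3)[OF unchart_in_solid[OF c y]] by simp
  have openU: "openin X (U c)" for c
  proof -
    have "openin (top_of_set solid) (solid \<inter> chart_dom c)" using open_chart_dom by blast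
    from openin_continuous_map_preimage[OF cb this] show ?thesis
      using b(1) by (simp add: topX U_def)
  qed
  have chart: "is_chart X (U c, \<phi> c)" if c: "c \<in> {1, -1}" for c
  proof -
    have "homeomorphic_maps (subtopology X (U c)) (top_of_set half_space) (\<phi> c) (\<beta>' \<circ> unchart c)"
      unfolding homeomorphic_maps_def
    proof (intro conjI ballI)
      have "continuous_map (subtopology X (U c)) (top_of_set (chart_dom c)) \<beta>"
        using continuous_map_from_subtopology[OF cb, of "U c"]
        by (auto simp: continuous_map_in_subtopology U_def topX)
      moreover have "continuous_map (top_of_set (chart_dom c)) euclidean (chart c)"
        using smooth_continuous[OF smooth_chart] by simp
      ultimately have "continuous_map (subtopology X (U c)) euclidean (\<phi> c)"
        unfolding \<phi>_def by (rule continuous_map_compose)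
      then show "continuous_map (subtopology X (U c)) (top_of_set half_space) (\<phi> c)"
        using hs_img[OF c] by (auto simp: continuous_map_in_subtopology topX)
      have "continuous_on half_space (unchart c)"
        using continuous_on_subset[OF smooth_continuous[OF smooth_unchart] half_space_subset] .
      then have "continuous_map (top_of_set half_space) (top_of_set solid) (unchart c)"
        using unchart_in_solid[OF c] by (auto simp: continuous_map_in_subtopology)
      from continuous_map_compose[OF this cb']
      show "continuous_map (top_of_set half_space) (subtopology X (U c)) (\<beta>' \<circ> unchart c)"
        using b(3)[OF unchart_in_solid[OF c]] chart_unchart(1)[OF c] half_space_subset
        by (auto simp: continuous_map_in_subtopology U_def subset_iff)
      show "(\<beta>' \<circ> unchart c) (\<phi> c x) = x" if "x \<in> topspace (subtopology X (U c))" for x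
        using phi_inv[OF c] that by simp
      show "\<phi> c ((\<beta>' \<circ> unchart c) y) = y" if "y \<in> topspace (top_of_set half_space)" for y
        using that b(3)[OF unchart_in_solid[OF c, of y]] chart_unchart(2)[OF c, of y] half_space_subset
        by (auto simp: \<phi>_def)
    qed
    then have "homeomorphic_map (subtopology X (U c)) (top_of_set half_space) (\<phi> c)" using homeomorphic_map_maps by blast
    then show ?thesis using openU by (simp add: is_chart_def hs_img[OF c])
  qed
  have trans: "smooth_on (\<phi> c ` (U c \<inter> U d)) (\<phi> d \<circ> inv_into (U c) (\<phi> c))" if c: "c \<in> {1, -1}" and d: "d \<in> {1, -1}" for c d
  proof -
    define V where "V = unchart c -` chart_dom d \<inter> unchart_dom"
    have oV: "open V" unfolding V_def
      using smooth_continuous[OF smooth_unchart] open_chart_dom open_unchart_dom continuous_on_open_vimage by blast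
    have "smooth V (\<lambda>y. chart d (unchart c y))"
      by (rule smooth_compose[OF smooth_chart smooth_subset[OF smooth_unchart oV]]) (auto simp: V_def)
    then show ?thesis
    proof (rule smooth_imp_smooth_on)
      have "y \<in> half_space \<and> unchart c y \<in> chart_dom d" if y: "y \<in> \<phi> c ` (U c \<inter> U d)" for y
      proof -
        obtain x where "x \<in> U c" "x \<in> U d" "y = \<phi> c x" using y by blast
        then show ?thesis using hs_img[OF c] unchart_chart[OF c, of "\<beta> x"] by (auto simp: \<phi>_def U_def)
      qed
      then show "\<phi> c ` (U c \<inter> U d) \<subseteq> V" "\<And>y. y \<in> \<phi> c ` (U c \<inter> U d) \<Longrightarrow> chart d (unchart c y) = (\<phi> d \<circ> inv_into (U c) (\<phi> c)) y"
        using half_space_subset binv[OF c] by (auto simp: V_def \<phi>_def)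
    qed
  qed
  have cover: "x \<in> U 1 \<or> x \<in> U (-1)" for x by (auto simp: U_def chart_dom_def)
  have mfd: "three_manifold_with_boundary X A"
    unfolding three_manifold_with_boundary_def is_atlas_def
  proof (intro conjI)
    show "Hausdorff_space X"
      using homeomorphic_Hausdorff_space[OF hsp] Hausdorff_space_subtopology[OF Hausdorff_space_euclidean] by blast
    show "second_countable X"
    proof -
      obtain \<B> :: "(complex \<times> real) set set" where B: "countable \<B>" "\<And>C. C \<in> \<B> \<Longrightarrow> open C"
        and gen: "\<And>S. open S \<Longrightarrow> \<exists>U. U \<subseteq> \<B> \<and> S = \<Union>U"
        using univ_second_countable by blast
      have "\<exists>V\<in>\<B>. x \<in> V \<and> V \<subseteq> W" if "open W" "x \<in> W" for W x
        using gen[OF that(1)] that(2) by blast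
      then have "second_countable (euclidean :: (complex \<times> real) topology)" unfolding second_countable_def
        by (intro exI[of _ \<B>] conjI B(1)) (simp_all add: B(2))
      then show ?thesis using homeomorphic_space_second_countability[OF hsp] second_countable_subtopology[of euclidean solid] by simp
    qed
    show "\<forall>c\<in>A. is_chart X c" using chart by (auto simp: A_def)
    show "\<Union> (fst ` A) = topspace X" using cover by (auto simp: A_def topX)
    show "\<forall>(U, \<phi>)\<in>A. \<forall>(V, \<psi>)\<in>A. smooth_on (\<phi> ` (U \<inter> V)) (\<psi> \<circ> inv_into U \<phi>)"
      unfolding A_def using trans by blast
  qed
  have conn: "connected_space X"
  proof -
    have "connected_space (top_of_set solid)"
      using convex_connected[of solid] by (intro connected_space_subtopology) (simp add: solid_def convex_Times)
    then show ?thesis using homeomorphic_connected_space[OF hsp] by blast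
  qed
  \<comment> \<open>in a chart the immersion is the restriction of a smooth immersion\<close>
  have local: "((e \<circ> inv_into (U c) (\<phi> c)) has_derivative (\<lambda>v. fill_deriv (unchart c y) (frechet_derivative (unchart c) (at y) v))) (at y within \<phi> c ` U c)"
    if c: "c \<in> {1, -1}" and y: "y \<in> half_space" for c y
  proof -
    have yd: "y \<in> unchart_dom" using y half_space_subset by blast
    have "((\<lambda>y. fill (unchart c y)) has_derivative (\<lambda>v. fill_deriv (unchart c y) (frechet_derivative (unchart c) (at y) v))) (at y)"
      by (rule has_derivative_compose[OF smooth_has_derivative[OF smooth_unchart yd] fill_has_derivative])
    then have "((\<lambda>y. fill (unchart c y)) has_derivative (\<lambda>v. fill_deriv (unchart c y) (frechet_derivative (unchart c) (at y) v))) (at y within half_space)"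
      by (rule has_derivative_at_withinI)
    then show ?thesis unfolding hs_img[OF c]
      by (rule has_derivative_transform[OF y, rotated]) (use binv[OF c] in \<open>simp add: e_def\<close>)
  qed
  have imm: "immersion_to_S3 X A e"
    unfolding immersion_to_S3_def
  proof (intro conjI)
    show "e ` topspace X \<subseteq> sphere 0 1" unfolding e_def o_def using norm_fill mem_sphere_0 by blast
    have "smooth_on (\<phi> c ` U c) (e \<circ> inv_into (U c) (\<phi> c))" if c: "c \<in> {1, -1}" for c
    proof -
      have "smooth unchart_dom (\<lambda>y. fill (unchart c y))" by (rule smooth_compose[OF smooth_fill smooth_unchart]) simp
      then show ?thesis
        by (rule smooth_imp_smooth_on) (use hs_img[OF c] half_space_subset binv[OF c] in \<open>auto simp: e_def\<close>)
    qed
    moreover have "\<exists>D. ((e \<circ> inv_into (U c) (\<phi> c)) has_derivative D) (at x within \<phi> c ` U c) \<and> inj D"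
      if c: "c \<in> {1, -1}" and x: "x \<in> \<phi> c ` U c" for c x
    proof -
      have h: "x \<in> half_space" using x hs_img[OF c] by blast
      then have xd: "x \<in> unchart_dom" using half_space_subset by blast
      have "frechet_derivative (chart c) (at (unchart c x)) (frechet_derivative (unchart c) (at x) v) = v" for v
        by (rule left_inverse_derivative[OF smooth_unchart smooth_chart xd chart_unchart(1)[OF c xd] chart_unchart(2)[OF c]])
      then have "inj (frechet_derivative (unchart c) (at x))" by (metis injI)
      then have "inj (\<lambda>v. fill_deriv (unchart c x) (frechet_derivative (unchart c) (at x) v))"
        using inj_compose[OF inj_fill_deriv] by (simp add: o_def)
      then show ?thesis using local[OF c h] by blast
    qed
    ultimately show "\<forall>(U, \<phi>)\<in>A. smooth_on (\<phi> ` U) (e \<circ> inv_into U \<phi>) \<and>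
        (\<forall>x\<in>\<phi> ` U. \<exists>D. (e \<circ> inv_into U \<phi> has_derivative D) (at x within \<phi> ` U) \<and> inj D)"
      unfolding A_def by blast
  qed
  have b_iota: "\<beta> (\<iota> z) = boundary_map z" for z using b(3)[OF boundary_map_solid] by (simp add: \<iota>_def)
  have bp: "boundary_parameterisation X A \<tau> \<iota>"
    unfolding boundary_parameterisation_def
  proof (intro conjI allI)
    have "continuous_map euclidean (top_of_set solid) boundary_map"
      using smooth_continuous[OF smooth_boundary_map] boundary_map_solid by (auto simp: continuous_map_in_subtopology)
    from continuous_map_compose[OF this cb'] show "continuous_map euclidean X \<iota>" by (simp add: \<iota>_def)
    have mb: "manifold_boundary X A = {x. norm (fst (\<beta> x)) = 1}"
    proof -
      have "x \<in> manifold_boundary X A \<longleftrightarrow> (\<exists>c\<in>{1, -1}. x \<in> U c \<and> \<phi> c x $ 3 = 0)" for x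
        by (auto simp: manifold_boundary_def A_def topX)
      also have "\<dots> x \<longleftrightarrow> (\<exists>c\<in>{1, -1}. x \<in> U c \<and> norm (fst (\<beta> x)) = 1)" for x
        using chart_boundary_iff[of _ "\<beta> x"] by (auto simp: U_def \<phi>_def)
      also have "\<dots> x \<longleftrightarrow> norm (fst (\<beta> x)) = 1" for x using cover[of x] by auto
      finally show ?thesis by blast
    qed
    show "range \<iota> = manifold_boundary X A"
    proof
      show "range \<iota> \<subseteq> manifold_boundary X A" unfolding mb
        by (rule image_subsetI) (simp only: mem_Collect_eq b_iota, simp add: boundary_map_def)
      show "manifold_boundary X A \<subseteq> range \<iota>"
      proof
        fix x assume "x \<in> manifold_boundary X A"
        then have "\<beta> x \<in> range boundary_map" unfolding mb boundary_map_range by simp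
        then obtain z where "\<beta> x = boundary_map z" by blast
        then have "x = \<iota> z" using b(2)[of x] by (simp add: \<iota>_def)
        then show "x \<in> range \<iota>" by blast
      qed
    qed
    show "\<iota> z = \<iota> w \<longleftrightarrow> (\<exists>k::int. w = z + of_int k * \<tau>)" for z w
      using b_iota boundary_map_eq_iff[OF tau] b(2) by metis
    have pre: "\<iota> -` U c = boundary_map -` chart_dom c" for c by (auto simp: U_def b_iota)
    have comp: "\<phi> c \<circ> \<iota> = (\<lambda>z. chart c (boundary_map z))" for c by (auto simp: \<phi>_def b_iota)
    have op: "open (boundary_map -` chart_dom c)" for c
      using smooth_continuous[OF smooth_boundary_map] open_chart_dom by (simp add: continuous_on_open_vimage[OF open_UNIV])
    have sm: "smooth (boundary_map -` chart_dom c) (\<lambda>z. chart c (boundary_map z))" for c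
      by (rule smooth_compose[OF smooth_chart smooth_subset[OF smooth_boundary_map op]]) auto
    have "smooth_on (\<iota> -` U c) (\<phi> c \<circ> \<iota>)" for c
      unfolding pre comp by (rule smooth_imp_smooth_on[OF sm]) auto
    moreover have "inj (frechet_derivative (\<phi> c \<circ> \<iota>) (at z))" if c: "c \<in> {1, -1}" and z: "z \<in> \<iota> -` U c" for c z
    proof -
      have zc: "boundary_map z \<in> chart_dom c" using z pre by auto
      have "((\<lambda>z. chart c (boundary_map z)) has_derivative
          (\<lambda>v. frechet_derivative (chart c) (at (boundary_map z)) (frechet_derivative boundary_map (at z) v))) (at z)"
        by (rule has_derivative_compose[OF smooth_has_derivative[OF smooth_boundary_map UNIV_I] smooth_has_derivative[OF smooth_chart zc]])
      from frechet_derivative_at[OF this, symmetric]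
      have fd: "frechet_derivative (\<phi> c \<circ> \<iota>) (at z) = (\<lambda>v. frechet_derivative (chart c) (at (boundary_map z)) (frechet_derivative boundary_map (at z) v))"
        unfolding comp .
      have cd: "chart c (boundary_map z) \<in> unchart_dom"
        using chart_in_half_space[OF c boundary_map_solid zc] half_space_subset by blast
      have "frechet_derivative (unchart c) (at (chart c (boundary_map z))) (frechet_derivative (chart c) (at (boundary_map z)) v) = v" for v
        by (rule left_inverse_derivative[OF smooth_chart smooth_unchart zc cd unchart_chart[OF c]])
      then have "inj (frechet_derivative (chart c) (at (boundary_map z)))" by (metis injI)
      from inj_compose[OF this inj_boundary_map_derivative] show ?thesis unfolding fd by (simp add: o_def)
    qed
    ultimately show "\<forall>(U, \<phi>)\<in>A. smooth_on (\<iota> -` U) (\<phi> \<circ> \<iota>) \<and> (\<forall>z\<in>\<iota> -` U. inj (frechet_derivative (\<phi> \<circ> \<iota>) (at z)))"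
      unfolding A_def by blast
  qed
  have e_iota: "e (\<iota> z) = torus \<delta> z" for z by (simp add: e_def b_iota fill_boundary)
  have inw: "inward_unit_normal A e \<iota> (torus_normal \<delta>)"
    unfolding inward_unit_normal_def
  proof (intro allI conjI)
    fix z
    show "norm (torus_normal \<delta> z) = 1"
    proof -
      have "norm (torus_normal \<delta> z) = sqrt ((sin \<delta>)\<^sup>2 + (cos \<delta>)\<^sup>2)"
        unfolding torus_normal_def norm_isom by (simp add: norm_Pair)
      then show ?thesis by simp
    qed
    have ei: "e \<circ> \<iota> = torus \<delta>" using e_iota by auto
    show "torus_normal \<delta> z \<bullet> frechet_derivative (e \<circ> \<iota>) (at z) w = 0" for w
      unfolding ei by (rule torus_tangent_normal)
    have "\<exists>D v. (e \<circ> inv_into (U c) (\<phi> c) has_derivative D) (at (\<phi> c (\<iota> z)) within \<phi> c ` U c) \<and> v $ 3 > 0 \<and> D v = torus_normal \<delta> z"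
      if c: "c \<in> {1, -1}" and z: "\<iota> z \<in> U c" for c
    proof -
      have zc: "boundary_map z \<in> chart_dom c" using z by (simp add: U_def b_iota)
      have y: "\<phi> c (\<iota> z) = chart c (boundary_map z)" by (simp add: \<phi>_def b_iota)
      have yh: "chart c (boundary_map z) \<in> half_space" by (rule chart_in_half_space[OF c boundary_map_solid zc])
      then have cd: "chart c (boundary_map z) \<in> unchart_dom" using half_space_subset by blast
      define u where "u = (- ((1 / (sin \<delta> * cos \<delta>)) *\<^sub>R cis (Re z * cos \<delta>)), 0 :: real)"
      define v where "v = frechet_derivative (chart c) (at (boundary_map z)) u"
      have "frechet_derivative (unchart c) (at (chart c (boundary_map z))) v = u" unfolding v_def
        by (rule left_inverse_derivative[OF smooth_chart smooth_unchart zc cd unchart_chart[OF c]])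
      then have "fill_deriv (unchart c (chart c (boundary_map z))) (frechet_derivative (unchart c) (at (chart c (boundary_map z))) v) = torus_normal \<delta> z"
        unfolding unchart_chart[OF c zc] by (simp add: u_def fill_normal)
      moreover have "v $ 3 > 0" unfolding v_def u_def
        by (rule chart_inward[OF c zc]) (use cos_pos sin_pos in simp)
      ultimately show ?thesis using local[OF c yh] unfolding y by blast
    qed
    then show "\<forall>(U, \<phi>)\<in>A. \<iota> z \<in> U \<longrightarrow> (\<exists>D v. (e \<circ> inv_into U \<phi> has_derivative D) (at (\<phi> (\<iota> z)) within \<phi> ` U) \<and> 0 < v $ 3 \<and> D v = torus_normal \<delta> z)"
      unfolding A_def by blast
  qed
  have comp: "complete_wrt_induced_metric X e"
    unfolding e_def
  proof (rule complete_path_metric[where N = solid and e' = fill_deriv and r = 1 and \<beta>' = \<beta>'])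
    show "closed solid" "convex solid" by (auto simp: solid_def intro: closed_Times convex_Times)
    show "(fill has_derivative fill_deriv x) (at x)" for x by (rule fill_has_derivative)
    show "continuous_on UNIV (\<lambda>x. fill_deriv x v)" for v
    proof -
      have "Ck_on (Suc 0) fill UNIV" using smooth_fill unfolding smooth_def by blast
      from Ck_on_SucD(2)[OF this, of v] show ?thesis by (simp add: frechet_fill)
    qed
    show "norm (fill_deriv x v) \<le> (k\<^sup>2 + 1 + k ^ 3 + k) * norm v" if "x \<in> solid" for x v
      using fill_norm_bound[of x v] that by (auto simp: solid_def)
    show "0 \<le> k\<^sup>2 + 1 + k ^ 3 + k" using k_pos by simp
    show "0 < (2 + 1 / k) * (1 / cos \<delta> + 1 / (cos \<delta>)\<^sup>2)"
      using k_pos cos_pos by (intro mult_pos_pos add_pos_pos) auto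
    show "dist p q \<le> (2 + 1 / k) * (1 / cos \<delta> + 1 / (cos \<delta>)\<^sup>2) * norm (fill p - fill q)"
      if "p \<in> solid" "q \<in> solid" "dist p q \<le> 1" for p q by (rule fill_lower[OF that])
  qed (use topX hom in auto)
  have "smooth_on UNIV (torus \<delta>)"
  proof -
    have "smooth UNIV (\<lambda>z. fill (boundary_map z))" by (rule smooth_compose[OF smooth_fill smooth_boundary_map]) simp
    then show ?thesis by (rule smooth_imp_smooth_on) (auto simp: fill_boundary)
  qed
  moreover have "inj (frechet_derivative (torus \<delta>) (at z))" for z
  proof -
    have "((\<lambda>z. fill (boundary_map z)) has_derivative (\<lambda>v. fill_deriv (boundary_map z) (frechet_derivative boundary_map (at z) v))) (at z)"
      by (rule has_derivative_compose[OF smooth_has_derivative[OF smooth_boundary_map UNIV_I] fill_has_derivative])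
    then have "(torus \<delta> has_derivative (\<lambda>v. fill_deriv (boundary_map z) (frechet_derivative boundary_map (at z) v))) (at z)"
      by (simp add: fill_boundary)
    from frechet_derivative_at[OF this, symmetric] inj_compose[OF inj_fill_deriv inj_boundary_map_derivative]
    show ?thesis by (simp add: o_def)
  qed
  ultimately show ?thesis
    unfolding mean_convex_alexandrov_embedded_def
    by (intro conjI allI exI[of _ X] exI[of _ A] exI[of _ e] exI[of _ \<iota>] mfd conn imm bp e_iota inw
        mean_curvature_torus comp)
qed

end

section \<open>The cylinders of spectral genus zero\<close>

lemma vacuum_potential: "vacuum \<in> potentials 0"
proof -
  have "vacuum \<in> potentials_closure 0" unfolding potentials_closure_0
    by (rule exI[of _ "\<i> / 4"]) (auto simp: vacuum_def)
  moreover have "\<exists>r>0. vacuum (-1) = mat2 0 (of_real r * \<i>) 0 0"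
    by (rule exI[of _ "1/4"]) (simp add: vacuum_def)
  moreover have "trace (vacuum (-1) ** vacuum 0) \<noteq> 0"
    by (simp add: vacuum_def mat2_mult trace_def sum_2)
  ultimately show ?thesis unfolding potentials_def by blast
qed

lemma eval_vacuum: "eval_laurent 0 vacuum l = mat2 0 (\<i> / 4 / l) (\<i> / 4) 0"
  unfolding vacuum_def by (rule eval_laurent_0)

lemma killing_field_vacuum: "killing_field 0 vacuum (\<lambda>_. vacuum)"
  unfolding killing_field_def
proof (intro conjI allI impI)
  show "range (\<lambda>_. vacuum) \<subseteq> potentials_closure 0" using vacuum_potential by (auto simp: potentials_def)
  fix l z :: complex assume l: "l \<noteq> 0"
  have "mat2 0 (\<i> / 4 / l) (\<i> / 4) 0 ** alpha_form vacuum l v - alpha_form vacuum l v ** mat2 0 (\<i> / 4 / l) (\<i> / 4) 0 = 0" for v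
    using l by (auto intro!: mat2_eqI simp: alpha_form_vacuum mat2_mult mat2_minus field_simps)
  then show "((\<lambda>x. eval_laurent 0 vacuum l) has_derivative (\<lambda>v. eval_laurent 0 vacuum l ** alpha_form vacuum l v - alpha_form vacuum l v ** eval_laurent 0 vacuum l)) (at z)"
    by (simp add: eval_vacuum)
qed simp

lemma frame_vacuum: "frame (\<lambda>_. vacuum) (\<lambda>l. vacuum_frame (csqrt l))"
  unfolding frame_def
proof (intro allI impI conjI)
  fix l z :: complex assume l: "l \<noteq> 0"
  show "vacuum_frame (csqrt l) 0 = mat 1" by (rule vacuum_frame_0)
  show "(vacuum_frame (csqrt l) has_derivative (\<lambda>v. vacuum_frame (csqrt l) z ** alpha_form vacuum l v)) (at z)"
    using has_derivative_vacuum_frame[of "csqrt l" z] l by simp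
qed

text \<open>Here \<open>h - \<tau> * \<nu> = \<tau> * \<nu> * l\<close>, which is bounded since \<open>(\<nu> * l)\<^sup>2 = - l / 16\<close>.\<close>

lemma genus0_is_period:
  assumes "c \<noteq> 0"
  shows "is_period a0 (b0_poly (of_real c)) (of_real (32 * c))"
  unfolding is_period_def
proof (intro conjI exI[of _ "\<lambda>(l, \<nu>). \<nu> * poly [:32 * of_real c, 32 * cnj (of_real c):] l"] exI[of _ "1::real"])
  show "is_h a0 (b0_poly (of_real c)) (\<lambda>(l, \<nu>). \<nu> * poly [:32 * of_real c, 32 * cnj (of_real c):] l)"
    by (rule genus0.is_h_product)
  have "norm (\<nu> * poly [:32 * of_real c, 32 * cnj (of_real c):] l - of_real (32 * c) * \<nu>) \<le> 32 * \<bar>c\<bar>"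
    if "(l, \<nu>) \<in> cut_curve a0" "norm l < 1" for l \<nu>
  proof -
    have nu: "\<nu>\<^sup>2 = - 1 / 16 / l" "l \<noteq> 0" using that by (auto simp: cut_curve_def spectral_curve_def a0_def)
    have "(norm (\<nu> * l))\<^sup>2 = norm (\<nu>\<^sup>2 * l\<^sup>2)" by (simp add: norm_power norm_mult power_mult_distrib)
    also have "\<nu>\<^sup>2 * l\<^sup>2 = - l / 16" using nu by (simp add: power2_eq_square)
    also have "norm (- l / 16) \<le> 1\<^sup>2" using that(2) by (simp add: norm_divide)
    finally have n: "norm (\<nu> * l) \<le> 1" by (rule power2_le_imp_le) simp
    have "\<nu> * poly [:32 * of_real c, 32 * cnj (of_real c):] l - of_real (32 * c) * \<nu> = of_real (32 * c) * (\<nu> * l)"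
      by (simp add: algebra_simps)
    then show ?thesis using mult_left_mono[OF n, of "32 * \<bar>c\<bar>"] by (simp only: norm_mult norm_of_real abs_mult) simp
  qed
  then show "bounded ((\<lambda>(l, \<nu>). (case (l, \<nu>) of (l, \<nu>) \<Rightarrow> \<nu> * poly [:32 * of_real c, 32 * cnj (of_real c):] l) - of_real (32 * c) * \<nu>) `
      {(l, \<nu>). (l, \<nu>) \<in> cut_curve a0 \<and> norm l < 1})"
    unfolding bounded_iff by (intro exI[of _ "32 * \<bar>c\<bar>"]) auto
qed (use assms in auto)

lemma M0_alexandrov:
  assumes "q \<in> M0"
  shows "alexandrov_spectral_data 0 q"
proof -
  obtain H c where q: "0 \<le> H" "c\<^sup>2 = (coef H 2)\<^sup>2" "q = (a0, b0_poly (of_real c), sym1 H, cnj (sym1 H))"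
    using M0_cases[OF assms] by blast
  obtain \<delta> where d: "0 < \<delta>" "\<delta> \<le> pi / 4" "sym1 H = cis (- (2 * \<delta>))" "cnj (sym1 H) = cis (2 * \<delta>)"
    "coef H 2 = pi / (16 * cos \<delta>)" using sym1_cis[OF q(1)] by blast
  interpret torus_filling \<delta> by unfold_locales (use d in auto)
  have c: "c = coef H 2 \<or> c = - coef H 2" using q(2) power2_eq_iff by blast
  have "32 * coef H 2 = 2 * pi / cos \<delta>" using d(5) by simp
  then have tau: "of_real (32 * c) = complex_of_real (2 * pi / cos \<delta>) \<or> of_real (32 * c) = - complex_of_real (2 * pi / cos \<delta>)"
    using c by (metis mult_minus_right of_real_minus)
  have "c \<noteq> 0" using c coef_pos[OF q(1), of 2] by auto
  note per = genus0_is_period[OF this]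
  have alex: "mean_convex_alexandrov_embedded (of_real (32 * c))
      (sym_immersion (\<lambda>l. vacuum_frame (csqrt l)) (sym1 H) (cnj (sym1 H)))
      (sym_normal (\<lambda>l. vacuum_frame (csqrt l)) (sym1 H) (cnj (sym1 H)))"
    unfolding sym_vacuum[OF frame_vacuum refl d(3,4)] by (rule torus_alexandrov_embedded[OF tau])
  have "det (eval_laurent 0 vacuum l) = - (poly a0 l / l)" if "l \<noteq> 0" for l
    using that by (simp add: eval_vacuum det_mat2 a0_def)
  then show ?thesis unfolding alexandrov_spectral_data_def q(3) prod.case
    using per vacuum_potential killing_field_vacuum frame_vacuum alex by blast
qed

theorem theorem2:
  shows "\<exists>(M0 :: spectral_quadruple set) (M1 :: spectral_quadruple set)
           (\<Phi>0 :: real \<Rightarrow> spectral_quadruple) (\<Phi>1 :: real \<times> real \<Rightarrow> spectral_quadruple).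
     M0 \<subseteq> spectral_data_plus 0 \<and>
     parameterised_by {0..} \<Phi>0 M0 \<and>
     (\<forall>H\<ge>0. sym_mean_curvature (\<Phi>0 H) = H) \<and>
     (\<forall>q\<in>M0. alexandrov_spectral_data 0 q) \<and>
     (\<forall>(a, b, l1, l2)\<in>M0. mu_roots a b = {l1, l2, -1}) \<and>
     (\<forall>q\<in>spectral_data_plus 0. alexandrov_spectral_data 0 q \<longrightarrow> q \<in> M0) \<and>
     M1 \<subseteq> spectral_data_plus 1 \<and>
     parameterised_by ({0..} \<times> {2..}) \<Phi>1 M1 \<and>
     (\<forall>H\<ge>0. \<forall>\<alpha>\<ge>2. sym_mean_curvature (\<Phi>1 (H, \<alpha>)) = H) \<and>
     add_double_point ` M0 \<subseteq> M1 \<and>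
     (\<forall>H\<ge>0. \<Phi>1 (H, 2) = add_double_point (\<Phi>0 H)) \<and>
     (\<forall>H\<ge>0. \<forall>\<alpha>>2. case \<Phi>1 (H, \<alpha>) of (a, b, l1, l2) \<Rightarrow> mu_roots a b = {l1, l2})"
proof (intro exI conjI)
  show "M0 \<subseteq> spectral_data_plus 0" by (rule M0_plus)
  show "parameterised_by {0..} Phi0 M0" by (rule M0_parameterised)
  show "\<forall>H\<ge>0. sym_mean_curvature (Phi0 H) = H" by (simp add: Phi0_def sym_H)
  show "\<forall>q\<in>M0. alexandrov_spectral_data 0 q" using M0_alexandrov by blast
  show "\<forall>(a, b, l1, l2)\<in>M0. mu_roots a b = {l1, l2, -1}"
  proof
    fix q assume "q \<in> M0"
    then obtain H c where "0 \<le> H" "c\<^sup>2 = (coef H 2)\<^sup>2" "q = (a0, b0_poly (of_real c), sym1 H, cnj (sym1 H))" by (rule M0_cases)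
    then show "case q of (a, b, l1, l2) \<Rightarrow> mu_roots a b = {l1, l2, -1}" using genus0_mu_roots by simp
  qed
  show "\<forall>q\<in>spectral_data_plus 0. alexandrov_spectral_data 0 q \<longrightarrow> q \<in> M0" using alexandrov_in_M0 by blast
  show "M1 \<subseteq> spectral_data_plus 1" by (rule M1_plus)
  show "parameterised_by ({0..} \<times> {2..}) Phi1 M1" by (rule M1_parameterised)
  show "\<forall>H\<ge>0. \<forall>\<alpha>\<ge>2. sym_mean_curvature (Phi1 (H, \<alpha>)) = H" by (simp add: Phi1_def sym_H)
  show "add_double_point ` M0 \<subseteq> M1" by (rule add_double_point_M0)
  show "\<forall>H\<ge>0. Phi1 (H, 2) = add_double_point (Phi0 H)" by (simp add: Phi1_at_2)
  show "\<forall>H\<ge>0. \<forall>\<alpha>>2. case Phi1 (H, \<alpha>) of (a, b, l1, l2) \<Rightarrow> mu_roots a b = {l1, l2}"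
    using genus1_mu_roots by (simp add: Phi1_def)
qed

end
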